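(* Let $\Bbbk$ be a field, $G$ a group and $\sigma\colon G\to\mathrm{Aut}(\Bbbk)$ a homomorphism. A triangulated $\Bbbk$-linear category with a $\sigma$-linear $G$-action and generated by a transitive exceptional $G$-block is determined by a transitive $G$-action on $\{1,\dots,n\}$, given by a homomorphism $\rho\colon G\to S_n$, and a cohomology class $[\alpha]\in H^2(G,(\Bbbk^* )^n_{\rho,\sigma})$. More precisely, let $\mathbf T_1,\mathbf T_2$ be two triangulated $\Bbbk$-linear categories with $\sigma$-linear $G$-actions, each generated by a transitive exceptional $G$-block. For $i=1,2$ let $\rho_i\colon G\to S_{n_i}$ be the corresponding homomorphism and $[\alpha_i]\in H^2(G,(\Bbbk^* )^{n_i}_{\rho_i,\sigma})$ the corresponding twisting cohomology class. Then $\mathbf T_1$ is $\Bbbk$-linearly $G$-equivariantly exact equivalent to $\mathbf T_2$ if and only if $n_1=n_2$ and for some $\tau\in S_{n_1}$ one has $\rho_2=\tau\rho_1\tau^{-1}$ and $[\alpha_2]=\tau([\alpha_1])$ in $H^2(G,(\Bbbk^* )^{n_2}_{\rho_2,\sigma})$.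
   Context: **Group actions on categories.** An action of $G$ on a category $\mathbf C$ consists of autoequivalences $\rho_g\colon\mathbf C\to\mathbf C$ ($g\in G$) and functorial isomorphisms $\epsilon_{g,h}\colon\rho_g\rho_h\to\rho_{gh}$ with $\epsilon_{fg,h}\circ(\epsilon_{f,g}\rho_h)=\epsilon_{f,gh}\circ(\rho_f\epsilon_{g,h})$ for all $f,g,h\in G$. If $\mathbf C$ is $\Bbbk$-linear, the action is $\sigma$-linear if $\rho_g(\lambda u)=\sigma(g)(\lambda)\rho_g(u)$ for all $g\in G$, $\lambda\in\Bbbk$ and morphisms $u$. On a triangulated category the $\rho_g$ are exact functors and the $\epsilon_{g,h}$ are isomorphisms of exact functors. A $G$-equivariant functor $\mathbf C\to\mathbf D$ is a functor $\phi$ with functorial isomorphisms $\beta_g\colon\phi\rho^{\mathbf C}_g\to\rho^{\mathbf D}_g\phi$ satisfying $\beta_{gh}\circ(\phi\,\epsilon^{\mathbf C}_{g,h})=(\epsilon^{\mathbf D}_{g,h}\phi)\circ(\rho^{\mathbf D}_g\beta_h)\circ(\beta_g\rho^{\mathbf C}_h)$; a $G$-equivariant equivalence is a $G$-equivariant functor that is an equivalence. **Exceptional blocks.** An object $E$ is exceptional if $\mathrm{End}(E)=\Bbbk$ and $\mathrm{Hom}(E,E[i])=0$ for $i\ne0$. An exceptional block is a collection $E_1,\dots,E_n$ of exceptional objects with $\mathrm{Hom}(E_k,E_l[i])=0$ for all $i$ and $k\ne l$. It is a $G$-block if for all $g,i$ there is $j$ with $\rho_g(E_i)\cong E_j$;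 it is transitive if the resulting permutation action $\rho\colon G\to S_n$ is transitive. $\mathbf T$ is generated by the block if it is the smallest triangulated subcategory of itself containing all $E_i$. **Twisting class.** $(\Bbbk^* )^n_{\rho,\sigma}$ is the group $(\Bbbk^* )^n$ with $G$-action $g(\lambda e_i)=\sigma(g)(\lambda)\,e_{\rho(g)(i)}$, where $e_i$ are the idempotents of $\Bbbk^n$. For a $G$-block put $E=E_1\oplus\dots\oplus E_n$, so $\mathrm{Aut}(E)=(\Bbbk^* )^n$, and choose isomorphisms $\theta_g\colon E\to\rho_g(E)$. Define $\alpha_{g,h}\in\mathrm{Aut}(E)$ by $\theta_{gh}\circ\alpha_{g,h}=\epsilon_{g,h}\circ\rho_g(\theta_h)\circ\theta_g$. Then $\alpha$ is a $2$-cocycle and its class $[\alpha]\in H^2(G,(\Bbbk^* )^n_{\rho,\sigma})$, independent of the choice of $\theta$, is the twisting cohomology class of the block. A permutation $\tau\in S_n$ with $\rho_2=\tau\rho_1\tau^{-1}$ induces an isomorphism of $G$-modules $(\Bbbk^* )^n_{\rho_1,\sigma}\to(\Bbbk^* )^n_{\rho_2,\sigma}$, also denoted $\tau$. *)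

theory Defs
  imports
    "HOL-Algebra.Module"
    "HOL-Algebra.Bij"
    "HOL-Algebra.Multiplicative_Group"
    "HOL-Algebra.Product_Groups"
    "HOL-Algebra.Sym_Groups"
begin

section \<open>Linear categories\<close>

text \<open>
  Every Hom-set carries a module structure over the base field (the \<open>mult\<close> and \<open>one\<close> fields of the
  \<open>module\<close> record are irrelevant). Hom-sets of different pairs of objects are disjoint, so that
  composition needs no object arguments; \<open>g \<cdot> f\<close> is "first \<open>f\<close>, then \<open>g\<close>".
\<close>

record ('o, 'm, 'k) lincat =
  Obj :: "'o set"
  Hom :: "'o \<Rightarrow> 'o \<Rightarrow> ('k, 'm) module"
  Id :: "'o \<Rightarrow> 'm"
  Comp :: "'m \<Rightarrow> 'm \<Rightarrow> 'm" (infixr \<open>\<cdot>\<index>\<close> 75)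

abbreviation homs :: "('o, 'm, 'k, 'z) lincat_scheme \<Rightarrow> 'o \<Rightarrow> 'o \<Rightarrow> 'm set"
  where "homs C X Y \<equiv> carrier (Hom C X Y)"

locale linear_category = field K for K :: "'k ring" +
  fixes C :: "('o, 'm, 'k, 'z) lincat_scheme"
  assumes Hom_module: "\<lbrakk>X \<in> Obj C; Y \<in> Obj C\<rbrakk> \<Longrightarrow> module K (Hom C X Y)"
    and Hom_disjoint:
      "\<lbrakk>X \<in> Obj C; Y \<in> Obj C; X' \<in> Obj C; Y' \<in> Obj C; f \<in> homs C X Y; f \<in> homs C X' Y'\<rbrakk>
        \<Longrightarrow> X = X' \<and> Y = Y'"
    and Id_closed: "X \<in> Obj C \<Longrightarrow> Id C X \<in> homs C X X"
    and Comp_closed: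
      "\<lbrakk>X \<in> Obj C; Y \<in> Obj C; Z \<in> Obj C; f \<in> homs C X Y; g \<in> homs C Y Z\<rbrakk>
        \<Longrightarrow> g \<cdot>\<^bsub>C\<^esub> f \<in> homs C X Z"
    and Id_left: "\<lbrakk>X \<in> Obj C; Y \<in> Obj C; f \<in> homs C X Y\<rbrakk> \<Longrightarrow> Id C Y \<cdot>\<^bsub>C\<^esub> f = f"
    and Id_right: "\<lbrakk>X \<in> Obj C; Y \<in> Obj C; f \<in> homs C X Y\<rbrakk> \<Longrightarrow> f \<cdot>\<^bsub>C\<^esub> Id C X = f"
    and Comp_assoc:
      "\<lbrakk>W \<in> Obj C; X \<in> Obj C; Y \<in> Obj C; Z \<in> Obj C;
        f \<in> homs C W X; g \<in> homs C X Y; h \<in> homs C Y Z\<rbrakk>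
        \<Longrightarrow> (h \<cdot>\<^bsub>C\<^esub> g) \<cdot>\<^bsub>C\<^esub> f = h \<cdot>\<^bsub>C\<^esub> (g \<cdot>\<^bsub>C\<^esub> f)"
    and Comp_add_right:
      "\<lbrakk>X \<in> Obj C; Y \<in> Obj C; Z \<in> Obj C; f \<in> homs C X Y; f' \<in> homs C X Y; g \<in> homs C Y Z\<rbrakk>
        \<Longrightarrow> g \<cdot>\<^bsub>C\<^esub> (f \<oplus>\<^bsub>Hom C X Y\<^esub> f') = (g \<cdot>\<^bsub>C\<^esub> f) \<oplus>\<^bsub>Hom C X Z\<^esub> (g \<cdot>\<^bsub>C\<^esub> f')"
    and Comp_add_left:
      "\<lbrakk>X \<in> Obj C; Y \<in> Obj C; Z \<in> Obj C; f \<in> homs C X Y; g \<in> homs C Y Z; g' \<in> homs C Y Z\<rbrakk>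
        \<Longrightarrow> (g \<oplus>\<^bsub>Hom C Y Z\<^esub> g') \<cdot>\<^bsub>C\<^esub> f = (g \<cdot>\<^bsub>C\<^esub> f) \<oplus>\<^bsub>Hom C X Z\<^esub> (g' \<cdot>\<^bsub>C\<^esub> f)"
    and Comp_smult_right:
      "\<lbrakk>X \<in> Obj C; Y \<in> Obj C; Z \<in> Obj C; f \<in> homs C X Y; g \<in> homs C Y Z; c \<in> carrier K\<rbrakk>
        \<Longrightarrow> g \<cdot>\<^bsub>C\<^esub> (c \<odot>\<^bsub>Hom C X Y\<^esub> f) = c \<odot>\<^bsub>Hom C X Z\<^esub> (g \<cdot>\<^bsub>C\<^esub> f)"
    and Comp_smult_left:
      "\<lbrakk>X \<in> Obj C; Y \<in> Obj C; Z \<in> Obj C; f \<in> homs C X Y; g \<in> homs C Y Z; c \<in> carrier K\<rbrakk>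
        \<Longrightarrow> (c \<odot>\<^bsub>Hom C Y Z\<^esub> g) \<cdot>\<^bsub>C\<^esub> f = c \<odot>\<^bsub>Hom C X Z\<^esub> (g \<cdot>\<^bsub>C\<^esub> f)"

definition is_iso :: "('o, 'm, 'k, 'z) lincat_scheme \<Rightarrow> 'o \<Rightarrow> 'o \<Rightarrow> 'm \<Rightarrow> bool"
  where "is_iso C X Y f \<longleftrightarrow>
    f \<in> homs C X Y \<and> (\<exists>g \<in> homs C Y X. g \<cdot>\<^bsub>C\<^esub> f = Id C X \<and> f \<cdot>\<^bsub>C\<^esub> g = Id C Y)"

definition isomorphic :: "('o, 'm, 'k, 'z) lincat_scheme \<Rightarrow> 'o \<Rightarrow> 'o \<Rightarrow> bool"
  where "isomorphic C X Y \<longleftrightarrow> (\<exists>f. is_iso C X Y f)"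

definition zero_object :: "('o, 'm, 'k, 'z) lincat_scheme \<Rightarrow> 'o \<Rightarrow> bool"
  where "zero_object C Z \<longleftrightarrow>
    Z \<in> Obj C \<and> (\<forall>X \<in> Obj C. (\<exists>!f. f \<in> homs C X Z) \<and> (\<exists>!f. f \<in> homs C Z X))"

text \<open>\<open>S\<close> is the direct sum of the family \<open>X i\<close>, \<open>i \<in> I\<close> (with \<open>I\<close> finite), with inclusions \<open>\<iota> i\<close> and
  projections \<open>\<pi> i\<close>.\<close>

definition direct_sum ::
  "('o, 'm, 'k, 'z) lincat_scheme \<Rightarrow> 'i set \<Rightarrow> ('i \<Rightarrow> 'o) \<Rightarrow> 'o \<Rightarrow> ('i \<Rightarrow> 'm) \<Rightarrow> ('i \<Rightarrow> 'm) \<Rightarrow> bool"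
  where "direct_sum C I X S \<iota> \<pi> \<longleftrightarrow>
    S \<in> Obj C \<and>
    (\<forall>i\<in>I. \<iota> i \<in> homs C (X i) S \<and> \<pi> i \<in> homs C S (X i)) \<and>
    (\<forall>i\<in>I. \<forall>j\<in>I. \<pi> j \<cdot>\<^bsub>C\<^esub> \<iota> i = (if i = j then Id C (X i) else \<zero>\<^bsub>Hom C (X i) (X j)\<^esub>)) \<and>
    finsum (Hom C S S) (\<lambda>i. \<iota> i \<cdot>\<^bsub>C\<^esub> \<pi> i) I = Id C S"

locale additive_linear_category = linear_category K C
  for K :: "'k ring" and C :: "('o, 'm, 'k, 'z) lincat_scheme" +
  assumes zero_object_exists: "\<exists>Z. zero_object C Z"
    and direct_sum_exists:
      "(\<forall>i \<in> {1, 2 :: nat}. X i \<in> Obj C) \<Longrightarrow> \<exists>S \<iota> \<pi>. direct_sum C {1, 2} X S \<iota> \<pi>"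


section \<open>Functors\<close>

record ('o1, 'm1, 'o2, 'm2) functr =
  On_obj :: "'o1 \<Rightarrow> 'o2"
  On_mor :: "'m1 \<Rightarrow> 'm2"

definition id_functor :: "('o, 'm, 'o, 'm) functr"
  where "id_functor = \<lparr>On_obj = (\<lambda>X. X), On_mor = (\<lambda>f. f)\<rparr>"

definition comp_functor ::
  "('o2, 'm2, 'o3, 'm3, 'y) functr_scheme \<Rightarrow> ('o1, 'm1, 'o2, 'm2, 'z) functr_scheme
    \<Rightarrow> ('o1, 'm1, 'o3, 'm3) functr"
  where "comp_functor F H = \<lparr>On_obj = On_obj F \<circ> On_obj H, On_mor = On_mor F \<circ> On_mor H\<rparr>"

definition is_functor ::
  "('o1, 'm1, 'k, 'y) lincat_scheme \<Rightarrow> ('o2, 'm2, 'k, 'z) lincat_scheme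
    \<Rightarrow> ('o1, 'm1, 'o2, 'm2, 'w) functr_scheme \<Rightarrow> bool"
  where "is_functor C D F \<longleftrightarrow>
    (\<forall>X \<in> Obj C. On_obj F X \<in> Obj D \<and> On_mor F (Id C X) = Id D (On_obj F X)) \<and>
    (\<forall>X \<in> Obj C. \<forall>Y \<in> Obj C. \<forall>f \<in> homs C X Y. On_mor F f \<in> homs D (On_obj F X) (On_obj F Y)) \<and>
    (\<forall>X \<in> Obj C. \<forall>Y \<in> Obj C. \<forall>Z \<in> Obj C. \<forall>f \<in> homs C X Y. \<forall>g \<in> homs C Y Z.
      On_mor F (g \<cdot>\<^bsub>C\<^esub> f) = On_mor F g \<cdot>\<^bsub>D\<^esub> On_mor F f)"

definition nat_iso ::
  "('o1, 'm1, 'k, 'y) lincat_scheme \<Rightarrow> ('o2, 'm2, 'k, 'z) lincat_scheme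
    \<Rightarrow> ('o1, 'm1, 'o2, 'm2, 'v) functr_scheme \<Rightarrow> ('o1, 'm1, 'o2, 'm2, 'w) functr_scheme
    \<Rightarrow> ('o1 \<Rightarrow> 'm2) \<Rightarrow> bool"
  where "nat_iso C D F H \<eta> \<longleftrightarrow>
    (\<forall>X \<in> Obj C. is_iso D (On_obj F X) (On_obj H X) (\<eta> X)) \<and>
    (\<forall>X \<in> Obj C. \<forall>Y \<in> Obj C. \<forall>f \<in> homs C X Y. \<eta> Y \<cdot>\<^bsub>D\<^esub> On_mor F f = On_mor H f \<cdot>\<^bsub>D\<^esub> \<eta> X)"

definition equivalence ::
  "('o1, 'm1, 'k, 'y) lincat_scheme \<Rightarrow> ('o2, 'm2, 'k, 'z) lincat_scheme
    \<Rightarrow> ('o1, 'm1, 'o2, 'm2, 'w) functr_scheme \<Rightarrow> bool"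
  where "equivalence C D F \<longleftrightarrow>
    is_functor C D F \<and>
    (\<exists>(H :: ('o2, 'm2, 'o1, 'm1) functr) \<eta> \<mu>.
      is_functor D C H \<and>
      nat_iso C C id_functor (comp_functor H F) \<eta> \<and>
      nat_iso D D (comp_functor F H) id_functor \<mu>)"

definition additive_functor ::
  "('o1, 'm1, 'k, 'y) lincat_scheme \<Rightarrow> ('o2, 'm2, 'k, 'z) lincat_scheme
    \<Rightarrow> ('o1, 'm1, 'o2, 'm2, 'w) functr_scheme \<Rightarrow> bool"
  where "additive_functor C D F \<longleftrightarrow>
    is_functor C D F \<and>
    (\<forall>X \<in> Obj C. \<forall>Y \<in> Obj C. \<forall>f \<in> homs C X Y. \<forall>f' \<in> homs C X Y.
      On_mor F (f \<oplus>\<^bsub>Hom C X Y\<^esub> f') =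
        On_mor F f \<oplus>\<^bsub>Hom D (On_obj F X) (On_obj F Y)\<^esub> On_mor F f')"

text \<open>\<open>s\<close>-semilinear functors; \<open>\<Bbbk>\<close>-linear ones are those with \<open>s = (\<lambda>c. c)\<close>.\<close>

definition semilinear_functor ::
  "'k ring \<Rightarrow> ('k \<Rightarrow> 'k) \<Rightarrow> ('o1, 'm1, 'k, 'y) lincat_scheme \<Rightarrow> ('o2, 'm2, 'k, 'z) lincat_scheme
    \<Rightarrow> ('o1, 'm1, 'o2, 'm2, 'w) functr_scheme \<Rightarrow> bool"
  where "semilinear_functor K s C D F \<longleftrightarrow>
    additive_functor C D F \<and>
    (\<forall>X \<in> Obj C. \<forall>Y \<in> Obj C. \<forall>f \<in> homs C X Y. \<forall>c \<in> carrier K.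
      On_mor F (c \<odot>\<^bsub>Hom C X Y\<^esub> f) = s c \<odot>\<^bsub>Hom D (On_obj F X) (On_obj F Y)\<^esub> On_mor F f)"

abbreviation linear_functor ::
  "'k ring \<Rightarrow> ('o1, 'm1, 'k, 'y) lincat_scheme \<Rightarrow> ('o2, 'm2, 'k, 'z) lincat_scheme
    \<Rightarrow> ('o1, 'm1, 'o2, 'm2, 'w) functr_scheme \<Rightarrow> bool"
  where "linear_functor K \<equiv> semilinear_functor K (\<lambda>c. c)"


section \<open>Triangulated categories\<close>

text \<open>
  Verdier's axioms. The shift \<open>X \<mapsto> X[1]\<close> is only required to be an autoequivalence, not an
  automorphism. A triangle \<open>X \<rightarrow> Y \<rightarrow> Z \<rightarrow> X[1]\<close> is given by its three morphisms.
\<close>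

record ('o, 'm, 'k) tricat = "('o, 'm, 'k) lincat" +
  Shift :: "('o, 'm, 'o, 'm) functr"
  Tri :: "('m \<times> 'm \<times> 'm) set"

abbreviation sh_obj :: "('o, 'm, 'k, 'z) tricat_scheme \<Rightarrow> 'o \<Rightarrow> 'o"
  where "sh_obj T \<equiv> On_obj (Shift T)"

abbreviation sh_mor :: "('o, 'm, 'k, 'z) tricat_scheme \<Rightarrow> 'm \<Rightarrow> 'm"
  where "sh_mor T \<equiv> On_mor (Shift T)"

text \<open>An object whose shift is \<open>X\<close>, unique up to isomorphism.\<close>

definition unshift_obj :: "('o, 'm, 'k, 'z) tricat_scheme \<Rightarrow> 'o \<Rightarrow> 'o"
  where "unshift_obj T X = (SOME Y. Y \<in> Obj T \<and> isomorphic T (sh_obj T Y) X)"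

text \<open>The object \<open>X[i]\<close> for an integer \<open>i\<close>.\<close>

definition shift_by :: "('o, 'm, 'k, 'z) tricat_scheme \<Rightarrow> int \<Rightarrow> 'o \<Rightarrow> 'o"
  where "shift_by T i X =
    (if 0 \<le> i then (sh_obj T ^^ nat i) X else (unshift_obj T ^^ nat (- i)) X)"

definition triangle ::
  "('o, 'm, 'k, 'z) tricat_scheme \<Rightarrow> 'o \<Rightarrow> 'o \<Rightarrow> 'o \<Rightarrow> 'm \<Rightarrow> 'm \<Rightarrow> 'm \<Rightarrow> bool"
  where "triangle T X Y Z u v w \<longleftrightarrow>
    X \<in> Obj T \<and> Y \<in> Obj T \<and> Z \<in> Obj T \<and>
    u \<in> homs T X Y \<and> v \<in> homs T Y Z \<and> w \<in> homs T Z (sh_obj T X)"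

definition distinguished ::
  "('o, 'm, 'k, 'z) tricat_scheme \<Rightarrow> 'o \<Rightarrow> 'o \<Rightarrow> 'o \<Rightarrow> 'm \<Rightarrow> 'm \<Rightarrow> 'm \<Rightarrow> bool"
  where "distinguished T X Y Z u v w \<longleftrightarrow> triangle T X Y Z u v w \<and> (u, v, w) \<in> Tri T"

locale triangulated_category = additive_linear_category K T
  for K :: "'k ring" and T :: "('o, 'm, 'k, 'z) tricat_scheme" +
  assumes Shift_linear: "linear_functor K T T (Shift T)"
    and Shift_equivalence: "equivalence T T (Shift T)"
    and TR1_iso:
      "\<lbrakk>distinguished T X Y Z u v w; triangle T X' Y' Z' u' v' w';
        is_iso T X X' f; is_iso T Y Y' g; is_iso T Z Z' h;
        g \<cdot>\<^bsub>T\<^esub> u = u' \<cdot>\<^bsub>T\<^esub> f; h \<cdot>\<^bsub>T\<^esub> v = v' \<cdot>\<^bsub>T\<^esub> g; sh_mor T f \<cdot>\<^bsub>T\<^esub> w = w' \<cdot>\<^bsub>T\<^esub> h\<rbrakk>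
        \<Longrightarrow> distinguished T X' Y' Z' u' v' w'"
    and TR1_id:
      "\<lbrakk>X \<in> Obj T; zero_object T Z\<rbrakk>
        \<Longrightarrow> distinguished T X X Z (Id T X) \<zero>\<^bsub>Hom T X Z\<^esub> \<zero>\<^bsub>Hom T Z (sh_obj T X)\<^esub>"
    and TR1_cone:
      "\<lbrakk>X \<in> Obj T; Y \<in> Obj T; u \<in> homs T X Y\<rbrakk> \<Longrightarrow> \<exists>Z v w. distinguished T X Y Z u v w"
    and TR2:
      "triangle T X Y Z u v w \<Longrightarrow>
        distinguished T X Y Z u v w \<longleftrightarrow>
        distinguished T Y Z (sh_obj T X) v w (\<ominus>\<^bsub>Hom T (sh_obj T X) (sh_obj T Y)\<^esub> sh_mor T u)"
    and TR3:
      "\<lbrakk>distinguished T X Y Z u v w; distinguished T X' Y' Z' u' v' w';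
        f \<in> homs T X X'; g \<in> homs T Y Y'; g \<cdot>\<^bsub>T\<^esub> u = u' \<cdot>\<^bsub>T\<^esub> f\<rbrakk>
        \<Longrightarrow> \<exists>h \<in> homs T Z Z'. h \<cdot>\<^bsub>T\<^esub> v = v' \<cdot>\<^bsub>T\<^esub> g \<and> sh_mor T f \<cdot>\<^bsub>T\<^esub> w = w' \<cdot>\<^bsub>T\<^esub> h"
    and TR4:
      "\<lbrakk>distinguished T X Y Z' f i i'; distinguished T Y Z X' g j j';
        distinguished T X Z Y' (g \<cdot>\<^bsub>T\<^esub> f) k k'\<rbrakk>
        \<Longrightarrow> \<exists>u v. distinguished T Z' Y' X' u v (sh_mor T i \<cdot>\<^bsub>T\<^esub> j') \<and>
              u \<cdot>\<^bsub>T\<^esub> i = k \<cdot>\<^bsub>T\<^esub> g \<and> k' \<cdot>\<^bsub>T\<^esub> u = i' \<and>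
              v \<cdot>\<^bsub>T\<^esub> k = j \<and> j' \<cdot>\<^bsub>T\<^esub> v = sh_mor T f \<cdot>\<^bsub>T\<^esub> k'"

text \<open>Full triangulated subcategories (closed under isomorphism), given by their sets of objects.\<close>

definition triangulated_subcategory :: "('o, 'm, 'k, 'z) tricat_scheme \<Rightarrow> 'o set \<Rightarrow> bool"
  where "triangulated_subcategory T P \<longleftrightarrow>
    P \<subseteq> Obj T \<and>
    (\<forall>Z. zero_object T Z \<longrightarrow> Z \<in> P) \<and>
    (\<forall>X \<in> P. \<forall>Y \<in> Obj T. isomorphic T X Y \<longrightarrow> Y \<in> P) \<and>
    (\<forall>X \<in> Obj T. sh_obj T X \<in> P \<longleftrightarrow> X \<in> P) \<and>
    (\<forall>X Y Z u v w. distinguished T X Y Z u v w \<longrightarrow> X \<in> P \<longrightarrow> Y \<in> P \<longrightarrow> Z \<in> P)"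

definition generated_by :: "('o, 'm, 'k, 'z) tricat_scheme \<Rightarrow> 'o set \<Rightarrow> bool"
  where "generated_by T S \<longleftrightarrow> Obj T = \<Inter>{P. triangulated_subcategory T P \<and> S \<subseteq> P}"

text \<open>An exact functor \<open>F\<close> comes with natural isomorphisms \<open>Fsh F X : F(X[1]) \<rightarrow> F(X)[1]\<close>.\<close>

record ('o1, 'm1, 'o2, 'm2) exfunctr = "('o1, 'm1, 'o2, 'm2) functr" +
  Fsh :: "'o1 \<Rightarrow> 'm2"

definition exact_functor ::
  "('o1, 'm1, 'k, 'y) tricat_scheme \<Rightarrow> ('o2, 'm2, 'k, 'z) tricat_scheme
    \<Rightarrow> ('o1, 'm1, 'o2, 'm2) exfunctr \<Rightarrow> bool"
  where "exact_functor T U F \<longleftrightarrow>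
    additive_functor T U F \<and>
    nat_iso T U (comp_functor F (Shift T)) (comp_functor (Shift U) F) (Fsh F) \<and>
    (\<forall>X Y Z u v w. distinguished T X Y Z u v w \<longrightarrow>
      distinguished U (On_obj F X) (On_obj F Y) (On_obj F Z)
        (On_mor F u) (On_mor F v) (Fsh F X \<cdot>\<^bsub>U\<^esub> On_mor F w))"

definition comp_exact ::
  "('o3, 'm3, 'k, 'z) lincat_scheme \<Rightarrow> ('o2, 'm2, 'o3, 'm3) exfunctr
    \<Rightarrow> ('o1, 'm1, 'o2, 'm2) exfunctr \<Rightarrow> ('o1, 'm1, 'o3, 'm3) exfunctr"
  where "comp_exact D F H =
    \<lparr>On_obj = On_obj F \<circ> On_obj H, On_mor = On_mor F \<circ> On_mor H,
     Fsh = (\<lambda>X. Fsh F (On_obj H X) \<cdot>\<^bsub>D\<^esub> On_mor F (Fsh H X))\<rparr>"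

text \<open>Isomorphisms of exact functors: natural isomorphisms compatible with the shifts.\<close>

definition exact_iso ::
  "('o1, 'm1, 'k, 'y) tricat_scheme \<Rightarrow> ('o2, 'm2, 'k, 'z) tricat_scheme
    \<Rightarrow> ('o1, 'm1, 'o2, 'm2) exfunctr \<Rightarrow> ('o1, 'm1, 'o2, 'm2) exfunctr
    \<Rightarrow> ('o1 \<Rightarrow> 'm2) \<Rightarrow> bool"
  where "exact_iso T U F H \<eta> \<longleftrightarrow>
    nat_iso T U F H \<eta> \<and>
    (\<forall>X \<in> Obj T. Fsh H X \<cdot>\<^bsub>U\<^esub> \<eta> (sh_obj T X) = sh_mor U (\<eta> X) \<cdot>\<^bsub>U\<^esub> Fsh F X)"


section \<open>Group actions\<close>

definition field_Aut :: "'k ring \<Rightarrow> ('k \<Rightarrow> 'k) monoid"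
  where "field_Aut K = BijGroup (carrier K) \<lparr>carrier := ring_hom K K \<inter> Bij (carrier K)\<rparr>"

text \<open>\<open>Act T g\<close> is the autoequivalence \<open>\<rho>\<^sub>g\<close> and \<open>Eps T g h X\<close> is \<open>\<epsilon>\<^sub>g\<^sub>,\<^sub>h\<close> at the object \<open>X\<close>.\<close>

record ('g, 'o, 'm, 'k) gtricat = "('o, 'm, 'k) tricat" +
  Act :: "'g \<Rightarrow> ('o, 'm, 'o, 'm) exfunctr"
  Eps :: "'g \<Rightarrow> 'g \<Rightarrow> 'o \<Rightarrow> 'm"

locale triangulated_category_with_action =
  triangulated_category K T + G?: group G
  for K :: "'k ring" and G :: "'g monoid" and \<sigma> :: "'g \<Rightarrow> 'k \<Rightarrow> 'k"
    and T :: "('g, 'o, 'm, 'k) gtricat" +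
  assumes sigma_hom: "\<sigma> \<in> hom G (field_Aut K)"
    and Act_exact: "g \<in> carrier G \<Longrightarrow> exact_functor T T (Act T g)"
    and Act_equivalence: "g \<in> carrier G \<Longrightarrow> equivalence T T (Act T g)"
    and Act_semilinear: "g \<in> carrier G \<Longrightarrow> semilinear_functor K (\<sigma> g) T T (Act T g)"
    and Eps_iso:
      "\<lbrakk>g \<in> carrier G; h \<in> carrier G\<rbrakk>
        \<Longrightarrow> exact_iso T T (comp_exact T (Act T g) (Act T h)) (Act T (g \<otimes>\<^bsub>G\<^esub> h)) (Eps T g h)"
    and Eps_assoc:
      "\<lbrakk>f \<in> carrier G; g \<in> carrier G; h \<in> carrier G; X \<in> Obj T\<rbrakk>
        \<Longrightarrow> Eps T (f \<otimes>\<^bsub>G\<^esub> g) h X \<cdot>\<^bsub>T\<^esub> Eps T f g (On_obj (Act T h) X) =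
            Eps T f (g \<otimes>\<^bsub>G\<^esub> h) X \<cdot>\<^bsub>T\<^esub> On_mor (Act T f) (Eps T g h X)"

text \<open>The isomorphisms \<open>\<beta>\<^sub>g\<close> of an exact equivariant functor are isomorphisms of exact functors.\<close>

definition equivariant_exact_functor ::
  "'g monoid \<Rightarrow> ('g, 'o1, 'm1, 'k) gtricat \<Rightarrow> ('g, 'o2, 'm2, 'k) gtricat
    \<Rightarrow> ('o1, 'm1, 'o2, 'm2) exfunctr \<Rightarrow> ('g \<Rightarrow> 'o1 \<Rightarrow> 'm2) \<Rightarrow> bool"
  where "equivariant_exact_functor G T U \<Phi> \<beta> \<longleftrightarrow>
    exact_functor T U \<Phi> \<and>
    (\<forall>g \<in> carrier G. exact_iso T U (comp_exact U \<Phi> (Act T g)) (comp_exact U (Act U g) \<Phi>) (\<beta> g)) \<and>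
    (\<forall>g \<in> carrier G. \<forall>h \<in> carrier G. \<forall>X \<in> Obj T.
      \<beta> (g \<otimes>\<^bsub>G\<^esub> h) X \<cdot>\<^bsub>U\<^esub> On_mor \<Phi> (Eps T g h X) =
      Eps U g h (On_obj \<Phi> X) \<cdot>\<^bsub>U\<^esub> On_mor (Act U g) (\<beta> h X) \<cdot>\<^bsub>U\<^esub> \<beta> g (On_obj (Act T h) X))"

definition linearly_equivariantly_exact_equivalent ::
  "'k ring \<Rightarrow> 'g monoid \<Rightarrow> ('g, 'o1, 'm1, 'k) gtricat \<Rightarrow> ('g, 'o2, 'm2, 'k) gtricat \<Rightarrow> bool"
  where "linearly_equivariantly_exact_equivalent K G T U \<longleftrightarrow>
    (\<exists>\<Phi> \<beta>. equivariant_exact_functor G T U \<Phi> \<beta> \<and> linear_functor K T U \<Phi> \<and> equivalence T U \<Phi>)"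


section \<open>Exceptional blocks\<close>

definition exceptional :: "'k ring \<Rightarrow> ('o, 'm, 'k, 'z) tricat_scheme \<Rightarrow> 'o \<Rightarrow> bool"
  where "exceptional K T E \<longleftrightarrow>
    E \<in> Obj T \<and>
    bij_betw (\<lambda>c. c \<odot>\<^bsub>Hom T E E\<^esub> Id T E) (carrier K) (homs T E E) \<and>
    (\<forall>i. i \<noteq> 0 \<longrightarrow> homs T E (shift_by T i E) = {\<zero>\<^bsub>Hom T E (shift_by T i E)\<^esub>})"

definition exceptional_block ::
  "'k ring \<Rightarrow> ('o, 'm, 'k, 'z) tricat_scheme \<Rightarrow> nat \<Rightarrow> (nat \<Rightarrow> 'o) \<Rightarrow> bool"
  where "exceptional_block K T n E \<longleftrightarrow>
    (\<forall>k \<in> {1..n}. exceptional K T (E k)) \<and>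
    (\<forall>k \<in> {1..n}. \<forall>l \<in> {1..n}. \<forall>i. k \<noteq> l \<longrightarrow>
      homs T (E k) (shift_by T i (E l)) = {\<zero>\<^bsub>Hom T (E k) (shift_by T i (E l))\<^esub>})"

definition G_block ::
  "'k ring \<Rightarrow> 'g monoid \<Rightarrow> ('g, 'o, 'm, 'k) gtricat \<Rightarrow> nat \<Rightarrow> (nat \<Rightarrow> 'o) \<Rightarrow> bool"
  where "G_block K G T n E \<longleftrightarrow>
    exceptional_block K T n E \<and>
    (\<forall>g \<in> carrier G. \<forall>i \<in> {1..n}. \<exists>j \<in> {1..n}. isomorphic T (On_obj (Act T g) (E i)) (E j))"

text \<open>\<open>\<rho>\<close> is the permutation action of \<open>G\<close> on \<open>{1..n}\<close> defined by the block.\<close>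

definition block_action ::
  "'g monoid \<Rightarrow> ('g, 'o, 'm, 'k) gtricat \<Rightarrow> nat \<Rightarrow> (nat \<Rightarrow> 'o) \<Rightarrow> ('g \<Rightarrow> nat \<Rightarrow> nat) \<Rightarrow> bool"
  where "block_action G T n E \<rho> \<longleftrightarrow>
    \<rho> \<in> hom G (sym_group n) \<and>
    (\<forall>g \<in> carrier G. \<forall>i \<in> {1..n}. isomorphic T (On_obj (Act T g) (E i)) (E (\<rho> g i)))"

definition transitive_action :: "'g monoid \<Rightarrow> nat \<Rightarrow> ('g \<Rightarrow> nat \<Rightarrow> nat) \<Rightarrow> bool"
  where "transitive_action G n \<rho> \<longleftrightarrow> (\<forall>i \<in> {1..n}. \<forall>j \<in> {1..n}. \<exists>g \<in> carrier G. \<rho> g i = j)"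


section \<open>Second group cohomology\<close>

text \<open>
  \<open>M\<close> is an abelian group (written multiplicatively) on which \<open>G\<close> acts through \<open>act\<close>.
  Cohomology is that of inhomogeneous cochains.
\<close>

definition cochains2 :: "'g monoid \<Rightarrow> 'a monoid \<Rightarrow> ('g \<times> 'g \<Rightarrow> 'a) monoid"
  where "cochains2 G M = product_group (carrier G \<times> carrier G) (\<lambda>_. M)"

definition cocycles2 :: "'g monoid \<Rightarrow> 'a monoid \<Rightarrow> ('g \<Rightarrow> 'a \<Rightarrow> 'a) \<Rightarrow> ('g \<times> 'g \<Rightarrow> 'a) monoid"
  where "cocycles2 G M act = (cochains2 G M) \<lparr>carrier :=
    {a \<in> carrier (cochains2 G M). \<forall>f \<in> carrier G. \<forall>g \<in> carrier G. \<forall>h \<in> carrier G.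
      act f (a (g, h)) \<otimes>\<^bsub>M\<^esub> a (f, g \<otimes>\<^bsub>G\<^esub> h) = a (f \<otimes>\<^bsub>G\<^esub> g, h) \<otimes>\<^bsub>M\<^esub> a (f, g)}\<rparr>"

definition coboundaries2 :: "'g monoid \<Rightarrow> 'a monoid \<Rightarrow> ('g \<Rightarrow> 'a \<Rightarrow> 'a) \<Rightarrow> ('g \<times> 'g \<Rightarrow> 'a) set"
  where "coboundaries2 G M act =
    (\<lambda>b. \<lambda>(g, h) \<in> carrier G \<times> carrier G. act g (b h) \<otimes>\<^bsub>M\<^esub> inv\<^bsub>M\<^esub> b (g \<otimes>\<^bsub>G\<^esub> h) \<otimes>\<^bsub>M\<^esub> b g)
      ` (carrier G \<rightarrow>\<^sub>E carrier M)"

definition H2 :: "'g monoid \<Rightarrow> 'a monoid \<Rightarrow> ('g \<Rightarrow> 'a \<Rightarrow> 'a) \<Rightarrow> ('g \<times> 'g \<Rightarrow> 'a) set monoid"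
  where "H2 G M act = cocycles2 G M act Mod coboundaries2 G M act"

definition H2_class ::
  "'g monoid \<Rightarrow> 'a monoid \<Rightarrow> ('g \<Rightarrow> 'a \<Rightarrow> 'a) \<Rightarrow> ('g \<times> 'g \<Rightarrow> 'a) \<Rightarrow> ('g \<times> 'g \<Rightarrow> 'a) set"
  where "H2_class G M act a = coboundaries2 G M act #>\<^bsub>cocycles2 G M act\<^esub> a"

text \<open>The map to \<open>H\<^sup>2(G, M)\<close> induced by a homomorphism \<open>\<phi>\<close> of \<open>G\<close>-modules with target \<open>M\<close>. The union
  is over representatives of the class \<open>c\<close>, all of which give the same class.\<close>

definition H2_map ::
  "'g monoid \<Rightarrow> 'b monoid \<Rightarrow> ('g \<Rightarrow> 'b \<Rightarrow> 'b) \<Rightarrow> ('a \<Rightarrow> 'b)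
    \<Rightarrow> ('g \<times> 'g \<Rightarrow> 'a) set \<Rightarrow> ('g \<times> 'g \<Rightarrow> 'b) set"
  where "H2_map G M act \<phi> c =
    (\<Union>a \<in> c. H2_class G M act (\<lambda>x \<in> carrier G \<times> carrier G. \<phi> (a x)))"

lemma H2_class_in_H2:
  "a \<in> carrier (cocycles2 G M act) \<Longrightarrow> H2_class G M act a \<in> carrier (H2 G M act)"
  by (auto simp: H2_def H2_class_def FactGroup_def RCOSETS_def)


section \<open>The twisting class\<close>

definition torus :: "'k ring \<Rightarrow> nat \<Rightarrow> (nat \<Rightarrow> 'k) monoid"
  where "torus K n = product_group {1..n} (\<lambda>_. mult_of K)"

text \<open>The \<open>G\<close>-action on \<open>(\<Bbbk>\<^sup>*)\<^sup>n\<close> with \<open>g (c e\<^sub>i) = \<sigma>(g)(c) e\<^sub>j\<close> for \<open>j = \<rho>(g)(i)\<close>, read off in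
  coordinates: the \<open>j\<close>-th entry of \<open>g a\<close> is \<open>\<sigma>(g)\<close> of the entry of \<open>a\<close> at the preimage of \<open>j\<close>.\<close>

definition torus_act ::
  "('g \<Rightarrow> 'k \<Rightarrow> 'k) \<Rightarrow> nat \<Rightarrow> ('g \<Rightarrow> nat \<Rightarrow> nat) \<Rightarrow> 'g \<Rightarrow> (nat \<Rightarrow> 'k) \<Rightarrow> nat \<Rightarrow> 'k"
  where "torus_act \<sigma> n \<rho> g a = (\<lambda>j \<in> {1..n}. \<sigma> g (a (inv_into {1..n} (\<rho> g) j)))"

text \<open>The map \<open>e\<^sub>i \<mapsto> e\<^sub>\<tau>\<^sub>(\<^sub>i\<^sub>)\<close>.\<close>

definition torus_perm :: "nat \<Rightarrow> (nat \<Rightarrow> nat) \<Rightarrow> (nat \<Rightarrow> 'k) \<Rightarrow> nat \<Rightarrow> 'k"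
  where "torus_perm n \<tau> a = (\<lambda>j \<in> {1..n}. a (inv_into {1..n} \<tau> j))"

text \<open>\<open>a \<in> (\<Bbbk>\<^sup>*)\<^sup>n\<close> regarded as an automorphism of the direct sum \<open>S\<close>.\<close>

definition diagonal ::
  "('o, 'm, 'k, 'z) lincat_scheme \<Rightarrow> nat \<Rightarrow> 'o \<Rightarrow> (nat \<Rightarrow> 'm) \<Rightarrow> (nat \<Rightarrow> 'm) \<Rightarrow> (nat \<Rightarrow> 'k) \<Rightarrow> 'm"
  where "diagonal C n S \<iota> \<pi> a =
    finsum (Hom C S S) (\<lambda>i. a i \<odot>\<^bsub>Hom C S S\<^esub> (\<iota> i \<cdot>\<^bsub>C\<^esub> \<pi> i)) {1..n}"

text \<open>\<open>\<alpha>\<close> is a twisting cocycle of the block, obtained from some choice of the direct sum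
  \<open>S = E\<^sub>1 \<oplus> \<dots> \<oplus> E\<^sub>n\<close> and of isomorphisms \<open>\<theta>\<^sub>g : S \<rightarrow> \<rho>\<^sub>g(S)\<close>.\<close>

definition twisting_cocycle ::
  "'k ring \<Rightarrow> 'g monoid \<Rightarrow> ('g, 'o, 'm, 'k) gtricat \<Rightarrow> nat \<Rightarrow> (nat \<Rightarrow> 'o)
    \<Rightarrow> ('g \<times> 'g \<Rightarrow> nat \<Rightarrow> 'k) \<Rightarrow> bool"
  where "twisting_cocycle K G T n E \<alpha> \<longleftrightarrow>
    \<alpha> \<in> carrier (cochains2 G (torus K n)) \<and>
    (\<exists>S \<iota> \<pi> \<theta>.
      direct_sum T {1..n} E S \<iota> \<pi> \<and>
      (\<forall>g \<in> carrier G. is_iso T S (On_obj (Act T g) S) (\<theta> g)) \<and>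
      (\<forall>g \<in> carrier G. \<forall>h \<in> carrier G.
        \<theta> (g \<otimes>\<^bsub>G\<^esub> h) \<cdot>\<^bsub>T\<^esub> diagonal T n S \<iota> \<pi> (\<alpha> (g, h)) =
        Eps T g h S \<cdot>\<^bsub>T\<^esub> On_mor (Act T g) (\<theta> h) \<cdot>\<^bsub>T\<^esub> \<theta> g))"

end

theory Submission
  imports Defs
begin

text \<open>
  A category generated by an exceptional block is semisimple: the shifts \<open>P i j = E\<^sub>i[j]\<close> have only
  scalar endomorphisms and no other morphisms between them, so every morphism \<open>u\<close> between objects whose
  identity factors through finite sums of them satisfies \<open>u s u = u\<close> for some \<open>s\<close>. Hence distinguished
  triangles with such a first morphism split, and these objects form a triangulated subcategory, which is
  the whole category. Since split candidate triangles are always distinguished, a linear functor commuting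
  with the shift is automatically exact, a shift-compatible transformation between two such functors is the
  same as an arbitrary choice of its components at the \<open>E\<^sub>i\<close>, and any bijection between two blocks
  extends to an exact equivalence. An equivariant structure is therefore determined by its components at
  the \<open>E\<^sub>i\<close>, where it amounts to scalars \<open>c\<^sub>g(i)\<close> whose compatibility with the composition isomorphisms
  says precisely that the two twisting cocycles differ by the coboundary of \<open>c\<close>. Conversely an equivalence
  sends the first block to a shift of the second, by the same integer for all \<open>i\<close> because the action is
  transitive, and shifting a block does not change its twisting cocycle.
\<close>

section \<open>Calculus in linear categories\<close>

text \<open>Direct sums come without a functorial choice and the shift is only an autoequivalence,
  so objects are never decomposed into chosen summands. What is recorded instead is the ideal
  \<open>block_ideal\<close> of morphisms that are finite sums of morphisms through single objects
  \<open>P i j\<close>. Once every identity lies in it, statements about an object are proved by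
  induction along an expression of its identity, usually after generalising from the identity to an
  arbitrary member of the ideal. Naturality between the \<open>P i j\<close> is automatic, since
  morphisms there are zero or scalars and the functors compared treat scalars in the same way. The
  functor between two categories comes from representability: an object of the target is matched
  with X when the block sees the same graded Hom-spaces in both, and all functor laws follow from
  uniqueness of lifts. The scalars \<open>c\<close> measure a given equivariant structure against a
  reference isomorphism, so the cochain whose coboundary relates the two cocycles is the inverse of
  \<open>c\<close>, with its coordinates moved along the permutations.\<close>

definition arr :: "('o, 'm, 'k, 'z) lincat_scheme \<Rightarrow> 'm \<Rightarrow> bool"
  where "arr C f \<longleftrightarrow> (\<exists>X \<in> Obj C. \<exists>Y \<in> Obj C. f \<in> homs C X Y)"

text \<open>Disjointness of Hom-sets makes source and target functions of the morphism alone. Typing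
  conditions become equations, and sums and multiples of morphisms can be written without naming a
  Hom-space.\<close>

definition dm :: "('o, 'm, 'k, 'z) lincat_scheme \<Rightarrow> 'm \<Rightarrow> 'o"
  where "dm C f = (THE X. X \<in> Obj C \<and> (\<exists>Y \<in> Obj C. f \<in> homs C X Y))"

definition cd :: "('o, 'm, 'k, 'z) lincat_scheme \<Rightarrow> 'm \<Rightarrow> 'o"
  where "cd C f = (THE Y. Y \<in> Obj C \<and> (\<exists>X \<in> Obj C. f \<in> homs C X Y))"

definition in_hom :: "('o, 'm, 'k, 'z) lincat_scheme \<Rightarrow> 'o \<Rightarrow> 'o \<Rightarrow> 'm \<Rightarrow> bool"
  where "in_hom C X Y f \<longleftrightarrow> X \<in> Obj C \<and> Y \<in> Obj C \<and> f \<in> homs C X Y"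

abbreviation zer :: "('o, 'm, 'k, 'z) lincat_scheme \<Rightarrow> 'o \<Rightarrow> 'o \<Rightarrow> 'm"
  where "zer C X Y \<equiv> \<zero>\<^bsub>Hom C X Y\<^esub>"

definition plus_mor :: "('o, 'm, 'k, 'z) lincat_scheme \<Rightarrow> 'm \<Rightarrow> 'm \<Rightarrow> 'm" (infixl \<open>\<uplus>\<index>\<close> 65)
  where "f \<uplus>\<^bsub>C\<^esub> g = f \<oplus>\<^bsub>Hom C (dm C f) (cd C f)\<^esub> g"

definition scale_mor :: "('o, 'm, 'k, 'z) lincat_scheme \<Rightarrow> 'k \<Rightarrow> 'm \<Rightarrow> 'm" (infixr \<open>\<star>\<index>\<close> 70)
  where "c \<star>\<^bsub>C\<^esub> f = c \<odot>\<^bsub>Hom C (dm C f) (cd C f)\<^esub> f"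

definition inv_mor :: "('o, 'm, 'k, 'z) lincat_scheme \<Rightarrow> 'm \<Rightarrow> 'm"
  where "inv_mor C f = (SOME g. arr C g \<and> dm C g = cd C f \<and> cd C g = dm C f \<and>
    g \<cdot>\<^bsub>C\<^esub> f = Id C (dm C f) \<and> f \<cdot>\<^bsub>C\<^esub> g = Id C (cd C f))"

context linear_category
begin

lemma dm_eq: "\<lbrakk>X \<in> Obj C; Y \<in> Obj C; f \<in> homs C X Y\<rbrakk> \<Longrightarrow> dm C f = X"
  unfolding dm_def using Hom_disjoint by (intro the_equality) blast+

lemma cd_eq: "\<lbrakk>X \<in> Obj C; Y \<in> Obj C; f \<in> homs C X Y\<rbrakk> \<Longrightarrow> cd C f = Y"
  unfolding cd_def using Hom_disjoint by (intro the_equality) blast+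

lemma homs_iff [simp]:
  "\<lbrakk>X \<in> Obj C; Y \<in> Obj C\<rbrakk> \<Longrightarrow> f \<in> homs C X Y \<longleftrightarrow> arr C f \<and> dm C f = X \<and> cd C f = Y"
  using dm_eq cd_eq unfolding arr_def by metis

lemma in_hom_iff [simp]:
  "in_hom C X Y f \<longleftrightarrow> X \<in> Obj C \<and> Y \<in> Obj C \<and> arr C f \<and> dm C f = X \<and> cd C f = Y"
  unfolding in_hom_def using homs_iff by blast

lemma dm_Obj [simp]: "arr C f \<Longrightarrow> dm C f \<in> Obj C"
  and cd_Obj [simp]: "arr C f \<Longrightarrow> cd C f \<in> Obj C"
  using dm_eq cd_eq unfolding arr_def by metis+

lemma arr_homs: "arr C f \<Longrightarrow> f \<in> homs C (dm C f) (cd C f)"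
  by simp

lemma homs_arr: "\<lbrakk>X \<in> Obj C; Y \<in> Obj C; f \<in> homs C X Y\<rbrakk> \<Longrightarrow> arr C f \<and> dm C f = X \<and> cd C f = Y"
  by simp

lemma Id_arr [simp]:
  assumes "X \<in> Obj C"
  shows "arr C (Id C X)" "dm C (Id C X) = X" "cd C (Id C X) = X"
  using homs_arr[OF assms assms Id_closed[OF assms]] by auto

lemma Comp_arr [simp]:
  assumes "arr C f" "arr C g" "dm C g = cd C f"
  shows "arr C (g \<cdot>\<^bsub>C\<^esub> f)" "dm C (g \<cdot>\<^bsub>C\<^esub> f) = dm C f" "cd C (g \<cdot>\<^bsub>C\<^esub> f) = cd C g"
proof -
  have "g \<cdot>\<^bsub>C\<^esub> f \<in> homs C (dm C f) (cd C g)"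
    by (rule Comp_closed[of _ "cd C f"]) (use assms in auto)
  then show "arr C (g \<cdot>\<^bsub>C\<^esub> f)" "dm C (g \<cdot>\<^bsub>C\<^esub> f) = dm C f" "cd C (g \<cdot>\<^bsub>C\<^esub> f) = cd C g"
    using assms by (auto simp del: homs_iff dest!: homs_arr[rotated 2])
qed

lemma Comp_Id [simp]:
  "\<lbrakk>arr C f; cd C f = Y\<rbrakk> \<Longrightarrow> Id C Y \<cdot>\<^bsub>C\<^esub> f = f"
  "\<lbrakk>arr C f; dm C f = X\<rbrakk> \<Longrightarrow> f \<cdot>\<^bsub>C\<^esub> Id C X = f"
  using Id_left[of "dm C f" "cd C f" f] Id_right[of "dm C f" "cd C f" f] by auto

lemma Comp_assoc_arr [simp]:
  "\<lbrakk>arr C f; arr C g; arr C h; dm C g = cd C f; dm C h = cd C g\<rbrakk>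
    \<Longrightarrow> (h \<cdot>\<^bsub>C\<^esub> g) \<cdot>\<^bsub>C\<^esub> f = h \<cdot>\<^bsub>C\<^esub> g \<cdot>\<^bsub>C\<^esub> f"
  by (rule Comp_assoc[of "dm C f" "cd C f" "cd C g" "cd C h"]) auto

lemma Hom_abelian_group: "\<lbrakk>X \<in> Obj C; Y \<in> Obj C\<rbrakk> \<Longrightarrow> abelian_group (Hom C X Y)"
  using Hom_module module.axioms(2) by blast

lemma zer_arr [simp]:
  assumes "X \<in> Obj C" "Y \<in> Obj C"
  shows "arr C (zer C X Y)" "dm C (zer C X Y) = X" "cd C (zer C X Y) = Y"
proof -
  interpret M: abelian_group "Hom C X Y" using assms by (rule Hom_abelian_group)
  show "arr C (zer C X Y)" "dm C (zer C X Y) = X" "cd C (zer C X Y) = Y"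
    using homs_arr[OF assms M.zero_closed] by auto
qed

lemma plus_arr [simp]:
  assumes "arr C f" "arr C g" "dm C g = dm C f" "cd C g = cd C f"
  shows "arr C (f \<uplus>\<^bsub>C\<^esub> g)" "dm C (f \<uplus>\<^bsub>C\<^esub> g) = dm C f" "cd C (f \<uplus>\<^bsub>C\<^esub> g) = cd C f"
proof -
  interpret M: abelian_group "Hom C (dm C f) (cd C f)" using assms by (simp add: Hom_abelian_group)
  have "f \<uplus>\<^bsub>C\<^esub> g \<in> homs C (dm C f) (cd C f)"
    unfolding plus_mor_def by (rule M.a_closed) (use assms in auto)
  then show "arr C (f \<uplus>\<^bsub>C\<^esub> g)" "dm C (f \<uplus>\<^bsub>C\<^esub> g) = dm C f" "cd C (f \<uplus>\<^bsub>C\<^esub> g) = cd C f"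
    using assms by (auto simp del: homs_iff dest!: homs_arr[rotated 2])
qed

lemma scale_arr [simp]:
  assumes "arr C f" "c \<in> carrier K"
  shows "arr C (c \<star>\<^bsub>C\<^esub> f)" "dm C (c \<star>\<^bsub>C\<^esub> f) = dm C f" "cd C (c \<star>\<^bsub>C\<^esub> f) = cd C f"
proof -
  interpret M: module K "Hom C (dm C f) (cd C f)" using assms by (simp add: Hom_module)
  have "c \<star>\<^bsub>C\<^esub> f \<in> homs C (dm C f) (cd C f)"
    unfolding scale_mor_def by (rule M.smult_closed) (use assms in auto)
  then show "arr C (c \<star>\<^bsub>C\<^esub> f)" "dm C (c \<star>\<^bsub>C\<^esub> f) = dm C f" "cd C (c \<star>\<^bsub>C\<^esub> f) = cd C f"
    using assms by (auto simp del: homs_iff dest!: homs_arr[rotated 2])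
qed

lemma plus_assoc [simp]:
  assumes "arr C f" "arr C g" "arr C h" "dm C g = dm C f" "cd C g = cd C f"
    "dm C h = dm C f" "cd C h = cd C f"
  shows "f \<uplus>\<^bsub>C\<^esub> g \<uplus>\<^bsub>C\<^esub> h = f \<uplus>\<^bsub>C\<^esub> (g \<uplus>\<^bsub>C\<^esub> h)"
proof -
  interpret M: abelian_group "Hom C (dm C f) (cd C f)" using assms by (simp add: Hom_abelian_group)
  have "arr C (f \<uplus>\<^bsub>C\<^esub> g)" "dm C (f \<uplus>\<^bsub>C\<^esub> g) = dm C f" "cd C (f \<uplus>\<^bsub>C\<^esub> g) = cd C f"
    using assms by simp_all
  with M.a_assoc[of f g h] assms show ?thesis
    by (simp add: plus_mor_def)
qed

lemma plus_comm:
  assumes "arr C f" "arr C g" "dm C g = dm C f" "cd C g = cd C f"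
  shows "f \<uplus>\<^bsub>C\<^esub> g = g \<uplus>\<^bsub>C\<^esub> f"
proof -
  interpret M: abelian_group "Hom C (dm C f) (cd C f)" using assms by (simp add: Hom_abelian_group)
  from M.a_comm[of f g] assms show ?thesis by (simp add: plus_mor_def)
qed

lemma plus_lcomm:
  assumes "arr C f" "arr C g" "arr C h" "dm C g = dm C f" "cd C g = cd C f"
    "dm C h = dm C f" "cd C h = cd C f"
  shows "f \<uplus>\<^bsub>C\<^esub> (g \<uplus>\<^bsub>C\<^esub> h) = g \<uplus>\<^bsub>C\<^esub> (f \<uplus>\<^bsub>C\<^esub> h)"
  using assms plus_comm[of f g] plus_assoc[of f g h] plus_assoc[of g f h] by simp

lemma plus_zer [simp]:
  assumes "arr C f" "dm C f = X" "cd C f = Y"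
  shows "f \<uplus>\<^bsub>C\<^esub> zer C X Y = f" "zer C X Y \<uplus>\<^bsub>C\<^esub> f = f"
proof -
  interpret M: abelian_group "Hom C (dm C f) (cd C f)" using assms(1) Hom_abelian_group dm_Obj cd_Obj by blast
  show "f \<uplus>\<^bsub>C\<^esub> zer C X Y = f" "zer C X Y \<uplus>\<^bsub>C\<^esub> f = f"
    using M.r_zero[of f] M.l_zero[of f] assms by (auto simp: plus_mor_def)
qed

lemma plus_left_cancel:
  assumes "f \<uplus>\<^bsub>C\<^esub> g = f \<uplus>\<^bsub>C\<^esub> h" "arr C f" "arr C g" "arr C h" "dm C g = dm C f" "cd C g = cd C f"
    "dm C h = dm C f" "cd C h = cd C f"
  shows "g = h"
proof -
  interpret M: abelian_group "Hom C (dm C f) (cd C f)" using assms by (simp add: Hom_abelian_group)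
  have "\<ominus>\<^bsub>Hom C (dm C f) (cd C f)\<^esub> f \<oplus>\<^bsub>Hom C (dm C f) (cd C f)\<^esub> (f \<uplus>\<^bsub>C\<^esub> x) = x"
    if "arr C x" "dm C x = dm C f" "cd C x = cd C f" for x
    using M.r_neg1[of f x] assms that by (simp add: plus_mor_def)
  then show ?thesis using assms by metis
qed

lemma plus_cancel_zer:
  assumes "f \<uplus>\<^bsub>C\<^esub> g = f" "arr C f" "arr C g" "dm C g = dm C f" "cd C g = cd C f"
  shows "g = zer C (dm C f) (cd C f)"
  by (rule plus_left_cancel[of f]) (use assms in auto)

text \<open>Stands in for subtraction: \<open>h\<close> is \<open>g - f\<close>, obtained together
  with the additive equation in which complements such as \<open>1 - u s\<close> are later
  used.\<close>

lemma complement_exists: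
  assumes "arr C f" "arr C g" "dm C g = dm C f" "cd C g = cd C f"
  obtains h where "arr C h" "dm C h = dm C f" "cd C h = cd C f" "f \<uplus>\<^bsub>C\<^esub> h = g"
proof -
  interpret M: abelian_group "Hom C (dm C f) (cd C f)" using assms by (simp add: Hom_abelian_group)
  have f: "f \<in> homs C (dm C f) (cd C f)" and g: "g \<in> homs C (dm C f) (cd C f)" using assms by auto
  define h where "h = \<ominus>\<^bsub>Hom C (dm C f) (cd C f)\<^esub> f \<oplus>\<^bsub>Hom C (dm C f) (cd C f)\<^esub> g"
  have "h \<in> homs C (dm C f) (cd C f)" using f g unfolding h_def by blast
  moreover have "f \<uplus>\<^bsub>C\<^esub> h = g"
    unfolding plus_mor_def h_def by (rule M.r_neg2) (use f g in auto)
  ultimately show ?thesis using that assms by auto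
qed

lemma Comp_plus [simp]:
  assumes "arr C f" "arr C f'" "arr C g" "dm C f' = dm C f" "cd C f' = cd C f" "dm C g = cd C f"
  shows "g \<cdot>\<^bsub>C\<^esub> (f \<uplus>\<^bsub>C\<^esub> f') = g \<cdot>\<^bsub>C\<^esub> f \<uplus>\<^bsub>C\<^esub> g \<cdot>\<^bsub>C\<^esub> f'"
  using Comp_add_right[of "dm C f" "cd C f" "cd C g" f f' g] assms by (simp add: plus_mor_def)

lemma plus_Comp [simp]:
  assumes "arr C f" "arr C g" "arr C g'" "dm C g' = dm C g" "cd C g' = cd C g" "dm C g = cd C f"
  shows "(g \<uplus>\<^bsub>C\<^esub> g') \<cdot>\<^bsub>C\<^esub> f = g \<cdot>\<^bsub>C\<^esub> f \<uplus>\<^bsub>C\<^esub> g' \<cdot>\<^bsub>C\<^esub> f"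
  using Comp_add_left[of "dm C f" "cd C f" "cd C g" f g g'] assms by (simp add: plus_mor_def)

lemma Comp_scale [simp]:
  assumes "arr C f" "arr C g" "dm C g = cd C f" "c \<in> carrier K"
  shows "g \<cdot>\<^bsub>C\<^esub> (c \<star>\<^bsub>C\<^esub> f) = c \<star>\<^bsub>C\<^esub> g \<cdot>\<^bsub>C\<^esub> f"
  using Comp_smult_right[of "dm C f" "cd C f" "cd C g" f g c] assms by (simp add: scale_mor_def)

lemma scale_Comp [simp]:
  assumes "arr C f" "arr C g" "dm C g = cd C f" "c \<in> carrier K"
  shows "(c \<star>\<^bsub>C\<^esub> g) \<cdot>\<^bsub>C\<^esub> f = c \<star>\<^bsub>C\<^esub> g \<cdot>\<^bsub>C\<^esub> f"
  using Comp_smult_left[of "dm C f" "cd C f" "cd C g" f g c] assms by (simp add: scale_mor_def)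

lemma scale_scale [simp]:
  assumes "arr C f" "c \<in> carrier K" "d \<in> carrier K"
  shows "c \<star>\<^bsub>C\<^esub> d \<star>\<^bsub>C\<^esub> f = (c \<otimes>\<^bsub>K\<^esub> d) \<star>\<^bsub>C\<^esub> f"
proof -
  interpret M: module K "Hom C (dm C f) (cd C f)" using assms by (simp add: Hom_module)
  have "dm C (d \<star>\<^bsub>C\<^esub> f) = dm C f" "cd C (d \<star>\<^bsub>C\<^esub> f) = cd C f" using assms by simp_all
  then show ?thesis using M.smult_assoc1[of c d f] assms by (simp add: scale_mor_def)
qed

lemma scale_plus:
  assumes "arr C f" "arr C g" "dm C g = dm C f" "cd C g = cd C f" "c \<in> carrier K"
  shows "c \<star>\<^bsub>C\<^esub> (f \<uplus>\<^bsub>C\<^esub> g) = c \<star>\<^bsub>C\<^esub> f \<uplus>\<^bsub>C\<^esub> c \<star>\<^bsub>C\<^esub> g"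
proof -
  interpret M: module K "Hom C (dm C f) (cd C f)" using assms by (simp add: Hom_module)
  have "dm C (c \<star>\<^bsub>C\<^esub> f) = dm C f" "cd C (c \<star>\<^bsub>C\<^esub> f) = cd C f"
    "dm C (f \<uplus>\<^bsub>C\<^esub> g) = dm C f" "cd C (f \<uplus>\<^bsub>C\<^esub> g) = cd C f" using assms by simp_all
  then show ?thesis using M.smult_r_distr[of c f g] assms by (simp add: scale_mor_def plus_mor_def)
qed

lemma scale_one [simp]: "arr C f \<Longrightarrow> \<one>\<^bsub>K\<^esub> \<star>\<^bsub>C\<^esub> f = f"
proof -
  assume f: "arr C f"
  then interpret M: module K "Hom C (dm C f) (cd C f)" by (simp add: Hom_module)
  show ?thesis using f M.smult_one by (simp add: scale_mor_def)
qed

lemma scale_zero [simp]: "\<lbrakk>arr C f; dm C f = X; cd C f = Y\<rbrakk> \<Longrightarrow> \<zero>\<^bsub>K\<^esub> \<star>\<^bsub>C\<^esub> f = zer C X Y"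
proof -
  assume f: "arr C f" "dm C f = X" "cd C f = Y"
  then interpret M: module K "Hom C (dm C f) (cd C f)" by (metis Hom_module dm_Obj cd_Obj)
  show ?thesis using f M.smult_l_null[OF arr_homs[OF f(1)]] by (simp add: scale_mor_def)
qed

lemma scale_zer [simp]: "\<lbrakk>X \<in> Obj C; Y \<in> Obj C; c \<in> carrier K\<rbrakk> \<Longrightarrow> c \<star>\<^bsub>C\<^esub> zer C X Y = zer C X Y"
proof -
  assume f: "X \<in> Obj C" "Y \<in> Obj C" "c \<in> carrier K"
  then interpret M: module K "Hom C X Y" by (simp add: Hom_module)
  show ?thesis using f M.smult_r_null by (simp add: scale_mor_def)
qed

lemma Comp_zer [simp]:
  assumes "arr C g" "dm C g = Y" "X \<in> Obj C"
  shows "g \<cdot>\<^bsub>C\<^esub> zer C X Y = zer C X (cd C g)"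
proof -
  have "zer C X Y = \<zero>\<^bsub>K\<^esub> \<star>\<^bsub>C\<^esub> zer C X Y" using assms by auto
  then have "g \<cdot>\<^bsub>C\<^esub> zer C X Y = \<zero>\<^bsub>K\<^esub> \<star>\<^bsub>C\<^esub> (g \<cdot>\<^bsub>C\<^esub> zer C X Y)"
    using assms Comp_scale[of "zer C X Y" g "\<zero>\<^bsub>K\<^esub>"] by auto
  also have "\<dots> = zer C X (cd C g)" by (rule scale_zero) (use assms in auto)
  finally show ?thesis .
qed

lemma zer_Comp [simp]:
  assumes "arr C f" "cd C f = X" "Y \<in> Obj C"
  shows "zer C X Y \<cdot>\<^bsub>C\<^esub> f = zer C (dm C f) Y"
proof -
  have "zer C X Y = \<zero>\<^bsub>K\<^esub> \<star>\<^bsub>C\<^esub> zer C X Y" using assms by auto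
  then have "zer C X Y \<cdot>\<^bsub>C\<^esub> f = \<zero>\<^bsub>K\<^esub> \<star>\<^bsub>C\<^esub> (zer C X Y \<cdot>\<^bsub>C\<^esub> f)"
    using assms scale_Comp[of f "zer C X Y" "\<zero>\<^bsub>K\<^esub>"] by auto
  also have "\<dots> = zer C (dm C f) Y" by (rule scale_zero) (use assms in auto)
  finally show ?thesis .
qed

lemma scale_eq_zer:
  assumes "c \<star>\<^bsub>C\<^esub> f = zer C X Y" "arr C f" "dm C f = X" "cd C f = Y" "c \<in> carrier K" "c \<noteq> \<zero>\<^bsub>K\<^esub>"
  shows "f = zer C X Y"
proof -
  have c: "inv\<^bsub>K\<^esub> c \<in> carrier K" "inv\<^bsub>K\<^esub> c \<otimes>\<^bsub>K\<^esub> c = \<one>\<^bsub>K\<^esub>" using assms by (simp_all add: field_Units)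
  have "f = inv\<^bsub>K\<^esub> c \<star>\<^bsub>C\<^esub> c \<star>\<^bsub>C\<^esub> f" using assms(2,5) c by simp
  also have "\<dots> = inv\<^bsub>K\<^esub> c \<star>\<^bsub>C\<^esub> zer C X Y" by (simp only: assms(1))
  also have "\<dots> = zer C X Y" by (rule scale_zer) (use assms c in auto)
  finally show ?thesis .
qed

lemma is_iso_iff:
  "is_iso C X Y f \<longleftrightarrow> X \<in> Obj C \<and> Y \<in> Obj C \<and> arr C f \<and> dm C f = X \<and> cd C f = Y \<and>
    (\<exists>g. arr C g \<and> dm C g = Y \<and> cd C g = X \<and> g \<cdot>\<^bsub>C\<^esub> f = Id C X \<and> f \<cdot>\<^bsub>C\<^esub> g = Id C Y)"
  if "X \<in> Obj C" "Y \<in> Obj C"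
  using that unfolding is_iso_def by auto

lemma is_iso_inverse:
  assumes "is_iso C X Y f" "X \<in> Obj C" "Y \<in> Obj C"
  shows "arr C f" "dm C f = X" "cd C f = Y"
    "arr C (inv_mor C f)" "dm C (inv_mor C f) = Y" "cd C (inv_mor C f) = X"
    "inv_mor C f \<cdot>\<^bsub>C\<^esub> f = Id C X" "f \<cdot>\<^bsub>C\<^esub> inv_mor C f = Id C Y"
    "\<lbrakk>arr C h; cd C h = X\<rbrakk> \<Longrightarrow> inv_mor C f \<cdot>\<^bsub>C\<^esub> f \<cdot>\<^bsub>C\<^esub> h = h"
    "\<lbrakk>arr C h; cd C h = Y\<rbrakk> \<Longrightarrow> f \<cdot>\<^bsub>C\<^esub> inv_mor C f \<cdot>\<^bsub>C\<^esub> h = h"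
proof -
  have *: "arr C f" "dm C f = X" "cd C f = Y"
    "\<exists>g. arr C g \<and> dm C g = cd C f \<and> cd C g = dm C f \<and>
      g \<cdot>\<^bsub>C\<^esub> f = Id C (dm C f) \<and> f \<cdot>\<^bsub>C\<^esub> g = Id C (cd C f)"
    using assms is_iso_iff by auto
  note g = someI_ex[OF *(4), folded inv_mor_def, unfolded *(2,3)]
  from * show "arr C f" "dm C f = X" "cd C f = Y" by auto
  from g show "arr C (inv_mor C f)" "dm C (inv_mor C f) = Y" "cd C (inv_mor C f) = X"
    "inv_mor C f \<cdot>\<^bsub>C\<^esub> f = Id C X" "f \<cdot>\<^bsub>C\<^esub> inv_mor C f = Id C Y" by auto
  show "inv_mor C f \<cdot>\<^bsub>C\<^esub> f \<cdot>\<^bsub>C\<^esub> h = h" if "arr C h" "cd C h = X"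
    using Comp_assoc_arr[of h f "inv_mor C f"] * g that by simp
  show "f \<cdot>\<^bsub>C\<^esub> inv_mor C f \<cdot>\<^bsub>C\<^esub> h = h" if "arr C h" "cd C h = Y"
    using Comp_assoc_arr[of h "inv_mor C f" f] * g that by simp
qed

lemma is_isoI:
  assumes "X \<in> Obj C" "Y \<in> Obj C" "arr C f" "dm C f = X" "cd C f = Y"
    "arr C g" "dm C g = Y" "cd C g = X" "g \<cdot>\<^bsub>C\<^esub> f = Id C X" "f \<cdot>\<^bsub>C\<^esub> g = Id C Y"
  shows "is_iso C X Y f"
  using assms is_iso_iff by blast

lemma is_iso_Id: "X \<in> Obj C \<Longrightarrow> is_iso C X X (Id C X)"
  by (rule is_isoI[of _ _ _ "Id C X"]) auto

lemma is_iso_Comp: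
  assumes "is_iso C X Y f" "is_iso C Y Z g" "X \<in> Obj C" "Y \<in> Obj C" "Z \<in> Obj C"
  shows "is_iso C X Z (g \<cdot>\<^bsub>C\<^esub> f)"
  using is_iso_inverse[OF assms(1,3,4)] is_iso_inverse[OF assms(2,4,5)] assms(3-)
  by (intro is_isoI[of _ _ _ "inv_mor C f \<cdot>\<^bsub>C\<^esub> inv_mor C g"]) auto

lemma is_iso_inv:
  assumes "is_iso C X Y f" "X \<in> Obj C" "Y \<in> Obj C"
  shows "is_iso C Y X (inv_mor C f)"
  using is_iso_inverse[OF assms] assms by (intro is_isoI[of _ _ _ f]) auto

lemma isomorphic_sym:
  assumes "isomorphic C X Y" "X \<in> Obj C" "Y \<in> Obj C"
  shows "isomorphic C Y X"
  using assms is_iso_inv unfolding isomorphic_def by blast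

lemma isomorphic_trans:
  assumes "isomorphic C X Y" "isomorphic C Y Z" "X \<in> Obj C" "Y \<in> Obj C" "Z \<in> Obj C"
  shows "isomorphic C X Z"
  using assms is_iso_Comp unfolding isomorphic_def by blast

lemma isomorphic_refl: "X \<in> Obj C \<Longrightarrow> isomorphic C X X"
  using is_iso_Id unfolding isomorphic_def by blast

text \<open>A morphism into or out of \<open>Z\<close> is unchanged by composing with the identity
  of \<open>Z\<close>, so it vanishes once that identity does. The equational form is what passes
  through linear functors such as the shift.\<close>

lemma zero_object_iff: "zero_object C Z \<longleftrightarrow> Z \<in> Obj C \<and> Id C Z = zer C Z Z"
proof
  assume "zero_object C Z"
  then have Z: "Z \<in> Obj C" and "\<exists>!f. f \<in> homs C Z Z"
    unfolding zero_object_def by blast+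
  moreover have "Id C Z \<in> homs C Z Z" "zer C Z Z \<in> homs C Z Z" using Z by auto
  ultimately show "Z \<in> Obj C \<and> Id C Z = zer C Z Z" by blast
next
  assume Z: "Z \<in> Obj C \<and> Id C Z = zer C Z Z"
  have 1: "f = zer C X Z" if "arr C f" "dm C f = X" "cd C f = Z" for f X
    using Comp_Id(1)[of f Z] zer_Comp[of f Z Z] that Z by simp
  have 2: "f = zer C Z X" if "arr C f" "dm C f = Z" "cd C f = X" for f X
    using Comp_Id(2)[of f Z] Comp_zer[of f Z Z] that Z by simp
  show "zero_object C Z"
    unfolding zero_object_def
  proof (intro conjI ballI)
    fix X assume X: "X \<in> Obj C"
    show "\<exists>!f. f \<in> homs C X Z"
      by (rule ex1I[of _ "zer C X Z"]) (use X Z 1 in auto)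
    show "\<exists>!f. f \<in> homs C Z X"
      by (rule ex1I[of _ "zer C Z X"]) (use X Z 2 in auto)
  qed (use Z in auto)
qed

lemma zero_object_mor:
  assumes "zero_object C Z"
  shows "\<lbrakk>arr C f; cd C f = Z\<rbrakk> \<Longrightarrow> f = zer C (dm C f) Z"
    "\<lbrakk>arr C f; dm C f = Z\<rbrakk> \<Longrightarrow> f = zer C Z (cd C f)"
proof -
  have Z: "Z \<in> Obj C" "Id C Z = zer C Z Z" using assms zero_object_iff by auto
  show "f = zer C (dm C f) Z" if "arr C f" "cd C f = Z"
    using Comp_Id(1)[of f Z] zer_Comp[of f Z Z] Z that by simp
  show "f = zer C Z (cd C f)" if "arr C f" "dm C f = Z"
    using Comp_Id(2)[of f Z] Comp_zer[of f Z Z] Z that by simp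
qed

text \<open>The sign in the rotation axiom becomes a scalar, so that bilinearity of composition and
  linearity of functors apply to it.\<close>

lemma uminus_mor [simp]:
  assumes "arr C f" "dm C f = X" "cd C f = Y"
  shows "\<ominus>\<^bsub>Hom C X Y\<^esub> f = (\<ominus>\<^bsub>K\<^esub> \<one>\<^bsub>K\<^esub>) \<star>\<^bsub>C\<^esub> f"
proof -
  interpret M: module K "Hom C (dm C f) (cd C f)" using assms(1) by (simp add: Hom_module)
  show ?thesis using M.smult_l_minus[OF one_closed arr_homs[OF assms(1)]] M.smult_one[OF arr_homs[OF assms(1)]] assms
    by (simp add: scale_mor_def)
qed

lemma minus_one_neq_zero: "\<ominus>\<^bsub>K\<^esub> \<one>\<^bsub>K\<^esub> \<noteq> \<zero>\<^bsub>K\<^esub>"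
proof
  assume "\<ominus>\<^bsub>K\<^esub> \<one>\<^bsub>K\<^esub> = \<zero>\<^bsub>K\<^esub>"
  then have "\<one>\<^bsub>K\<^esub> = \<zero>\<^bsub>K\<^esub>" using r_neg[OF one_closed] r_zero[OF one_closed] by simp
  then show False by simp
qed

lemma minus_mor_eq_zer:
  assumes "(\<ominus>\<^bsub>K\<^esub> \<one>\<^bsub>K\<^esub>) \<star>\<^bsub>C\<^esub> f = zer C X Y" "arr C f" "dm C f = X" "cd C f = Y"
  shows "f = zer C X Y"
  by (rule scale_eq_zer[OF assms]) (auto simp: minus_one_neq_zero)

text \<open>Composites are kept bracketed to the right, where an equation for \<open>a b\<close> is
  no longer visible in front of a further factor. This is the same equation with a tail
  \<open>x\<close>.\<close>

lemma Comp_reduce: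
  "\<lbrakk>a \<cdot>\<^bsub>C\<^esub> b = c; arr C x; arr C b; arr C a; dm C b = cd C x; dm C a = cd C b\<rbrakk>
    \<Longrightarrow> a \<cdot>\<^bsub>C\<^esub> b \<cdot>\<^bsub>C\<^esub> x = c \<cdot>\<^bsub>C\<^esub> x"
  by (metis Comp_assoc_arr)

lemma is_iso_cancel:
  assumes "is_iso C X Y f" "X \<in> Obj C" "Y \<in> Obj C"
  shows "\<lbrakk>f \<cdot>\<^bsub>C\<^esub> g = f \<cdot>\<^bsub>C\<^esub> h; arr C g; arr C h; cd C g = X; cd C h = X\<rbrakk> \<Longrightarrow> g = h"
    "\<lbrakk>g \<cdot>\<^bsub>C\<^esub> f = h \<cdot>\<^bsub>C\<^esub> f; arr C g; arr C h; dm C g = Y; dm C h = Y\<rbrakk> \<Longrightarrow> g = h"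
proof -
  note i = is_iso_inverse[OF assms]
  show "\<lbrakk>f \<cdot>\<^bsub>C\<^esub> g = f \<cdot>\<^bsub>C\<^esub> h; arr C g; arr C h; cd C g = X; cd C h = X\<rbrakk> \<Longrightarrow> g = h"
    by (metis i(9))
  assume a: "g \<cdot>\<^bsub>C\<^esub> f = h \<cdot>\<^bsub>C\<^esub> f" "arr C g" "arr C h" "dm C g = Y" "dm C h = Y"
  then have "(g \<cdot>\<^bsub>C\<^esub> f) \<cdot>\<^bsub>C\<^esub> inv_mor C f = (h \<cdot>\<^bsub>C\<^esub> f) \<cdot>\<^bsub>C\<^esub> inv_mor C f" by simp
  then show "g = h" using a(2-) i by simp
qed

end

section \<open>Semilinear functors\<close>

text \<open>Covers both the \<Bbbk>-linear functors, with \<open>s\<close> the identity, and the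
  autoequivalences of the action, with \<open>s = \<sigma> g\<close>.\<close>

locale lin_functor = C: linear_category K C + D: linear_category K D
  for K :: "'k ring" and s :: "'k \<Rightarrow> 'k"
    and C :: "('o1, 'm1, 'k, 'y) lincat_scheme" and D :: "('o2, 'm2, 'k, 'z) lincat_scheme"
    and F :: "('o1, 'm1, 'o2, 'm2, 'w) functr_scheme" +
  assumes semilinear: "semilinear_functor K s C D F"
    and s_closed [simp]: "c \<in> carrier K \<Longrightarrow> s c \<in> carrier K"
begin

lemma F_Obj [simp]: "X \<in> Obj C \<Longrightarrow> On_obj F X \<in> Obj D"
  and F_Id [simp]: "X \<in> Obj C \<Longrightarrow> On_mor F (Id C X) = Id D (On_obj F X)"
  using semilinear unfolding semilinear_functor_def additive_functor_def is_functor_def by auto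

lemma F_arr [simp]:
  assumes "arr C f"
  shows "arr D (On_mor F f)" "dm D (On_mor F f) = On_obj F (dm C f)"
    "cd D (On_mor F f) = On_obj F (cd C f)"
proof -
  have "On_mor F f \<in> homs D (On_obj F (dm C f)) (On_obj F (cd C f))"
    using semilinear C.arr_homs[OF assms] assms
    unfolding semilinear_functor_def additive_functor_def is_functor_def
    by (metis C.dm_Obj C.cd_Obj)
  then show "arr D (On_mor F f)" "dm D (On_mor F f) = On_obj F (dm C f)"
    "cd D (On_mor F f) = On_obj F (cd C f)"
    using assms by auto
qed

lemma F_Comp [simp]:
  assumes "arr C f" "arr C g" "dm C g = cd C f"
  shows "On_mor F (g \<cdot>\<^bsub>C\<^esub> f) = On_mor F g \<cdot>\<^bsub>D\<^esub> On_mor F f"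
proof -
  have *: "\<forall>X \<in> Obj C. \<forall>Y \<in> Obj C. \<forall>Z \<in> Obj C. \<forall>f \<in> homs C X Y. \<forall>g \<in> homs C Y Z.
      On_mor F (g \<cdot>\<^bsub>C\<^esub> f) = On_mor F g \<cdot>\<^bsub>D\<^esub> On_mor F f"
    using semilinear unfolding semilinear_functor_def additive_functor_def is_functor_def by blast
  show ?thesis
    using *[rule_format, of "dm C f" "cd C f" "cd C g" f g] assms by simp
qed

lemma F_plus [simp]:
  assumes "arr C f" "arr C g" "dm C g = dm C f" "cd C g = cd C f"
  shows "On_mor F (f \<uplus>\<^bsub>C\<^esub> g) = On_mor F f \<uplus>\<^bsub>D\<^esub> On_mor F g"
proof -
  have *: "\<forall>X \<in> Obj C. \<forall>Y \<in> Obj C. \<forall>f \<in> homs C X Y. \<forall>f' \<in> homs C X Y.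
      On_mor F (f \<oplus>\<^bsub>Hom C X Y\<^esub> f') =
        On_mor F f \<oplus>\<^bsub>Hom D (On_obj F X) (On_obj F Y)\<^esub> On_mor F f'"
    using semilinear unfolding semilinear_functor_def additive_functor_def by blast
  show ?thesis
    using *[rule_format, of "dm C f" "cd C f" f g] assms by (simp add: plus_mor_def)
qed

lemma F_scale [simp]:
  assumes "arr C f" "c \<in> carrier K"
  shows "On_mor F (c \<star>\<^bsub>C\<^esub> f) = s c \<star>\<^bsub>D\<^esub> On_mor F f"
proof -
  have *: "\<forall>X \<in> Obj C. \<forall>Y \<in> Obj C. \<forall>f \<in> homs C X Y. \<forall>c \<in> carrier K.
      On_mor F (c \<odot>\<^bsub>Hom C X Y\<^esub> f) = s c \<odot>\<^bsub>Hom D (On_obj F X) (On_obj F Y)\<^esub> On_mor F f"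
    using semilinear unfolding semilinear_functor_def by blast
  show ?thesis
    using *[rule_format, of "dm C f" "cd C f" f c] assms by (simp add: scale_mor_def)
qed

lemma F_zer [simp]:
  assumes "X \<in> Obj C" "Y \<in> Obj C"
  shows "On_mor F (zer C X Y) = zer D (On_obj F X) (On_obj F Y)"
proof -
  have "On_mor F (zer C X Y) = On_mor F (zer C X Y \<uplus>\<^bsub>C\<^esub> zer C X Y)" using assms by simp
  also have "\<dots> = On_mor F (zer C X Y) \<uplus>\<^bsub>D\<^esub> On_mor F (zer C X Y)"
    by (rule F_plus) (use assms in auto)
  finally show ?thesis
    using D.plus_cancel_zer[of "On_mor F (zer C X Y)" "On_mor F (zer C X Y)"] assms by simp
qed

lemma F_iso:
  assumes "is_iso C X Y f" "X \<in> Obj C" "Y \<in> Obj C"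
  shows "is_iso D (On_obj F X) (On_obj F Y) (On_mor F f)"
proof (rule D.is_isoI[of _ _ _ "On_mor F (inv_mor C f)"])
  note i = C.is_iso_inverse[OF assms]
  have "On_mor F (inv_mor C f) \<cdot>\<^bsub>D\<^esub> On_mor F f = On_mor F (inv_mor C f \<cdot>\<^bsub>C\<^esub> f)"
    using i by (subst F_Comp) auto
  then show "On_mor F (inv_mor C f) \<cdot>\<^bsub>D\<^esub> On_mor F f = Id D (On_obj F X)"
    using i assms by auto
  have "On_mor F f \<cdot>\<^bsub>D\<^esub> On_mor F (inv_mor C f) = On_mor F (f \<cdot>\<^bsub>C\<^esub> inv_mor C f)"
    using i by (subst F_Comp) auto
  then show "On_mor F f \<cdot>\<^bsub>D\<^esub> On_mor F (inv_mor C f) = Id D (On_obj F Y)"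
    using i assms by auto
qed (use C.is_iso_inverse[OF assms] assms in auto)

lemma F_isomorphic:
  assumes "isomorphic C X Y" "X \<in> Obj C" "Y \<in> Obj C"
  shows "isomorphic D (On_obj F X) (On_obj F Y)"
  using assms F_iso unfolding isomorphic_def by blast

end

locale lin_equivalence = lin_functor K s C D F
  for K :: "'k ring" and s :: "'k \<Rightarrow> 'k"
    and C :: "('o1, 'm1, 'k, 'y) lincat_scheme" and D :: "('o2, 'm2, 'k, 'z) lincat_scheme"
    and F :: "('o1, 'm1, 'o2, 'm2, 'w) functr_scheme" +
  assumes equivalence: "equivalence C D F"
begin

lemma quasi_inverse:
  obtains H :: "('o2, 'm2, 'o1, 'm1) functr" and \<eta> \<mu> where "is_functor C D F" "is_functor D C H"
    "\<And>X. X \<in> Obj D \<Longrightarrow> On_obj H X \<in> Obj C"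
    "\<And>f. arr D f \<Longrightarrow> arr C (On_mor H f)"
    "\<And>f. arr D f \<Longrightarrow> dm C (On_mor H f) = On_obj H (dm D f)"
    "\<And>f. arr D f \<Longrightarrow> cd C (On_mor H f) = On_obj H (cd D f)"
    "\<And>X. X \<in> Obj C \<Longrightarrow> is_iso C X (On_obj H (On_obj F X)) (\<eta> X)"
    "\<And>X. X \<in> Obj D \<Longrightarrow> is_iso D (On_obj F (On_obj H X)) X (\<mu> X)"
    "\<And>f. arr C f \<Longrightarrow> \<eta> (cd C f) \<cdot>\<^bsub>C\<^esub> f = On_mor H (On_mor F f) \<cdot>\<^bsub>C\<^esub> \<eta> (dm C f)"
    "\<And>f. arr D f \<Longrightarrow> \<mu> (cd D f) \<cdot>\<^bsub>D\<^esub> On_mor F (On_mor H f) = f \<cdot>\<^bsub>D\<^esub> \<mu> (dm D f)"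
proof -
  obtain H :: "('o2, 'm2, 'o1, 'm1) functr" and \<eta> \<mu> where
    H: "is_functor C D F" "is_functor D C H"
    "nat_iso C C id_functor (comp_functor H F) \<eta>" "nat_iso D D (comp_functor F H) id_functor \<mu>"
    using equivalence unfolding equivalence_def by blast
  have o: "On_obj H X \<in> Obj C" if "X \<in> Obj D" for X
    using H(2) that unfolding is_functor_def by blast
  have m: "On_mor H f \<in> homs C (On_obj H (dm D f)) (On_obj H (cd D f))" if "arr D f" for f
    using H(2) D.arr_homs[OF that] that D.dm_Obj D.cd_Obj unfolding is_functor_def by metis
  show ?thesis
  proof (rule that[OF H(1,2), of \<eta> \<mu>])
    fix f assume f: "arr D f"
    show "arr C (On_mor H f)" "dm C (On_mor H f) = On_obj H (dm D f)"
      "cd C (On_mor H f) = On_obj H (cd D f)"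
      using m[OF f] f o by auto
    show "\<mu> (cd D f) \<cdot>\<^bsub>D\<^esub> On_mor F (On_mor H f) = f \<cdot>\<^bsub>D\<^esub> \<mu> (dm D f)"
      using H(4) D.arr_homs[OF f] f D.dm_Obj D.cd_Obj
      unfolding nat_iso_def comp_functor_def id_functor_def by fastforce
  next
    fix f assume f: "arr C f"
    show "\<eta> (cd C f) \<cdot>\<^bsub>C\<^esub> f = On_mor H (On_mor F f) \<cdot>\<^bsub>C\<^esub> \<eta> (dm C f)"
      using H(3) C.arr_homs[OF f] f C.dm_Obj C.cd_Obj
      unfolding nat_iso_def comp_functor_def id_functor_def by fastforce
  qed (use o H(3,4) in \<open>auto simp: nat_iso_def comp_functor_def id_functor_def\<close>)
qed

lemma faithful:
  assumes "On_mor F f = On_mor F g" "arr C f" "arr C g" "dm C g = dm C f" "cd C g = cd C f"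
  shows "f = g"
proof -
  obtain H :: "('o2, 'm2, 'o1, 'm1) functr" and \<eta> \<mu> where H: "\<And>X. X \<in> Obj D \<Longrightarrow> On_obj H X \<in> Obj C"
    "\<And>X. X \<in> Obj C \<Longrightarrow> is_iso C X (On_obj H (On_obj F X)) (\<eta> X)"
    "\<And>f. arr C f \<Longrightarrow> \<eta> (cd C f) \<cdot>\<^bsub>C\<^esub> f = On_mor H (On_mor F f) \<cdot>\<^bsub>C\<^esub> \<eta> (dm C f)"
    by (rule quasi_inverse) blast
  have *: "\<eta> (cd C f) \<cdot>\<^bsub>C\<^esub> f = \<eta> (cd C f) \<cdot>\<^bsub>C\<^esub> g" using H(3)[of f] H(3)[of g] assms by simp
  show ?thesis
    by (rule C.is_iso_cancel(1)[OF H(2) _ _ *]) (use assms H(1) in auto)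
qed

lemma full:
  assumes "arr D g" "dm D g = On_obj F X" "cd D g = On_obj F Y" "X \<in> Obj C" "Y \<in> Obj C"
  obtains f where "arr C f" "dm C f = X" "cd C f = Y" "On_mor F f = g"
proof -
  obtain H :: "('o2, 'm2, 'o1, 'm1) functr" and \<eta> \<mu> where H: "\<And>X. X \<in> Obj D \<Longrightarrow> On_obj H X \<in> Obj C"
    "\<And>f. arr D f \<Longrightarrow> arr C (On_mor H f)"
    "\<And>f. arr D f \<Longrightarrow> dm C (On_mor H f) = On_obj H (dm D f)"
    "\<And>f. arr D f \<Longrightarrow> cd C (On_mor H f) = On_obj H (cd D f)"
    "\<And>X. X \<in> Obj C \<Longrightarrow> is_iso C X (On_obj H (On_obj F X)) (\<eta> X)"
    "\<And>X. X \<in> Obj D \<Longrightarrow> is_iso D (On_obj F (On_obj H X)) X (\<mu> X)"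
    "\<And>f. arr C f \<Longrightarrow> \<eta> (cd C f) \<cdot>\<^bsub>C\<^esub> f = On_mor H (On_mor F f) \<cdot>\<^bsub>C\<^esub> \<eta> (dm C f)"
    "\<And>f. arr D f \<Longrightarrow> \<mu> (cd D f) \<cdot>\<^bsub>D\<^esub> On_mor F (On_mor H f) = f \<cdot>\<^bsub>D\<^esub> \<mu> (dm D f)"
    by (rule quasi_inverse) blast
  have HO: "On_obj H (On_obj F Z) \<in> Obj C" if "Z \<in> Obj C" for Z using that H(1) by simp
  note iX = C.is_iso_inverse[OF H(5)[OF assms(4)] assms(4) HO[OF assms(4)]]
    and iY = C.is_iso_inverse[OF H(5)[OF assms(5)] assms(5) HO[OF assms(5)]]
  \<comment> \<open>Naturality of \<eta> forces this formula on any preimage of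
    \<open>g\<close>.\<close>
  define f where "f = inv_mor C (\<eta> Y) \<cdot>\<^bsub>C\<^esub> On_mor H g \<cdot>\<^bsub>C\<^esub> \<eta> X"
  have f: "arr C f" "dm C f = X" "cd C f = Y"
    unfolding f_def using iX iY H(2-4) assms by simp_all
  have "\<eta> Y \<cdot>\<^bsub>C\<^esub> f = On_mor H g \<cdot>\<^bsub>C\<^esub> \<eta> X"
    using iX iY H(2-4) assms unfolding f_def by simp
  then have *: "On_mor H (On_mor F f) \<cdot>\<^bsub>C\<^esub> \<eta> X = On_mor H g \<cdot>\<^bsub>C\<^esub> \<eta> X"
    using H(7)[OF f(1)] f by simp
  have HH: "On_mor H (On_mor F f) = On_mor H g"
    by (rule C.is_iso_cancel(2)[OF H(5)[OF assms(4)] assms(4) HO[OF assms(4)] *])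
      (use f H(2-4) assms in auto)
  \<comment> \<open>So far only the images under the quasi-inverse \<open>H\<close> agree;
    naturality of \<mu> shows that \<open>H\<close> is faithful.\<close>
  have *: "On_mor F f \<cdot>\<^bsub>D\<^esub> \<mu> (On_obj F X) = g \<cdot>\<^bsub>D\<^esub> \<mu> (On_obj F X)"
    using H(8)[of "On_mor F f"] H(8)[of g] assms f HH by simp
  have "On_mor F f = g"
    by (rule D.is_iso_cancel(2)[OF H(6) _ _ *]) (use f assms HO in auto)
  with f that show ?thesis by blast
qed

lemma essentially_surjective:
  assumes "Y \<in> Obj D"
  obtains X where "X \<in> Obj C" "isomorphic D (On_obj F X) Y"
  using quasi_inverse assms unfolding isomorphic_def by metis

lemma reflects_iso:
  assumes "is_iso D (On_obj F X) (On_obj F Y) (On_mor F f)"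
    "arr C f" "dm C f = X" "cd C f = Y" "X \<in> Obj C" "Y \<in> Obj C"
  shows "is_iso C X Y f"
proof -
  note i = D.is_iso_inverse[OF assms(1) F_Obj F_Obj, OF assms(5,6)]
  obtain g where g: "arr C g" "dm C g = Y" "cd C g = X" "On_mor F g = inv_mor D (On_mor F f)"
    using full[of "inv_mor D (On_mor F f)" Y X] i assms by metis
  show ?thesis
  proof (rule C.is_isoI[of _ _ _ g])
    show "g \<cdot>\<^bsub>C\<^esub> f = Id C X" by (rule faithful) (use g i assms in auto)
    show "f \<cdot>\<^bsub>C\<^esub> g = Id C Y" by (rule faithful) (use g i assms in auto)
  qed (use g assms in auto)
qed

end

section \<open>Split triangles\<close>

text \<open>A contracting homotopy \<open>(s, t, r)\<close> of a candidate triangle.\<close>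

definition split_triangle ::
  "('o, 'm, 'k, 'z) tricat_scheme \<Rightarrow> 'o \<Rightarrow> 'o \<Rightarrow> 'o \<Rightarrow> 'm \<Rightarrow> 'm \<Rightarrow> 'm \<Rightarrow> 'm \<Rightarrow> 'm \<Rightarrow> 'm \<Rightarrow> bool"
  where "split_triangle T X Y Z u v w s t r \<longleftrightarrow>
    triangle T X Y Z u v w \<and> in_hom T Y X s \<and> in_hom T Z Y t \<and> in_hom T (sh_obj T X) Z r \<and>
    v \<cdot>\<^bsub>T\<^esub> u = zer T X Z \<and> w \<cdot>\<^bsub>T\<^esub> v = zer T Y (sh_obj T X) \<and>
    sh_mor T u \<cdot>\<^bsub>T\<^esub> w = zer T Z (sh_obj T Y) \<and>
    u \<cdot>\<^bsub>T\<^esub> s \<uplus>\<^bsub>T\<^esub> t \<cdot>\<^bsub>T\<^esub> v = Id T Y \<and> v \<cdot>\<^bsub>T\<^esub> t \<uplus>\<^bsub>T\<^esub> r \<cdot>\<^bsub>T\<^esub> w = Id T Z \<and>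
    w \<cdot>\<^bsub>T\<^esub> r \<uplus>\<^bsub>T\<^esub> sh_mor T (s \<cdot>\<^bsub>T\<^esub> u) = Id T (sh_obj T X)"

sublocale triangulated_category \<subseteq> Sh: lin_equivalence K "\<lambda>c. c" T T "Shift T"
  by unfold_locales (auto simp: Shift_linear Shift_equivalence)

context triangulated_category
begin

lemma triangle_iff [simp]:
  "triangle T X Y Z u v w \<longleftrightarrow> X \<in> Obj T \<and> Y \<in> Obj T \<and> Z \<in> Obj T \<and>
    arr T u \<and> dm T u = X \<and> cd T u = Y \<and> arr T v \<and> dm T v = Y \<and> cd T v = Z \<and>
    arr T w \<and> dm T w = Z \<and> cd T w = sh_obj T X"
  unfolding triangle_def by (auto simp del: Sh.F_arr)

lemma distD:
  assumes "distinguished T X Y Z u v w"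
  shows "X \<in> Obj T" "Y \<in> Obj T" "Z \<in> Obj T" "arr T u" "dm T u = X" "cd T u = Y"
    "arr T v" "dm T v = Y" "cd T v = Z" "arr T w" "dm T w = Z" "cd T w = sh_obj T X"
  using assms unfolding distinguished_def by auto

lemma rotate:
  assumes "distinguished T X Y Z u v w"
  shows "distinguished T Y Z (sh_obj T X) v w ((\<ominus>\<^bsub>K\<^esub> \<one>\<^bsub>K\<^esub>) \<star>\<^bsub>T\<^esub> sh_mor T u)"
  using TR2[of X Y Z u v w] assms distD[OF assms] by (simp add: distinguished_def)

lemma zero_object_shift: "zero_object T Z \<Longrightarrow> zero_object T (sh_obj T Z)"
  unfolding zero_object_iff using Sh.F_Id Sh.F_zer by (metis Sh.F_Obj)

text \<open>Map the triangle of the identity of \<open>X\<close> to the given one by the identity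
  and \<open>u\<close>; the third component factors \<open>v u\<close> through a zero
  object.\<close>

lemma dist_comp1:
  assumes "distinguished T X Y Z u v w"
  shows "v \<cdot>\<^bsub>T\<^esub> u = zer T X Z"
proof -
  note d = distD[OF assms]
  obtain N where N: "zero_object T N" using zero_object_exists by blast
  then have N': "N \<in> Obj T" using zero_object_iff by blast
  obtain h where h: "h \<in> homs T N Z" "h \<cdot>\<^bsub>T\<^esub> zer T X N = v \<cdot>\<^bsub>T\<^esub> u"
    using TR3[OF TR1_id[OF d(1) N] assms, of "Id T X" u] d by auto
  then show ?thesis using d N' by auto
qed

lemma dist_comp2:
  assumes "distinguished T X Y Z u v w"
  shows "w \<cdot>\<^bsub>T\<^esub> v = zer T Y (sh_obj T X)"
  using dist_comp1[OF rotate[OF assms]] .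

lemma dist_comp3:
  assumes "distinguished T X Y Z u v w"
  shows "sh_mor T u \<cdot>\<^bsub>T\<^esub> w = zer T Z (sh_obj T Y)"
proof (rule minus_mor_eq_zer)
  note d = distD[OF assms]
  show "(\<ominus>\<^bsub>K\<^esub> \<one>\<^bsub>K\<^esub>) \<star>\<^bsub>T\<^esub> sh_mor T u \<cdot>\<^bsub>T\<^esub> w = zer T Z (sh_obj T Y)"
    using dist_comp2[OF rotate[OF assms]] d by simp
qed (use distD[OF assms] in auto)

text \<open>In a distinguished triangle \<open>v\<close> is a weak cokernel of \<open>u\<close>: TR3
  applied to a morphism into a triangle with first object zero and second morphism an
  identity.\<close>

lemma dist_coker:
  assumes "distinguished T X Y Z u v w" "arr T f" "dm T f = Y" "f \<cdot>\<^bsub>T\<^esub> u = zer T X (cd T f)"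
  obtains g where "arr T g" "dm T g = Z" "cd T g = cd T f" "g \<cdot>\<^bsub>T\<^esub> v = f"
proof -
  note d = distD[OF assms(1)]
  obtain N where N: "zero_object T N" using zero_object_exists by blast
  let ?A = "cd T f"
  have A: "?A \<in> Obj T" and N': "N \<in> Obj T" using assms zero_object_iff N by auto
  \<comment> \<open>The identity triangle on the codomain, with the zero object \<open>N[1]\<close>
    as its third vertex, rotated backwards.\<close>
  have *: "distinguished T N ?A ?A (zer T N ?A) (Id T ?A) (zer T ?A (sh_obj T N))"
    using TR2[of N ?A ?A "zer T N ?A" "Id T ?A" "zer T ?A (sh_obj T N)"]
      TR1_id[OF A zero_object_shift[OF N]] A N' by simp
  have "zer T X N \<in> homs T X N" "f \<in> homs T Y ?A" "f \<cdot>\<^bsub>T\<^esub> u = zer T N ?A \<cdot>\<^bsub>T\<^esub> zer T X N"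
    using d assms A N' by simp_all
  from TR3[OF assms(1) * this]
  obtain h where h: "h \<in> homs T Z ?A" "h \<cdot>\<^bsub>T\<^esub> v = Id T ?A \<cdot>\<^bsub>T\<^esub> f" by blast
  have "arr T h" "dm T h = Z" "cd T h = ?A" using h(1) d A by simp_all
  moreover have "h \<cdot>\<^bsub>T\<^esub> v = f" using h(2) assms by simp
  ultimately show ?thesis using that by blast
qed

text \<open>Dually, \<open>u\<close> is a weak kernel of \<open>v\<close>. TR3 only fills the third
  vertex, so both triangles are rotated first and the morphism obtained has to be shifted
  back.\<close>

lemma dist_ker:
  assumes "distinguished T X Y Z u v w" "arr T f" "cd T f = Y" "v \<cdot>\<^bsub>T\<^esub> f = zer T (dm T f) Z"
  obtains g where "arr T g" "dm T g = dm T f" "cd T g = X" "u \<cdot>\<^bsub>T\<^esub> g = f"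
proof -
  note d = distD[OF assms(1)]
  obtain N where N: "zero_object T N" using zero_object_exists by blast
  let ?A = "dm T f"
  have A: "?A \<in> Obj T" and N': "N \<in> Obj T" using assms zero_object_iff N by auto
  \<comment> \<open>After a rotation of the identity triangle on the source of \<open>f\<close>, the
    third vertices are the shifts of that source and of \<open>X\<close>; both third morphisms carry
    the sign of TR2.\<close>
  obtain h where h: "h \<in> homs T (sh_obj T ?A) (sh_obj T X)"
      "sh_mor T f \<cdot>\<^bsub>T\<^esub> ((\<ominus>\<^bsub>K\<^esub> \<one>\<^bsub>K\<^esub>) \<star>\<^bsub>T\<^esub> sh_mor T (Id T ?A)) = ((\<ominus>\<^bsub>K\<^esub> \<one>\<^bsub>K\<^esub>) \<star>\<^bsub>T\<^esub> sh_mor T u) \<cdot>\<^bsub>T\<^esub> h"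
    using TR3[OF rotate[OF TR1_id[OF A N]] rotate[OF assms(1)], of f "zer T N Z"] d assms A N'
    by auto
  obtain g where g: "arr T g" "dm T g = ?A" "cd T g = X" "sh_mor T g = h"
    using Sh.full[of h ?A X] h(1) A d by auto
  have "(\<ominus>\<^bsub>K\<^esub> \<one>\<^bsub>K\<^esub>) \<star>\<^bsub>T\<^esub> sh_mor T f = (\<ominus>\<^bsub>K\<^esub> \<one>\<^bsub>K\<^esub>) \<star>\<^bsub>T\<^esub> sh_mor T (u \<cdot>\<^bsub>T\<^esub> g)"
    using h(2) g(1-3) assms d A unfolding g(4)[symmetric] by simp
  \<comment> \<open>Multiplying by -1 once more removes the sign on both sides, after which the
    shift can be cancelled by faithfulness.\<close>
  then have "(\<ominus>\<^bsub>K\<^esub> \<one>\<^bsub>K\<^esub>) \<star>\<^bsub>T\<^esub> (\<ominus>\<^bsub>K\<^esub> \<one>\<^bsub>K\<^esub>) \<star>\<^bsub>T\<^esub> sh_mor T f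
      = (\<ominus>\<^bsub>K\<^esub> \<one>\<^bsub>K\<^esub>) \<star>\<^bsub>T\<^esub> (\<ominus>\<^bsub>K\<^esub> \<one>\<^bsub>K\<^esub>) \<star>\<^bsub>T\<^esub> sh_mor T (u \<cdot>\<^bsub>T\<^esub> g)" by simp
  moreover have "(\<ominus>\<^bsub>K\<^esub> \<one>\<^bsub>K\<^esub>) \<otimes>\<^bsub>K\<^esub> (\<ominus>\<^bsub>K\<^esub> \<one>\<^bsub>K\<^esub>) = \<one>\<^bsub>K\<^esub>"
    by (simp add: l_minus r_minus)
  ultimately have "sh_mor T f = sh_mor T (u \<cdot>\<^bsub>T\<^esub> g)" using g(1-3) assms d by simp
  then have "f = u \<cdot>\<^bsub>T\<^esub> g" by (rule Sh.faithful) (use g(1-3) assms d in auto)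
  with g that show ?thesis by blast
qed

lemma dist_ker2:
  assumes "distinguished T X Y Z u v w" "arr T f" "cd T f = Z"
    "w \<cdot>\<^bsub>T\<^esub> f = zer T (dm T f) (sh_obj T X)"
  obtains g where "arr T g" "dm T g = dm T f" "cd T g = Y" "v \<cdot>\<^bsub>T\<^esub> g = f"
  using dist_ker[OF rotate[OF assms(1)] assms(2-4)] that by blast

lemma dist_ker3:
  assumes "distinguished T X Y Z u v w" "arr T f" "cd T f = sh_obj T X"
    "sh_mor T u \<cdot>\<^bsub>T\<^esub> f = zer T (dm T f) (sh_obj T Y)"
  obtains g where "arr T g" "dm T g = dm T f" "cd T g = Z" "w \<cdot>\<^bsub>T\<^esub> g = f"
proof -
  note d = distD[OF assms(1)]
  have "((\<ominus>\<^bsub>K\<^esub> \<one>\<^bsub>K\<^esub>) \<star>\<^bsub>T\<^esub> sh_mor T u) \<cdot>\<^bsub>T\<^esub> f = zer T (dm T f) (sh_obj T Y)"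
    using assms d by simp
  from dist_ker2[OF rotate[OF assms(1)] assms(2,3) this] that show ?thesis by blast
qed

text \<open>Because \<open>u s u = u\<close>, the complement of \<open>u s\<close> kills
  \<open>u\<close> and factors as \<open>t v\<close> through the weak cokernel, while the complement
  of \<open>s u\<close> is killed by \<open>u\<close>, so its shift factors as \<open>w r\<close>.
  Two of the three homotopy equations then hold; the one at \<open>Z\<close> holds up to an error of
  square zero, which a change of \<open>t\<close> absorbs.\<close>

lemma split_triangle_exists:
  assumes dist: "distinguished T X Y Z u v w"
    and s: "arr T s" "dm T s = Y" "cd T s = X" and usu: "u \<cdot>\<^bsub>T\<^esub> s \<cdot>\<^bsub>T\<^esub> u = u"
  obtains t r where "split_triangle T X Y Z u v w s t r"
proof -
  note [simp] = distD[OF dist] s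
  have vu [simp]: "v \<cdot>\<^bsub>T\<^esub> u = zer T X Z" and wv [simp]: "w \<cdot>\<^bsub>T\<^esub> v = zer T Y (sh_obj T X)"
    and uw: "sh_mor T u \<cdot>\<^bsub>T\<^esub> w = zer T Z (sh_obj T Y)"
    using dist dist_comp1 dist_comp2 dist_comp3 by blast+
  note [simp] = Comp_reduce[OF vu] Comp_reduce[OF wv]
  obtain p where p [simp]: "arr T p" "dm T p = X" "cd T p = X" and sup: "s \<cdot>\<^bsub>T\<^esub> u \<uplus>\<^bsub>T\<^esub> p = Id T X"
    using complement_exists[of "s \<cdot>\<^bsub>T\<^esub> u" "Id T X"] by auto
  obtain e where e [simp]: "arr T e" "dm T e = Y" "cd T e = Y" and use: "u \<cdot>\<^bsub>T\<^esub> s \<uplus>\<^bsub>T\<^esub> e = Id T Y"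
    using complement_exists[of "u \<cdot>\<^bsub>T\<^esub> s" "Id T Y"] by auto
  have "(u \<cdot>\<^bsub>T\<^esub> s \<uplus>\<^bsub>T\<^esub> e) \<cdot>\<^bsub>T\<^esub> u = u" unfolding use by simp
  then have "e \<cdot>\<^bsub>T\<^esub> u = zer T X Y"
    using plus_cancel_zer[of u "e \<cdot>\<^bsub>T\<^esub> u"] usu by simp
  then obtain t where t [simp]: "arr T t" "dm T t = Z" "cd T t = Y" and tv: "t \<cdot>\<^bsub>T\<^esub> v = e"
    using dist_coker[OF dist, of e] by auto
  have "u \<cdot>\<^bsub>T\<^esub> (s \<cdot>\<^bsub>T\<^esub> u \<uplus>\<^bsub>T\<^esub> p) = u" unfolding sup by simp
  then have "u \<cdot>\<^bsub>T\<^esub> p = zer T X Y"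
    using plus_cancel_zer[of u "u \<cdot>\<^bsub>T\<^esub> p"] usu by simp
  then have "sh_mor T u \<cdot>\<^bsub>T\<^esub> sh_mor T p = zer T (sh_obj T X) (sh_obj T Y)"
    using Sh.F_Comp[of p u] by simp
  then obtain r where r [simp]: "arr T r" "dm T r = sh_obj T X" "cd T r = Z"
      and wr: "w \<cdot>\<^bsub>T\<^esub> r = sh_mor T p"
    using dist_ker3[OF dist, of "sh_mor T p"] by auto
  have "v \<cdot>\<^bsub>T\<^esub> (u \<cdot>\<^bsub>T\<^esub> s \<uplus>\<^bsub>T\<^esub> e) = v" unfolding use by simp
  then have vtv: "v \<cdot>\<^bsub>T\<^esub> e = v" by simp
  have "sh_mor T (s \<cdot>\<^bsub>T\<^esub> u \<uplus>\<^bsub>T\<^esub> p) \<cdot>\<^bsub>T\<^esub> w = w" unfolding sup by simp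
  then have wrw: "sh_mor T p \<cdot>\<^bsub>T\<^esub> w = w" using uw by simp
  \<comment> \<open>The error at \<open>Z\<close>. Being killed on both sides by \<open>v\<close>
    and \<open>w\<close>, it factors as \<open>v l\<close>, and therefore has square zero.\<close>
  obtain d where d [simp]: "arr T d" "dm T d = Z" "cd T d = Z"
    and vtd: "v \<cdot>\<^bsub>T\<^esub> t \<uplus>\<^bsub>T\<^esub> r \<cdot>\<^bsub>T\<^esub> w \<uplus>\<^bsub>T\<^esub> d = Id T Z"
    using complement_exists[of "v \<cdot>\<^bsub>T\<^esub> t \<uplus>\<^bsub>T\<^esub> r \<cdot>\<^bsub>T\<^esub> w" "Id T Z"] by auto
  have "(v \<cdot>\<^bsub>T\<^esub> t \<uplus>\<^bsub>T\<^esub> r \<cdot>\<^bsub>T\<^esub> w \<uplus>\<^bsub>T\<^esub> d) \<cdot>\<^bsub>T\<^esub> v = v" unfolding vtd by simp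
  then have dv: "d \<cdot>\<^bsub>T\<^esub> v = zer T Y Z"
    using plus_cancel_zer[of v "d \<cdot>\<^bsub>T\<^esub> v"] by (simp add: tv vtv)
  have "w \<cdot>\<^bsub>T\<^esub> (v \<cdot>\<^bsub>T\<^esub> t \<uplus>\<^bsub>T\<^esub> r \<cdot>\<^bsub>T\<^esub> w \<uplus>\<^bsub>T\<^esub> d) = w" unfolding vtd by simp
  then have wd: "w \<cdot>\<^bsub>T\<^esub> d = zer T Z (sh_obj T X)"
    using plus_cancel_zer[of w "w \<cdot>\<^bsub>T\<^esub> d"] by (simp add: Comp_reduce[OF wr] wrw)
  then obtain l where l: "arr T l" "dm T l = Z" "cd T l = Y" "v \<cdot>\<^bsub>T\<^esub> l = d"
    using dist_ker2[OF dist, of d] by auto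
  have dd: "d \<cdot>\<^bsub>T\<^esub> d = zer T Z Z"
    using Comp_reduce[OF dv, of l] l by simp
  have "(v \<cdot>\<^bsub>T\<^esub> t \<uplus>\<^bsub>T\<^esub> r \<cdot>\<^bsub>T\<^esub> w \<uplus>\<^bsub>T\<^esub> d) \<cdot>\<^bsub>T\<^esub> d = d" unfolding vtd by simp
  then have vtdd: "v \<cdot>\<^bsub>T\<^esub> t \<cdot>\<^bsub>T\<^esub> d = d" by (simp add: wd dd)
  \<comment> \<open>Replacing \<open>t\<close> by \<open>t + t d\<close> repairs the equation at
    \<open>Z\<close>, since \<open>v t d = d\<close>, and keeps the one at \<open>Y\<close>, since
    \<open>d v = 0\<close>.\<close>
  have "v \<cdot>\<^bsub>T\<^esub> (t \<uplus>\<^bsub>T\<^esub> t \<cdot>\<^bsub>T\<^esub> d) \<uplus>\<^bsub>T\<^esub> r \<cdot>\<^bsub>T\<^esub> w = Id T Z"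
    using vtd by (simp add: vtdd plus_comm plus_lcomm)
  moreover have "w \<cdot>\<^bsub>T\<^esub> r \<uplus>\<^bsub>T\<^esub> sh_mor T (s \<cdot>\<^bsub>T\<^esub> u) = Id T (sh_obj T X)"
    using arg_cong[OF sup, of "sh_mor T"] by (simp add: wr plus_comm)
  moreover have "u \<cdot>\<^bsub>T\<^esub> s \<uplus>\<^bsub>T\<^esub> (t \<uplus>\<^bsub>T\<^esub> t \<cdot>\<^bsub>T\<^esub> d) \<cdot>\<^bsub>T\<^esub> v = Id T Y"
    using use by (simp add: tv dv)
  ultimately have "split_triangle T X Y Z u v w s (t \<uplus>\<^bsub>T\<^esub> t \<cdot>\<^bsub>T\<^esub> d) r"
    unfolding split_triangle_def using uw by simp
  then show ?thesis by (rule that)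
qed

text \<open>TR3 says nothing about a triangle not yet known to be distinguished, so the isomorphism
  with the true cone of \<open>u\<close> is built by hand from the homotopy, and its bijectivity is
  checked with the weak kernel properties of the cone.\<close>

lemma split_triangle_distinguished:
  assumes "split_triangle T X Y Z u v w s t r"
  shows "distinguished T X Y Z u v w"
proof -
  have tri: "triangle T X Y Z u v w" using assms unfolding split_triangle_def by blast
  have [simp]: "X \<in> Obj T" "Y \<in> Obj T" "Z \<in> Obj T" "arr T u" "dm T u = X" "cd T u = Y"
    "arr T v" "dm T v = Y" "cd T v = Z" "arr T w" "dm T w = Z" "cd T w = sh_obj T X"
    "arr T s" "dm T s = Y" "cd T s = X" "arr T t" "dm T t = Z" "cd T t = Y"
    "arr T r" "dm T r = sh_obj T X" "cd T r = Z"
    and vu [simp]: "v \<cdot>\<^bsub>T\<^esub> u = zer T X Z" and wv [simp]: "w \<cdot>\<^bsub>T\<^esub> v = zer T Y (sh_obj T X)"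
    and uw: "sh_mor T u \<cdot>\<^bsub>T\<^esub> w = zer T Z (sh_obj T Y)"
    and Y: "u \<cdot>\<^bsub>T\<^esub> s \<uplus>\<^bsub>T\<^esub> t \<cdot>\<^bsub>T\<^esub> v = Id T Y" and Z: "v \<cdot>\<^bsub>T\<^esub> t \<uplus>\<^bsub>T\<^esub> r \<cdot>\<^bsub>T\<^esub> w = Id T Z"
    and X: "w \<cdot>\<^bsub>T\<^esub> r \<uplus>\<^bsub>T\<^esub> sh_mor T (s \<cdot>\<^bsub>T\<^esub> u) = Id T (sh_obj T X)"
    using assms by (auto simp: split_triangle_def)
  note [simp] = Comp_reduce[OF vu] Comp_reduce[OF wv]
  obtain C v' w' where dist: "distinguished T X Y C u v' w'"
    using TR1_cone[of X Y u] by auto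
  note [simp] = distD[OF dist]
  have vu' [simp]: "v' \<cdot>\<^bsub>T\<^esub> u = zer T X C" and wv' [simp]: "w' \<cdot>\<^bsub>T\<^esub> v' = zer T Y (sh_obj T X)"
    and uw': "sh_mor T u \<cdot>\<^bsub>T\<^esub> w' = zer T C (sh_obj T Y)"
    using dist dist_comp1 dist_comp2 dist_comp3 by blast+
  note [simp] = Comp_reduce[OF vu'] Comp_reduce[OF wv']
  obtain e where e [simp]: "arr T e" "dm T e = Z" "cd T e = C" and we: "w' \<cdot>\<^bsub>T\<^esub> e = w"
    using dist_ker3[OF dist, of w] uw by auto
  have "w \<cdot>\<^bsub>T\<^esub> (v \<cdot>\<^bsub>T\<^esub> t \<uplus>\<^bsub>T\<^esub> r \<cdot>\<^bsub>T\<^esub> w) = w" unfolding Z by simp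
  then have wrw: "w \<cdot>\<^bsub>T\<^esub> r \<cdot>\<^bsub>T\<^esub> w = w" by simp
  \<comment> \<open>The identity of \<open>Z\<close> is \<open>v t + r w\<close>: the first part
    must go to \<open>v' t\<close> in order that \<open>c v = v'\<close>, and on the second
    \<open>e\<close> already satisfies \<open>w' e = w\<close>.\<close>
  define c where "c = v' \<cdot>\<^bsub>T\<^esub> t \<uplus>\<^bsub>T\<^esub> e \<cdot>\<^bsub>T\<^esub> r \<cdot>\<^bsub>T\<^esub> w"
  have c [simp]: "arr T c" "dm T c = Z" "cd T c = C" unfolding c_def by simp_all
  have "v' \<cdot>\<^bsub>T\<^esub> (u \<cdot>\<^bsub>T\<^esub> s \<uplus>\<^bsub>T\<^esub> t \<cdot>\<^bsub>T\<^esub> v) = v'" unfolding Y by simp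
  then have cv: "c \<cdot>\<^bsub>T\<^esub> v = v'" unfolding c_def by simp
  have wc: "w' \<cdot>\<^bsub>T\<^esub> c = w" unfolding c_def using wrw by (simp add: Comp_reduce[OF we])
  have "(w \<cdot>\<^bsub>T\<^esub> r \<uplus>\<^bsub>T\<^esub> sh_mor T (s \<cdot>\<^bsub>T\<^esub> u)) \<cdot>\<^bsub>T\<^esub> w' = w'" unfolding X by simp
  then have wrw': "w \<cdot>\<^bsub>T\<^esub> r \<cdot>\<^bsub>T\<^esub> w' = w'" using uw' by simp
  \<comment> \<open>\<open>c r w'\<close> is the identity up to something killed by
    \<open>w'\<close>, which lifts through \<open>v' = c v\<close>; this corrects
    \<open>r w'\<close> to a right inverse \<open>g\<close> of \<open>c\<close>.\<close>
  obtain k where k: "arr T k" "dm T k = C" "cd T k = C" "c \<cdot>\<^bsub>T\<^esub> r \<cdot>\<^bsub>T\<^esub> w' \<uplus>\<^bsub>T\<^esub> k = Id T C"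
    using complement_exists[of "c \<cdot>\<^bsub>T\<^esub> r \<cdot>\<^bsub>T\<^esub> w'" "Id T C"] by auto
  have "w' \<cdot>\<^bsub>T\<^esub> (c \<cdot>\<^bsub>T\<^esub> r \<cdot>\<^bsub>T\<^esub> w' \<uplus>\<^bsub>T\<^esub> k) = w'" unfolding k by simp
  then have "w' \<cdot>\<^bsub>T\<^esub> k = zer T C (sh_obj T X)"
    using plus_cancel_zer[of w' "w' \<cdot>\<^bsub>T\<^esub> k"] wrw' k(1-3) by (simp add: Comp_reduce[OF wc])
  then obtain y where y: "arr T y" "dm T y = C" "cd T y = Y" "v' \<cdot>\<^bsub>T\<^esub> y = k"
    using dist_ker2[OF dist, of k] k by auto
  define g where "g = r \<cdot>\<^bsub>T\<^esub> w' \<uplus>\<^bsub>T\<^esub> v \<cdot>\<^bsub>T\<^esub> y"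
  have g [simp]: "arr T g" "dm T g = C" "cd T g = Z" unfolding g_def using y by simp_all
  have cg: "c \<cdot>\<^bsub>T\<^esub> g = Id T C"
    unfolding g_def using y k(4) by (simp add: Comp_reduce[OF cv])
  \<comment> \<open>\<open>m\<close> measures the failure of \<open>g c = 1\<close>. Since
    \<open>c m = 0\<close> one gets \<open>w m = 0\<close> and hence \<open>m = v t m\<close>;
    moreover \<open>t m\<close> factors through \<open>u\<close>, and
    \<open>v u = 0\<close>.\<close>
  obtain m where m [simp]: "arr T m" "dm T m = Z" "cd T m = Z" and gcm: "g \<cdot>\<^bsub>T\<^esub> c \<uplus>\<^bsub>T\<^esub> m = Id T Z"
    using complement_exists[of "g \<cdot>\<^bsub>T\<^esub> c" "Id T Z"] by auto
  have "c \<cdot>\<^bsub>T\<^esub> (g \<cdot>\<^bsub>T\<^esub> c \<uplus>\<^bsub>T\<^esub> m) = c" unfolding gcm by simp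
  then have cm: "c \<cdot>\<^bsub>T\<^esub> m = zer T Z C"
    using plus_cancel_zer[of c "c \<cdot>\<^bsub>T\<^esub> m"] by (simp add: Comp_reduce[OF cg])
  have wm: "w \<cdot>\<^bsub>T\<^esub> m = zer T Z (sh_obj T X)"
    using Comp_reduce[OF wc, of m] by (simp add: cm)
  have "(v \<cdot>\<^bsub>T\<^esub> t \<uplus>\<^bsub>T\<^esub> r \<cdot>\<^bsub>T\<^esub> w) \<cdot>\<^bsub>T\<^esub> m = m" unfolding Z by simp
  then have vtm: "v \<cdot>\<^bsub>T\<^esub> t \<cdot>\<^bsub>T\<^esub> m = m" by (simp add: wm)
  have "v' \<cdot>\<^bsub>T\<^esub> t \<cdot>\<^bsub>T\<^esub> m = zer T Z C"
    using Comp_reduce[OF cv, of "t \<cdot>\<^bsub>T\<^esub> m"] by (simp add: vtm cm)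
  then obtain x where x: "arr T x" "dm T x = Z" "cd T x = X" "u \<cdot>\<^bsub>T\<^esub> x = t \<cdot>\<^bsub>T\<^esub> m"
    using dist_ker[OF dist, of "t \<cdot>\<^bsub>T\<^esub> m"] by auto
  have "m = zer T Z Z"
    using Comp_reduce[OF vu, of x] x vtm by simp
  then have gc: "g \<cdot>\<^bsub>T\<^esub> c = Id T Z" using gcm by simp
  have "is_iso T C Z g" by (rule is_isoI[of _ _ _ c]) (use gc cg in auto)
  moreover have "g \<cdot>\<^bsub>T\<^esub> v' = v" using Comp_reduce[OF gc, of v] by (simp add: cv)
  moreover have "w \<cdot>\<^bsub>T\<^esub> g = w'" using Comp_reduce[OF wc, of g] by (simp add: cg)
  ultimately show ?thesis
    using TR1_iso[OF dist tri is_iso_Id is_iso_Id, of g] by simp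
qed

end

section \<open>Categories generated by a block\<close>

text \<open>The morphisms that factor through a finite direct sum of objects \<open>P i j\<close>,
  written as sums of morphisms through one such object each, which spares the choice of direct sums.
  The identity of an object belongs to it exactly when the object is a retract of such a sum or
  zero.\<close>

inductive block_ideal ::
  "('o, 'm, 'k, 'z) tricat_scheme \<Rightarrow> 'i set \<Rightarrow> ('i \<Rightarrow> int \<Rightarrow> 'o) \<Rightarrow> 'o \<Rightarrow> 'o \<Rightarrow> 'm \<Rightarrow> bool"
  for T I P X Y where
  zer: "block_ideal T I P X Y (zer T X Y)"
| plus: "\<lbrakk>block_ideal T I P X Y f; block_ideal T I P X Y g\<rbrakk> \<Longrightarrow> block_ideal T I P X Y (f \<uplus>\<^bsub>T\<^esub> g)"
| comp:
    "\<lbrakk>i \<in> I; arr T p; dm T p = X; cd T p = P i j; arr T q; dm T q = P i j; cd T q = Y\<rbrakk>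
    \<Longrightarrow> block_ideal T I P X Y (q \<cdot>\<^bsub>T\<^esub> p)"

text \<open>\<open>P i j\<close> plays the role of \<open>E\<^sub>i[j]\<close>; since the shift is only an autoequivalence, the isomorphisms
  \<open>\<kappa> i j : P i j[1] \<rightarrow> P i (j + 1)\<close> are part of the data.\<close>

locale tri_block = triangulated_category K T
  for K :: "'k ring" and T :: "('o, 'm, 'k, 'z) tricat_scheme" +
  fixes I :: "'i set" and P :: "'i \<Rightarrow> int \<Rightarrow> 'o" and \<kappa> :: "'i \<Rightarrow> int \<Rightarrow> 'm"
  assumes P_Obj [simp]: "i \<in> I \<Longrightarrow> P i j \<in> Obj T"
    and kappa_iso: "i \<in> I \<Longrightarrow> is_iso T (sh_obj T (P i j)) (P i (j + 1)) (\<kappa> i j)"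
    and P_End: "\<lbrakk>i \<in> I; arr T f; dm T f = P i j; cd T f = P i j\<rbrakk>
      \<Longrightarrow> \<exists>c \<in> carrier K. f = c \<star>\<^bsub>T\<^esub> Id T (P i j)"
    and P_nonzero: "i \<in> I \<Longrightarrow> Id T (P i j) \<noteq> zer T (P i j) (P i j)"
    and P_orth: "\<lbrakk>i \<in> I; k \<in> I; (i, j) \<noteq> (k, l); arr T f; dm T f = P i j; cd T f = P k l\<rbrakk>
      \<Longrightarrow> f = zer T (P i j) (P k l)"
    and gen: "generated_by T ((\<lambda>i. P i 0) ` I)"
begin

lemma kappa [simp]:
  assumes "i \<in> I"
  shows "arr T (\<kappa> i j)" "dm T (\<kappa> i j) = sh_obj T (P i j)" "cd T (\<kappa> i j) = P i (j + 1)"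
    "arr T (inv_mor T (\<kappa> i j))" "dm T (inv_mor T (\<kappa> i j)) = P i (j + 1)"
    "cd T (inv_mor T (\<kappa> i j)) = sh_obj T (P i j)"
    "inv_mor T (\<kappa> i j) \<cdot>\<^bsub>T\<^esub> \<kappa> i j = Id T (sh_obj T (P i j))" "\<kappa> i j \<cdot>\<^bsub>T\<^esub> inv_mor T (\<kappa> i j) = Id T (P i (j + 1))"
    "\<lbrakk>arr T h; cd T h = sh_obj T (P i j)\<rbrakk> \<Longrightarrow> inv_mor T (\<kappa> i j) \<cdot>\<^bsub>T\<^esub> \<kappa> i j \<cdot>\<^bsub>T\<^esub> h = h"
    "\<lbrakk>arr T h; cd T h = P i (j + 1)\<rbrakk> \<Longrightarrow> \<kappa> i j \<cdot>\<^bsub>T\<^esub> inv_mor T (\<kappa> i j) \<cdot>\<^bsub>T\<^esub> h = h"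
  using is_iso_inverse[OF kappa_iso[OF assms]] assms by auto

lemma P_hom_cases:
  assumes "i \<in> I" "k \<in> I" "arr T f" "dm T f = P i j" "cd T f = P k l"
  obtains "f = zer T (P i j) (P k l)"
  | c where "k = i" "l = j" "c \<in> carrier K" "c \<noteq> \<zero>\<^bsub>K\<^esub>" "f = c \<star>\<^bsub>T\<^esub> Id T (P i j)"
proof (cases "(i, j) = (k, l) \<and> f \<noteq> zer T (P i j) (P k l)")
  case True
  then obtain c where "c \<in> carrier K" "f = c \<star>\<^bsub>T\<^esub> Id T (P i j)" using P_End assms by blast
  moreover from this have "c \<noteq> \<zero>\<^bsub>K\<^esub>" using True assms by auto
  ultimately show ?thesis using True that by blast
next
  case False
  then show ?thesis using P_orth assms that by blast
qed

section \<open>The ideal of morphisms through block objects and its behaviour under composition and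
  shift\<close>

abbreviation fac :: "'o \<Rightarrow> 'o \<Rightarrow> 'm \<Rightarrow> bool"
  where "fac \<equiv> block_ideal T I P"

lemma fac_zer: "fac X Y (zer T X Y)"
  by (rule block_ideal.zer)

lemma fac_plus: "\<lbrakk>fac X Y f; fac X Y g\<rbrakk> \<Longrightarrow> fac X Y (f \<uplus>\<^bsub>T\<^esub> g)"
  by (rule block_ideal.plus)

lemma fac_comp:
  "\<lbrakk>i \<in> I; arr T p; dm T p = X; cd T p = P i j; arr T q; dm T q = P i j; cd T q = Y\<rbrakk>
    \<Longrightarrow> fac X Y (q \<cdot>\<^bsub>T\<^esub> p)"
  by (rule block_ideal.comp)

lemma fac_arr:
  assumes "fac X Y f" "X \<in> Obj T" "Y \<in> Obj T"
  shows "arr T f" "dm T f = X" "cd T f = Y"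
proof -
  from assms have "arr T f \<and> dm T f = X \<and> cd T f = Y" by induction auto
  then show "arr T f" "dm T f = X" "cd T f = Y" by auto
qed

lemma fac_precomp:
  assumes "fac X Y f" "X \<in> Obj T" "Y \<in> Obj T" "arr T g" "cd T g = X"
  shows "fac (dm T g) Y (f \<cdot>\<^bsub>T\<^esub> g)"
  using assms
proof induction
  case zer
  then show ?case by (simp add: fac_zer)
next
  case (plus f h)
  then show ?case using fac_arr[OF plus(1)] fac_arr[OF plus(2)] by (simp add: fac_plus)
next
  case (comp i p j q)
  then show ?case using fac_comp[of i "p \<cdot>\<^bsub>T\<^esub> g" "dm T g" j q Y] by simp
qed

lemma fac_postcomp:
  assumes "fac X Y f" "X \<in> Obj T" "Y \<in> Obj T" "arr T g" "dm T g = Y"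
  shows "fac X (cd T g) (g \<cdot>\<^bsub>T\<^esub> f)"
  using assms
proof induction
  case zer
  then show ?case by (simp add: fac_zer)
next
  case (plus f h)
  then show ?case using fac_arr[OF plus(1)] fac_arr[OF plus(2)] by (simp add: fac_plus)
next
  case (comp i p j q)
  then show ?case using fac_comp[of i p X j "g \<cdot>\<^bsub>T\<^esub> q" "cd T g"] by simp
qed

lemma fac_shift:
  assumes "fac X Y f" "X \<in> Obj T" "Y \<in> Obj T"
  shows "fac (sh_obj T X) (sh_obj T Y) (sh_mor T f)"
  using assms
proof induction
  case zer
  then show ?case by (simp add: fac_zer)
next
  case (plus f h)
  then show ?case using fac_arr[OF plus(1)] fac_arr[OF plus(2)] by (simp add: fac_plus)
next
  case (comp i p j q)
  then show ?case
    using fac_comp[of i "\<kappa> i j \<cdot>\<^bsub>T\<^esub> sh_mor T p" "sh_obj T X" "j + 1"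
        "sh_mor T q \<cdot>\<^bsub>T\<^esub> inv_mor T (\<kappa> i j)" "sh_obj T Y"] by simp
qed

text \<open>A factorisation of \<open>f\<close> through \<open>P i j\<close> comes from one through
  \<open>P i (j - 1)\<close>: correct both factors by \<kappa> and use that the shift is full.
  Needed because a triangulated subcategory must contain \<open>X\<close> whenever it contains
  \<open>X[1]\<close>.\<close>

lemma fac_unshift:
  assumes "fac (sh_obj T X) (sh_obj T Y) f" "X \<in> Obj T" "Y \<in> Obj T"
  shows "\<exists>g. fac X Y g \<and> sh_mor T g = f"
  using assms
proof induction
  case zer
  then show ?case using fac_zer[of X Y] Sh.F_zer by blast
next
  case (plus f h)
  then obtain f' h' where g: "fac X Y f'" "sh_mor T f' = f" "fac X Y h'" "sh_mor T h' = h" by blast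
  have "sh_mor T (f' \<uplus>\<^bsub>T\<^esub> h') = f \<uplus>\<^bsub>T\<^esub> h"
    using fac_arr[OF g(1)] fac_arr[OF g(3)] g(2,4) plus by (metis Sh.F_plus)
  then show ?case using fac_plus[OF g(1,3)] by blast
next
  case (comp i p j q)
  define l where "l = j - 1"
  have j: "j = l + 1" unfolding l_def by simp
  note [simp] = comp(1-7)[unfolded j] comp(8,9)
  obtain p' where p': "arr T p'" "dm T p' = X" "cd T p' = P i l" "sh_mor T p' = inv_mor T (\<kappa> i l) \<cdot>\<^bsub>T\<^esub> p"
    using Sh.full[of "inv_mor T (\<kappa> i l) \<cdot>\<^bsub>T\<^esub> p" X "P i l"] by auto
  obtain q' where q': "arr T q'" "dm T q' = P i l" "cd T q' = Y" "sh_mor T q' = q \<cdot>\<^bsub>T\<^esub> \<kappa> i l"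
    using Sh.full[of "q \<cdot>\<^bsub>T\<^esub> \<kappa> i l" "P i l" Y] by auto
  have "sh_mor T (q' \<cdot>\<^bsub>T\<^esub> p') = q \<cdot>\<^bsub>T\<^esub> p" using p' q' by simp
  moreover have "fac X Y (q' \<cdot>\<^bsub>T\<^esub> p')" using fac_comp[of i p' X l q' Y] p' q' by simp
  ultimately show ?case by blast
qed

text \<open>Either some morphism from \<open>Y\<close> to a block object does not kill
  \<open>u\<close>; the composite is then a nonzero scalar, and dividing by it gives
  \<open>s\<close>. Or all of them kill \<open>u\<close>; then so does the whole ideal, including
  the identity of \<open>Y\<close>, and \<open>u = 0\<close>.\<close>

lemma P_regular:
  assumes Y: "fac Y Y (Id T Y)" "Y \<in> Obj T" and i: "i \<in> I"
    and u: "arr T u" "dm T u = P i j" "cd T u = Y"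
  obtains s where "arr T s" "dm T s = Y" "cd T s = P i j" "u \<cdot>\<^bsub>T\<^esub> s \<cdot>\<^bsub>T\<^esub> u = u"
proof (cases "\<exists>k l \<pi>. k \<in> I \<and> arr T \<pi> \<and> dm T \<pi> = Y \<and> cd T \<pi> = P k l \<and> \<pi> \<cdot>\<^bsub>T\<^esub> u \<noteq> zer T (P i j) (P k l)")
  case True
  then obtain k l \<pi> where \<pi>: "k \<in> I" "arr T \<pi>" "dm T \<pi> = Y" "cd T \<pi> = P k l"
    "\<pi> \<cdot>\<^bsub>T\<^esub> u \<noteq> zer T (P i j) (P k l)" by blast
  from P_hom_cases[OF i \<pi>(1), of "\<pi> \<cdot>\<^bsub>T\<^esub> u" j l] \<pi> u
  obtain c where c: "k = i" "l = j" "c \<in> carrier K" "c \<noteq> \<zero>\<^bsub>K\<^esub>" "\<pi> \<cdot>\<^bsub>T\<^esub> u = c \<star>\<^bsub>T\<^esub> Id T (P i j)"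
    by auto
  have c': "inv\<^bsub>K\<^esub> c \<in> carrier K" "inv\<^bsub>K\<^esub> c \<otimes>\<^bsub>K\<^esub> c = \<one>\<^bsub>K\<^esub>" using c by (simp_all add: field_Units)
  show ?thesis
    by (rule that[of "(inv\<^bsub>K\<^esub> c) \<star>\<^bsub>T\<^esub> \<pi>"]) (use \<pi> u c c' i Y in \<open>auto\<close>)
next
  case False
  have "f \<cdot>\<^bsub>T\<^esub> u = zer T (P i j) Y" if "fac Y Y f" for f
    using that
  proof induction
    case (plus f g)
    then show ?case using fac_arr[OF plus(1)] fac_arr[OF plus(2)] Y u i by simp
  next
    case (comp k p l q)
    then have "p \<cdot>\<^bsub>T\<^esub> u = zer T (P i j) (P k l)" using False by blast
    then show ?case using comp u i Y by simp
  qed (use u Y in auto)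
  from this[OF Y(1)] have "u = zer T (P i j) Y" using u by simp
  then show ?thesis using that[of "zer T Y (P i j)"] Y i by simp
qed

text \<open>Regularity of \<open>u\<close>, weakened by a right factor \<open>f\<close> so that it
  can be proved by induction on the ideal of \<open>f\<close> for all \<open>u\<close> at once; the
  identity as \<open>f\<close> gives back regularity.\<close>

lemma fac_regular:
  assumes "fac W X f" "W \<in> Obj T" "X \<in> Obj T" "fac Y Y (Id T Y)" "Y \<in> Obj T"
    "arr T u" "dm T u = X" "cd T u = Y"
  shows "\<exists>s. arr T s \<and> dm T s = Y \<and> cd T s = X \<and> u \<cdot>\<^bsub>T\<^esub> s \<cdot>\<^bsub>T\<^esub> u \<cdot>\<^bsub>T\<^esub> f = u \<cdot>\<^bsub>T\<^esub> f"
  using assms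
proof (induction arbitrary: u)
  case zer
  then show ?case by (intro exI[of _ "zer T Y X"]) simp
next
  case (comp i p j q)
  obtain s where s: "arr T s" "dm T s = Y" "cd T s = P i j" "(u \<cdot>\<^bsub>T\<^esub> q) \<cdot>\<^bsub>T\<^esub> s \<cdot>\<^bsub>T\<^esub> (u \<cdot>\<^bsub>T\<^esub> q) = u \<cdot>\<^bsub>T\<^esub> q"
    using P_regular[of Y i "u \<cdot>\<^bsub>T\<^esub> q" j] comp by auto
  have "u \<cdot>\<^bsub>T\<^esub> q \<cdot>\<^bsub>T\<^esub> s \<cdot>\<^bsub>T\<^esub> u \<cdot>\<^bsub>T\<^esub> q \<cdot>\<^bsub>T\<^esub> p = u \<cdot>\<^bsub>T\<^esub> q \<cdot>\<^bsub>T\<^esub> p"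
    using Comp_reduce[OF s(4), of p] s(1-3) comp by simp
  then show ?case using s(1-3) comp by (intro exI[of _ "q \<cdot>\<^bsub>T\<^esub> s"]) simp
next
  case (plus f1 f2)
  note [simp] = plus(5-) fac_arr[OF plus(1,5,6)] fac_arr[OF plus(2,5,6)]
  obtain s1 where s1 [simp]: "arr T s1" "dm T s1 = Y" "cd T s1 = X" and
    1: "u \<cdot>\<^bsub>T\<^esub> s1 \<cdot>\<^bsub>T\<^esub> u \<cdot>\<^bsub>T\<^esub> f1 = u \<cdot>\<^bsub>T\<^esub> f1" using plus(3)[of u] by auto
  \<comment> \<open>The complements \<open>p = 1 - s1 u\<close> and \<open>q = 1 - u s1\<close>
    satisfy \<open>u p = q u\<close>. The remainder \<open>q u\<close> vanishes on
    \<open>f1\<close>, so it can be treated separately on \<open>f2\<close>.\<close>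
  obtain p where p [simp]: "arr T p" "dm T p = X" "cd T p = X" and sup: "s1 \<cdot>\<^bsub>T\<^esub> u \<uplus>\<^bsub>T\<^esub> p = Id T X"
    using complement_exists[of "s1 \<cdot>\<^bsub>T\<^esub> u" "Id T X"] by auto
  obtain q where q [simp]: "arr T q" "dm T q = Y" "cd T q = Y" and usq: "u \<cdot>\<^bsub>T\<^esub> s1 \<uplus>\<^bsub>T\<^esub> q = Id T Y"
    using complement_exists[of "u \<cdot>\<^bsub>T\<^esub> s1" "Id T Y"] by auto
  have "u \<cdot>\<^bsub>T\<^esub> (s1 \<cdot>\<^bsub>T\<^esub> u \<uplus>\<^bsub>T\<^esub> p) = (u \<cdot>\<^bsub>T\<^esub> s1 \<uplus>\<^bsub>T\<^esub> q) \<cdot>\<^bsub>T\<^esub> u" unfolding sup usq by simp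
  then have up: "u \<cdot>\<^bsub>T\<^esub> p = q \<cdot>\<^bsub>T\<^esub> u"
    using plus_left_cancel[of "u \<cdot>\<^bsub>T\<^esub> s1 \<cdot>\<^bsub>T\<^esub> u" "u \<cdot>\<^bsub>T\<^esub> p" "q \<cdot>\<^bsub>T\<^esub> u"] by simp
  obtain s2 where s2 [simp]: "arr T s2" "dm T s2 = Y" "cd T s2 = X" and
    2: "(q \<cdot>\<^bsub>T\<^esub> u) \<cdot>\<^bsub>T\<^esub> s2 \<cdot>\<^bsub>T\<^esub> (q \<cdot>\<^bsub>T\<^esub> u) \<cdot>\<^bsub>T\<^esub> f2 = (q \<cdot>\<^bsub>T\<^esub> u) \<cdot>\<^bsub>T\<^esub> f2" using plus(4)[of "q \<cdot>\<^bsub>T\<^esub> u"] by auto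
  \<comment> \<open>With this choice \<open>u s = u s1 + q u s2 q\<close>: on \<open>u f1\<close>
    the second term vanishes, and on \<open>u f2\<close> it supplies the missing
    \<open>q u f2\<close>.\<close>
  define s where "s = s1 \<uplus>\<^bsub>T\<^esub> p \<cdot>\<^bsub>T\<^esub> s2 \<cdot>\<^bsub>T\<^esub> q"
  have s [simp]: "arr T s" "dm T s = Y" "cd T s = X" unfolding s_def by simp_all
  have us: "u \<cdot>\<^bsub>T\<^esub> s = u \<cdot>\<^bsub>T\<^esub> s1 \<uplus>\<^bsub>T\<^esub> q \<cdot>\<^bsub>T\<^esub> u \<cdot>\<^bsub>T\<^esub> s2 \<cdot>\<^bsub>T\<^esub> q"
    unfolding s_def using Comp_reduce[OF up, of "s2 \<cdot>\<^bsub>T\<^esub> q"] by simp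
  have "(u \<cdot>\<^bsub>T\<^esub> s1 \<uplus>\<^bsub>T\<^esub> q) \<cdot>\<^bsub>T\<^esub> u \<cdot>\<^bsub>T\<^esub> f1 = u \<cdot>\<^bsub>T\<^esub> f1" unfolding usq by simp
  then have quf1: "q \<cdot>\<^bsub>T\<^esub> u \<cdot>\<^bsub>T\<^esub> f1 = zer T W Y"
    using plus_cancel_zer[of "u \<cdot>\<^bsub>T\<^esub> f1" "q \<cdot>\<^bsub>T\<^esub> u \<cdot>\<^bsub>T\<^esub> f1"] 1 by simp
  have "u \<cdot>\<^bsub>T\<^esub> s \<cdot>\<^bsub>T\<^esub> u \<cdot>\<^bsub>T\<^esub> f1 = u \<cdot>\<^bsub>T\<^esub> f1"
    using Comp_reduce[OF us, of "u \<cdot>\<^bsub>T\<^esub> f1"] 1 quf1 by simp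
  moreover have "(u \<cdot>\<^bsub>T\<^esub> s1 \<uplus>\<^bsub>T\<^esub> q) \<cdot>\<^bsub>T\<^esub> u \<cdot>\<^bsub>T\<^esub> f2 = u \<cdot>\<^bsub>T\<^esub> f2" unfolding usq by simp
  then have "u \<cdot>\<^bsub>T\<^esub> s \<cdot>\<^bsub>T\<^esub> u \<cdot>\<^bsub>T\<^esub> f2 = u \<cdot>\<^bsub>T\<^esub> f2"
    using Comp_reduce[OF us, of "u \<cdot>\<^bsub>T\<^esub> f2"] 2 by simp
  ultimately show ?case using s by (intro exI[of _ s]) simp
qed

text \<open>Closure under cones is where regularity enters: the triangle splits, so the identity of
  \<open>Z\<close> is \<open>v t + r w\<close>, whose summands pass through \<open>Y\<close> and
  \<open>X[1]\<close>.\<close>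

lemma triangulated_subcategory_fac:
  "triangulated_subcategory T {X \<in> Obj T. fac X X (Id T X)}"
  unfolding triangulated_subcategory_def
proof (intro conjI ballI allI impI)
  fix Z assume "zero_object T Z"
  then show "Z \<in> {X \<in> Obj T. fac X X (Id T X)}" using fac_zer[of Z Z] zero_object_iff by auto
next
  fix X Y assume X: "X \<in> {X \<in> Obj T. fac X X (Id T X)}" and Y: "Y \<in> Obj T" "isomorphic T X Y"
  then obtain f where f: "is_iso T X Y f" unfolding isomorphic_def by blast
  note i = is_iso_inverse[OF f, of]
  have "fac Y X (inv_mor T f)" using fac_precomp[of X X "Id T X" "inv_mor T f"] X Y i by simp
  then have "fac Y Y (f \<cdot>\<^bsub>T\<^esub> inv_mor T f)" using fac_postcomp[of Y X "inv_mor T f" f] X Y i by simp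
  then show "Y \<in> {X \<in> Obj T. fac X X (Id T X)}" using X Y i by simp
next
  fix X assume X: "X \<in> Obj T"
  show "sh_obj T X \<in> {X \<in> Obj T. fac X X (Id T X)} \<longleftrightarrow> X \<in> {X \<in> Obj T. fac X X (Id T X)}"
  proof
    assume "X \<in> {X \<in> Obj T. fac X X (Id T X)}"
    then show "sh_obj T X \<in> {X \<in> Obj T. fac X X (Id T X)}"
      using fac_shift[of X X "Id T X"] X by simp
  next
    assume "sh_obj T X \<in> {X \<in> Obj T. fac X X (Id T X)}"
    then obtain g where g: "fac X X g" "sh_mor T g = Id T (sh_obj T X)"
      using fac_unshift[of X X "Id T (sh_obj T X)"] X by auto
    have "g = Id T X" by (rule Sh.faithful) (use g fac_arr[OF g(1)] X in auto)
    then show "X \<in> {X \<in> Obj T. fac X X (Id T X)}" using g X by simp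
  qed
next
  fix X Y Z u v w
  assume d: "distinguished T X Y Z u v w"
    and XY: "X \<in> {X \<in> Obj T. fac X X (Id T X)}" "Y \<in> {X \<in> Obj T. fac X X (Id T X)}"
  note [simp] = distD[OF d]
  obtain s where s: "arr T s" "dm T s = Y" "cd T s = X" "u \<cdot>\<^bsub>T\<^esub> s \<cdot>\<^bsub>T\<^esub> u = u"
    using fac_regular[of X X "Id T X" Y u] XY by auto
  obtain t r where st: "split_triangle T X Y Z u v w s t r"
    by (rule split_triangle_exists[OF d s])
  then have t: "arr T t" "dm T t = Z" "cd T t = Y" "arr T r" "dm T r = sh_obj T X" "cd T r = Z"
    "v \<cdot>\<^bsub>T\<^esub> t \<uplus>\<^bsub>T\<^esub> r \<cdot>\<^bsub>T\<^esub> w = Id T Z"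
    unfolding split_triangle_def by auto
  have "fac Y Z v" using fac_postcomp[of Y Y "Id T Y" v] XY by simp
  then have vt: "fac Z Z (v \<cdot>\<^bsub>T\<^esub> t)" using fac_precomp[of Y Z v t] t by simp
  have "fac (sh_obj T X) Z r"
    using fac_postcomp[of "sh_obj T X" "sh_obj T X" "Id T (sh_obj T X)" r] XY t
      fac_shift[of X X "Id T X"] by simp
  then have rw: "fac Z Z (r \<cdot>\<^bsub>T\<^esub> w)" using fac_precomp[of "sh_obj T X" Z r w] t by simp
  show "Z \<in> {X \<in> Obj T. fac X X (Id T X)}" using fac_plus[OF vt rw] t by simp
qed auto

lemma gen_induct:
  assumes "triangulated_subcategory T Q" "\<And>i. i \<in> I \<Longrightarrow> P i 0 \<in> Q" "X \<in> Obj T"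
  shows "X \<in> Q"
  using assms gen unfolding generated_by_def by blast

lemma Id_fac: "X \<in> Obj T \<Longrightarrow> fac X X (Id T X)"
proof -
  assume X: "X \<in> Obj T"
  have "X \<in> {X \<in> Obj T. fac X X (Id T X)}"
  proof (rule gen_induct[OF triangulated_subcategory_fac _ X])
    show "P i 0 \<in> {X \<in> Obj T. fac X X (Id T X)}" if "i \<in> I" for i
      using fac_comp[of i "Id T (P i 0)" "P i 0" 0 "Id T (P i 0)" "P i 0"] that by simp
  qed
  then show ?thesis by blast
qed

lemma regular:
  assumes "arr T u"
  obtains s where "arr T s" "dm T s = cd T u" "cd T s = dm T u" "u \<cdot>\<^bsub>T\<^esub> s \<cdot>\<^bsub>T\<^esub> u = u"
  using fac_regular[OF Id_fac _ _ Id_fac, of "dm T u" "cd T u" u] assms by auto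

text \<open>Two morphisms that agree on all \<open>P i j\<close> agree after composition with any
  member of the ideal, and the identity of \<open>X\<close> is one.\<close>

lemma P_separates:
  assumes "arr T f" "arr T g" "dm T f = X" "dm T g = X" "cd T f = cd T g"
    and eq: "\<And>i j p. \<lbrakk>i \<in> I; arr T p; dm T p = P i j; cd T p = X\<rbrakk> \<Longrightarrow> f \<cdot>\<^bsub>T\<^esub> p = g \<cdot>\<^bsub>T\<^esub> p"
  shows "f = g"
proof -
  have X: "X \<in> Obj T" using assms by auto
  have "f \<cdot>\<^bsub>T\<^esub> h = g \<cdot>\<^bsub>T\<^esub> h" if "fac X X h" for h
    using that
  proof induction
    case (plus h k)
    then show ?case using fac_arr[OF plus(1)] fac_arr[OF plus(2)] X assms(1-5) by simp
  next
    case (comp i p j q)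
    then show ?case using Comp_reduce[OF eq[of i q j], of p] assms(1-5) by simp
  qed (use assms(1-5) X in auto)
  from this[OF Id_fac[OF X]] show ?thesis using assms(1-5) X by simp
qed

end

section \<open>Transformations of shift-compatible functors\<close>

text \<open>The data of an exact functor without the condition on triangles, which is automatic when
  the source is generated by a block (\<open>sh_functor_exact\<close>). Constructions can therefore
  ignore triangles.\<close>

locale sh_functor = T: triangulated_category K T + U: triangulated_category K U +
  lin_functor K s T U F
  for K :: "'k ring" and s :: "'k \<Rightarrow> 'k" and T :: "('o1, 'm1, 'k, 'y) tricat_scheme"
    and U :: "('o2, 'm2, 'k, 'z) tricat_scheme" and F :: "('o1, 'm1, 'o2, 'm2) exfunctr" +
  assumes Fsh_nat: "nat_iso T U (comp_functor F (Shift T)) (comp_functor (Shift U) F) (Fsh F)"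
begin

lemma Fsh_iso: "X \<in> Obj T \<Longrightarrow> is_iso U (On_obj F (sh_obj T X)) (sh_obj U (On_obj F X)) (Fsh F X)"
  using Fsh_nat unfolding nat_iso_def comp_functor_def by simp

lemma Fsh_simps [simp]:
  assumes "X \<in> Obj T"
  shows "arr U (Fsh F X)" "dm U (Fsh F X) = On_obj F (sh_obj T X)"
    "cd U (Fsh F X) = sh_obj U (On_obj F X)"
    "arr U (inv_mor U (Fsh F X))" "dm U (inv_mor U (Fsh F X)) = sh_obj U (On_obj F X)"
    "cd U (inv_mor U (Fsh F X)) = On_obj F (sh_obj T X)"
    "inv_mor U (Fsh F X) \<cdot>\<^bsub>U\<^esub> Fsh F X = Id U (On_obj F (sh_obj T X))"
    "Fsh F X \<cdot>\<^bsub>U\<^esub> inv_mor U (Fsh F X) = Id U (sh_obj U (On_obj F X))"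
    "\<lbrakk>arr U h; cd U h = On_obj F (sh_obj T X)\<rbrakk> \<Longrightarrow> inv_mor U (Fsh F X) \<cdot>\<^bsub>U\<^esub> Fsh F X \<cdot>\<^bsub>U\<^esub> h = h"
    "\<lbrakk>arr U h; cd U h = sh_obj U (On_obj F X)\<rbrakk> \<Longrightarrow> Fsh F X \<cdot>\<^bsub>U\<^esub> inv_mor U (Fsh F X) \<cdot>\<^bsub>U\<^esub> h = h"
  using U.is_iso_inverse[OF Fsh_iso[OF assms]] assms by auto

lemma Fsh_natural:
  assumes "arr T f" "dm T f = X" "cd T f = Y"
  shows "Fsh F Y \<cdot>\<^bsub>U\<^esub> On_mor F (sh_mor T f) = sh_mor U (On_mor F f) \<cdot>\<^bsub>U\<^esub> Fsh F X"
proof -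
  have *: "\<forall>X \<in> Obj T. \<forall>Y \<in> Obj T. \<forall>f \<in> homs T X Y.
      Fsh F Y \<cdot>\<^bsub>U\<^esub> On_mor F (sh_mor T f) = sh_mor U (On_mor F f) \<cdot>\<^bsub>U\<^esub> Fsh F X"
    using Fsh_nat unfolding nat_iso_def comp_functor_def by simp
  have "X \<in> Obj T" "Y \<in> Obj T" using assms by auto
  then show ?thesis
    using *[rule_format, of X Y f] assms by simp
qed

end

definition sh_trans ::
  "('o1, 'm1, 'k, 'y) tricat_scheme \<Rightarrow> ('o2, 'm2, 'k, 'z) tricat_scheme
    \<Rightarrow> ('o1, 'm1, 'o2, 'm2) exfunctr \<Rightarrow> ('o1, 'm1, 'o2, 'm2) exfunctr \<Rightarrow> ('o1 \<Rightarrow> 'm2) \<Rightarrow> bool"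
  where "sh_trans T U F H \<eta> \<longleftrightarrow>
    (\<forall>X \<in> Obj T. in_hom U (On_obj F X) (On_obj H X) (\<eta> X)) \<and>
    (\<forall>f. arr T f \<longrightarrow> \<eta> (cd T f) \<cdot>\<^bsub>U\<^esub> On_mor F f = On_mor H f \<cdot>\<^bsub>U\<^esub> \<eta> (dm T f)) \<and>
    (\<forall>X \<in> Obj T. Fsh H X \<cdot>\<^bsub>U\<^esub> \<eta> (sh_obj T X) = sh_mor U (\<eta> X) \<cdot>\<^bsub>U\<^esub> Fsh F X)"

text \<open>Stated for a relation and not for a step function, because the two directions are solved
  differently: upwards by a formula, downwards by a preimage under the shift. Two recursions start
  at 0 and are glued.\<close>

lemma int_chain_exists:
  fixes D :: "int \<Rightarrow> 'a set"
  assumes "x0 \<in> D 0"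
    and up: "\<And>j x. x \<in> D j \<Longrightarrow> \<exists>y \<in> D (j + 1). R j x y"
    and down: "\<And>j y. y \<in> D (j + 1) \<Longrightarrow> \<exists>x \<in> D j. R j x y"
  shows "\<exists>\<zeta>. \<zeta> 0 = x0 \<and> (\<forall>j. \<zeta> j \<in> D j \<and> R j (\<zeta> j) (\<zeta> (j + 1)))"
proof -
  define a where "a j x = (SOME y. y \<in> D (j + 1) \<and> R j x y)" for j x
  define b where "b j y = (SOME x. x \<in> D j \<and> R j x y)" for j y
  have a: "a j x \<in> D (j + 1) \<and> R j x (a j x)" if "x \<in> D j" for j x
    unfolding a_def by (rule someI_ex) (use up[OF that] in blast)
  have b: "b j y \<in> D j \<and> R j (b j y) y" if "y \<in> D (j + 1)" for j y
    unfolding b_def by (rule someI_ex) (use down[OF that] in blast)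
  define f where "f = rec_nat x0 (\<lambda>n. a (int n))"
  define g where "g = rec_nat x0 (\<lambda>n. b (- int n - 1))"
  have f: "f n \<in> D (int n)" for n
    by (induction n) (use assms(1) a[of _ "int _"] in \<open>auto simp: f_def add.commute\<close>)
  have g: "g n \<in> D (- int n)" for n
  proof (induction n)
    case (Suc n)
    have "b (- int n - 1) (g n) \<in> D (- int n - 1)" using b[of "g n" "- int n - 1"] Suc by simp
    moreover have "g (Suc n) = b (- int n - 1) (g n)" "- int (Suc n) = - int n - 1" by (simp_all add: g_def)
    ultimately show ?case by metis
  qed (use assms(1) in \<open>auto simp: g_def\<close>)
  define \<zeta> where "\<zeta> j = (if 0 \<le> j then f (nat j) else g (nat (- j)))" for j
  have "\<zeta> j \<in> D j" for j
    using f[of "nat j"] g[of "nat (- j)"] by (cases "0 \<le> j") (simp_all add: \<zeta>_def)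
  moreover have "R j (\<zeta> j) (\<zeta> (j + 1))" for j
  proof (cases "0 \<le> j")
    case True
    then have "f (nat (j + 1)) = a j (f (nat j))"
      by (simp add: f_def nat_add_distrib)
    then show ?thesis using a[of "f (nat j)" j] f[of "nat j"] True by (simp add: \<zeta>_def)
  next
    case False
    then obtain n where n: "j = - int n - 1" by (intro that[of "nat (- j - 1)"]) simp
    have "\<zeta> (j + 1) = g n" using n by (simp add: \<zeta>_def f_def g_def)
    moreover have "nat (- j) = Suc n" using n by simp
    then have "\<zeta> j = b j (g n)" using n by (simp add: \<zeta>_def g_def)
    ultimately show ?thesis using b[of "g n" j] g[of n] n by simp
  qed
  moreover have "\<zeta> 0 = x0" by (simp add: \<zeta>_def f_def)
  ultimately show ?thesis by blast
qed

locale block_functors = T: tri_block K T I P \<kappa> + F: sh_functor K s T U F + H: sh_functor K s T U H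
  for K :: "'k ring" and s :: "'k \<Rightarrow> 'k" and T :: "('o1, 'm1, 'k, 'y) tricat_scheme"
    and I :: "'i set" and P :: "'i \<Rightarrow> int \<Rightarrow> 'o1" and \<kappa> :: "'i \<Rightarrow> int \<Rightarrow> 'm1"
    and U :: "('o2, 'm2, 'k, 'z) tricat_scheme" and F H :: "('o1, 'm1, 'o2, 'm2) exfunctr"
begin

lemma sh_transD:
  assumes "sh_trans T U F H \<eta>"
  shows "X \<in> Obj T \<Longrightarrow> arr U (\<eta> X)" "X \<in> Obj T \<Longrightarrow> dm U (\<eta> X) = On_obj F X"
    "X \<in> Obj T \<Longrightarrow> cd U (\<eta> X) = On_obj H X"
    "\<lbrakk>arr T f; dm T f = X; cd T f = Y\<rbrakk> \<Longrightarrow> \<eta> Y \<cdot>\<^bsub>U\<^esub> On_mor F f = On_mor H f \<cdot>\<^bsub>U\<^esub> \<eta> X"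
    "X \<in> Obj T \<Longrightarrow> Fsh H X \<cdot>\<^bsub>U\<^esub> \<eta> (sh_obj T X) = sh_mor U (\<eta> X) \<cdot>\<^bsub>U\<^esub> Fsh F X"
  using assms unfolding sh_trans_def by auto

text \<open>The analogue of \<open>P_separates\<close> for morphisms of \<open>U\<close> out of
  \<open>On_obj F X\<close>, which need not be images under \<open>F\<close>: apply \<open>F\<close>
  to an expression of the identity of \<open>X\<close>.\<close>

lemma F_separates:
  assumes "arr U m" "arr U m'" "dm U m = On_obj F X" "dm U m' = On_obj F X" "cd U m = cd U m'" "X \<in> Obj T"
    and eq: "\<And>i j p. \<lbrakk>i \<in> I; arr T p; dm T p = P i j; cd T p = X\<rbrakk> \<Longrightarrow> m \<cdot>\<^bsub>U\<^esub> On_mor F p = m' \<cdot>\<^bsub>U\<^esub> On_mor F p"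
  shows "m = m'"
proof -
  have "m \<cdot>\<^bsub>U\<^esub> On_mor F h = m' \<cdot>\<^bsub>U\<^esub> On_mor F h" if "T.fac X X h" for h
    using that
  proof induction
    case (plus h k)
    then show ?case using T.fac_arr[OF plus(1)] T.fac_arr[OF plus(2)] assms(1-6) by simp
  next
    case (comp i p j q)
    then show ?case using F.U.Comp_reduce[OF eq[of i q j], of "On_mor F p"] assms(1-6) by simp
  qed (use assms(1-6) in auto)
  from this[OF T.Id_fac[OF assms(6)]] show ?thesis using assms(1-6) by simp
qed

text \<open>Shift compatibility relates the component at \<open>P i j\<close> to that at its shift,
  and naturality at \<kappa> relates the latter to \<open>P i (j + 1)\<close>. The comparison maps
  are isomorphisms and the shift is faithful, so equality spreads in both directions.\<close>

lemma sh_trans_unique: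
  assumes \<eta>: "sh_trans T U F H \<eta>" and \<eta>': "sh_trans T U F H \<eta>'"
    and eq: "\<And>i. i \<in> I \<Longrightarrow> \<eta> (P i 0) = \<eta>' (P i 0)" and X: "X \<in> Obj T"
  shows "\<eta> X = \<eta>' X"
proof -
  note [simp] = sh_transD(1-3)[OF \<eta>] sh_transD(1-3)[OF \<eta>']
  have P: "\<eta> (P i j) = \<eta>' (P i j)" if i: "i \<in> I" for i j
  proof (induction j rule: int_induct[where k = 0])
    case base
    then show ?case using eq i by simp
  next
    case (step1 j)
    note [simp] = i
    have *: "Fsh H (P i j) \<cdot>\<^bsub>U\<^esub> \<eta> (sh_obj T (P i j)) = Fsh H (P i j) \<cdot>\<^bsub>U\<^esub> \<eta>' (sh_obj T (P i j))"
      using sh_transD(5)[OF \<eta>, of "P i j"] sh_transD(5)[OF \<eta>', of "P i j"] step1 by simp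
    have "\<eta> (sh_obj T (P i j)) = \<eta>' (sh_obj T (P i j))"
      by (rule F.U.is_iso_cancel(1)[OF H.Fsh_iso _ _ *]) auto
    then have *: "\<eta> (P i (j + 1)) \<cdot>\<^bsub>U\<^esub> On_mor F (\<kappa> i j) = \<eta>' (P i (j + 1)) \<cdot>\<^bsub>U\<^esub> On_mor F (\<kappa> i j)"
      using sh_transD(4)[OF \<eta>, of "\<kappa> i j" "sh_obj T (P i j)" "P i (j + 1)"] sh_transD(4)[OF \<eta>', of "\<kappa> i j" "sh_obj T (P i j)" "P i (j + 1)"] by simp
    show ?case
      by (rule F.U.is_iso_cancel(2)[OF F.F_iso[OF T.kappa_iso] _ _ *]) auto
  next
    case (step2 l)
    define j where "j = l - 1"
    have l: "l = j + 1" unfolding j_def by simp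
    note [simp] = i
    have *: "On_mor H (\<kappa> i j) \<cdot>\<^bsub>U\<^esub> \<eta> (sh_obj T (P i j)) = On_mor H (\<kappa> i j) \<cdot>\<^bsub>U\<^esub> \<eta>' (sh_obj T (P i j))"
      using sh_transD(4)[OF \<eta>, of "\<kappa> i j" "sh_obj T (P i j)" "P i (j + 1)"] sh_transD(4)[OF \<eta>', of "\<kappa> i j" "sh_obj T (P i j)" "P i (j + 1)"] step2 l by simp
    have "\<eta> (sh_obj T (P i j)) = \<eta>' (sh_obj T (P i j))"
      by (rule F.U.is_iso_cancel(1)[OF H.F_iso[OF T.kappa_iso] _ _ *]) auto
    then have *: "sh_mor U (\<eta> (P i j)) \<cdot>\<^bsub>U\<^esub> Fsh F (P i j) = sh_mor U (\<eta>' (P i j)) \<cdot>\<^bsub>U\<^esub> Fsh F (P i j)"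
      using sh_transD(5)[OF \<eta>, of "P i j"] sh_transD(5)[OF \<eta>', of "P i j"] by simp
    have "sh_mor U (\<eta> (P i j)) = sh_mor U (\<eta>' (P i j))"
      by (rule F.U.is_iso_cancel(2)[OF F.Fsh_iso _ _ *]) auto
    then have "\<eta> (P i j) = \<eta>' (P i j)" by (rule F.U.Sh.faithful) auto
    then show ?case using l by simp
  qed
  show ?thesis
  proof (rule F_separates)
    fix i j p assume p: "i \<in> I" "arr T p" "dm T p = P i j" "cd T p = X"
    then show "\<eta> X \<cdot>\<^bsub>U\<^esub> On_mor F p = \<eta>' X \<cdot>\<^bsub>U\<^esub> On_mor F p"
      using sh_transD(4)[OF \<eta> p(2-4)] sh_transD(4)[OF \<eta>' p(2-4)] P by simp
  qed (use X in auto)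
qed

text \<open>The components at the shifted block objects are determined along the isomorphisms \<open>\<kappa> i j\<close>;
  in the negative direction this uses that the shift is full.\<close>

lemma block_components_exist:
  assumes i: "i \<in> I" and e: "arr U e" "dm U e = On_obj F (P i 0)" "cd U e = On_obj H (P i 0)"
  shows "\<exists>\<zeta>. \<zeta> 0 = e \<and> (\<forall>j. (arr U (\<zeta> j) \<and> dm U (\<zeta> j) = On_obj F (P i j) \<and> cd U (\<zeta> j) = On_obj H (P i j)) \<and>
    Fsh H (P i j) \<cdot>\<^bsub>U\<^esub> On_mor H (inv_mor T (\<kappa> i j)) \<cdot>\<^bsub>U\<^esub> \<zeta> (j + 1) \<cdot>\<^bsub>U\<^esub> On_mor F (\<kappa> i j)
      = sh_mor U (\<zeta> j) \<cdot>\<^bsub>U\<^esub> Fsh F (P i j))"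
proof -
  define D where "D j = {x. arr U x \<and> dm U x = On_obj F (P i j) \<and> cd U x = On_obj H (P i j)}" for j
  define R where "R j x y \<longleftrightarrow> Fsh H (P i j) \<cdot>\<^bsub>U\<^esub> On_mor H (inv_mor T (\<kappa> i j)) \<cdot>\<^bsub>U\<^esub> y \<cdot>\<^bsub>U\<^esub> On_mor F (\<kappa> i j)
    = sh_mor U x \<cdot>\<^bsub>U\<^esub> Fsh F (P i j)" for j x y
  note [simp] = i
  have Hk: "On_mor H (inv_mor T (\<kappa> i j)) \<cdot>\<^bsub>U\<^esub> On_mor H (\<kappa> i j) = Id U (On_obj H (sh_obj T (P i j)))" for j
    using H.F_Comp[of "\<kappa> i j" "inv_mor T (\<kappa> i j)"] by simp
  have Fk: "On_mor F (inv_mor T (\<kappa> i j)) \<cdot>\<^bsub>U\<^esub> On_mor F (\<kappa> i j) = Id U (On_obj F (sh_obj T (P i j)))" for j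
    using F.F_Comp[of "\<kappa> i j" "inv_mor T (\<kappa> i j)"] by simp
  have "\<exists>\<zeta>. \<zeta> 0 = e \<and> (\<forall>j. \<zeta> j \<in> D j \<and> R j (\<zeta> j) (\<zeta> (j + 1)))"
  proof (rule int_chain_exists)
    show "e \<in> D 0" using e by (simp add: D_def)
    fix j x assume "x \<in> D j"
    then have x [simp]: "arr U x" "dm U x = On_obj F (P i j)" "cd U x = On_obj H (P i j)"
      by (auto simp: D_def)
    define y where "y = On_mor H (\<kappa> i j) \<cdot>\<^bsub>U\<^esub> inv_mor U (Fsh H (P i j)) \<cdot>\<^bsub>U\<^esub> sh_mor U x \<cdot>\<^bsub>U\<^esub>
      Fsh F (P i j) \<cdot>\<^bsub>U\<^esub> On_mor F (inv_mor T (\<kappa> i j))"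
    have "y \<in> D (j + 1)" by (simp add: D_def y_def)
    moreover have "R j x y"
      by (simp add: R_def y_def F.U.Comp_reduce[OF Hk] Fk)
    ultimately show "\<exists>y \<in> D (j + 1). R j x y" by blast
  next
    fix j y assume "y \<in> D (j + 1)"
    then have y [simp]: "arr U y" "dm U y = On_obj F (P i (j + 1))" "cd U y = On_obj H (P i (j + 1))"
      by (auto simp: D_def)
    define z where "z = Fsh H (P i j) \<cdot>\<^bsub>U\<^esub> On_mor H (inv_mor T (\<kappa> i j)) \<cdot>\<^bsub>U\<^esub> y \<cdot>\<^bsub>U\<^esub> On_mor F (\<kappa> i j)
      \<cdot>\<^bsub>U\<^esub> inv_mor U (Fsh F (P i j))"
    have z: "arr U z" "dm U z = sh_obj U (On_obj F (P i j))" "cd U z = sh_obj U (On_obj H (P i j))"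
      by (simp_all add: z_def)
    obtain x where x: "arr U x" "dm U x = On_obj F (P i j)" "cd U x = On_obj H (P i j)" "sh_mor U x = z"
      using F.U.Sh.full[OF z] by auto
    then have "R j x y" by (simp add: R_def x(4)) (simp add: z_def)
    with x show "\<exists>x \<in> D j. R j x y" by (auto simp: D_def)
  qed
  then show ?thesis by (simp add: D_def R_def)
qed

text \<open>Components at shifted block objects come from the chain \<zeta>. At a general
  \<open>X\<close> the component is prescribed on all images of morphisms from block objects, and
  such a morphism exists because the identity of \<open>X\<close> lies in the ideal.\<close>

lemma sh_trans_exists:
  assumes e: "\<And>i. i \<in> I \<Longrightarrow> arr U (e i)" "\<And>i. i \<in> I \<Longrightarrow> dm U (e i) = On_obj F (P i 0)"
    "\<And>i. i \<in> I \<Longrightarrow> cd U (e i) = On_obj H (P i 0)"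
  obtains \<eta> where "sh_trans T U F H \<eta>" "\<And>i. i \<in> I \<Longrightarrow> \<eta> (P i 0) = e i"
proof -
  have "\<forall>i. \<exists>\<zeta>. i \<in> I \<longrightarrow> \<zeta> 0 = e i \<and> (\<forall>j. (arr U (\<zeta> j) \<and> dm U (\<zeta> j) = On_obj F (P i j) \<and> cd U (\<zeta> j) = On_obj H (P i j)) \<and>
    Fsh H (P i j) \<cdot>\<^bsub>U\<^esub> On_mor H (inv_mor T (\<kappa> i j)) \<cdot>\<^bsub>U\<^esub> \<zeta> (j + 1) \<cdot>\<^bsub>U\<^esub> On_mor F (\<kappa> i j)
      = sh_mor U (\<zeta> j) \<cdot>\<^bsub>U\<^esub> Fsh F (P i j))"
    (is "\<forall>i. \<exists>\<zeta>. ?Q i \<zeta>")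
  proof
    show "\<exists>\<zeta>. ?Q i \<zeta>" for i
      using block_components_exist[of i "e i"] e[of i] by (cases "i \<in> I") simp_all
  qed
  from choice[OF this] obtain \<zeta> where
    \<zeta>0: "\<And>i. i \<in> I \<Longrightarrow> \<zeta> i 0 = e i"
    and \<zeta> [simp]: "\<And>i j. i \<in> I \<Longrightarrow> arr U (\<zeta> i j)" "\<And>i j. i \<in> I \<Longrightarrow> dm U (\<zeta> i j) = On_obj F (P i j)"
      "\<And>i j. i \<in> I \<Longrightarrow> cd U (\<zeta> i j) = On_obj H (P i j)"
    and \<zeta>s: "\<And>i j. i \<in> I \<Longrightarrow> Fsh H (P i j) \<cdot>\<^bsub>U\<^esub> On_mor H (inv_mor T (\<kappa> i j)) \<cdot>\<^bsub>U\<^esub> \<zeta> i (j + 1) \<cdot>\<^bsub>U\<^esub> On_mor F (\<kappa> i j)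
      = sh_mor U (\<zeta> i j) \<cdot>\<^bsub>U\<^esub> Fsh F (P i j)"
    by blast
  \<comment> \<open>Between block objects only zero and scalar multiples of identities occur;
    \<open>F\<close> and \<open>H\<close> are semilinear for the same \<open>s\<close>, so any
    family of components is natural there.\<close>
  have \<zeta>n: "\<zeta> k l \<cdot>\<^bsub>U\<^esub> On_mor F f = On_mor H f \<cdot>\<^bsub>U\<^esub> \<zeta> i j"
    if "i \<in> I" "k \<in> I" "arr T f" "dm T f = P i j" "cd T f = P k l" for i j k l f
    by (rule T.P_hom_cases[OF that]) (use that in auto)
  \<comment> \<open>For \<open>f\<close> in the ideal, \<open>m\<close> plays the role of the image
    of \<open>f\<close> under \<open>H\<close> composed with the unknown component at
    \<open>X\<close>. It is additive in \<open>f\<close> and explicit for \<open>f\<close> through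
    one block object; the identity as \<open>f\<close> yields the component itself.\<close>
  have "\<exists>m. arr U m \<and> dm U m = On_obj F X \<and> cd U m = On_obj H X \<and>
      (\<forall>i \<in> I. \<forall>j p. arr T p \<longrightarrow> dm T p = P i j \<longrightarrow> cd T p = X \<longrightarrow> m \<cdot>\<^bsub>U\<^esub> On_mor F p = On_mor H (f \<cdot>\<^bsub>T\<^esub> p) \<cdot>\<^bsub>U\<^esub> \<zeta> i j)"
    if "T.fac X X f" and X [simp]: "X \<in> Obj T" for X f
    using that(1)
  proof induction
    case zer
    show ?case by (intro exI[of _ "zer U (On_obj F X) (On_obj H X)"]) simp
  next
    case (plus f g)
    note [simp] = T.fac_arr[OF plus(1) X X] T.fac_arr[OF plus(2) X X]
    note plus(3,4)
    then obtain m m' where m: "arr U m" "dm U m = On_obj F X" "cd U m = On_obj H X"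
      "\<forall>i \<in> I. \<forall>j p. arr T p \<longrightarrow> dm T p = P i j \<longrightarrow> cd T p = X \<longrightarrow> m \<cdot>\<^bsub>U\<^esub> On_mor F p = On_mor H (f \<cdot>\<^bsub>T\<^esub> p) \<cdot>\<^bsub>U\<^esub> \<zeta> i j"
      and m': "arr U m'" "dm U m' = On_obj F X" "cd U m' = On_obj H X"
      "\<forall>i \<in> I. \<forall>j p. arr T p \<longrightarrow> dm T p = P i j \<longrightarrow> cd T p = X \<longrightarrow> m' \<cdot>\<^bsub>U\<^esub> On_mor F p = On_mor H (g \<cdot>\<^bsub>T\<^esub> p) \<cdot>\<^bsub>U\<^esub> \<zeta> i j"
      by blast
    show ?case
      by (intro exI[of _ "m \<uplus>\<^bsub>U\<^esub> m'"]) (use m m' in simp)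
  next
    case (comp k p l q)
    show ?case
    proof (intro exI[of _ "On_mor H q \<cdot>\<^bsub>U\<^esub> \<zeta> k l \<cdot>\<^bsub>U\<^esub> On_mor F p"] conjI ballI allI impI)
      fix i j r assume r: "i \<in> I" "arr T r" "dm T r = P i j" "cd T r = X"
      then have "\<zeta> k l \<cdot>\<^bsub>U\<^esub> On_mor F (p \<cdot>\<^bsub>T\<^esub> r) = On_mor H (p \<cdot>\<^bsub>T\<^esub> r) \<cdot>\<^bsub>U\<^esub> \<zeta> i j"
        using comp by (intro \<zeta>n) auto
      then show "(On_mor H q \<cdot>\<^bsub>U\<^esub> \<zeta> k l \<cdot>\<^bsub>U\<^esub> On_mor F p) \<cdot>\<^bsub>U\<^esub> On_mor F r = On_mor H ((q \<cdot>\<^bsub>T\<^esub> p) \<cdot>\<^bsub>T\<^esub> r) \<cdot>\<^bsub>U\<^esub> \<zeta> i j"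
        using comp r by simp
    qed (use comp in auto)
  qed
  from this[OF T.Id_fac] have "\<forall>X. \<exists>m. X \<in> Obj T \<longrightarrow> arr U m \<and> dm U m = On_obj F X \<and> cd U m = On_obj H X \<and>
      (\<forall>i \<in> I. \<forall>j p. arr T p \<longrightarrow> dm T p = P i j \<longrightarrow> cd T p = X \<longrightarrow> m \<cdot>\<^bsub>U\<^esub> On_mor F p = On_mor H p \<cdot>\<^bsub>U\<^esub> \<zeta> i j)"
    by (simp cong: conj_cong imp_cong)
  from choice[OF this] obtain \<eta> where
    \<eta> [simp]: "\<And>X. X \<in> Obj T \<Longrightarrow> arr U (\<eta> X)" "\<And>X. X \<in> Obj T \<Longrightarrow> dm U (\<eta> X) = On_obj F X"
      "\<And>X. X \<in> Obj T \<Longrightarrow> cd U (\<eta> X) = On_obj H X"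
    and \<eta>p: "\<And>X i j p. \<lbrakk>i \<in> I; arr T p; dm T p = P i j; cd T p = X\<rbrakk> \<Longrightarrow> \<eta> X \<cdot>\<^bsub>U\<^esub> On_mor F p = On_mor H p \<cdot>\<^bsub>U\<^esub> \<zeta> i j"
    using T.cd_Obj by metis
  have "sh_trans T U F H \<eta>"
    unfolding sh_trans_def
  proof (intro conjI ballI allI impI)
    fix f assume f: "arr T f"
    show "\<eta> (cd T f) \<cdot>\<^bsub>U\<^esub> On_mor F f = On_mor H f \<cdot>\<^bsub>U\<^esub> \<eta> (dm T f)"
    proof (rule F_separates[of _ _ "dm T f"])
      fix i j p assume p: "i \<in> I" "arr T p" "dm T p = P i j" "cd T p = dm T f"
      then show "(\<eta> (cd T f) \<cdot>\<^bsub>U\<^esub> On_mor F f) \<cdot>\<^bsub>U\<^esub> On_mor F p = (On_mor H f \<cdot>\<^bsub>U\<^esub> \<eta> (dm T f)) \<cdot>\<^bsub>U\<^esub> On_mor F p"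
        using \<eta>p[of i p j "dm T f"] \<eta>p[of i "f \<cdot>\<^bsub>T\<^esub> p" j "cd T f"] f by simp
    qed (use f in auto)
  next
    fix X assume X [simp]: "X \<in> Obj T"
    show "Fsh H X \<cdot>\<^bsub>U\<^esub> \<eta> (sh_obj T X) = sh_mor U (\<eta> X) \<cdot>\<^bsub>U\<^esub> Fsh F X"
    proof (rule F_separates[of _ _ "sh_obj T X"])
      fix i l p assume p: "i \<in> I" "arr T p" "dm T p = P i l" "cd T p = sh_obj T X"
      define j where "j = l - 1"
      have l: "l = j + 1" unfolding j_def by simp
      note [simp] = p[unfolded l]
      \<comment> \<open>Up to \<kappa>, a morphism from \<open>P i (j + 1)\<close> to
        \<open>X[1]\<close> is the shift of one from \<open>P i j\<close> to \<open>X\<close>, so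
        shift compatibility at \<open>X\<close> is reduced to the chain condition on
        \<zeta>.\<close>
      obtain q where q [simp]: "arr T q" "dm T q = P i j" "cd T q = X" and qp: "sh_mor T q = p \<cdot>\<^bsub>T\<^esub> \<kappa> i j"
        using T.Sh.full[of "p \<cdot>\<^bsub>T\<^esub> \<kappa> i j" "P i j" X] by auto
      have pq: "p = sh_mor T q \<cdot>\<^bsub>T\<^esub> inv_mor T (\<kappa> i j)" unfolding qp by simp
      have Fk: "On_mor F (\<kappa> i j) \<cdot>\<^bsub>U\<^esub> On_mor F (inv_mor T (\<kappa> i j)) = Id U (On_obj F (P i (j + 1)))"
        using F.F_Comp[of "inv_mor T (\<kappa> i j)" "\<kappa> i j"] by simp
      have 1: "(Fsh H X \<cdot>\<^bsub>U\<^esub> \<eta> (sh_obj T X)) \<cdot>\<^bsub>U\<^esub> On_mor F p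
          = sh_mor U (On_mor H q) \<cdot>\<^bsub>U\<^esub> Fsh H (P i j) \<cdot>\<^bsub>U\<^esub> On_mor H (inv_mor T (\<kappa> i j)) \<cdot>\<^bsub>U\<^esub> \<zeta> i (j + 1)"
        using \<eta>p[of i p "j + 1" "sh_obj T X"] arg_cong[OF pq, of "On_mor H"]
          F.U.Comp_reduce[OF H.Fsh_natural[of q "P i j" X], of "On_mor H (inv_mor T (\<kappa> i j)) \<cdot>\<^bsub>U\<^esub> \<zeta> i (j + 1)"]
        by simp
      have "sh_mor U (\<eta> X \<cdot>\<^bsub>U\<^esub> On_mor F q) = sh_mor U (On_mor H q \<cdot>\<^bsub>U\<^esub> \<zeta> i j)"
        using \<eta>p[of i q j X] by simp
      then have 2: "sh_mor U (\<eta> X) \<cdot>\<^bsub>U\<^esub> sh_mor U (On_mor F q) = sh_mor U (On_mor H q) \<cdot>\<^bsub>U\<^esub> sh_mor U (\<zeta> i j)"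
        by simp
      have 3: "sh_mor U (\<zeta> i j) \<cdot>\<^bsub>U\<^esub> Fsh F (P i j) \<cdot>\<^bsub>U\<^esub> On_mor F (inv_mor T (\<kappa> i j))
        = Fsh H (P i j) \<cdot>\<^bsub>U\<^esub> On_mor H (inv_mor T (\<kappa> i j)) \<cdot>\<^bsub>U\<^esub> \<zeta> i (j + 1)"
        using F.U.Comp_reduce[OF \<zeta>s[of i j, symmetric], of "On_mor F (inv_mor T (\<kappa> i j))"] by (simp add: Fk)
      have "(sh_mor U (\<eta> X) \<cdot>\<^bsub>U\<^esub> Fsh F X) \<cdot>\<^bsub>U\<^esub> On_mor F p
          = sh_mor U (\<eta> X) \<cdot>\<^bsub>U\<^esub> sh_mor U (On_mor F q) \<cdot>\<^bsub>U\<^esub> Fsh F (P i j) \<cdot>\<^bsub>U\<^esub> On_mor F (inv_mor T (\<kappa> i j))"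
        using arg_cong[OF pq, of "On_mor F"]
          F.U.Comp_reduce[OF F.Fsh_natural[of q "P i j" X], of "On_mor F (inv_mor T (\<kappa> i j))"] by simp
      also have "\<dots> = sh_mor U (On_mor H q) \<cdot>\<^bsub>U\<^esub> sh_mor U (\<zeta> i j) \<cdot>\<^bsub>U\<^esub> Fsh F (P i j) \<cdot>\<^bsub>U\<^esub> On_mor F (inv_mor T (\<kappa> i j))"
        using F.U.Comp_reduce[OF 2, of "Fsh F (P i j) \<cdot>\<^bsub>U\<^esub> On_mor F (inv_mor T (\<kappa> i j))"] by simp
      finally show "(Fsh H X \<cdot>\<^bsub>U\<^esub> \<eta> (sh_obj T X)) \<cdot>\<^bsub>U\<^esub> On_mor F p = (sh_mor U (\<eta> X) \<cdot>\<^bsub>U\<^esub> Fsh F X) \<cdot>\<^bsub>U\<^esub> On_mor F p"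
        using 1 3 by simp
    qed auto
  qed auto
  moreover have "\<eta> (P i 0) = e i" if "i \<in> I" for i
    using \<eta>p[of i "Id T (P i 0)" 0 "P i 0"] \<zeta>0[OF that] e[OF that] that by simp
  ultimately show ?thesis by (rule that)
qed

end

lemma (in linear_category) nat_iso_iff:
  "nat_iso C D F H \<eta> \<longleftrightarrow>
    (\<forall>X \<in> Obj C. is_iso D (On_obj F X) (On_obj H X) (\<eta> X)) \<and>
    (\<forall>f. arr C f \<longrightarrow> \<eta> (cd C f) \<cdot>\<^bsub>D\<^esub> On_mor F f = On_mor H f \<cdot>\<^bsub>D\<^esub> \<eta> (dm C f))"
  unfolding nat_iso_def
proof (intro conj_cong refl iffI allI impI ballI)
  fix f assume "\<forall>X \<in> Obj C. \<forall>Y \<in> Obj C. \<forall>f \<in> homs C X Y. \<eta> Y \<cdot>\<^bsub>D\<^esub> On_mor F f = On_mor H f \<cdot>\<^bsub>D\<^esub> \<eta> X" "arr C f"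
  then show "\<eta> (cd C f) \<cdot>\<^bsub>D\<^esub> On_mor F f = On_mor H f \<cdot>\<^bsub>D\<^esub> \<eta> (dm C f)"
    using arr_homs[of f] by (simp del: homs_iff)
qed auto

lemma semilinear_functorI:
  assumes "linear_category K C" "linear_category K D"
    and o: "\<And>X. X \<in> Obj C \<Longrightarrow> On_obj F X \<in> Obj D"
    and m: "\<And>f. arr C f \<Longrightarrow> arr D (On_mor F f)"
      "\<And>f. arr C f \<Longrightarrow> dm D (On_mor F f) = On_obj F (dm C f)"
      "\<And>f. arr C f \<Longrightarrow> cd D (On_mor F f) = On_obj F (cd C f)"
    and i: "\<And>X. X \<in> Obj C \<Longrightarrow> On_mor F (Id C X) = Id D (On_obj F X)"
    and c: "\<And>f g. \<lbrakk>arr C f; arr C g; dm C g = cd C f\<rbrakk> \<Longrightarrow> On_mor F (g \<cdot>\<^bsub>C\<^esub> f) = On_mor F g \<cdot>\<^bsub>D\<^esub> On_mor F f"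
    and a: "\<And>f g. \<lbrakk>arr C f; arr C g; dm C g = dm C f; cd C g = cd C f\<rbrakk>
      \<Longrightarrow> On_mor F (f \<uplus>\<^bsub>C\<^esub> g) = On_mor F f \<uplus>\<^bsub>D\<^esub> On_mor F g"
    and k: "\<And>f c. \<lbrakk>arr C f; c \<in> carrier K\<rbrakk> \<Longrightarrow> On_mor F (c \<star>\<^bsub>C\<^esub> f) = s c \<star>\<^bsub>D\<^esub> On_mor F f"
  shows "semilinear_functor K s C D F"
proof -
  interpret C: linear_category K C by fact
  interpret D: linear_category K D by fact
  show ?thesis
    unfolding semilinear_functor_def additive_functor_def is_functor_def
  proof (intro conjI ballI)
    fix X Y f f' assume f: "X \<in> Obj C" "Y \<in> Obj C" "f \<in> homs C X Y" "f' \<in> homs C X Y"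
    then show "On_mor F (f \<oplus>\<^bsub>Hom C X Y\<^esub> f') =
        On_mor F f \<oplus>\<^bsub>Hom D (On_obj F X) (On_obj F Y)\<^esub> On_mor F f'"
      using a[of f f'] m[of f] by (simp add: plus_mor_def)
  next
    fix X Y f c assume f: "X \<in> Obj C" "Y \<in> Obj C" "f \<in> homs C X Y" "c \<in> carrier K"
    then show "On_mor F (c \<odot>\<^bsub>Hom C X Y\<^esub> f) = s c \<odot>\<^bsub>Hom D (On_obj F X) (On_obj F Y)\<^esub> On_mor F f"
      using k[of f c] m[of f] by (simp add: scale_mor_def)
  qed (use o m i c in auto)
qed

lemma (in lin_functor) F_functor: "is_functor C D F" "additive_functor C D F"
  using semilinear unfolding semilinear_functor_def additive_functor_def by auto

definition id_exact :: "('o, 'm, 'k, 'z) tricat_scheme \<Rightarrow> ('o, 'm, 'o, 'm) exfunctr"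
  where "id_exact T = \<lparr>On_obj = (\<lambda>X. X), On_mor = (\<lambda>f. f), Fsh = (\<lambda>X. Id T (sh_obj T X))\<rparr>"

lemma (in triangulated_category) sh_functor_id: "sh_functor K (\<lambda>c. c) T T (id_exact T)"
proof unfold_locales
  show "semilinear_functor K (\<lambda>c. c) T T (id_exact T)"
    by (rule semilinear_functorI) (use linear_category_axioms in \<open>auto simp: id_exact_def\<close>)
  show "nat_iso T T (comp_functor (id_exact T) (Shift T)) (comp_functor (Shift T) (id_exact T)) (Fsh (id_exact T))"
    unfolding nat_iso_iff by (simp add: id_exact_def comp_functor_def is_iso_Id)
qed

lemma sh_functor_comp:
  assumes "sh_functor K s T U F" "sh_functor K t U V H"
  shows "sh_functor K (\<lambda>c. t (s c)) T V (comp_exact V H F)"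
proof -
  interpret F: sh_functor K s T U F by fact
  interpret H: sh_functor K t U V H by fact
  show ?thesis
  proof unfold_locales
    show "semilinear_functor K (\<lambda>c. t (s c)) T V (comp_exact V H F)"
      by (rule semilinear_functorI)
        (use F.T.linear_category_axioms H.U.linear_category_axioms in \<open>auto simp: comp_exact_def\<close>)
    show "nat_iso T V (comp_functor (comp_exact V H F) (Shift T)) (comp_functor (Shift V) (comp_exact V H F))
      (Fsh (comp_exact V H F))"
      unfolding F.T.nat_iso_iff
    proof (intro conjI ballI allI impI)
      fix X assume X: "X \<in> Obj T"
      show "is_iso V (On_obj (comp_functor (comp_exact V H F) (Shift T)) X)
          (On_obj (comp_functor (Shift V) (comp_exact V H F)) X) (Fsh (comp_exact V H F) X)"
        using H.U.is_iso_Comp[OF H.F_iso[OF F.Fsh_iso[OF X]] H.Fsh_iso[OF F.F_Obj[OF X]]] X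
        by (simp add: comp_exact_def comp_functor_def)
    next
      fix f assume f: "arr T f"
      note [simp] = F.Fsh_natural[OF f refl refl] H.Fsh_natural[of "On_mor F f" "On_obj F (dm T f)" "On_obj F (cd T f)"]
      have "On_mor H (Fsh F (cd T f) \<cdot>\<^bsub>U\<^esub> On_mor F (sh_mor T f)) = On_mor H (sh_mor U (On_mor F f) \<cdot>\<^bsub>U\<^esub> Fsh F (dm T f))"
        by simp
      then have *: "On_mor H (Fsh F (cd T f)) \<cdot>\<^bsub>V\<^esub> On_mor H (On_mor F (sh_mor T f))
        = On_mor H (sh_mor U (On_mor F f)) \<cdot>\<^bsub>V\<^esub> On_mor H (Fsh F (dm T f))"
        using f by (simp del: F.Fsh_natural[OF f refl refl])
      have **: "Fsh H (On_obj F (cd T f)) \<cdot>\<^bsub>V\<^esub> On_mor H (sh_mor U (On_mor F f)) =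
        sh_mor V (On_mor H (On_mor F f)) \<cdot>\<^bsub>V\<^esub> Fsh H (On_obj F (dm T f))"
        using f by simp
      show "Fsh (comp_exact V H F) (cd T f) \<cdot>\<^bsub>V\<^esub> On_mor (comp_functor (comp_exact V H F) (Shift T)) f =
          On_mor (comp_functor (Shift V) (comp_exact V H F)) f \<cdot>\<^bsub>V\<^esub> Fsh (comp_exact V H F) (dm T f)"
        using f * H.U.Comp_reduce[OF **, of "On_mor H (Fsh F (dm T f))"] by (simp add: comp_exact_def comp_functor_def)
    qed
  qed auto
qed

text \<open>Only the values of \<open>s\<close> on the field matter. The maps
  \<open>\<sigma> (g h)\<close> and \<open>\<sigma> g\<close> after \<open>\<sigma> h\<close> are
  known to agree there and not as functions on the whole type.\<close>

lemma sh_functor_cong: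
  assumes "sh_functor K s T U F" "\<And>c. c \<in> carrier K \<Longrightarrow> s c = s' c"
  shows "sh_functor K s' T U F"
proof -
  interpret F: sh_functor K s T U F by fact
  show ?thesis
  proof unfold_locales
    show "semilinear_functor K s' T U F"
      using F.semilinear assms(2) unfolding semilinear_functor_def by metis
    show "s' c \<in> carrier K" if "c \<in> carrier K" for c using F.s_closed[OF that] assms(2)[OF that] by simp
  qed (rule F.Fsh_nat)
qed

lemma exact_functor_sh_functor:
  assumes "triangulated_category K T" "triangulated_category K U" "exact_functor T U F"
    "semilinear_functor K s T U F" "\<And>c. c \<in> carrier K \<Longrightarrow> s c \<in> carrier K"
  shows "sh_functor K s T U F"
proof -
  interpret T: triangulated_category K T by fact
  interpret U: triangulated_category K U by fact
  show ?thesis by unfold_locales (use assms in \<open>auto simp: exact_functor_def\<close>)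
qed

section \<open>Composition and invertibility of shift-compatible transformations\<close>

context block_functors
begin

lemma sh_trans_comp:
  assumes "sh_trans T U F H \<eta>" "sh_trans T U H L \<mu>" "sh_functor K s T U L"
  shows "sh_trans T U F L (\<lambda>X. \<mu> X \<cdot>\<^bsub>U\<^esub> \<eta> X)"
proof -
  interpret L: sh_functor K s T U L by fact
  interpret HL: block_functors K s T I P \<kappa> U H L by unfold_locales
  note [simp] = sh_transD(1-3)[OF assms(1)] HL.sh_transD(1-3)[OF assms(2)]
  show ?thesis
    unfolding sh_trans_def
  proof (intro conjI ballI allI impI)
    fix f assume f: "arr T f"
    note n = sh_transD(4)[OF assms(1) f refl refl] HL.sh_transD(4)[OF assms(2) f refl refl]
    show "(\<mu> (cd T f) \<cdot>\<^bsub>U\<^esub> \<eta> (cd T f)) \<cdot>\<^bsub>U\<^esub> On_mor F f = On_mor L f \<cdot>\<^bsub>U\<^esub> \<mu> (dm T f) \<cdot>\<^bsub>U\<^esub> \<eta> (dm T f)"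
      using n F.U.Comp_reduce[OF n(2), of "\<eta> (dm T f)"] f by simp
  next
    fix X assume X: "X \<in> Obj T"
    note n = sh_transD(5)[OF assms(1) X] HL.sh_transD(5)[OF assms(2) X]
    show "Fsh L X \<cdot>\<^bsub>U\<^esub> \<mu> (sh_obj T X) \<cdot>\<^bsub>U\<^esub> \<eta> (sh_obj T X) = sh_mor U (\<mu> X \<cdot>\<^bsub>U\<^esub> \<eta> X) \<cdot>\<^bsub>U\<^esub> Fsh F X"
      using n F.U.Comp_reduce[OF n(2), of "\<eta> (sh_obj T X)"] X by simp
  qed auto
qed

lemma sh_trans_Id: "sh_trans T U F F (\<lambda>X. Id U (On_obj F X))"
  unfolding sh_trans_def by auto

text \<open>The inverses of the components at the block extend to a transformation in the other
  direction, and uniqueness identifies both composites with the identity.\<close>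

lemma sh_trans_iso:
  assumes \<eta>: "sh_trans T U F H \<eta>"
    and iso: "\<And>i. i \<in> I \<Longrightarrow> is_iso U (On_obj F (P i 0)) (On_obj H (P i 0)) (\<eta> (P i 0))"
    and X: "X \<in> Obj T"
  shows "is_iso U (On_obj F X) (On_obj H X) (\<eta> X)"
proof -
  interpret HF: block_functors K s T I P \<kappa> U H F by unfold_locales
  interpret FF: block_functors K s T I P \<kappa> U F F by unfold_locales
  interpret HH: block_functors K s T I P \<kappa> U H H by unfold_locales
  note inv = F.U.is_iso_inverse[OF iso]
  obtain \<mu> where \<mu>: "sh_trans T U H F \<mu>" "\<And>i. i \<in> I \<Longrightarrow> \<mu> (P i 0) = inv_mor U (\<eta> (P i 0))"
    by (rule HF.sh_trans_exists[of "\<lambda>i. inv_mor U (\<eta> (P i 0))"]) (use inv in auto)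
  have "\<mu> X \<cdot>\<^bsub>U\<^esub> \<eta> X = Id U (On_obj F X)"
    by (rule FF.sh_trans_unique[OF sh_trans_comp[OF \<eta> \<mu>(1)] sh_trans_Id _ X])
      (use \<mu>(2) inv F.sh_functor_axioms in auto)
  moreover have "\<eta> X \<cdot>\<^bsub>U\<^esub> \<mu> X = Id U (On_obj H X)"
    by (rule HH.sh_trans_unique[OF HF.sh_trans_comp[OF \<mu>(1) \<eta>] HF.sh_trans_Id _ X])
      (use \<mu>(2) inv H.sh_functor_axioms in auto)
  ultimately show ?thesis
    by (intro F.U.is_isoI[of _ _ _ "\<mu> X"]) (use X sh_transD[OF \<eta>] HF.sh_transD[OF \<mu>(1)] in auto)
qed

lemma exact_iso_iff:
  "exact_iso T U F H \<eta> \<longleftrightarrow>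
    sh_trans T U F H \<eta> \<and> (\<forall>X \<in> Obj T. is_iso U (On_obj F X) (On_obj H X) (\<eta> X))"
proof
  assume "exact_iso T U F H \<eta>"
  then show "sh_trans T U F H \<eta> \<and> (\<forall>X \<in> Obj T. is_iso U (On_obj F X) (On_obj H X) (\<eta> X))"
    unfolding exact_iso_def T.nat_iso_iff sh_trans_def
    using F.U.is_iso_inverse by (auto simp del: F.U.in_hom_iff simp: F.U.in_hom_iff[abs_def])
next
  assume "sh_trans T U F H \<eta> \<and> (\<forall>X \<in> Obj T. is_iso U (On_obj F X) (On_obj H X) (\<eta> X))"
  then show "exact_iso T U F H \<eta>"
    unfolding exact_iso_def T.nat_iso_iff sh_trans_def by auto
qed

lemma exact_iso_exists:
  assumes "\<And>i. i \<in> I \<Longrightarrow> is_iso U (On_obj F (P i 0)) (On_obj H (P i 0)) (e i)"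
  obtains \<eta> where "exact_iso T U F H \<eta>" "\<And>i. i \<in> I \<Longrightarrow> \<eta> (P i 0) = e i"
proof -
  note inv = F.U.is_iso_inverse[OF assms]
  obtain \<eta> where \<eta>: "sh_trans T U F H \<eta>" "\<And>i. i \<in> I \<Longrightarrow> \<eta> (P i 0) = e i"
    by (rule sh_trans_exists[of e]) (use inv in auto)
  then have "exact_iso T U F H \<eta>" using sh_trans_iso[OF \<eta>(1)] assms by (simp add: exact_iso_iff)
  with \<eta> that show ?thesis by blast
qed

end

text \<open>Isomorphisms of objects at the block are enough: with no compatibility assumed, they
  extend to natural isomorphisms of the composites with the identity functors.\<close>

lemma equivalence_criterion:
  assumes "tri_block K T I P \<kappa>" "tri_block K U I' P' \<kappa>'"
    and F: "sh_functor K (\<lambda>c. c) T U F" and H: "sh_functor K (\<lambda>c. c) U T H"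
    and 1: "\<And>i. i \<in> I \<Longrightarrow> isomorphic T (P i 0) (On_obj H (On_obj F (P i 0)))"
    and 2: "\<And>i. i \<in> I' \<Longrightarrow> isomorphic U (On_obj F (On_obj H (P' i 0))) (P' i 0)"
  shows "equivalence T U F"
proof -
  interpret T: tri_block K T I P \<kappa> by fact
  interpret U: tri_block K U I' P' \<kappa>' by fact
  interpret F: sh_functor K "\<lambda>c. c" T U F by fact
  interpret H: sh_functor K "\<lambda>c. c" U T H by fact
  interpret A: block_functors K "\<lambda>c. c" T I P \<kappa> T "id_exact T" "comp_exact T H F"
    by (intro block_functors.intro assms T.sh_functor_id sh_functor_comp[OF F H])
  interpret B: block_functors K "\<lambda>c. c" U I' P' \<kappa>' U "comp_exact U F H" "id_exact U"
    by (intro block_functors.intro assms U.sh_functor_id sh_functor_comp[OF H F])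
  obtain e where e: "\<And>i. i \<in> I \<Longrightarrow> is_iso T (P i 0) (On_obj H (On_obj F (P i 0))) (e i)"
    using 1 unfolding isomorphic_def by metis
  obtain \<eta> where \<eta>: "exact_iso T T (id_exact T) (comp_exact T H F) \<eta>"
    by (rule A.exact_iso_exists[of e, rotated]) (use e in \<open>auto simp: id_exact_def comp_exact_def\<close>)
  obtain e where e: "\<And>i. i \<in> I' \<Longrightarrow> is_iso U (On_obj F (On_obj H (P' i 0))) (P' i 0) (e i)"
    using 2 unfolding isomorphic_def by metis
  obtain \<mu> where \<mu>: "exact_iso U U (comp_exact U F H) (id_exact U) \<mu>"
    by (rule B.exact_iso_exists[of e, rotated]) (use e in \<open>auto simp: id_exact_def comp_exact_def\<close>)
  let ?H = "\<lparr>On_obj = On_obj H, On_mor = On_mor H\<rparr>"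
  have "is_functor T U F" "is_functor U T ?H"
    using F.F_functor H.F_functor unfolding is_functor_def by auto
  moreover have "nat_iso T T id_functor (comp_functor ?H F) \<eta>" "nat_iso U U (comp_functor F ?H) id_functor \<mu>"
    using \<eta> \<mu> unfolding exact_iso_def nat_iso_def
    by (simp_all add: id_exact_def comp_exact_def id_functor_def comp_functor_def)
  ultimately show ?thesis unfolding equivalence_def by blast
qed

section \<open>Exactness from split triangles\<close>

text \<open>A contracting homotopy consists of equations, which every functor of this kind
  preserves; only the component starting at \<open>X[1]\<close> has to be corrected by the shift
  isomorphism of \<open>F\<close>.\<close>

lemma split_triangle_image:
  assumes F: "sh_functor K s T U F" and sp: "split_triangle T X Y Z u v w a b c"
  shows "split_triangle U (On_obj F X) (On_obj F Y) (On_obj F Z)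
    (On_mor F u) (On_mor F v) (Fsh F X \<cdot>\<^bsub>U\<^esub> On_mor F w)
    (On_mor F a) (On_mor F b) (On_mor F c \<cdot>\<^bsub>U\<^esub> inv_mor U (Fsh F X))"
proof -
  interpret F: sh_functor K s T U F by fact
  have [simp]: "X \<in> Obj T" "Y \<in> Obj T" "Z \<in> Obj T" "arr T u" "dm T u = X" "cd T u = Y"
    "arr T v" "dm T v = Y" "cd T v = Z" "arr T w" "dm T w = Z" "cd T w = sh_obj T X"
    "arr T a" "dm T a = Y" "cd T a = X" "arr T b" "dm T b = Z" "cd T b = Y"
    "arr T c" "dm T c = sh_obj T X" "cd T c = Z"
    and vu: "v \<cdot>\<^bsub>T\<^esub> u = zer T X Z" and wv: "w \<cdot>\<^bsub>T\<^esub> v = zer T Y (sh_obj T X)"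
    and uw: "sh_mor T u \<cdot>\<^bsub>T\<^esub> w = zer T Z (sh_obj T Y)"
    and Y: "u \<cdot>\<^bsub>T\<^esub> a \<uplus>\<^bsub>T\<^esub> b \<cdot>\<^bsub>T\<^esub> v = Id T Y" and Z: "v \<cdot>\<^bsub>T\<^esub> b \<uplus>\<^bsub>T\<^esub> c \<cdot>\<^bsub>T\<^esub> w = Id T Z"
    and X: "w \<cdot>\<^bsub>T\<^esub> c \<uplus>\<^bsub>T\<^esub> sh_mor T (a \<cdot>\<^bsub>T\<^esub> u) = Id T (sh_obj T X)"
    using sp by (auto simp: split_triangle_def)
  note n = F.Fsh_natural[of u X Y] F.Fsh_natural[of "a \<cdot>\<^bsub>T\<^esub> u" X X]
  have "Fsh F X \<cdot>\<^bsub>U\<^esub> On_mor F (w \<cdot>\<^bsub>T\<^esub> c \<uplus>\<^bsub>T\<^esub> sh_mor T (a \<cdot>\<^bsub>T\<^esub> u)) \<cdot>\<^bsub>U\<^esub> inv_mor U (Fsh F X) = Id U (sh_obj U (On_obj F X))"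
    unfolding X by simp
  moreover have "Fsh F X \<cdot>\<^bsub>U\<^esub> On_mor F (sh_mor T (a \<cdot>\<^bsub>T\<^esub> u)) \<cdot>\<^bsub>U\<^esub> inv_mor U (Fsh F X) = sh_mor U (On_mor F (a \<cdot>\<^bsub>T\<^esub> u))"
    using F.U.Comp_reduce[OF n(2), of "inv_mor U (Fsh F X)"] by simp
  ultimately have X': "Fsh F X \<cdot>\<^bsub>U\<^esub> On_mor F w \<cdot>\<^bsub>U\<^esub> On_mor F c \<cdot>\<^bsub>U\<^esub> inv_mor U (Fsh F X) \<uplus>\<^bsub>U\<^esub>
      sh_mor U (On_mor F a) \<cdot>\<^bsub>U\<^esub> sh_mor U (On_mor F u) = Id U (sh_obj U (On_obj F X))"
    by simp
  have uw': "sh_mor U (On_mor F u) \<cdot>\<^bsub>U\<^esub> Fsh F X \<cdot>\<^bsub>U\<^esub> On_mor F w = zer U (On_obj F Z) (sh_obj U (On_obj F Y))"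
    using F.U.Comp_reduce[OF n(1)[symmetric], of "On_mor F w"] arg_cong[OF uw, of "On_mor F"] by simp
  show ?thesis
    unfolding split_triangle_def
    using arg_cong[OF vu, of "On_mor F"] arg_cong[OF wv, of "On_mor F"] X' uw'
      arg_cong[OF Y, of "On_mor F"] arg_cong[OF Z, of "On_mor F"] by simp
qed

lemma (in tri_block) sh_functor_exact:
  assumes F: "sh_functor K s T U F"
  shows "exact_functor T U F"
proof -
  interpret F: sh_functor K s T U F by fact
  show ?thesis
    unfolding exact_functor_def
  proof (intro conjI allI impI F.F_functor F.Fsh_nat)
    fix X Y Z u v w assume d: "distinguished T X Y Z u v w"
    obtain a where "arr T a" "dm T a = Y" "cd T a = X" "u \<cdot>\<^bsub>T\<^esub> a \<cdot>\<^bsub>T\<^esub> u = u"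
      using regular[of u] distD[OF d] by auto
    then obtain b c where "split_triangle T X Y Z u v w a b c"
      using split_triangle_exists[OF d] by metis
    then show "distinguished U (On_obj F X) (On_obj F Y) (On_obj F Z)
        (On_mor F u) (On_mor F v) (Fsh F X \<cdot>\<^bsub>U\<^esub> On_mor F w)"
      using F.U.split_triangle_distinguished split_triangle_image[OF F] by blast
  qed
qed

section \<open>The functor between categories generated by blocks\<close>

definition hom_iso ::
  "'k ring \<Rightarrow> ('o1, 'm1, 'k, 'y) lincat_scheme \<Rightarrow> ('o2, 'm2, 'k, 'z) lincat_scheme
    \<Rightarrow> 'o1 \<Rightarrow> 'o1 \<Rightarrow> 'o2 \<Rightarrow> 'o2 \<Rightarrow> ('m1 \<Rightarrow> 'm2) \<Rightarrow> bool"
  where "hom_iso K C D A X B Y \<phi> \<longleftrightarrow>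
    A \<in> Obj C \<and> X \<in> Obj C \<and> B \<in> Obj D \<and> Y \<in> Obj D \<and>
    bij_betw \<phi> (homs C A X) (homs D B Y) \<and>
    (\<forall>f \<in> homs C A X. \<forall>g \<in> homs C A X. \<phi> (f \<uplus>\<^bsub>C\<^esub> g) = \<phi> f \<uplus>\<^bsub>D\<^esub> \<phi> g) \<and>
    (\<forall>f \<in> homs C A X. \<forall>c \<in> carrier K. \<phi> (c \<star>\<^bsub>C\<^esub> f) = c \<star>\<^bsub>D\<^esub> \<phi> f)"

section \<open>Linear bijections between Hom-spaces of two categories\<close>

lemma hom_isoD:
  assumes "hom_iso K C D A X B Y \<phi>" "linear_category K C" "linear_category K D"
  shows "A \<in> Obj C" "X \<in> Obj C" "B \<in> Obj D" "Y \<in> Obj D"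
    "\<lbrakk>arr C f; dm C f = A; cd C f = X\<rbrakk> \<Longrightarrow> arr D (\<phi> f)"
    "\<lbrakk>arr C f; dm C f = A; cd C f = X\<rbrakk> \<Longrightarrow> dm D (\<phi> f) = B"
    "\<lbrakk>arr C f; dm C f = A; cd C f = X\<rbrakk> \<Longrightarrow> cd D (\<phi> f) = Y"
    "\<lbrakk>arr C f; dm C f = A; cd C f = X; arr C g; dm C g = A; cd C g = X\<rbrakk> \<Longrightarrow> \<phi> (f \<uplus>\<^bsub>C\<^esub> g) = \<phi> f \<uplus>\<^bsub>D\<^esub> \<phi> g"
    "\<lbrakk>arr C f; dm C f = A; cd C f = X; c \<in> carrier K\<rbrakk> \<Longrightarrow> \<phi> (c \<star>\<^bsub>C\<^esub> f) = c \<star>\<^bsub>D\<^esub> \<phi> f"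
    "\<lbrakk>\<phi> f = \<phi> g; arr C f; dm C f = A; cd C f = X; arr C g; dm C g = A; cd C g = X\<rbrakk> \<Longrightarrow> f = g"
    "\<lbrakk>arr D h; dm D h = B; cd D h = Y\<rbrakk> \<Longrightarrow> \<exists>f. arr C f \<and> dm C f = A \<and> cd C f = X \<and> \<phi> f = h"
    "\<phi> (zer C A X) = zer D B Y"
proof -
  interpret C: linear_category K C by fact
  interpret D: linear_category K D by fact
  show o [simp]: "A \<in> Obj C" "X \<in> Obj C" "B \<in> Obj D" "Y \<in> Obj D"
    using assms unfolding hom_iso_def by auto
  have b: "bij_betw \<phi> {f. arr C f \<and> dm C f = A \<and> cd C f = X} {f. arr D f \<and> dm D f = B \<and> cd D f = Y}"
  proof -
    have "homs C A X = {f. arr C f \<and> dm C f = A \<and> cd C f = X}" by auto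
    moreover have "homs D B Y = {f. arr D f \<and> dm D f = B \<and> cd D f = Y}" by auto
    ultimately show ?thesis using assms(1) unfolding hom_iso_def by simp
  qed
  note m = bij_betwE[OF b]
  show *: "arr D (\<phi> f)" "dm D (\<phi> f) = B" "cd D (\<phi> f) = Y" if "arr C f" "dm C f = A" "cd C f = X" for f
    using m that by auto
  show **: "\<phi> (c \<star>\<^bsub>C\<^esub> f) = c \<star>\<^bsub>D\<^esub> \<phi> f" if "arr C f" "dm C f = A" "cd C f = X" "c \<in> carrier K" for c f
    using assms(1) that unfolding hom_iso_def by simp
  show "\<phi> (f \<uplus>\<^bsub>C\<^esub> g) = \<phi> f \<uplus>\<^bsub>D\<^esub> \<phi> g"
    if "arr C f" "dm C f = A" "cd C f = X" "arr C g" "dm C g = A" "cd C g = X"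
    using assms(1) that unfolding hom_iso_def by simp
  show "f = g" if "\<phi> f = \<phi> g" "arr C f" "dm C f = A" "cd C f = X" "arr C g" "dm C g = A" "cd C g = X"
    using bij_betw_imp_inj_on[OF b] that unfolding inj_on_def by blast
  show "\<exists>f. arr C f \<and> dm C f = A \<and> cd C f = X \<and> \<phi> f = h" if "arr D h" "dm D h = B" "cd D h = Y"
  proof -
    have "h \<in> \<phi> ` {f. arr C f \<and> dm C f = A \<and> cd C f = X}"
      using that by (simp add: bij_betw_imp_surj_on[OF b])
    then show ?thesis by auto
  qed
  have "\<phi> (\<zero>\<^bsub>K\<^esub> \<star>\<^bsub>C\<^esub> zer C A X) = \<zero>\<^bsub>K\<^esub> \<star>\<^bsub>D\<^esub> \<phi> (zer C A X)" by (rule **) auto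
  then show "\<phi> (zer C A X) = zer D B Y" using *[of "zer C A X"] by simp
qed

lemma hom_isoI:
  assumes "linear_category K C" "linear_category K D"
    and o: "A \<in> Obj C" "X \<in> Obj C" "B \<in> Obj D" "Y \<in> Obj D"
    and m: "\<And>f. \<lbrakk>arr C f; dm C f = A; cd C f = X\<rbrakk> \<Longrightarrow> arr D (\<phi> f) \<and> dm D (\<phi> f) = B \<and> cd D (\<phi> f) = Y"
    and a: "\<And>f g. \<lbrakk>arr C f; dm C f = A; cd C f = X; arr C g; dm C g = A; cd C g = X\<rbrakk>
      \<Longrightarrow> \<phi> (f \<uplus>\<^bsub>C\<^esub> g) = \<phi> f \<uplus>\<^bsub>D\<^esub> \<phi> g"
    and s: "\<And>f c. \<lbrakk>arr C f; dm C f = A; cd C f = X; c \<in> carrier K\<rbrakk> \<Longrightarrow> \<phi> (c \<star>\<^bsub>C\<^esub> f) = c \<star>\<^bsub>D\<^esub> \<phi> f"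
    and i: "\<And>f g. \<lbrakk>\<phi> f = \<phi> g; arr C f; dm C f = A; cd C f = X; arr C g; dm C g = A; cd C g = X\<rbrakk> \<Longrightarrow> f = g"
    and t: "\<And>h. \<lbrakk>arr D h; dm D h = B; cd D h = Y\<rbrakk> \<Longrightarrow> \<exists>f. arr C f \<and> dm C f = A \<and> cd C f = X \<and> \<phi> f = h"
  shows "hom_iso K C D A X B Y \<phi>"
proof -
  interpret C: linear_category K C by fact
  interpret D: linear_category K D by fact
  have "homs D B Y \<subseteq> \<phi> ` homs C A X"
  proof
    fix h assume "h \<in> homs D B Y"
    then obtain f where "arr C f \<and> dm C f = A \<and> cd C f = X \<and> \<phi> f = h" using t[of h] o by auto
    then show "h \<in> \<phi> ` homs C A X" using o by (intro image_eqI[of _ _ f]) auto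
  qed
  then have "bij_betw \<phi> (homs C A X) (homs D B Y)"
    unfolding bij_betw_def inj_on_def using o m i by auto
  then show ?thesis unfolding hom_iso_def using o a s by auto
qed

lemma hom_iso_Comp:
  assumes "hom_iso K C D A X B Y \<phi>" "hom_iso K D E B Y B' Z \<psi>"
    "linear_category K C" "linear_category K D" "linear_category K E"
  shows "hom_iso K C E A X B' Z (\<psi> \<circ> \<phi>)"
proof -
  note [simp] = hom_isoD(1-9)[OF assms(1,3,4)] hom_isoD(1-9)[OF assms(2,4,5)]
  show ?thesis
  proof (rule hom_isoI[OF assms(3,5)])
    fix f g assume "(\<psi> \<circ> \<phi>) f = (\<psi> \<circ> \<phi>) g" and fg: "arr C f" "dm C f = A" "cd C f = X" "arr C g" "dm C g = A" "cd C g = X"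
    then have "\<phi> f = \<phi> g" using hom_isoD(10)[OF assms(2,4,5), of "\<phi> f" "\<phi> g"] by simp
    then show "f = g" using hom_isoD(10)[OF assms(1,3,4)] fg by blast
  next
    fix h assume "arr E h" "dm E h = B'" "cd E h = Z"
    then obtain g where g: "arr D g" "dm D g = B" "cd D g = Y" "\<psi> g = h"
      using hom_isoD(11)[OF assms(2,4,5)] by blast
    then obtain f where "arr C f" "dm C f = A" "cd C f = X" "\<phi> f = g"
      using hom_isoD(11)[OF assms(1,3,4)] by blast
    then show "\<exists>f. arr C f \<and> dm C f = A \<and> cd C f = X \<and> (\<psi> \<circ> \<phi>) f = h" using g by auto
  qed auto
qed

lemma hom_iso_inverse:
  assumes "hom_iso K C D A X B Y \<phi>" "linear_category K C" "linear_category K D"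
  shows "hom_iso K D C B Y A X (inv_into (homs C A X) \<phi>)"
proof -
  interpret C: linear_category K C by fact
  interpret D: linear_category K D by fact
  note h = hom_isoD[OF assms]
  note [simp] = h(1-9)
  let ?\<psi> = "inv_into (homs C A X) \<phi>"
  have b: "bij_betw \<phi> (homs C A X) (homs D B Y)" using assms(1) unfolding hom_iso_def by blast
  have \<psi>: "arr C (?\<psi> f)" "dm C (?\<psi> f) = A" "cd C (?\<psi> f) = X" "\<phi> (?\<psi> f) = f"
    if "arr D f" "dm D f = B" "cd D f = Y" for f
    using bij_betwE[OF bij_betw_inv_into[OF b]] bij_betw_inv_into_right[OF b, of f] that by auto
  show ?thesis
  proof (rule hom_isoI[OF assms(3,2)])
    show "?\<psi> (f \<uplus>\<^bsub>D\<^esub> g) = ?\<psi> f \<uplus>\<^bsub>C\<^esub> ?\<psi> g"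
      if "arr D f" "dm D f = B" "cd D f = Y" "arr D g" "dm D g = B" "cd D g = Y" for f g
      by (rule h(10)) (use \<psi> that in auto)
    show "?\<psi> (c \<star>\<^bsub>D\<^esub> f) = c \<star>\<^bsub>C\<^esub> ?\<psi> f"
      if "arr D f" "dm D f = B" "cd D f = Y" "c \<in> carrier K" for f c
      by (rule h(10)) (use \<psi> that in auto)
    show "f = g" if "?\<psi> f = ?\<psi> g" "arr D f" "dm D f = B" "cd D f = Y" "arr D g" "dm D g = B" "cd D g = Y" for f g
      using \<psi>(4) that by metis
    show "\<exists>f. arr D f \<and> dm D f = B \<and> cd D f = Y \<and> ?\<psi> f = g" if g: "arr C g" "dm C g = A" "cd C g = X" for g
    proof (intro exI[of _ "\<phi> g"] conjI)
      show "?\<psi> (\<phi> g) = g" by (rule h(10)) (use \<psi> g in auto)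
    qed (use g in auto)
  qed (use \<psi> in auto)
qed

lemma (in linear_category) hom_iso_postcomp:
  assumes "is_iso C X Y e" "A \<in> Obj C" "X \<in> Obj C" "Y \<in> Obj C"
  shows "hom_iso K C C A X A Y (\<lambda>p. e \<cdot>\<^bsub>C\<^esub> p)"
proof (rule hom_isoI)
  note [simp] = is_iso_inverse[OF assms(1,3,4)]
  show "f = g" if "e \<cdot>\<^bsub>C\<^esub> f = e \<cdot>\<^bsub>C\<^esub> g" "arr C f" "dm C f = A" "cd C f = X" "arr C g" "dm C g = A" "cd C g = X" for f g
    by (rule is_iso_cancel(1)[OF assms(1,3,4) that(1)]) (use that in auto)
  show "\<exists>f. arr C f \<and> dm C f = A \<and> cd C f = X \<and> e \<cdot>\<^bsub>C\<^esub> f = h" if "arr C h" "dm C h = A" "cd C h = Y" for h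
    by (rule exI[of _ "inv_mor C e \<cdot>\<^bsub>C\<^esub> h"]) (use that in auto)
qed (use assms is_iso_inverse[OF assms(1,3,4)] linear_category_axioms in auto)

lemma (in linear_category) hom_iso_precomp:
  assumes "is_iso C B A e" "A \<in> Obj C" "B \<in> Obj C" "X \<in> Obj C"
  shows "hom_iso K C C A X B X (\<lambda>p. p \<cdot>\<^bsub>C\<^esub> e)"
proof (rule hom_isoI)
  note [simp] = is_iso_inverse[OF assms(1,3,2)]
  show "f = g" if "f \<cdot>\<^bsub>C\<^esub> e = g \<cdot>\<^bsub>C\<^esub> e" "arr C f" "dm C f = A" "cd C f = X" "arr C g" "dm C g = A" "cd C g = X" for f g
    by (rule is_iso_cancel(2)[OF assms(1,3,2) that(1)]) (use that in auto)
  show "\<exists>f. arr C f \<and> dm C f = A \<and> cd C f = X \<and> f \<cdot>\<^bsub>C\<^esub> e = h" if "arr C h" "dm C h = B" "cd C h = X" for h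
    by (rule exI[of _ "h \<cdot>\<^bsub>C\<^esub> inv_mor C e"]) (use that in auto)
qed (use assms is_iso_inverse[OF assms(1,3,2)] linear_category_axioms in auto)

lemma (in triangulated_category) hom_iso_shift:
  assumes "A \<in> Obj T" "X \<in> Obj T"
  shows "hom_iso K T T A X (sh_obj T A) (sh_obj T X) (sh_mor T)"
proof (rule hom_isoI)
  show "f = g" if "sh_mor T f = sh_mor T g" "arr T f" "dm T f = A" "cd T f = X" "arr T g" "dm T g = A" "cd T g = X" for f g
    by (rule Sh.faithful) (use that in auto)
  show "\<exists>f. arr T f \<and> dm T f = A \<and> cd T f = X \<and> sh_mor T f = h"
    if "arr T h" "dm T h = sh_obj T A" "cd T h = sh_obj T X" for h
    using Sh.full[OF that assms] by blast
qed (use assms linear_category_axioms in auto)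

context linear_category
begin

lemma scale_Id_inject:
  assumes "c \<star>\<^bsub>C\<^esub> Id C X = d \<star>\<^bsub>C\<^esub> Id C X" "X \<in> Obj C" "Id C X \<noteq> zer C X X" "c \<in> carrier K" "d \<in> carrier K"
  shows "c = d"
proof (rule ccontr)
  assume "c \<noteq> d"
  then have n: "c \<ominus>\<^bsub>K\<^esub> d \<noteq> \<zero>\<^bsub>K\<^esub>" using assms r_right_minus_eq by blast
  interpret M: module K "Hom C X X" using assms by (simp add: Hom_module)
  have Id: "Id C X \<in> homs C X X" using assms by simp
  have "(c \<ominus>\<^bsub>K\<^esub> d) \<star>\<^bsub>C\<^esub> Id C X = zer C X X"
    using assms M.smult_l_distr[OF assms(4) a_inv_closed[OF assms(5)] Id] M.smult_l_minus[OF assms(5) Id]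
      M.r_neg[OF M.smult_closed[OF assms(5) Id]]
    by (simp add: scale_mor_def a_minus_def)
  then have "Id C X = zer C X X" by (rule scale_eq_zer) (use assms n in auto)
  then show False using assms by blast
qed

lemma scale_add_left:
  assumes "arr C f" "c \<in> carrier K" "d \<in> carrier K"
  shows "(c \<oplus>\<^bsub>K\<^esub> d) \<star>\<^bsub>C\<^esub> f = c \<star>\<^bsub>C\<^esub> f \<uplus>\<^bsub>C\<^esub> d \<star>\<^bsub>C\<^esub> f"
proof -
  interpret M: module K "Hom C (dm C f) (cd C f)" using assms by (simp add: Hom_module)
  have "dm C (c \<star>\<^bsub>C\<^esub> f) = dm C f" "cd C (c \<star>\<^bsub>C\<^esub> f) = cd C f" using assms by simp_all
  then show ?thesis using M.smult_l_distr[of c d f] assms by (simp add: scale_mor_def plus_mor_def)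
qed

end

locale block_pair = T: tri_block K T I P \<kappa> + U: tri_block K U I P' \<kappa>'
  for K :: "'k ring" and T :: "('o1, 'm1, 'k, 'y) tricat_scheme" and I :: "'i set"
    and P :: "'i \<Rightarrow> int \<Rightarrow> 'o1" and \<kappa> :: "'i \<Rightarrow> int \<Rightarrow> 'm1"
    and U :: "('o2, 'm2, 'k, 'z) tricat_scheme" and P' :: "'i \<Rightarrow> int \<Rightarrow> 'o2" and \<kappa>' :: "'i \<Rightarrow> int \<Rightarrow> 'm2"
begin

text \<open>\<open>Y\<close> represents the same graded vector spaces \<open>Hom(P i j, _)\<close> as \<open>X\<close>.\<close>

definition match :: "'o1 \<Rightarrow> 'o2 \<Rightarrow> ('i \<Rightarrow> int \<Rightarrow> 'm1 \<Rightarrow> 'm2) \<Rightarrow> bool"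
  where "match X Y \<phi> \<longleftrightarrow> X \<in> Obj T \<and> Y \<in> Obj U \<and>
    (\<forall>i \<in> I. \<forall>j. hom_iso K T U (P i j) X (P' i j) Y (\<phi> i j))"

lemma match_Obj: "match X Y \<phi> \<Longrightarrow> X \<in> Obj T" "match X Y \<phi> \<Longrightarrow> Y \<in> Obj U"
  unfolding match_def by auto

lemma match_hom_iso:
  "\<lbrakk>match X Y \<phi>; i \<in> I\<rbrakk> \<Longrightarrow> hom_iso K T U (P i j) X (P' i j) Y (\<phi> i j)"
  unfolding match_def by blast

lemmas matchD = hom_isoD(5-12)[OF match_hom_iso T.linear_category_axioms U.linear_category_axioms]

text \<open>\<open>g\<close> induces on the graded spaces seen by the block the same maps as
  \<open>f\<close>, after identification by the two matches. This relation will be the graph of the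
  functor on morphisms.\<close>

definition lifts :: "'o1 \<Rightarrow> ('i \<Rightarrow> int \<Rightarrow> 'm1 \<Rightarrow> 'm2) \<Rightarrow> ('i \<Rightarrow> int \<Rightarrow> 'm1 \<Rightarrow> 'm2) \<Rightarrow> 'm1 \<Rightarrow> 'm2 \<Rightarrow> bool"
  where "lifts X \<phi> \<phi>' f g \<longleftrightarrow>
    (\<forall>i \<in> I. \<forall>j p. arr T p \<longrightarrow> dm T p = P i j \<longrightarrow> cd T p = X \<longrightarrow> g \<cdot>\<^bsub>U\<^esub> \<phi> i j p = \<phi>' i j (f \<cdot>\<^bsub>T\<^esub> p))"

lemma liftsD:
  "\<lbrakk>lifts X \<phi> \<phi>' f g; i \<in> I; arr T p; dm T p = P i j; cd T p = X\<rbrakk> \<Longrightarrow> g \<cdot>\<^bsub>U\<^esub> \<phi> i j p = \<phi>' i j (f \<cdot>\<^bsub>T\<^esub> p)"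
  unfolding lifts_def by blast

lemma lift_unique:
  assumes m: "match X Y \<phi>" and g: "arr U g" "dm U g = Y" "arr U g'" "dm U g' = Y" "cd U g = cd U g'"
    and l: "lifts X \<phi> \<phi>' f g" "lifts X \<phi> \<phi>' f g'"
  shows "g = g'"
proof (rule U.P_separates[OF g(1,3,2,4,5)])
  fix i j p assume p: "i \<in> I" "arr U p" "dm U p = P' i j" "cd U p = Y"
  then obtain q where q: "arr T q" "dm T q = P i j" "cd T q = X" "\<phi> i j q = p"
    using matchD(7)[OF m, of i p j] by auto
  then show "g \<cdot>\<^bsub>U\<^esub> p = g' \<cdot>\<^bsub>U\<^esub> p"
    using liftsD[OF l(1), of i q j] liftsD[OF l(2), of i q j] p by simp
qed

text \<open>The lift is assembled along an expression of the identity of \<open>Y\<close> through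
  block objects of \<open>U\<close>, on each of which it is dictated by the match.\<close>

lemma lift_exists:
  assumes m: "match X Y \<phi>" and m': "match X' Y' \<phi>'" and f: "arr T f" "dm T f = X" "cd T f = X'"
  obtains g where "arr U g" "dm U g = Y" "cd U g = Y'" "lifts X \<phi> \<phi>' f g"
proof -
  note [simp] = match_Obj[OF m] match_Obj[OF m'] matchD(1-5,8)[OF m] matchD(1-5,8)[OF m'] f
  \<comment> \<open>For \<open>y\<close> in the ideal, \<open>g\<close> stands for the desired lift
    composed with \<open>y\<close>. Describing it by all pairs with
    \<open>\<phi> i j p = y q\<close> avoids inverting \<phi>; the identity as \<open>y\<close>
    gives the lift.\<close>
  have "\<exists>g. arr U g \<and> dm U g = Y \<and> cd U g = Y' \<and>
      (\<forall>i \<in> I. \<forall>j p q. arr T p \<longrightarrow> dm T p = P i j \<longrightarrow> cd T p = X \<longrightarrow>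
        arr U q \<longrightarrow> dm U q = P' i j \<longrightarrow> cd U q = Y \<longrightarrow> \<phi> i j p = y \<cdot>\<^bsub>U\<^esub> q \<longrightarrow> g \<cdot>\<^bsub>U\<^esub> q = \<phi>' i j (f \<cdot>\<^bsub>T\<^esub> p))"
    if "U.fac Y Y y" for y
    using that
  proof induction
    case zer
    show ?case
    proof (intro exI[of _ "zer U Y Y'"] conjI ballI allI impI)
      fix i j p q assume p: "i \<in> I" "arr T p" "dm T p = P i j" "cd T p = X"
        "arr U q" "dm U q = P' i j" "cd U q = Y" "\<phi> i j p = zer U Y Y \<cdot>\<^bsub>U\<^esub> q"
      then have "p = zer T (P i j) X" by (intro matchD(6)[OF m p(1)]) auto
      then show "zer U Y Y' \<cdot>\<^bsub>U\<^esub> q = \<phi>' i j (f \<cdot>\<^bsub>T\<^esub> p)" using p by simp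
    qed auto
  next
    case (plus y1 y2)
    note [simp] = U.fac_arr[OF plus(1)] U.fac_arr[OF plus(2)]
    obtain g1 where g1: "arr U g1" "dm U g1 = Y" "cd U g1 = Y'"
      and 1: "\<forall>i \<in> I. \<forall>j p q. arr T p \<longrightarrow> dm T p = P i j \<longrightarrow> cd T p = X \<longrightarrow>
        arr U q \<longrightarrow> dm U q = P' i j \<longrightarrow> cd U q = Y \<longrightarrow> \<phi> i j p = y1 \<cdot>\<^bsub>U\<^esub> q \<longrightarrow> g1 \<cdot>\<^bsub>U\<^esub> q = \<phi>' i j (f \<cdot>\<^bsub>T\<^esub> p)"
      using plus(3) by blast
    obtain g2 where g2: "arr U g2" "dm U g2 = Y" "cd U g2 = Y'"
      and 2: "\<forall>i \<in> I. \<forall>j p q. arr T p \<longrightarrow> dm T p = P i j \<longrightarrow> cd T p = X \<longrightarrow>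
        arr U q \<longrightarrow> dm U q = P' i j \<longrightarrow> cd U q = Y \<longrightarrow> \<phi> i j p = y2 \<cdot>\<^bsub>U\<^esub> q \<longrightarrow> g2 \<cdot>\<^bsub>U\<^esub> q = \<phi>' i j (f \<cdot>\<^bsub>T\<^esub> p)"
      using plus(4) by blast
    show ?case
    proof (intro exI[of _ "g1 \<uplus>\<^bsub>U\<^esub> g2"] conjI ballI allI impI)
      fix i j p q assume p: "i \<in> I" "arr T p" "dm T p = P i j" "cd T p = X"
        "arr U q" "dm U q = P' i j" "cd U q = Y" "\<phi> i j p = (y1 \<uplus>\<^bsub>U\<^esub> y2) \<cdot>\<^bsub>U\<^esub> q"
      obtain p1 where p1: "arr T p1" "dm T p1 = P i j" "cd T p1 = X" "\<phi> i j p1 = y1 \<cdot>\<^bsub>U\<^esub> q"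
        using matchD(7)[OF m p(1), of "y1 \<cdot>\<^bsub>U\<^esub> q" j] p by auto
      obtain p2 where p2: "arr T p2" "dm T p2 = P i j" "cd T p2 = X" "\<phi> i j p2 = y2 \<cdot>\<^bsub>U\<^esub> q"
        using matchD(7)[OF m p(1), of "y2 \<cdot>\<^bsub>U\<^esub> q" j] p by auto
      have "p = p1 \<uplus>\<^bsub>T\<^esub> p2" by (rule matchD(6)[OF m p(1)]) (use p p1 p2 in auto)
      moreover have "g1 \<cdot>\<^bsub>U\<^esub> q = \<phi>' i j (f \<cdot>\<^bsub>T\<^esub> p1)" using 1 p p1 by blast
      moreover have "g2 \<cdot>\<^bsub>U\<^esub> q = \<phi>' i j (f \<cdot>\<^bsub>T\<^esub> p2)" using 2 p p2 by blast
      ultimately show "(g1 \<uplus>\<^bsub>U\<^esub> g2) \<cdot>\<^bsub>U\<^esub> q = \<phi>' i j (f \<cdot>\<^bsub>T\<^esub> p)" using p g1 g2 p1 p2 by simp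
    qed (use g1 g2 in auto)
  next
    case (comp k \<pi> l \<iota>)
    \<comment> \<open>If \<open>y\<close> goes through \<open>P' k l\<close> by \<pi> and then
      \<iota>, the match turns \<iota> into a morphism \<open>\<iota>0\<close> of \<open>T\<close>;
      the lift must send \<iota> to the image of \<open>f \<iota>0\<close>. Compatibility with
      \<open>q\<close> holds because \<open>\<pi> q\<close> is zero or a scalar.\<close>
    obtain \<iota>0 where \<iota>0: "arr T \<iota>0" "dm T \<iota>0 = P k l" "cd T \<iota>0 = X" "\<phi> k l \<iota>0 = \<iota>"
      using matchD(7)[OF m, of k \<iota> l] comp by auto
    note [simp] = comp \<iota>0
    show ?case
    proof (intro exI[of _ "\<phi>' k l (f \<cdot>\<^bsub>T\<^esub> \<iota>0) \<cdot>\<^bsub>U\<^esub> \<pi>"] conjI ballI allI impI)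
      fix i j p q assume p: "i \<in> I" "arr T p" "dm T p = P i j" "cd T p = X"
        "arr U q" "dm U q = P' i j" "cd U q = Y" "\<phi> i j p = (\<iota> \<cdot>\<^bsub>U\<^esub> \<pi>) \<cdot>\<^bsub>U\<^esub> q"
      have "arr U (\<pi> \<cdot>\<^bsub>U\<^esub> q)" "dm U (\<pi> \<cdot>\<^bsub>U\<^esub> q) = P' i j" "cd U (\<pi> \<cdot>\<^bsub>U\<^esub> q) = P' k l" using p by auto
      then show "(\<phi>' k l (f \<cdot>\<^bsub>T\<^esub> \<iota>0) \<cdot>\<^bsub>U\<^esub> \<pi>) \<cdot>\<^bsub>U\<^esub> q = \<phi>' i j (f \<cdot>\<^bsub>T\<^esub> p)"
      proof (rule U.P_hom_cases[OF p(1) comp(1)])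
        assume z: "\<pi> \<cdot>\<^bsub>U\<^esub> q = zer U (P' i j) (P' k l)"
        have "p = zer T (P i j) X" by (rule matchD(6)[OF m p(1)]) (use p z in auto)
        then show ?thesis using p z by simp
      next
        fix c assume c: "k = i" "l = j" "c \<in> carrier K" "\<pi> \<cdot>\<^bsub>U\<^esub> q = c \<star>\<^bsub>U\<^esub> Id U (P' i j)"
        have "p = c \<star>\<^bsub>T\<^esub> \<iota>0" by (rule matchD(6)[OF m p(1)]) (use p c \<iota>0(4)[unfolded c(1,2)] in auto)
        then show ?thesis using p c by simp
      qed
    qed auto
  qed
  from this[OF U.Id_fac] obtain g where g: "arr U g" "dm U g = Y" "cd U g = Y'"
    "\<forall>i \<in> I. \<forall>j p q. arr T p \<longrightarrow> dm T p = P i j \<longrightarrow> cd T p = X \<longrightarrow>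
        arr U q \<longrightarrow> dm U q = P' i j \<longrightarrow> cd U q = Y \<longrightarrow> \<phi> i j p = Id U Y \<cdot>\<^bsub>U\<^esub> q \<longrightarrow> g \<cdot>\<^bsub>U\<^esub> q = \<phi>' i j (f \<cdot>\<^bsub>T\<^esub> p)"
    by auto
  have "lifts X \<phi> \<phi>' f g"
    unfolding lifts_def
  proof (intro ballI allI impI)
    fix i j p assume "i \<in> I" "arr T p" "dm T p = P i j" "cd T p = X"
    then show "g \<cdot>\<^bsub>U\<^esub> \<phi> i j p = \<phi>' i j (f \<cdot>\<^bsub>T\<^esub> p)"
      using g(4)[rule_format, of i p j "\<phi> i j p"] by simp
  qed
  with g that show ?thesis by blast
qed

lemma lifts_Comp:
  assumes "match X Y \<phi>" "match X' Y' \<phi>'" "lifts X \<phi> \<phi>' f g" "lifts X' \<phi>' \<phi>'' f' g'"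
    "arr T f" "dm T f = X" "cd T f = X'" "arr U g" "dm U g = Y" "cd U g = Y'"
    "arr T f'" "dm T f' = X'" "arr U g'" "dm U g' = Y'"
  shows "lifts X \<phi> \<phi>'' (f' \<cdot>\<^bsub>T\<^esub> f) (g' \<cdot>\<^bsub>U\<^esub> g)"
  unfolding lifts_def
proof (intro ballI allI impI)
  fix i j p assume p: "i \<in> I" "arr T p" "dm T p = P i j" "cd T p = X"
  then show "(g' \<cdot>\<^bsub>U\<^esub> g) \<cdot>\<^bsub>U\<^esub> \<phi> i j p = \<phi>'' i j ((f' \<cdot>\<^bsub>T\<^esub> f) \<cdot>\<^bsub>T\<^esub> p)"
    using liftsD[OF assms(3) p] liftsD[OF assms(4), of i "f \<cdot>\<^bsub>T\<^esub> p" j] matchD(1-3)[OF assms(1)] assms(5-) by simp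
qed

lemma lifts_Id:
  assumes "match X Y \<phi>"
  shows "lifts X \<phi> \<phi> (Id T X) (Id U Y)"
  unfolding lifts_def using matchD(1-3)[OF assms] by simp

text \<open>Two objects matched with the same \<open>X\<close> are canonically isomorphic: lift the
  identity in both directions and use uniqueness.\<close>

lemma lift_iso:
  assumes m: "match X Y \<phi>" and m': "match X Y' \<phi>'"
    and g: "arr U g" "dm U g = Y" "cd U g = Y'" "lifts X \<phi> \<phi>' (Id T X) g"
  shows "is_iso U Y Y' g"
proof -
  note [simp] = match_Obj[OF m] match_Obj[OF m'] g(1-3)
  obtain h where h: "arr U h" "dm U h = Y'" "cd U h = Y" "lifts X \<phi>' \<phi> (Id T X) h"
    using lift_exists[OF m' m, of "Id T X"] by auto
  have hg: "lifts X \<phi> \<phi> (Id T X) (h \<cdot>\<^bsub>U\<^esub> g)" and gh: "lifts X \<phi>' \<phi>' (Id T X) (g \<cdot>\<^bsub>U\<^esub> h)"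
    using lifts_Comp[OF m m' g(4) h(4)] lifts_Comp[OF m' m h(4) g(4)] h(1-3) by simp_all
  have "h \<cdot>\<^bsub>U\<^esub> g = Id U Y"
    by (rule lift_unique[OF m _ _ _ _ _ hg lifts_Id[OF m]]) (use h in auto)
  moreover have "g \<cdot>\<^bsub>U\<^esub> h = Id U Y'"
    by (rule lift_unique[OF m' _ _ _ _ _ gh lifts_Id[OF m']]) (use h in auto)
  ultimately show ?thesis by (intro U.is_isoI[of _ _ _ h]) (use h in auto)
qed

text \<open>Both objects receive only scalars from the block object of the same index in degree 0
  and nothing from the others, so identifying scalars is a match.\<close>

lemma canonical_match:
  assumes i: "i \<in> I"
  obtains \<phi> where "match (P i 0) (P' i 0) \<phi>"
proof -
  \<comment> \<open>The scalar of an endomorphism, unique because the identity of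
    \<open>P i 0\<close> is nonzero.\<close>
  define co where "co p = (SOME c. c \<in> carrier K \<and> p = c \<star>\<^bsub>T\<^esub> Id T (P i 0))" for p
  define \<phi> where "\<phi> k l p = (if k = i \<and> l = 0 then co p \<star>\<^bsub>U\<^esub> Id U (P' i 0) else zer U (P' k l) (P' i 0))" for k l p
  note [simp] = i
  have co: "co p \<in> carrier K" "p = co p \<star>\<^bsub>T\<^esub> Id T (P i 0)" if "arr T p" "dm T p = P i 0" "cd T p = P i 0" for p
  proof -
    have "\<exists>c. c \<in> carrier K \<and> p = c \<star>\<^bsub>T\<^esub> Id T (P i 0)" using T.P_End[OF i that] by blast
    from someI_ex[OF this] show "co p \<in> carrier K" "p = co p \<star>\<^bsub>T\<^esub> Id T (P i 0)" unfolding co_def by auto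
  qed
  have co_eq: "co (c \<star>\<^bsub>T\<^esub> Id T (P i 0)) = c" if "c \<in> carrier K" for c
    by (rule T.scale_Id_inject[symmetric, where X = "P i 0"])
      (use co[of "c \<star>\<^bsub>T\<^esub> Id T (P i 0)"] that T.P_nonzero[OF i] in auto)
  have "hom_iso K T U (P k l) (P i 0) (P' k l) (P' i 0) (\<phi> k l)" if k: "k \<in> I" for k l
  proof (cases "k = i \<and> l = 0")
    case True
    then have [simp]: "k = i" "l = 0" by auto
    show ?thesis
    proof (rule hom_isoI[OF T.linear_category_axioms U.linear_category_axioms])
      fix f g assume f: "arr T f" "dm T f = P k l" "cd T f = P i 0" and g: "arr T g" "dm T g = P k l" "cd T g = P i 0"
      have "f \<uplus>\<^bsub>T\<^esub> g = (co f \<oplus>\<^bsub>K\<^esub> co g) \<star>\<^bsub>T\<^esub> Id T (P i 0)"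
        using co[of f] co[of g] f g by (simp add: T.scale_add_left)
      then have "co (f \<uplus>\<^bsub>T\<^esub> g) = co f \<oplus>\<^bsub>K\<^esub> co g" using co_eq co(1)[of f] co(1)[of g] f g by simp
      then show "\<phi> k l (f \<uplus>\<^bsub>T\<^esub> g) = \<phi> k l f \<uplus>\<^bsub>U\<^esub> \<phi> k l g"
        using co(1)[of f] co(1)[of g] f g by (simp add: \<phi>_def U.scale_add_left)
      show "f = g" if "\<phi> k l f = \<phi> k l g"
      proof -
        have "co f = co g"
          by (rule U.scale_Id_inject[where X = "P' i 0"])
            (use that co(1)[of f] co(1)[of g] f g U.P_nonzero[OF i] in \<open>auto simp: \<phi>_def\<close>)
        then show ?thesis using co(2)[of f] co(2)[of g] f g by simp
      qed
    next
      fix f c assume f: "arr T f" "dm T f = P k l" "cd T f = P i 0" and c: "c \<in> carrier K"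
      have "c \<star>\<^bsub>T\<^esub> f = (c \<otimes>\<^bsub>K\<^esub> co f) \<star>\<^bsub>T\<^esub> Id T (P i 0)"
        using co[of f] f c T.scale_scale[of "Id T (P i 0)" c "co f"] by simp
      then have "co (c \<star>\<^bsub>T\<^esub> f) = c \<otimes>\<^bsub>K\<^esub> co f" using co_eq co(1)[of f] f c by simp
      then show "\<phi> k l (c \<star>\<^bsub>T\<^esub> f) = c \<star>\<^bsub>U\<^esub> \<phi> k l f" using co(1)[of f] f c by (simp add: \<phi>_def)
    next
      fix h assume h: "arr U h" "dm U h = P' k l" "cd U h = P' i 0"
      then obtain c where c: "c \<in> carrier K" "h = c \<star>\<^bsub>U\<^esub> Id U (P' i 0)" using U.P_End[OF i, of h 0] by auto
      then show "\<exists>f. arr T f \<and> dm T f = P k l \<and> cd T f = P i 0 \<and> \<phi> k l f = h"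
        by (intro exI[of _ "c \<star>\<^bsub>T\<^esub> Id T (P i 0)"]) (simp add: \<phi>_def co_eq)
    qed (use co in \<open>auto simp: \<phi>_def\<close>)
  next
    case False
    have 1: "f = zer T (P k l) (P i 0)" if "arr T f" "dm T f = P k l" "cd T f = P i 0" for f
      by (rule T.P_orth) (use False that k in auto)
    have 2: "f = zer U (P' k l) (P' i 0)" if "arr U f" "dm U f = P' k l" "cd U f = P' i 0" for f
      by (rule U.P_orth) (use False that k in auto)
    show ?thesis
    proof (rule hom_isoI[OF T.linear_category_axioms U.linear_category_axioms])
      show "f = g" if "arr T f" "dm T f = P k l" "cd T f = P i 0" "arr T g" "dm T g = P k l" "cd T g = P i 0" for f g
        using 1[of f] 1[of g] that by simp
      show "\<exists>f. arr T f \<and> dm T f = P k l \<and> cd T f = P i 0 \<and> \<phi> k l f = h" if "arr U h" "dm U h = P' k l" "cd U h = P' i 0" for h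
        by (rule exI[of _ "zer T (P k l) (P i 0)"]) (use 2[of h] False that k in \<open>auto simp: \<phi>_def\<close>)
    qed (use False k in \<open>auto simp: \<phi>_def\<close>)
  qed
  then have "match (P i 0) (P' i 0) \<phi>" unfolding match_def by simp
  then show ?thesis by (rule that)
qed

text \<open>The match of the shifted objects: \<open>sh_match X \<phi>\<close> takes \<open>q[1] \<kappa>\<^sup>-\<^sup>1\<close> to \<open>(\<phi> q)[1] \<kappa>'\<^sup>-\<^sup>1\<close>.\<close>

definition sh_match :: "'o1 \<Rightarrow> ('i \<Rightarrow> int \<Rightarrow> 'm1 \<Rightarrow> 'm2) \<Rightarrow> 'i \<Rightarrow> int \<Rightarrow> 'm1 \<Rightarrow> 'm2"
  where "sh_match X \<phi> i j =
    (\<lambda>r. sh_mor U r \<cdot>\<^bsub>U\<^esub> inv_mor U (\<kappa>' i (j - 1))) \<circ> \<phi> i (j - 1) \<circ>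
    inv_into (homs T (P i (j - 1)) X) (\<lambda>q. sh_mor T q \<cdot>\<^bsub>T\<^esub> inv_mor T (\<kappa> i (j - 1)))"

end

lemma (in tri_block) hom_iso_shift_kappa:
  assumes "i \<in> I" "X \<in> Obj T"
  shows "hom_iso K T T (P i j) X (P i (j + 1)) (sh_obj T X) (\<lambda>q. sh_mor T q \<cdot>\<^bsub>T\<^esub> inv_mor T (\<kappa> i j))"
proof -
  have "hom_iso K T T (P i j) X (P i (j + 1)) (sh_obj T X) ((\<lambda>p. p \<cdot>\<^bsub>T\<^esub> inv_mor T (\<kappa> i j)) \<circ> sh_mor T)"
    by (rule hom_iso_Comp[OF hom_iso_shift hom_iso_precomp[OF is_iso_inv[OF kappa_iso]]])
      (use assms linear_category_axioms in auto)
  then show ?thesis by (simp add: comp_def)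
qed

section \<open>Compatibility of matches with the shift in both directions\<close>

context block_pair
begin

lemma match_shift:
  assumes m: "match X Y \<phi>"
  shows "match (sh_obj T X) (sh_obj U Y) (sh_match X \<phi>)"
  unfolding match_def
proof (intro conjI ballI allI)
  fix i j assume i: "i \<in> I"
  have m': "hom_iso K T U (P i (j - 1)) X (P' i (j - 1)) Y (\<phi> i (j - 1))"
    using m i unfolding match_def by blast
  note l = T.linear_category_axioms U.linear_category_axioms
  show "hom_iso K T U (P i j) (sh_obj T X) (P' i j) (sh_obj U Y) (sh_match X \<phi> i j)"
    unfolding sh_match_def
    using hom_iso_Comp[OF hom_iso_inverse[OF T.hom_iso_shift_kappa[OF i match_Obj(1)[OF m], of "j - 1"] l(1,1)]
      hom_iso_Comp[OF m' U.hom_iso_shift_kappa[OF i match_Obj(2)[OF m], of "j - 1"] l(1,2,2)] l(1,1,2)]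
    by (simp add: comp_assoc)
qed (use match_Obj[OF m] in auto)

lemma sh_match_eq:
  assumes m: "match X Y \<phi>" and q: "i \<in> I" "arr T q" "dm T q = P i j" "cd T q = X"
  shows "sh_match X \<phi> i (j + 1) (sh_mor T q \<cdot>\<^bsub>T\<^esub> inv_mor T (\<kappa> i j)) = sh_mor U (\<phi> i j q) \<cdot>\<^bsub>U\<^esub> inv_mor U (\<kappa>' i j)"
proof -
  have "bij_betw (\<lambda>q. sh_mor T q \<cdot>\<^bsub>T\<^esub> inv_mor T (\<kappa> i j)) (homs T (P i j) X) (homs T (P i (j + 1)) (sh_obj T X))"
    using T.hom_iso_shift_kappa[OF q(1) match_Obj(1)[OF m]] unfolding hom_iso_def by blast
  from bij_betw_inv_into_left[OF this, of q]
  have "inv_into (homs T (P i j) X) (\<lambda>q. sh_mor T q \<cdot>\<^bsub>T\<^esub> inv_mor T (\<kappa> i j)) (sh_mor T q \<cdot>\<^bsub>T\<^esub> inv_mor T (\<kappa> i j)) = q"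
    using q match_Obj(1)[OF m] by simp
  then show ?thesis unfolding sh_match_def by simp
qed

lemma unshift_cases:
  assumes "i \<in> I" "arr T p" "dm T p = P i j" "cd T p = sh_obj T X" "X \<in> Obj T"
  obtains q l where "j = l + 1" "arr T q" "dm T q = P i l" "cd T q = X" "p = sh_mor T q \<cdot>\<^bsub>T\<^esub> inv_mor T (\<kappa> i l)"
  using hom_isoD(11)[OF T.hom_iso_shift_kappa[OF assms(1,5), of "j - 1"] T.linear_category_axioms T.linear_category_axioms,
      of p] assms(2-4) that[of "j - 1"] by auto

lemma lifts_shift:
  assumes m: "match X Y \<phi>" and m': "match X' Y' \<phi>'" and l: "lifts X \<phi> \<phi>' f g"
    and f: "arr T f" "dm T f = X" "cd T f = X'" and g: "arr U g" "dm U g = Y" "cd U g = Y'"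
  shows "lifts (sh_obj T X) (sh_match X \<phi>) (sh_match X' \<phi>') (sh_mor T f) (sh_mor U g)"
  unfolding lifts_def
proof (intro ballI allI impI)
  fix i j p assume p: "i \<in> I" "arr T p" "dm T p = P i j" "cd T p = sh_obj T X"
  obtain q l where q: "j = l + 1" "arr T q" "dm T q = P i l" "cd T q = X" "p = sh_mor T q \<cdot>\<^bsub>T\<^esub> inv_mor T (\<kappa> i l)"
    by (rule unshift_cases[OF p match_Obj(1)[OF m]])
  have 1: "g \<cdot>\<^bsub>U\<^esub> \<phi> i l q = \<phi>' i l (f \<cdot>\<^bsub>T\<^esub> q)" by (rule liftsD[OF l p(1) q(2-4)])
  have 2: "sh_match X \<phi> i j p = sh_mor U (\<phi> i l q) \<cdot>\<^bsub>U\<^esub> inv_mor U (\<kappa>' i l)"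
    using sh_match_eq[OF m p(1) q(2-4)] q by simp
  have 3: "sh_match X' \<phi>' i j (sh_mor T f \<cdot>\<^bsub>T\<^esub> p) = sh_mor U (\<phi>' i l (f \<cdot>\<^bsub>T\<^esub> q)) \<cdot>\<^bsub>U\<^esub> inv_mor U (\<kappa>' i l)"
    using sh_match_eq[OF m' p(1), of "f \<cdot>\<^bsub>T\<^esub> q" l] q f p by simp
  have 4: "sh_mor U g \<cdot>\<^bsub>U\<^esub> sh_mor U (\<phi> i l q) = sh_mor U (\<phi>' i l (f \<cdot>\<^bsub>T\<^esub> q))"
    unfolding 1[symmetric] using g matchD(1-3)[OF m p(1) q(2-4)] by simp
  show "sh_mor U g \<cdot>\<^bsub>U\<^esub> sh_match X \<phi> i j p = sh_match X' \<phi>' i j (sh_mor T f \<cdot>\<^bsub>T\<^esub> p)"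
    unfolding 2 3 using U.Comp_reduce[OF 4, of "inv_mor U (\<kappa>' i l)"] g p(1) matchD(1-3)[OF m p(1) q(2-4)] by simp
qed

text \<open>The shift of \<open>U\<close> is essentially surjective, so \<open>Y\<close> is
  isomorphic to some \<open>Y0[1]\<close>, and fully faithful, so a match with \<open>Y0\<close> is
  obtained by undoing one degree on each side.\<close>

lemma match_unshift:
  assumes m: "match (sh_obj T X) Y \<phi>" and X: "X \<in> Obj T"
  obtains Y0 \<phi>0 where "match X Y0 \<phi>0"
proof -
  note l = T.linear_category_axioms U.linear_category_axioms
  have Y: "Y \<in> Obj U" by (rule match_Obj(2)[OF m])
  obtain Y0 where Y0: "Y0 \<in> Obj U" and "isomorphic U (sh_obj U Y0) Y"
    using U.Sh.essentially_surjective[OF Y] by blast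
  then obtain e where "is_iso U (sh_obj U Y0) Y e" unfolding isomorphic_def by blast
  then have e: "is_iso U Y (sh_obj U Y0) (inv_mor U e)" using Y Y0 by (intro U.is_iso_inv) auto
  have "\<exists>\<phi>0. hom_iso K T U (P i j) X (P' i j) Y0 \<phi>0" if i: "i \<in> I" for i j
  proof -
    have m': "hom_iso K T U (P i (j + 1)) (sh_obj T X) (P' i (j + 1)) Y (\<phi> i (j + 1))"
      using m i unfolding match_def by blast
    have e': "hom_iso K U U (P' i (j + 1)) Y (P' i (j + 1)) (sh_obj U Y0) (\<lambda>p. inv_mor U e \<cdot>\<^bsub>U\<^esub> p)"
      by (rule U.hom_iso_postcomp[OF e]) (use i Y Y0 in auto)
    show ?thesis
      using hom_iso_Comp[OF hom_iso_Comp[OF T.hom_iso_shift_kappa[OF i X] m' l(1,1,2)]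
        hom_iso_Comp[OF e' hom_iso_inverse[OF U.hom_iso_shift_kappa[OF i Y0] l(2,2)] l(2,2,2)] l(1,2,2)] by blast
  qed
  then have "\<forall>i. \<exists>f. \<forall>j. i \<in> I \<longrightarrow> hom_iso K T U (P i j) X (P' i j) Y0 (f j)" by metis
  from choice[OF this] show ?thesis using that[of Y0] X Y0 unfolding match_def by blast
qed

end

lemma (in triangulated_category) split_triangleD:
  assumes "split_triangle T X Y Z u v w s t r"
  shows "X \<in> Obj T" "Y \<in> Obj T" "Z \<in> Obj T" "arr T u" "dm T u = X" "cd T u = Y"
    "arr T v" "dm T v = Y" "cd T v = Z" "arr T w" "dm T w = Z" "cd T w = sh_obj T X"
    "arr T s" "dm T s = Y" "cd T s = X" "arr T t" "dm T t = Z" "cd T t = Y"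
    "arr T r" "dm T r = sh_obj T X" "cd T r = Z"
    "v \<cdot>\<^bsub>T\<^esub> u = zer T X Z" "w \<cdot>\<^bsub>T\<^esub> v = zer T Y (sh_obj T X)" "sh_mor T u \<cdot>\<^bsub>T\<^esub> w = zer T Z (sh_obj T Y)"
    "u \<cdot>\<^bsub>T\<^esub> s \<uplus>\<^bsub>T\<^esub> t \<cdot>\<^bsub>T\<^esub> v = Id T Y" "v \<cdot>\<^bsub>T\<^esub> t \<uplus>\<^bsub>T\<^esub> r \<cdot>\<^bsub>T\<^esub> w = Id T Z"
    "w \<cdot>\<^bsub>T\<^esub> r \<uplus>\<^bsub>T\<^esub> sh_mor T s \<cdot>\<^bsub>T\<^esub> sh_mor T u = Id T (sh_obj T X)"
    "v \<cdot>\<^bsub>T\<^esub> t \<cdot>\<^bsub>T\<^esub> v = v" "w \<cdot>\<^bsub>T\<^esub> r \<cdot>\<^bsub>T\<^esub> w = w" "t \<cdot>\<^bsub>T\<^esub> r \<cdot>\<^bsub>T\<^esub> w = u \<cdot>\<^bsub>T\<^esub> s \<cdot>\<^bsub>T\<^esub> t"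
proof -
  show [simp]: "X \<in> Obj T" "Y \<in> Obj T" "Z \<in> Obj T" "arr T u" "dm T u = X" "cd T u = Y"
    "arr T v" "dm T v = Y" "cd T v = Z" "arr T w" "dm T w = Z" "cd T w = sh_obj T X"
    "arr T s" "dm T s = Y" "cd T s = X" "arr T t" "dm T t = Z" "cd T t = Y"
    "arr T r" "dm T r = sh_obj T X" "cd T r = Z"
    and vu: "v \<cdot>\<^bsub>T\<^esub> u = zer T X Z" and wv: "w \<cdot>\<^bsub>T\<^esub> v = zer T Y (sh_obj T X)"
    and uw: "sh_mor T u \<cdot>\<^bsub>T\<^esub> w = zer T Z (sh_obj T Y)"
    and Y: "u \<cdot>\<^bsub>T\<^esub> s \<uplus>\<^bsub>T\<^esub> t \<cdot>\<^bsub>T\<^esub> v = Id T Y" and Z: "v \<cdot>\<^bsub>T\<^esub> t \<uplus>\<^bsub>T\<^esub> r \<cdot>\<^bsub>T\<^esub> w = Id T Z"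
    and X: "w \<cdot>\<^bsub>T\<^esub> r \<uplus>\<^bsub>T\<^esub> sh_mor T s \<cdot>\<^bsub>T\<^esub> sh_mor T u = Id T (sh_obj T X)"
    using assms by (auto simp: split_triangle_def)
  have "v \<cdot>\<^bsub>T\<^esub> (u \<cdot>\<^bsub>T\<^esub> s \<uplus>\<^bsub>T\<^esub> t \<cdot>\<^bsub>T\<^esub> v) = v" unfolding Y by simp
  then show "v \<cdot>\<^bsub>T\<^esub> t \<cdot>\<^bsub>T\<^esub> v = v" using Comp_reduce[OF vu, of s] by simp
  have "w \<cdot>\<^bsub>T\<^esub> (v \<cdot>\<^bsub>T\<^esub> t \<uplus>\<^bsub>T\<^esub> r \<cdot>\<^bsub>T\<^esub> w) = w" unfolding Z by simp
  then show "w \<cdot>\<^bsub>T\<^esub> r \<cdot>\<^bsub>T\<^esub> w = w" using Comp_reduce[OF wv, of t] by simp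
  \<comment> \<open>Both \<open>u s t\<close> and \<open>t r w\<close> complement
    \<open>t v t\<close> in \<open>t\<close>, as seen from the equations at \<open>Y\<close> and at
    \<open>Z\<close>; so they are equal. They need not vanish.\<close>
  have "(u \<cdot>\<^bsub>T\<^esub> s \<uplus>\<^bsub>T\<^esub> t \<cdot>\<^bsub>T\<^esub> v) \<cdot>\<^bsub>T\<^esub> t = t \<cdot>\<^bsub>T\<^esub> (v \<cdot>\<^bsub>T\<^esub> t \<uplus>\<^bsub>T\<^esub> r \<cdot>\<^bsub>T\<^esub> w)" unfolding Y Z by simp
  then have "t \<cdot>\<^bsub>T\<^esub> v \<cdot>\<^bsub>T\<^esub> t \<uplus>\<^bsub>T\<^esub> u \<cdot>\<^bsub>T\<^esub> s \<cdot>\<^bsub>T\<^esub> t = t \<cdot>\<^bsub>T\<^esub> v \<cdot>\<^bsub>T\<^esub> t \<uplus>\<^bsub>T\<^esub> t \<cdot>\<^bsub>T\<^esub> r \<cdot>\<^bsub>T\<^esub> w"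
    using plus_comm[of "u \<cdot>\<^bsub>T\<^esub> s \<cdot>\<^bsub>T\<^esub> t" "t \<cdot>\<^bsub>T\<^esub> v \<cdot>\<^bsub>T\<^esub> t"] by simp
  then show "t \<cdot>\<^bsub>T\<^esub> r \<cdot>\<^bsub>T\<^esub> w = u \<cdot>\<^bsub>T\<^esub> s \<cdot>\<^bsub>T\<^esub> t"
    using plus_left_cancel[of "t \<cdot>\<^bsub>T\<^esub> v \<cdot>\<^bsub>T\<^esub> t" "u \<cdot>\<^bsub>T\<^esub> s \<cdot>\<^bsub>T\<^esub> t" "t \<cdot>\<^bsub>T\<^esub> r \<cdot>\<^bsub>T\<^esub> w"] by simp
qed

context block_pair
begin

text \<open>For \<open>Z\<close> the cone of \<open>u\<close>, a contracting homotopy identifies \<open>Hom(P i j, Z)\<close> with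
  \<open>coker(u) \<oplus> ker(u[1])\<close>; the same happens for the cone of the morphism matched with \<open>u\<close>.\<close>

lemma match_cone:
  assumes d: "distinguished T X Y Z u v w" and mX: "match X X' \<phi>" and mY: "match Y Y' \<psi>"
  obtains Z' \<theta> where "match Z Z' \<theta>"
proof -
  note [simp] = T.distD[OF d]
  note [simp] = match_Obj[OF mX] match_Obj[OF mY] matchD(1-5,8)[OF mX] matchD(1-5,8)[OF mY]
  obtain s where s: "arr T s" "dm T s = Y" "cd T s = X" "u \<cdot>\<^bsub>T\<^esub> s \<cdot>\<^bsub>T\<^esub> u = u"
    using T.regular[of u] by auto
  obtain t r where sp: "split_triangle T X Y Z u v w s t r"
    by (rule T.split_triangle_exists[OF d s])
  note S = T.split_triangleD[OF sp]
  note [simp] = S(13-24) T.Comp_reduce[OF S(22)] T.Comp_reduce[OF S(23)] T.Comp_reduce[OF S(24)]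
  obtain u' where u' [simp]: "arr U u'" "dm U u' = X'" "cd U u' = Y'" and lu: "lifts X \<phi> \<psi> u u'"
    by (rule lift_exists[OF mX mY, of u]) auto
  obtain s' where s' [simp]: "arr U s'" "dm U s' = Y'" "cd U s' = X'" and ls: "lifts Y \<psi> \<phi> s s'"
    by (rule lift_exists[OF mY mX, of s]) auto
  \<comment> \<open>The relation \<open>u s u = u\<close> passes to the lifts by uniqueness, so the
    cone of \<open>u'\<close> splits as well, with the lifted \<open>s'\<close>.\<close>
  have "lifts X \<phi> \<psi> (u \<cdot>\<^bsub>T\<^esub> s \<cdot>\<^bsub>T\<^esub> u) (u' \<cdot>\<^bsub>U\<^esub> s' \<cdot>\<^bsub>U\<^esub> u')"
    by (rule lifts_Comp[OF mX mX lifts_Comp[OF mX mY lu ls] lu, simplified])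
  then have "lifts X \<phi> \<psi> u (u' \<cdot>\<^bsub>U\<^esub> s' \<cdot>\<^bsub>U\<^esub> u')" using s by simp
  then have usu': "u' \<cdot>\<^bsub>U\<^esub> s' \<cdot>\<^bsub>U\<^esub> u' = u'" by (rule lift_unique[OF mX _ _ _ _ _ _ lu, rotated -1]) auto
  obtain Z' v' w' where d': "distinguished U X' Y' Z' u' v' w'"
    using U.TR1_cone[of X' Y' u'] by auto
  note [simp] = U.distD[OF d']
  obtain t' r' where sp': "split_triangle U X' Y' Z' u' v' w' s' t' r'"
    by (rule U.split_triangle_exists[OF d' s' usu'])
  note S' = U.split_triangleD[OF sp']
  note [simp] = S'(13-24) U.Comp_reduce[OF S'(22)] U.Comp_reduce[OF S'(23)] U.Comp_reduce[OF S'(24)]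
  let ?\<chi> = "sh_match X \<phi>"
  note mS = match_shift[OF mX]
  note [simp] = match_Obj[OF mS] matchD(1-5,8)[OF mS]
  have lu1: "lifts (sh_obj T X) ?\<chi> (sh_match Y \<psi>) (sh_mor T u) (sh_mor U u')"
    and ls1: "lifts (sh_obj T Y) (sh_match Y \<psi>) ?\<chi> (sh_mor T s) (sh_mor U s')"
    by (rule lifts_shift[OF mX mY lu]; simp) (rule lifts_shift[OF mY mX ls]; simp)
  have lsu1: "lifts (sh_obj T X) ?\<chi> ?\<chi> (sh_mor T s \<cdot>\<^bsub>T\<^esub> sh_mor T u) (sh_mor U s' \<cdot>\<^bsub>U\<^esub> sh_mor U u')"
    by (rule lifts_Comp[OF mS match_shift[OF mY] lu1 ls1]) auto
  \<comment> \<open>No match for \<open>Z\<close> exists yet, so nothing can be said about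
    \<open>w\<close> or \<open>r\<close> alone; but \<open>w r\<close> is the complement of the
    shift of \<open>s u\<close>, whose lift is known. The same is done with \<open>t v\<close>, the
    complement of \<open>u s\<close>.\<close>
  have \<chi>: "?\<chi> i j (w \<cdot>\<^bsub>T\<^esub> r \<cdot>\<^bsub>T\<^esub> p) = w' \<cdot>\<^bsub>U\<^esub> r' \<cdot>\<^bsub>U\<^esub> ?\<chi> i j p"
    if i [simp]: "i \<in> I" and p [simp]: "arr T p" "dm T p = P i j" "cd T p = sh_obj T X" for i j p
  proof -
    have "?\<chi> i j (sh_mor T s \<cdot>\<^bsub>T\<^esub> sh_mor T u \<cdot>\<^bsub>T\<^esub> p) \<uplus>\<^bsub>U\<^esub> ?\<chi> i j (w \<cdot>\<^bsub>T\<^esub> r \<cdot>\<^bsub>T\<^esub> p)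
        = ?\<chi> i j ((w \<cdot>\<^bsub>T\<^esub> r \<uplus>\<^bsub>T\<^esub> sh_mor T s \<cdot>\<^bsub>T\<^esub> sh_mor T u) \<cdot>\<^bsub>T\<^esub> p)"
      using T.plus_comm[of "w \<cdot>\<^bsub>T\<^esub> r \<cdot>\<^bsub>T\<^esub> p" "sh_mor T s \<cdot>\<^bsub>T\<^esub> sh_mor T u \<cdot>\<^bsub>T\<^esub> p"] by simp
    also have "\<dots> = (w' \<cdot>\<^bsub>U\<^esub> r' \<uplus>\<^bsub>U\<^esub> sh_mor U s' \<cdot>\<^bsub>U\<^esub> sh_mor U u') \<cdot>\<^bsub>U\<^esub> ?\<chi> i j p"
      unfolding S(27) S'(27) by simp
    also have "\<dots> = ?\<chi> i j (sh_mor T s \<cdot>\<^bsub>T\<^esub> sh_mor T u \<cdot>\<^bsub>T\<^esub> p) \<uplus>\<^bsub>U\<^esub> w' \<cdot>\<^bsub>U\<^esub> r' \<cdot>\<^bsub>U\<^esub> ?\<chi> i j p"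
      using liftsD[OF lsu1 i p] U.plus_comm[of "w' \<cdot>\<^bsub>U\<^esub> r' \<cdot>\<^bsub>U\<^esub> ?\<chi> i j p" "sh_mor U s' \<cdot>\<^bsub>U\<^esub> sh_mor U u' \<cdot>\<^bsub>U\<^esub> ?\<chi> i j p"]
      by simp
    finally show ?thesis by (rule U.plus_left_cancel) auto
  qed
  have \<psi>: "\<psi> i j (t \<cdot>\<^bsub>T\<^esub> v \<cdot>\<^bsub>T\<^esub> p) = t' \<cdot>\<^bsub>U\<^esub> v' \<cdot>\<^bsub>U\<^esub> \<psi> i j p"
    if i [simp]: "i \<in> I" and p [simp]: "arr T p" "dm T p = P i j" "cd T p = Y" for i j p
  proof -
    have "\<psi> i j (u \<cdot>\<^bsub>T\<^esub> s \<cdot>\<^bsub>T\<^esub> p) \<uplus>\<^bsub>U\<^esub> \<psi> i j (t \<cdot>\<^bsub>T\<^esub> v \<cdot>\<^bsub>T\<^esub> p) = \<psi> i j ((u \<cdot>\<^bsub>T\<^esub> s \<uplus>\<^bsub>T\<^esub> t \<cdot>\<^bsub>T\<^esub> v) \<cdot>\<^bsub>T\<^esub> p)" by simp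
    also have "\<dots> = (u' \<cdot>\<^bsub>U\<^esub> s' \<uplus>\<^bsub>U\<^esub> t' \<cdot>\<^bsub>U\<^esub> v') \<cdot>\<^bsub>U\<^esub> \<psi> i j p" unfolding S(25) S'(25) by simp
    also have "\<dots> = \<psi> i j (u \<cdot>\<^bsub>T\<^esub> s \<cdot>\<^bsub>T\<^esub> p) \<uplus>\<^bsub>U\<^esub> t' \<cdot>\<^bsub>U\<^esub> v' \<cdot>\<^bsub>U\<^esub> \<psi> i j p"
      using liftsD[OF lifts_Comp[OF mY mX ls lu] i p] by simp
    finally show ?thesis by (rule U.plus_left_cancel) auto
  qed
  \<comment> \<open>Mirrors the decomposition \<open>v t + r w\<close> of the identity of
    \<open>Z\<close>: the two components of \<open>p\<close> are transported by the known matches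
    and recombined in \<open>Z'\<close>.\<close>
  define \<theta> where "\<theta> i j p = v' \<cdot>\<^bsub>U\<^esub> \<psi> i j (t \<cdot>\<^bsub>T\<^esub> p) \<uplus>\<^bsub>U\<^esub> r' \<cdot>\<^bsub>U\<^esub> ?\<chi> i j (w \<cdot>\<^bsub>T\<^esub> p)" for i j p
  have w'\<theta>: "w' \<cdot>\<^bsub>U\<^esub> \<theta> i j p = ?\<chi> i j (w \<cdot>\<^bsub>T\<^esub> p)" and t'\<theta>: "t' \<cdot>\<^bsub>U\<^esub> \<theta> i j p = \<psi> i j (t \<cdot>\<^bsub>T\<^esub> v \<cdot>\<^bsub>T\<^esub> t \<cdot>\<^bsub>T\<^esub> p) \<uplus>\<^bsub>U\<^esub> t' \<cdot>\<^bsub>U\<^esub> r' \<cdot>\<^bsub>U\<^esub> ?\<chi> i j (w \<cdot>\<^bsub>T\<^esub> p)"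
    if i [simp]: "i \<in> I" and p [simp]: "arr T p" "dm T p = P i j" "cd T p = Z" for i j p
  proof -
    have "w \<cdot>\<^bsub>T\<^esub> r \<cdot>\<^bsub>T\<^esub> w \<cdot>\<^bsub>T\<^esub> p = w \<cdot>\<^bsub>T\<^esub> p" using T.Comp_reduce[of "w" "r \<cdot>\<^bsub>T\<^esub> w" w p] S(29) by simp
    then show "w' \<cdot>\<^bsub>U\<^esub> \<theta> i j p = ?\<chi> i j (w \<cdot>\<^bsub>T\<^esub> p)" unfolding \<theta>_def using \<chi>[of i "w \<cdot>\<^bsub>T\<^esub> p" j] by simp
    show "t' \<cdot>\<^bsub>U\<^esub> \<theta> i j p = \<psi> i j (t \<cdot>\<^bsub>T\<^esub> v \<cdot>\<^bsub>T\<^esub> t \<cdot>\<^bsub>T\<^esub> p) \<uplus>\<^bsub>U\<^esub> t' \<cdot>\<^bsub>U\<^esub> r' \<cdot>\<^bsub>U\<^esub> ?\<chi> i j (w \<cdot>\<^bsub>T\<^esub> p)"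
      unfolding \<theta>_def using \<psi>[of i "t \<cdot>\<^bsub>T\<^esub> p" j] by simp
  qed
  have decomp: "v \<cdot>\<^bsub>T\<^esub> t \<cdot>\<^bsub>T\<^esub> p \<uplus>\<^bsub>T\<^esub> r \<cdot>\<^bsub>T\<^esub> w \<cdot>\<^bsub>T\<^esub> p = p" and vtv: "v \<cdot>\<^bsub>T\<^esub> t \<cdot>\<^bsub>T\<^esub> v \<cdot>\<^bsub>T\<^esub> t \<cdot>\<^bsub>T\<^esub> p = v \<cdot>\<^bsub>T\<^esub> t \<cdot>\<^bsub>T\<^esub> p"
    if [simp]: "arr T p" "cd T p = Z" for p
  proof -
    have "(v \<cdot>\<^bsub>T\<^esub> t \<uplus>\<^bsub>T\<^esub> r \<cdot>\<^bsub>T\<^esub> w) \<cdot>\<^bsub>T\<^esub> p = p" unfolding S(26) by simp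
    then show "v \<cdot>\<^bsub>T\<^esub> t \<cdot>\<^bsub>T\<^esub> p \<uplus>\<^bsub>T\<^esub> r \<cdot>\<^bsub>T\<^esub> w \<cdot>\<^bsub>T\<^esub> p = p" by simp
    show "v \<cdot>\<^bsub>T\<^esub> t \<cdot>\<^bsub>T\<^esub> v \<cdot>\<^bsub>T\<^esub> t \<cdot>\<^bsub>T\<^esub> p = v \<cdot>\<^bsub>T\<^esub> t \<cdot>\<^bsub>T\<^esub> p" using T.Comp_reduce[of v "t \<cdot>\<^bsub>T\<^esub> v" v "t \<cdot>\<^bsub>T\<^esub> p"] S(28) by simp
  qed
  have "hom_iso K T U (P i j) Z (P' i j) Z' (\<theta> i j)" if i [simp]: "i \<in> I" for i j
  proof (rule hom_isoI[OF T.linear_category_axioms U.linear_category_axioms])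
    fix f g assume f [simp]: "arr T f" "dm T f = P i j" "cd T f = Z" and g [simp]: "arr T g" "dm T g = P i j" "cd T g = Z"
    show "\<theta> i j (f \<uplus>\<^bsub>T\<^esub> g) = \<theta> i j f \<uplus>\<^bsub>U\<^esub> \<theta> i j g"
      unfolding \<theta>_def by (simp add: U.plus_lcomm)
    assume eq: "\<theta> i j f = \<theta> i j g"
    \<comment> \<open>Applying \<open>w'\<close> recovers \<open>w f\<close>, and then applying
      \<open>t'\<close> recovers \<open>t v t f\<close>; together they determine
      \<open>f\<close>.\<close>
    then have "?\<chi> i j (w \<cdot>\<^bsub>T\<^esub> f) = ?\<chi> i j (w \<cdot>\<^bsub>T\<^esub> g)" using w'\<theta>[OF i f] w'\<theta>[OF i g] by simp
    then have wfg: "w \<cdot>\<^bsub>T\<^esub> f = w \<cdot>\<^bsub>T\<^esub> g" by (rule matchD(6)[OF mS i]) auto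
    have "t' \<cdot>\<^bsub>U\<^esub> r' \<cdot>\<^bsub>U\<^esub> ?\<chi> i j (w \<cdot>\<^bsub>T\<^esub> g) \<uplus>\<^bsub>U\<^esub> \<psi> i j (t \<cdot>\<^bsub>T\<^esub> v \<cdot>\<^bsub>T\<^esub> t \<cdot>\<^bsub>T\<^esub> f) = t' \<cdot>\<^bsub>U\<^esub> r' \<cdot>\<^bsub>U\<^esub> ?\<chi> i j (w \<cdot>\<^bsub>T\<^esub> g) \<uplus>\<^bsub>U\<^esub> \<psi> i j (t \<cdot>\<^bsub>T\<^esub> v \<cdot>\<^bsub>T\<^esub> t \<cdot>\<^bsub>T\<^esub> g)"
      using t'\<theta>[OF i f] t'\<theta>[OF i g] eq wfg
        U.plus_comm[of "t' \<cdot>\<^bsub>U\<^esub> r' \<cdot>\<^bsub>U\<^esub> ?\<chi> i j (w \<cdot>\<^bsub>T\<^esub> g)" "\<psi> i j (t \<cdot>\<^bsub>T\<^esub> v \<cdot>\<^bsub>T\<^esub> t \<cdot>\<^bsub>T\<^esub> f)"]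
        U.plus_comm[of "t' \<cdot>\<^bsub>U\<^esub> r' \<cdot>\<^bsub>U\<^esub> ?\<chi> i j (w \<cdot>\<^bsub>T\<^esub> g)" "\<psi> i j (t \<cdot>\<^bsub>T\<^esub> v \<cdot>\<^bsub>T\<^esub> t \<cdot>\<^bsub>T\<^esub> g)"] by simp
    then have "\<psi> i j (t \<cdot>\<^bsub>T\<^esub> v \<cdot>\<^bsub>T\<^esub> t \<cdot>\<^bsub>T\<^esub> f) = \<psi> i j (t \<cdot>\<^bsub>T\<^esub> v \<cdot>\<^bsub>T\<^esub> t \<cdot>\<^bsub>T\<^esub> g)" by (rule U.plus_left_cancel) auto
    then have "t \<cdot>\<^bsub>T\<^esub> v \<cdot>\<^bsub>T\<^esub> t \<cdot>\<^bsub>T\<^esub> f = t \<cdot>\<^bsub>T\<^esub> v \<cdot>\<^bsub>T\<^esub> t \<cdot>\<^bsub>T\<^esub> g" by (rule matchD(6)[OF mY i]) auto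
    then have "v \<cdot>\<^bsub>T\<^esub> t \<cdot>\<^bsub>T\<^esub> f = v \<cdot>\<^bsub>T\<^esub> t \<cdot>\<^bsub>T\<^esub> g" using vtv[OF f(1,3)] vtv[OF g(1,3)] by metis
    then show "f = g" using decomp[OF f(1,3)] decomp[OF g(1,3)] wfg by metis
  next
    fix f c assume f [simp]: "arr T f" "dm T f = P i j" "cd T f = Z" and c [simp]: "c \<in> carrier K"
    show "\<theta> i j (c \<star>\<^bsub>T\<^esub> f) = c \<star>\<^bsub>U\<^esub> \<theta> i j f" unfolding \<theta>_def by (simp add: U.scale_plus)
  next
    fix q assume q [simp]: "arr U q" "dm U q = P' i j" "cd U q = Z'"
    \<comment> \<open>A preimage of \<open>q\<close> is \<open>v a + r b\<close>, where
      \<open>a\<close> and \<open>b\<close> correspond to \<open>t' q\<close> and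
      \<open>w' q\<close>.\<close>
    obtain a where a [simp]: "arr T a" "dm T a = P i j" "cd T a = Y" and \<psi>a: "\<psi> i j a = t' \<cdot>\<^bsub>U\<^esub> q"
      using matchD(7)[OF mY i, of "t' \<cdot>\<^bsub>U\<^esub> q" j] by auto
    obtain b where b [simp]: "arr T b" "dm T b = P i j" "cd T b = sh_obj T X" and \<chi>b: "?\<chi> i j b = w' \<cdot>\<^bsub>U\<^esub> q"
      using matchD(7)[OF mS i, of "w' \<cdot>\<^bsub>U\<^esub> q" j] by auto
    have "?\<chi> i j (w \<cdot>\<^bsub>T\<^esub> r \<cdot>\<^bsub>T\<^esub> b) = w' \<cdot>\<^bsub>U\<^esub> r' \<cdot>\<^bsub>U\<^esub> w' \<cdot>\<^bsub>U\<^esub> q" using \<chi>[OF i b] \<chi>b by simp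
    also have "\<dots> = w' \<cdot>\<^bsub>U\<^esub> q" using U.Comp_reduce[of w' "r' \<cdot>\<^bsub>U\<^esub> w'" w' q] S'(29) by simp
    finally have wrb: "w \<cdot>\<^bsub>T\<^esub> r \<cdot>\<^bsub>T\<^esub> b = b" using \<chi>b by (intro matchD(6)[OF mS i]) auto
    \<comment> \<open>The cross term \<open>t r\<close> may be nonzero, but on
      \<open>b = w r b\<close> it factors through \<open>u\<close>, so it is carried into the image
      of \<open>u'\<close> and killed by \<open>v'\<close>.\<close>
    have "t \<cdot>\<^bsub>T\<^esub> r \<cdot>\<^bsub>T\<^esub> b = t \<cdot>\<^bsub>T\<^esub> r \<cdot>\<^bsub>T\<^esub> w \<cdot>\<^bsub>T\<^esub> r \<cdot>\<^bsub>T\<^esub> b" using wrb by simp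
    also have "\<dots> = u \<cdot>\<^bsub>T\<^esub> s \<cdot>\<^bsub>T\<^esub> t \<cdot>\<^bsub>T\<^esub> r \<cdot>\<^bsub>T\<^esub> b"
      using T.Comp_reduce[of t "r \<cdot>\<^bsub>T\<^esub> w" "u \<cdot>\<^bsub>T\<^esub> s \<cdot>\<^bsub>T\<^esub> t" "r \<cdot>\<^bsub>T\<^esub> b"] S(30) by simp
    finally have trb: "t \<cdot>\<^bsub>T\<^esub> r \<cdot>\<^bsub>T\<^esub> b = u \<cdot>\<^bsub>T\<^esub> s \<cdot>\<^bsub>T\<^esub> t \<cdot>\<^bsub>T\<^esub> r \<cdot>\<^bsub>T\<^esub> b" .
    have 1: "v' \<cdot>\<^bsub>U\<^esub> \<psi> i j (t \<cdot>\<^bsub>T\<^esub> r \<cdot>\<^bsub>T\<^esub> b) = zer U (P' i j) Z'"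
      using liftsD[OF lu, of i "s \<cdot>\<^bsub>T\<^esub> t \<cdot>\<^bsub>T\<^esub> r \<cdot>\<^bsub>T\<^esub> b" j, symmetric] by (subst trb) simp
    have 2: "v' \<cdot>\<^bsub>U\<^esub> \<psi> i j (t \<cdot>\<^bsub>T\<^esub> v \<cdot>\<^bsub>T\<^esub> a) = v' \<cdot>\<^bsub>U\<^esub> t' \<cdot>\<^bsub>U\<^esub> q"
      using \<psi>[OF i a] U.Comp_reduce[of v' "t' \<cdot>\<^bsub>U\<^esub> v'" v' "\<psi> i j a"] S'(28) \<psi>a by simp
    have "\<theta> i j (v \<cdot>\<^bsub>T\<^esub> a \<uplus>\<^bsub>T\<^esub> r \<cdot>\<^bsub>T\<^esub> b) = v' \<cdot>\<^bsub>U\<^esub> t' \<cdot>\<^bsub>U\<^esub> q \<uplus>\<^bsub>U\<^esub> r' \<cdot>\<^bsub>U\<^esub> w' \<cdot>\<^bsub>U\<^esub> q"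
      unfolding \<theta>_def using 1 2 wrb \<chi>b by simp
    also have "\<dots> = (v' \<cdot>\<^bsub>U\<^esub> t' \<uplus>\<^bsub>U\<^esub> r' \<cdot>\<^bsub>U\<^esub> w') \<cdot>\<^bsub>U\<^esub> q" by simp
    also have "\<dots> = q" unfolding S'(26) by simp
    finally show "\<exists>f. arr T f \<and> dm T f = P i j \<and> cd T f = Z \<and> \<theta> i j f = q"
      by (intro exI[of _ "v \<cdot>\<^bsub>T\<^esub> a \<uplus>\<^bsub>T\<^esub> r \<cdot>\<^bsub>T\<^esub> b"]) simp
  qed (auto simp: \<theta>_def)
  then show ?thesis using that[of Z' \<theta>] unfolding match_def by simp
qed

lemma triangulated_subcategory_match:
  "triangulated_subcategory T {X \<in> Obj T. \<exists>Y \<phi>. match X Y \<phi>}" (is "triangulated_subcategory T ?M")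
  unfolding triangulated_subcategory_def
proof (intro conjI ballI allI impI)
  fix Z assume Z: "zero_object T Z"
  obtain N where N: "zero_object U N" using U.zero_object_exists by blast
  have [simp]: "Z \<in> Obj T" "N \<in> Obj U" using Z N T.zero_object_iff U.zero_object_iff by auto
  have "hom_iso K T U (P i j) Z (P' i j) N (\<lambda>_. zer U (P' i j) N)" if i [simp]: "i \<in> I" for i j
  proof (rule hom_isoI[OF T.linear_category_axioms U.linear_category_axioms])
    show "f = g" if "arr T f" "dm T f = P i j" "cd T f = Z" "arr T g" "dm T g = P i j" "cd T g = Z" for f g
      using T.zero_object_mor(1)[OF Z] that by metis
    show "\<exists>f. arr T f \<and> dm T f = P i j \<and> cd T f = Z \<and> zer U (P' i j) N = h"
      if "arr U h" "dm U h = P' i j" "cd U h = N" for h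
      by (rule exI[of _ "zer T (P i j) Z"]) (use U.zero_object_mor(1)[OF N that(1,3)] that in simp)
  qed auto
  then have "match Z N (\<lambda>i j _. zer U (P' i j) N)" unfolding match_def by simp
  then show "Z \<in> ?M" by auto
next
  fix X Y assume X: "X \<in> ?M" and Y: "Y \<in> Obj T" "isomorphic T X Y"
  then obtain X' \<phi> where m: "match X X' \<phi>" by blast
  obtain e where e: "is_iso T Y X e" using T.isomorphic_sym[OF Y(2)] X Y(1) unfolding isomorphic_def by blast
  have "match Y X' (\<lambda>i j. \<phi> i j \<circ> (\<lambda>p. e \<cdot>\<^bsub>T\<^esub> p))"
    unfolding match_def
  proof (intro conjI ballI allI)
    fix i j assume i: "i \<in> I"
    have *: "hom_iso K T U (P i j) X (P' i j) X' (\<phi> i j)" using m i unfolding match_def by blast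
    show "hom_iso K T U (P i j) Y (P' i j) X' (\<phi> i j \<circ> (\<lambda>p. e \<cdot>\<^bsub>T\<^esub> p))"
      by (rule hom_iso_Comp[OF T.hom_iso_postcomp[OF e] *])
        (use i Y match_Obj[OF m] T.linear_category_axioms U.linear_category_axioms in auto)
  qed (use Y match_Obj[OF m] in auto)
  then show "Y \<in> ?M" using Y by blast
next
  fix X assume X: "X \<in> Obj T"
  show "sh_obj T X \<in> ?M \<longleftrightarrow> X \<in> ?M"
    using match_shift match_unshift X T.Sh.F_Obj by blast
next
  fix X Y Z u v w
  assume d: "distinguished T X Y Z u v w" and XY: "X \<in> ?M" "Y \<in> ?M"
  then obtain X' \<phi> Y' \<psi> where "match X X' \<phi>" "match Y Y' \<psi>" by blast
  from match_cone[OF d this] show "Z \<in> ?M" using T.distD(3)[OF d] by blast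
qed auto

lemma match_exists:
  assumes "X \<in> Obj T"
  shows "\<exists>Y \<phi>. match X Y \<phi>"
proof -
  have "X \<in> {X \<in> Obj T. \<exists>Y \<phi>. match X Y \<phi>}"
    
  proof (rule T.gen_induct[OF triangulated_subcategory_match _ assms])
    fix i assume i: "i \<in> I"
    obtain \<phi> where "match (P i 0) (P' i 0) \<phi>" by (rule canonical_match[OF i])
    then show "P i 0 \<in> {X \<in> Obj T. \<exists>Y \<phi>. match X Y \<phi>}" using i by auto
  qed
  then show ?thesis by blast
qed

text \<open>Choose a matched object for every object and take the unique lift of every morphism.
  Only the isomorphism class at the block objects is controlled, through the canonical
  match.\<close>

lemma functor_exists:
  obtains F where "sh_functor K (\<lambda>c. c) T U F" "\<And>i. i \<in> I \<Longrightarrow> isomorphic U (P' i 0) (On_obj F (P i 0))"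
proof -
  have "\<forall>X. \<exists>Y. \<exists>\<phi>. X \<in> Obj T \<longrightarrow> match X Y \<phi>" using match_exists by blast
  from choice[OF this] obtain Fo where "\<forall>X. \<exists>\<phi>. X \<in> Obj T \<longrightarrow> match X (Fo X) \<phi>" by blast
  from choice[OF this] obtain \<phi> where m: "\<And>X. X \<in> Obj T \<Longrightarrow> match X (Fo X) (\<phi> X)" by blast
  have [simp]: "X \<in> Obj T \<Longrightarrow> Fo X \<in> Obj U" for X using match_Obj(2)[OF m] .
  have "\<exists>g. arr T f \<longrightarrow> arr U g \<and> dm U g = Fo (dm T f) \<and> cd U g = Fo (cd T f) \<and>
      lifts (dm T f) (\<phi> (dm T f)) (\<phi> (cd T f)) f g" for f
    by (cases "arr T f") (use lift_exists[OF m m, of "dm T f" "cd T f" f] in auto)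
  then obtain Fm where Fm [simp]: "\<And>f. arr T f \<Longrightarrow> arr U (Fm f)" "\<And>f. arr T f \<Longrightarrow> dm U (Fm f) = Fo (dm T f)"
    "\<And>f. arr T f \<Longrightarrow> cd U (Fm f) = Fo (cd T f)"
    and Fml: "\<And>f. arr T f \<Longrightarrow> lifts (dm T f) (\<phi> (dm T f)) (\<phi> (cd T f)) f (Fm f)"
    by metis
  \<comment> \<open>The shifted object has two matches, the one chosen for it and the shift of the
    one chosen for \<open>X\<close>; the shift isomorphism lifts the identity between them.\<close>
  have "\<exists>g. X \<in> Obj T \<longrightarrow> arr U g \<and> dm U g = Fo (sh_obj T X) \<and> cd U g = sh_obj U (Fo X) \<and>
      lifts (sh_obj T X) (\<phi> (sh_obj T X)) (sh_match X (\<phi> X)) (Id T (sh_obj T X)) g" for X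
    by (cases "X \<in> Obj T") (use lift_exists[OF m match_shift[OF m], of "sh_obj T X" X "Id T (sh_obj T X)"] in auto)
  then obtain Fs where Fs [simp]: "\<And>X. X \<in> Obj T \<Longrightarrow> arr U (Fs X)" "\<And>X. X \<in> Obj T \<Longrightarrow> dm U (Fs X) = Fo (sh_obj T X)"
    "\<And>X. X \<in> Obj T \<Longrightarrow> cd U (Fs X) = sh_obj U (Fo X)"
    and Fsl: "\<And>X. X \<in> Obj T \<Longrightarrow> lifts (sh_obj T X) (\<phi> (sh_obj T X)) (sh_match X (\<phi> X)) (Id T (sh_obj T X)) (Fs X)"
    by metis
  \<comment> \<open>Uniqueness of lifts: each functor law reduces to checking that its right-hand
    side lifts the right morphism.\<close>
  have FmI: "Fm f = g"
    if "arr T f" "arr U g" "dm U g = Fo (dm T f)" "cd U g = Fo (cd T f)"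
      "lifts (dm T f) (\<phi> (dm T f)) (\<phi> (cd T f)) f g" for f g
    by (rule lift_unique[OF m _ _ _ _ _ Fml]) (use that in auto)
  define F where "F = \<lparr>On_obj = Fo, On_mor = Fm, Fsh = Fs\<rparr>"
  have "sh_functor K (\<lambda>c. c) T U F"
  proof unfold_locales
    show "semilinear_functor K (\<lambda>c. c) T U F"
    proof (rule semilinear_functorI[OF T.linear_category_axioms U.linear_category_axioms])
      show "On_mor F (Id T X) = Id U (On_obj F X)" if X: "X \<in> Obj T" for X
        using FmI[of "Id T X"] lifts_Id[OF m[OF X]] X by (simp add: F_def)
      show "On_mor F (g \<cdot>\<^bsub>T\<^esub> f) = On_mor F g \<cdot>\<^bsub>U\<^esub> On_mor F f" if f: "arr T f" "arr T g" "dm T g = cd T f" for f g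
        using FmI[of "g \<cdot>\<^bsub>T\<^esub> f" "Fm g \<cdot>\<^bsub>U\<^esub> Fm f"]
          lifts_Comp[OF m m Fml[of f] Fml[of g, unfolded f]] f by (simp add: F_def)
      show "On_mor F (f \<uplus>\<^bsub>T\<^esub> g) = On_mor F f \<uplus>\<^bsub>U\<^esub> On_mor F g"
        if f: "arr T f" "arr T g" "dm T g = dm T f" "cd T g = cd T f" for f g
      proof -
        have "lifts (dm T f) (\<phi> (dm T f)) (\<phi> (cd T f)) (f \<uplus>\<^bsub>T\<^esub> g) (Fm f \<uplus>\<^bsub>U\<^esub> Fm g)"
          unfolding lifts_def
        proof (intro ballI allI impI)
          fix i j p assume p: "i \<in> I" "arr T p" "dm T p = P i j" "cd T p = dm T f"
          then show "(Fm f \<uplus>\<^bsub>U\<^esub> Fm g) \<cdot>\<^bsub>U\<^esub> \<phi> (dm T f) i j p = \<phi> (cd T f) i j ((f \<uplus>\<^bsub>T\<^esub> g) \<cdot>\<^bsub>T\<^esub> p)"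
            using liftsD[OF Fml[OF f(1)] p] liftsD[OF Fml[OF f(2), unfolded f(3,4)] p] f
              matchD(1-4)[OF m] by simp
        qed
        then show ?thesis using FmI[of "f \<uplus>\<^bsub>T\<^esub> g" "Fm f \<uplus>\<^bsub>U\<^esub> Fm g"] f by (simp add: F_def)
      qed
      show "On_mor F (c \<star>\<^bsub>T\<^esub> f) = c \<star>\<^bsub>U\<^esub> On_mor F f" if f: "arr T f" "c \<in> carrier K" for f c
      proof -
        have "lifts (dm T f) (\<phi> (dm T f)) (\<phi> (cd T f)) (c \<star>\<^bsub>T\<^esub> f) (c \<star>\<^bsub>U\<^esub> Fm f)"
          unfolding lifts_def
        proof (intro ballI allI impI)
          fix i j p assume p: "i \<in> I" "arr T p" "dm T p = P i j" "cd T p = dm T f"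
          then show "(c \<star>\<^bsub>U\<^esub> Fm f) \<cdot>\<^bsub>U\<^esub> \<phi> (dm T f) i j p = \<phi> (cd T f) i j ((c \<star>\<^bsub>T\<^esub> f) \<cdot>\<^bsub>T\<^esub> p)"
            using liftsD[OF Fml[OF f(1)] p] f matchD(1-3,5)[OF m] by simp
        qed
        then show ?thesis using FmI[of "c \<star>\<^bsub>T\<^esub> f" "c \<star>\<^bsub>U\<^esub> Fm f"] f by (simp add: F_def)
      qed
    qed (auto simp: F_def)
    show "nat_iso T U (comp_functor F (Shift T)) (comp_functor (Shift U) F) (Fsh F)"
      unfolding T.nat_iso_iff
    proof (intro conjI ballI allI impI)
      show "is_iso U (On_obj (comp_functor F (Shift T)) X) (On_obj (comp_functor (Shift U) F) X) (Fsh F X)"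
        if X: "X \<in> Obj T" for X
        using lift_iso[OF m match_shift[OF m], OF _ X _ _ _ Fsl[OF X]] X by (simp add: F_def comp_functor_def)
    next
      fix f assume f: "arr T f"
      let ?X = "dm T f" and ?Y = "cd T f"
      have 1: "lifts (sh_obj T ?X) (\<phi> (sh_obj T ?X)) (sh_match ?Y (\<phi> ?Y)) (sh_mor T f) (Fs ?Y \<cdot>\<^bsub>U\<^esub> Fm (sh_mor T f))"
      proof -
        have "lifts (sh_obj T ?X) (\<phi> (sh_obj T ?X)) (\<phi> (sh_obj T ?Y)) (sh_mor T f) (Fm (sh_mor T f))"
          using Fml[of "sh_mor T f"] f by simp
        from lifts_Comp[OF m m this Fsl[of ?Y]] show ?thesis using f by simp
      qed
      have 2: "lifts (sh_obj T ?X) (\<phi> (sh_obj T ?X)) (sh_match ?Y (\<phi> ?Y)) (sh_mor T f) (sh_mor U (Fm f) \<cdot>\<^bsub>U\<^esub> Fs ?X)"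
        using lifts_Comp[OF m match_shift[OF m] Fsl[of ?X] lifts_shift[OF m m Fml[of f]]] f by simp
      have "Fs ?Y \<cdot>\<^bsub>U\<^esub> Fm (sh_mor T f) = sh_mor U (Fm f) \<cdot>\<^bsub>U\<^esub> Fs ?X"
        by (rule lift_unique[OF m _ _ _ _ _ 1 2]) (use f in auto)
      then show "Fsh F ?Y \<cdot>\<^bsub>U\<^esub> On_mor (comp_functor F (Shift T)) f = On_mor (comp_functor (Shift U) F) f \<cdot>\<^bsub>U\<^esub> Fsh F ?X"
        by (simp add: F_def comp_functor_def)
    qed
  qed auto
  moreover have "isomorphic U (P' i 0) (On_obj F (P i 0))" if i: "i \<in> I" for i
  proof -
    obtain \<chi> where \<chi>: "match (P i 0) (P' i 0) \<chi>" by (rule canonical_match[OF i])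
    have mi: "match (P i 0) (Fo (P i 0)) (\<phi> (P i 0))" using m i by simp
    obtain g where "arr U g" "dm U g = P' i 0" "cd U g = Fo (P i 0)" "lifts (P i 0) \<chi> (\<phi> (P i 0)) (Id T (P i 0)) g"
      by (rule lift_exists[OF \<chi> mi, of "Id T (P i 0)"]) (use i in auto)
    from lift_iso[OF \<chi> mi this] show ?thesis unfolding isomorphic_def F_def by auto
  qed
  ultimately show ?thesis by (rule that)
qed

end

theorem block_equivalence_exists:
  assumes "tri_block K T I P \<kappa>" "tri_block K U I P' \<kappa>'"
  obtains F where "exact_functor T U F" "linear_functor K T U F" "equivalence T U F"
    "\<And>i. i \<in> I \<Longrightarrow> isomorphic U (P' i 0) (On_obj F (P i 0))"
proof -
  interpret TU: block_pair K T I P \<kappa> U P' \<kappa>' by (intro block_pair.intro assms)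
  interpret UT: block_pair K U I P' \<kappa>' T P \<kappa> by (intro block_pair.intro assms)
  obtain F where F: "sh_functor K (\<lambda>c. c) T U F" "\<And>i. i \<in> I \<Longrightarrow> isomorphic U (P' i 0) (On_obj F (P i 0))"
    by (rule TU.functor_exists) blast
  obtain H where H: "sh_functor K (\<lambda>c. c) U T H" "\<And>i. i \<in> I \<Longrightarrow> isomorphic T (P i 0) (On_obj H (P' i 0))"
    by (rule UT.functor_exists) blast
  interpret F: sh_functor K "\<lambda>c. c" T U F by (rule F(1))
  interpret H: sh_functor K "\<lambda>c. c" U T H by (rule H(1))
  have "equivalence T U F"
  proof (rule equivalence_criterion[OF assms F(1) H(1)])
    fix i assume i: "i \<in> I"
    show "isomorphic T (P i 0) (On_obj H (On_obj F (P i 0)))"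
      by (rule TU.T.isomorphic_trans[OF H(2)[OF i] H.F_isomorphic[OF F(2)[OF i]]]) (use i in auto)
    show "isomorphic U (On_obj F (On_obj H (P' i 0))) (P' i 0)"
      by (rule TU.U.isomorphic_sym[OF TU.U.isomorphic_trans[OF F(2)[OF i] F.F_isomorphic[OF H(2)[OF i]]]]) (use i in auto)
  qed
  then show ?thesis using that[OF TU.T.sh_functor_exact[OF F(1)] F.semilinear] F(2) by blast
qed

section \<open>Exceptional blocks\<close>

context triangulated_category
begin

section \<open>Integer shifts of an object\<close>

lemma unshift_obj: 
  assumes "X \<in> Obj T"
  shows "unshift_obj T X \<in> Obj T" "isomorphic T (sh_obj T (unshift_obj T X)) X"
proof -
  have "\<exists>Y. Y \<in> Obj T \<and> isomorphic T (sh_obj T Y) X"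
    using Sh.essentially_surjective[OF assms] by metis
  from someI_ex[OF this] show "unshift_obj T X \<in> Obj T" "isomorphic T (sh_obj T (unshift_obj T X)) X"
    unfolding unshift_obj_def by auto
qed

lemma shift_by_0 [simp]: "shift_by T 0 X = X"
  by (simp add: shift_by_def)

lemma shift_by_Obj [simp]:
  assumes "X \<in> Obj T"
  shows "shift_by T j X \<in> Obj T"
proof -
  have "(sh_obj T ^^ n) X \<in> Obj T" "(unshift_obj T ^^ n) X \<in> Obj T" for n
    using assms unshift_obj(1) by (induction n) auto
  then show ?thesis by (simp add: shift_by_def)
qed

lemma shift_by_step:
  assumes X: "X \<in> Obj T"
  shows "isomorphic T (sh_obj T (shift_by T j X)) (shift_by T (j + 1) X)"
proof (cases "0 \<le> j")
  case True
  then have "sh_obj T (shift_by T j X) = shift_by T (j + 1) X"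
    by (simp add: shift_by_def nat_add_distrib)
  then show ?thesis using isomorphic_refl[of "shift_by T (j + 1) X"] X by simp
next
  case False
  then obtain n where n: "j = - int n - 1" by (intro that[of "nat (- j - 1)"]) simp
  have "nat (- j) = Suc n" "nat (- (j + 1)) = n" using n by auto
  \<comment> \<open>In negative degrees the object is an iterated unshift. For \<open>n = 0\<close>
    the degree \<open>j + 1\<close> is 0 and belongs to the other branch of the definition, which
    there also returns \<open>X\<close>.\<close>
  then have "shift_by T j X = unshift_obj T (shift_by T (j + 1) X)"
    using False by (cases "n = 0") (auto simp: shift_by_def n)
  then show ?thesis using unshift_obj(2)[of "shift_by T (j + 1) X"] X by simp
qed

lemma int_step_induct [case_names zero up down]:
  assumes "Q (0::int)" "\<And>j. Q j \<Longrightarrow> Q (j + 1)" "\<And>j. Q (j + 1) \<Longrightarrow> Q j"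
  shows "Q j"
proof (induction j rule: int_induct[where k = 0])
  case (step2 i)
  then show ?case using assms(3)[of "i - 1"] by simp
qed (use assms in auto)

text \<open>The definitions of exceptional object and block only speak of morphisms out of unshifted
  objects. Conjugation by \<kappa> after shifting moves each assertion one degree up or down, so it
  holds between arbitrary shifts.\<close>

lemma exceptional_tri_block:
  assumes ex: "exceptional_block K T n E" and gen: "generated_by T (E ` {1..n})"
  obtains \<kappa> where "tri_block K T {1..n} (\<lambda>i j. shift_by T j (E i)) \<kappa>"
proof -
  define J where "J = {1..n}"
  note ex = ex[unfolded exceptional_block_def, folded J_def] and gen = gen[folded J_def]
  let ?P = "\<lambda>i j. shift_by T j (E i)"
  have ex1: "exceptional K T (E i)" if "i \<in> J" for i
    using ex that by blast
  have E [simp]: "E i \<in> Obj T" if "i \<in> J" for i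
    using ex1[OF that] unfolding exceptional_def by blast
  have "\<exists>\<kappa>. i \<in> J \<longrightarrow> is_iso T (sh_obj T (?P i j)) (?P i (j + 1)) \<kappa>" for i j
    using shift_by_step[OF E, of i j] unfolding isomorphic_def by blast
  then obtain \<kappa> where k: "\<And>i j. i \<in> J \<Longrightarrow> is_iso T (sh_obj T (?P i j)) (?P i (j + 1)) (\<kappa> i j)"
    by metis
  have k': "arr T (\<kappa> i j)" "dm T (\<kappa> i j) = sh_obj T (?P i j)" "cd T (\<kappa> i j) = ?P i (j + 1)"
    "arr T (inv_mor T (\<kappa> i j))" "dm T (inv_mor T (\<kappa> i j)) = ?P i (j + 1)"
    "cd T (inv_mor T (\<kappa> i j)) = sh_obj T (?P i j)"
    "inv_mor T (\<kappa> i j) \<cdot>\<^bsub>T\<^esub> \<kappa> i j = Id T (sh_obj T (?P i j))"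
    "\<kappa> i j \<cdot>\<^bsub>T\<^esub> inv_mor T (\<kappa> i j) = Id T (?P i (j + 1))"
    "\<And>h. \<lbrakk>arr T h; cd T h = sh_obj T (?P i j)\<rbrakk> \<Longrightarrow> inv_mor T (\<kappa> i j) \<cdot>\<^bsub>T\<^esub> \<kappa> i j \<cdot>\<^bsub>T\<^esub> h = h"
    "\<And>h. \<lbrakk>arr T h; cd T h = ?P i (j + 1)\<rbrakk> \<Longrightarrow> \<kappa> i j \<cdot>\<^bsub>T\<^esub> inv_mor T (\<kappa> i j) \<cdot>\<^bsub>T\<^esub> h = h"
    if "i \<in> J" for i j
    using is_iso_inverse[OF k[OF that]] that by auto
  note [simp] = k'
  \<comment> \<open>Fullness of the shift: every morphism between objects one degree higher is a
    shifted morphism conjugated by \<kappa>.\<close>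
  have down: "\<exists>g. arr T g \<and> dm T g = ?P i j \<and> cd T g = ?P k l \<and> f = \<kappa> k l \<cdot>\<^bsub>T\<^esub> sh_mor T g \<cdot>\<^bsub>T\<^esub> inv_mor T (\<kappa> i j)"
    if "i \<in> J" "k \<in> J" "arr T f" "dm T f = ?P i (j + 1)" "cd T f = ?P k (l + 1)" for f i j k l
  proof -
    have "arr T (inv_mor T (\<kappa> k l) \<cdot>\<^bsub>T\<^esub> f \<cdot>\<^bsub>T\<^esub> \<kappa> i j)" "dm T (inv_mor T (\<kappa> k l) \<cdot>\<^bsub>T\<^esub> f \<cdot>\<^bsub>T\<^esub> \<kappa> i j) = sh_obj T (?P i j)"
      "cd T (inv_mor T (\<kappa> k l) \<cdot>\<^bsub>T\<^esub> f \<cdot>\<^bsub>T\<^esub> \<kappa> i j) = sh_obj T (?P k l)" using that by simp_all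
    from Sh.full[OF this] that(1,2)
    obtain g where g: "arr T g" "dm T g = ?P i j" "cd T g = ?P k l" "sh_mor T g = inv_mor T (\<kappa> k l) \<cdot>\<^bsub>T\<^esub> f \<cdot>\<^bsub>T\<^esub> \<kappa> i j"
      by (metis E shift_by_Obj)
    then have "f = \<kappa> k l \<cdot>\<^bsub>T\<^esub> sh_mor T g \<cdot>\<^bsub>T\<^esub> inv_mor T (\<kappa> i j)" unfolding g(4) using that by simp
    with g show ?thesis by blast
  qed
  have up: "sh_mor T g = inv_mor T (\<kappa> k l) \<cdot>\<^bsub>T\<^esub> (\<kappa> k l \<cdot>\<^bsub>T\<^esub> sh_mor T g \<cdot>\<^bsub>T\<^esub> inv_mor T (\<kappa> i j)) \<cdot>\<^bsub>T\<^esub> \<kappa> i j"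
    if "i \<in> J" "k \<in> J" "arr T g" "dm T g = ?P i j" "cd T g = ?P k l" for g i j k l
    using that by simp
  have orth: "\<forall>l f. (i, j) \<noteq> (k, l) \<longrightarrow> arr T f \<longrightarrow> dm T f = ?P i j \<longrightarrow> cd T f = ?P k l \<longrightarrow> f = zer T (?P i j) (?P k l)"
    if [simp]: "i \<in> J" "k \<in> J" for i j k
  proof (induction j rule: int_step_induct)
    case zero
    show ?case
    proof (intro allI impI)
      fix l f assume l: "(i, 0::int) \<noteq> (k, l)" and f: "arr T f" "dm T f = ?P i 0" "cd T f = ?P k l"
      have "homs T (E i) (?P k l) = {zer T (E i) (?P k l)}"
      proof (cases "i = k")
        case True
        then show ?thesis using l ex1[of i] unfolding exceptional_def by simp
      next
        case False
        then show ?thesis using ex that by blast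
      qed
      moreover have "f \<in> homs T (E i) (?P k l)" using f by simp
      ultimately show "f = zer T (?P i 0) (?P k l)" by simp
    qed
  next
    case (up j)
    show ?case
    proof (intro allI impI)
      fix l f assume l: "(i, j + 1) \<noteq> (k, l)" and f: "arr T f" "dm T f = ?P i (j + 1)" "cd T f = ?P k l"
      obtain m where m: "l = m + 1" by (rule that[of "l - 1"]) simp
      obtain g where g: "arr T g" "dm T g = ?P i j" "cd T g = ?P k m" "f = \<kappa> k m \<cdot>\<^bsub>T\<^esub> sh_mor T g \<cdot>\<^bsub>T\<^esub> inv_mor T (\<kappa> i j)"
        using down[of i k f j m] f m by auto
      have "g = zer T (?P i j) (?P k m)" using up g l m by auto
      then show "f = zer T (?P i (j + 1)) (?P k l)" using g(4) m by simp
    qed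
  next
    case (down j)
    show ?case
    proof (intro allI impI)
      fix l f assume l: "(i, j) \<noteq> (k, l)" and f: "arr T f" "dm T f = ?P i j" "cd T f = ?P k l"
      have "\<kappa> k l \<cdot>\<^bsub>T\<^esub> sh_mor T f \<cdot>\<^bsub>T\<^esub> inv_mor T (\<kappa> i j) = zer T (?P i (j + 1)) (?P k (l + 1))"
        using down[rule_format, of "l + 1" "\<kappa> k l \<cdot>\<^bsub>T\<^esub> sh_mor T f \<cdot>\<^bsub>T\<^esub> inv_mor T (\<kappa> i j)"] l f by simp
      then have "sh_mor T f = sh_mor T (zer T (?P i j) (?P k l))"
        by (subst up[of i k f j l]) (use f in simp_all)
      then show "f = zer T (?P i j) (?P k l)" by (rule Sh.faithful) (use f in simp_all)
    qed
  qed
  have End: "\<forall>f. arr T f \<longrightarrow> dm T f = ?P i j \<longrightarrow> cd T f = ?P i j \<longrightarrow> (\<exists>c \<in> carrier K. f = c \<star>\<^bsub>T\<^esub> Id T (?P i j))"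
    if [simp]: "i \<in> J" for i j
  proof (induction j rule: int_step_induct)
    case zero
    show ?case
    proof (intro allI impI)
      fix f assume f: "arr T f" "dm T f = ?P i 0" "cd T f = ?P i 0"
      have "f \<in> homs T (E i) (E i)" using f by simp
      moreover have "(\<lambda>c. c \<odot>\<^bsub>Hom T (E i) (E i)\<^esub> Id T (E i)) ` carrier K = homs T (E i) (E i)"
        using ex1[of i] unfolding exceptional_def bij_betw_def by simp
      ultimately show "\<exists>c \<in> carrier K. f = c \<star>\<^bsub>T\<^esub> Id T (?P i 0)"
        by (auto simp: scale_mor_def simp del: homs_iff)
    qed
  next
    case (up j)
    show ?case
    proof (intro allI impI)
      fix f assume f: "arr T f" "dm T f = ?P i (j + 1)" "cd T f = ?P i (j + 1)"
      obtain g where g: "arr T g" "dm T g = ?P i j" "cd T g = ?P i j" "f = \<kappa> i j \<cdot>\<^bsub>T\<^esub> sh_mor T g \<cdot>\<^bsub>T\<^esub> inv_mor T (\<kappa> i j)"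
        using down[of i i f j j] f by auto
      obtain c where c: "c \<in> carrier K" "g = c \<star>\<^bsub>T\<^esub> Id T (?P i j)" using up g by blast
      then show "\<exists>c \<in> carrier K. f = c \<star>\<^bsub>T\<^esub> Id T (?P i (j + 1))" using g(4) by auto
    qed
  next
    case (down j)
    show ?case
    proof (intro allI impI)
      fix f assume f: "arr T f" "dm T f = ?P i j" "cd T f = ?P i j"
      obtain c where c: "c \<in> carrier K" "\<kappa> i j \<cdot>\<^bsub>T\<^esub> sh_mor T f \<cdot>\<^bsub>T\<^esub> inv_mor T (\<kappa> i j) = c \<star>\<^bsub>T\<^esub> Id T (?P i (j + 1))"
        using down[rule_format, of "\<kappa> i j \<cdot>\<^bsub>T\<^esub> sh_mor T f \<cdot>\<^bsub>T\<^esub> inv_mor T (\<kappa> i j)"] f by auto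
      then have "sh_mor T f = sh_mor T (c \<star>\<^bsub>T\<^esub> Id T (?P i j))"
        by (subst up[of i i f j j]) (use f c in simp_all)
      then have "f = c \<star>\<^bsub>T\<^esub> Id T (?P i j)" by (rule Sh.faithful) (use f c in simp_all)
      then show "\<exists>c \<in> carrier K. f = c \<star>\<^bsub>T\<^esub> Id T (?P i j)" using c by blast
    qed
  qed
  have nz: "Id T (?P i j) \<noteq> zer T (?P i j) (?P i j)" if [simp]: "i \<in> J" for i j
  proof (induction j rule: int_step_induct)
    case zero
    have inj: "inj_on (\<lambda>c. c \<odot>\<^bsub>Hom T (E i) (E i)\<^esub> Id T (E i)) (carrier K)"
      using ex1[of i] unfolding exceptional_def bij_betw_def by simp
    show ?case
    proof
      assume "Id T (?P i 0) = zer T (?P i 0) (?P i 0)"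
      then have "\<one>\<^bsub>K\<^esub> \<star>\<^bsub>T\<^esub> Id T (E i) = \<zero>\<^bsub>K\<^esub> \<star>\<^bsub>T\<^esub> Id T (E i)" by simp
      then have "\<one>\<^bsub>K\<^esub> = \<zero>\<^bsub>K\<^esub>" using inj_onD[OF inj, of "\<one>\<^bsub>K\<^esub>" "\<zero>\<^bsub>K\<^esub>"] by (simp add: scale_mor_def)
      then show False by simp
    qed
  next
    case (up j)
    show ?case
    proof
      assume "Id T (?P i (j + 1)) = zer T (?P i (j + 1)) (?P i (j + 1))"
      then have "inv_mor T (\<kappa> i j) \<cdot>\<^bsub>T\<^esub> Id T (?P i (j + 1)) \<cdot>\<^bsub>T\<^esub> \<kappa> i j = sh_mor T (zer T (?P i j) (?P i j))" by simp
      then have "sh_mor T (Id T (?P i j)) = sh_mor T (zer T (?P i j) (?P i j))" by simp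
      then have "Id T (?P i j) = zer T (?P i j) (?P i j)" by (rule Sh.faithful) simp_all
      then show False using up by blast
    qed
  next
    case (down j)
    show ?case
    proof
      assume "Id T (?P i j) = zer T (?P i j) (?P i j)"
      then have "\<kappa> i j \<cdot>\<^bsub>T\<^esub> sh_mor T (Id T (?P i j)) \<cdot>\<^bsub>T\<^esub> inv_mor T (\<kappa> i j)
        = \<kappa> i j \<cdot>\<^bsub>T\<^esub> sh_mor T (zer T (?P i j) (?P i j)) \<cdot>\<^bsub>T\<^esub> inv_mor T (\<kappa> i j)" by simp
      then show False using down by simp
    qed
  qed
  have "tri_block K T J ?P \<kappa>"
  proof unfold_locales
    show "\<exists>c \<in> carrier K. f = c \<star>\<^bsub>T\<^esub> Id T (?P i j)"
      if "i \<in> J" "arr T f" "dm T f = ?P i j" "cd T f = ?P i j" for i j f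
      using End[OF that(1)] that(2-) by simp
    show "f = zer T (?P i j) (?P k l)"
      if "i \<in> J" "k \<in> J" "(i, j) \<noteq> (k, l)" "arr T f" "dm T f = ?P i j" "cd T f = ?P k l" for i j k l f
      using orth[OF that(1,2)] that(3-) by simp
  qed (use k nz gen in simp_all)
  then show ?thesis using that unfolding J_def by blast
qed

end

lemma tri_block_reindex:
  assumes "tri_block K T I P \<kappa>" and \<tau>: "bij_betw \<tau> J I"
  shows "tri_block K T J (\<lambda>i. P (\<tau> i)) (\<lambda>i. \<kappa> (\<tau> i))"
proof -
  interpret tri_block K T I P \<kappa> by fact
  have \<tau>I: "\<tau> i \<in> I" if "i \<in> J" for i using bij_betwE[OF \<tau>] that by blast
  have im: "(\<lambda>i. P (\<tau> i) 0) ` J = (\<lambda>i. P i 0) ` I"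
    by (simp add: image_image flip: bij_betw_imp_surj_on[OF \<tau>])
  show ?thesis
  proof unfold_locales
    show "f = zer T (P (\<tau> i) j) (P (\<tau> k) l)"
      if "i \<in> J" "k \<in> J" "(i, j) \<noteq> (k, l)" "arr T f" "dm T f = P (\<tau> i) j" "cd T f = P (\<tau> k) l" for i j k l f
      using bij_betw_imp_inj_on[OF \<tau>] that \<tau>I by (intro P_orth) (auto simp: inj_on_def)
  qed (use \<tau>I kappa_iso P_End P_nonzero gen im in auto)
qed

section \<open>Categories with an action\<close>

abbreviation act_obj :: "('g, 'o, 'm, 'k, 'z) gtricat_scheme \<Rightarrow> 'g \<Rightarrow> 'o \<Rightarrow> 'o"
  where "act_obj T g \<equiv> On_obj (Act T g)"

abbreviation act_mor :: "('g, 'o, 'm, 'k, 'z) gtricat_scheme \<Rightarrow> 'g \<Rightarrow> 'm \<Rightarrow> 'm"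
  where "act_mor T g \<equiv> On_mor (Act T g)"

context linear_category
begin

lemma is_iso_scale:
  assumes "is_iso C X Y f" "c \<in> carrier K" "c \<noteq> \<zero>\<^bsub>K\<^esub>" "X \<in> Obj C" "Y \<in> Obj C"
  shows "is_iso C X Y (c \<star>\<^bsub>C\<^esub> f)"
proof -
  have "inv\<^bsub>K\<^esub> c \<in> carrier K" "inv\<^bsub>K\<^esub> c \<otimes>\<^bsub>K\<^esub> c = \<one>\<^bsub>K\<^esub>" "c \<otimes>\<^bsub>K\<^esub> inv\<^bsub>K\<^esub> c = \<one>\<^bsub>K\<^esub>"
    using assms by (simp_all add: field_Units)
  then show ?thesis
    using is_iso_inverse[OF assms(1,4,5)] assms
    by (intro is_isoI[of _ _ _ "(inv\<^bsub>K\<^esub> c) \<star>\<^bsub>C\<^esub> inv_mor C f"]) auto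
qed

lemma finsum_mor:
  assumes "X \<in> Obj C" "Y \<in> Obj C" "finite J" "\<And>j. j \<in> J \<Longrightarrow> arr C (h j) \<and> dm C (h j) = X \<and> cd C (h j) = Y"
  shows "arr C (finsum (Hom C X Y) h J) \<and> dm C (finsum (Hom C X Y) h J) = X \<and> cd C (finsum (Hom C X Y) h J) = Y"
proof -
  interpret M: abelian_group "Hom C X Y" using assms(1,2) by (rule Hom_abelian_group)
  have "finsum (Hom C X Y) h J \<in> homs C X Y" by (rule M.finsum_closed) (use assms in auto)
  then show ?thesis using assms(1,2) by simp
qed

lemma finsum_mor_empty: "\<lbrakk>X \<in> Obj C; Y \<in> Obj C\<rbrakk> \<Longrightarrow> finsum (Hom C X Y) h {} = zer C X Y"
  using abelian_monoid.finsum_empty[OF abelian_group.axioms(1)[OF Hom_abelian_group]] .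

lemma finsum_mor_insert:
  assumes "X \<in> Obj C" "Y \<in> Obj C" "finite J" "i \<notin> J"
    "\<And>j. j \<in> insert i J \<Longrightarrow> arr C (h j) \<and> dm C (h j) = X \<and> cd C (h j) = Y"
  shows "finsum (Hom C X Y) h (insert i J) = h i \<uplus>\<^bsub>C\<^esub> finsum (Hom C X Y) h J"
proof -
  interpret M: abelian_group "Hom C X Y" using assms(1,2) by (rule Hom_abelian_group)
  have "finsum (Hom C X Y) h (insert i J) = h i \<oplus>\<^bsub>Hom C X Y\<^esub> finsum (Hom C X Y) h J"
    by (rule M.finsum_insert) (use assms in auto)
  then show ?thesis using assms(5)[of i] by (simp add: plus_mor_def)
qed

lemma direct_sumD:
  assumes "direct_sum C I X S \<iota> \<pi>" "\<forall>i \<in> I. X i \<in> Obj C"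
  shows "S \<in> Obj C" "finsum (Hom C S S) (\<lambda>i. \<iota> i \<cdot>\<^bsub>C\<^esub> \<pi> i) I = Id C S"
    "i \<in> I \<Longrightarrow> arr C (\<iota> i)" "i \<in> I \<Longrightarrow> dm C (\<iota> i) = X i" "i \<in> I \<Longrightarrow> cd C (\<iota> i) = S"
    "i \<in> I \<Longrightarrow> arr C (\<pi> i)" "i \<in> I \<Longrightarrow> dm C (\<pi> i) = S" "i \<in> I \<Longrightarrow> cd C (\<pi> i) = X i"
    "i \<in> I \<Longrightarrow> \<pi> i \<cdot>\<^bsub>C\<^esub> \<iota> i = Id C (X i)"
    "\<lbrakk>i \<in> I; j \<in> I; i \<noteq> j\<rbrakk> \<Longrightarrow> \<pi> j \<cdot>\<^bsub>C\<^esub> \<iota> i = zer C (X i) (X j)"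
  using assms unfolding direct_sum_def by auto

end

text \<open>The functor preserves the expression of the identity of \<open>S\<close> as the finite
  sum of the \<open>\<iota> i \<pi> i\<close>, so the images of the projections still detect
  equality.\<close>

lemma (in lin_functor) F_jointly_monic:
  assumes S: "direct_sum C I X S \<iota> \<pi>" "finite I" "\<forall>i \<in> I. X i \<in> Obj C"
    and f: "arr D f" "arr D f'" "dm D f = dm D f'" "cd D f = On_obj F S" "cd D f' = On_obj F S"
    and eq: "\<And>i. i \<in> I \<Longrightarrow> On_mor F (\<pi> i) \<cdot>\<^bsub>D\<^esub> f = On_mor F (\<pi> i) \<cdot>\<^bsub>D\<^esub> f'"
  shows "f = f'"
proof -
  note d = C.direct_sumD[OF S(1,3)]
  note [simp] = d(1,3-8) S(3)[rule_format]
  have "On_mor F (finsum (Hom C S S) (\<lambda>i. \<iota> i \<cdot>\<^bsub>C\<^esub> \<pi> i) J) \<cdot>\<^bsub>D\<^esub> f = On_mor F (finsum (Hom C S S) (\<lambda>i. \<iota> i \<cdot>\<^bsub>C\<^esub> \<pi> i) J) \<cdot>\<^bsub>D\<^esub> f'"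
    if "finite J" "J \<subseteq> I" for J
    using that
  proof induction
    case empty
    then show ?case using f by (simp add: C.finsum_mor_empty)
  next
    case (insert j J)
    have fs: "finsum (Hom C S S) (\<lambda>i. \<iota> i \<cdot>\<^bsub>C\<^esub> \<pi> i) (insert j J) = \<iota> j \<cdot>\<^bsub>C\<^esub> \<pi> j \<uplus>\<^bsub>C\<^esub> finsum (Hom C S S) (\<lambda>i. \<iota> i \<cdot>\<^bsub>C\<^esub> \<pi> i) J"
      by (rule C.finsum_mor_insert) (use insert d(1,3-8) in auto)
    have "arr C (finsum (Hom C S S) (\<lambda>i. \<iota> i \<cdot>\<^bsub>C\<^esub> \<pi> i) J) \<and> dm C (finsum (Hom C S S) (\<lambda>i. \<iota> i \<cdot>\<^bsub>C\<^esub> \<pi> i) J) = S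
      \<and> cd C (finsum (Hom C S S) (\<lambda>i. \<iota> i \<cdot>\<^bsub>C\<^esub> \<pi> i) J) = S"
      by (rule C.finsum_mor) (use insert d(1,3-8) in auto)
    then show ?case unfolding fs using insert f eq[of j] by simp
  qed
  from this[OF S(2)] show ?thesis using d(2) f by simp
qed

lemma (in linear_category) diagonal_Comp:
  assumes S: "direct_sum C {1..n} X S \<iota> \<pi>" "\<forall>i \<in> {1..n}. X i \<in> Obj C"
    and a: "\<forall>i \<in> {1..n}. a i \<in> carrier K" and k: "k \<in> {1..n}"
  shows "arr C (diagonal C n S \<iota> \<pi> a)" "dm C (diagonal C n S \<iota> \<pi> a) = S" "cd C (diagonal C n S \<iota> \<pi> a) = S"
    "diagonal C n S \<iota> \<pi> a \<cdot>\<^bsub>C\<^esub> \<iota> k = a k \<star>\<^bsub>C\<^esub> \<iota> k"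
proof -
  define J0 where "J0 = {1..n}"
  note S = S[folded J0_def] and a = a[folded J0_def, rule_format] and k = k[folded J0_def]
  note d = direct_sumD[OF S]
  note [simp] = d(1,3-8) S(2)[rule_format]
  let ?h = "\<lambda>i. a i \<odot>\<^bsub>Hom C S S\<^esub> (\<iota> i \<cdot>\<^bsub>C\<^esub> \<pi> i)"
  have h: "?h i = a i \<star>\<^bsub>C\<^esub> (\<iota> i \<cdot>\<^bsub>C\<^esub> \<pi> i)" if "i \<in> J0" for i using that by (simp add: scale_mor_def)
  have hh: "arr C (?h i) \<and> dm C (?h i) = S \<and> cd C (?h i) = S" if "i \<in> J0" for i
    unfolding h[OF that] using that a by simp
  have "arr C (finsum (Hom C S S) ?h J) \<and> dm C (finsum (Hom C S S) ?h J) = S \<and> cd C (finsum (Hom C S S) ?h J) = S \<and>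
     finsum (Hom C S S) ?h J \<cdot>\<^bsub>C\<^esub> \<iota> k = (if k \<in> J then a k \<star>\<^bsub>C\<^esub> \<iota> k else zer C (X k) S)"
    if "finite J" "J \<subseteq> J0" for J
    using that
  proof induction
    case empty
    then show ?case using k by (simp add: finsum_mor_empty)
  next
    case (insert j J)
    have j: "j \<in> J0" using insert by simp
    have fs: "finsum (Hom C S S) ?h (insert j J) = ?h j \<uplus>\<^bsub>C\<^esub> finsum (Hom C S S) ?h J"
      by (rule finsum_mor_insert) (use insert hh d(1) in auto)
    have "?h j \<cdot>\<^bsub>C\<^esub> \<iota> k = (if k = j then a k \<star>\<^bsub>C\<^esub> \<iota> k else zer C (X k) S)"
      unfolding h[OF j] using j k a[OF j] d(9)[OF j] d(10)[OF k j] by (cases "k = j") simp_all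
    then show ?case unfolding fs using insert hh[OF j] k a by auto
  qed
  from this[of J0] show "arr C (diagonal C n S \<iota> \<pi> a)" "dm C (diagonal C n S \<iota> \<pi> a) = S" "cd C (diagonal C n S \<iota> \<pi> a) = S"
    "diagonal C n S \<iota> \<pi> a \<cdot>\<^bsub>C\<^esub> \<iota> k = a k \<star>\<^bsub>C\<^esub> \<iota> k"
    using k unfolding diagonal_def J0_def by auto
qed

lemma field_Aut_hom:
  assumes "\<sigma> \<in> hom G (field_Aut K)" "field K" "group G"
  shows "\<lbrakk>g \<in> carrier G; c \<in> carrier K\<rbrakk> \<Longrightarrow> \<sigma> g c \<in> carrier K"
    "\<lbrakk>g \<in> carrier G; c \<in> carrier K; d \<in> carrier K\<rbrakk> \<Longrightarrow> \<sigma> g (c \<otimes>\<^bsub>K\<^esub> d) = \<sigma> g c \<otimes>\<^bsub>K\<^esub> \<sigma> g d"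
    "\<lbrakk>g \<in> carrier G; h \<in> carrier G; c \<in> carrier K\<rbrakk> \<Longrightarrow> \<sigma> (g \<otimes>\<^bsub>G\<^esub> h) c = \<sigma> g (\<sigma> h c)"
    "g \<in> carrier G \<Longrightarrow> \<sigma> g \<one>\<^bsub>K\<^esub> = \<one>\<^bsub>K\<^esub>"
    "\<lbrakk>g \<in> carrier G; c \<in> carrier K; c \<noteq> \<zero>\<^bsub>K\<^esub>\<rbrakk> \<Longrightarrow> \<sigma> g c \<noteq> \<zero>\<^bsub>K\<^esub>"
proof -
  interpret K: field K by fact
  have *: "\<sigma> g \<in> ring_hom K K" "\<sigma> g \<in> Bij (carrier K)" if "g \<in> carrier G" for g
    using hom_in_carrier[OF assms(1) that] unfolding field_Aut_def by auto
  show c: "\<sigma> g c \<in> carrier K" if "g \<in> carrier G" "c \<in> carrier K" for g c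
    using ring_hom_closed[OF *(1)] that by blast
  show "\<sigma> g (c \<otimes>\<^bsub>K\<^esub> d) = \<sigma> g c \<otimes>\<^bsub>K\<^esub> \<sigma> g d" if "g \<in> carrier G" "c \<in> carrier K" "d \<in> carrier K"
    using ring_hom_mult[OF *(1)] that by blast
  show "\<sigma> g \<one>\<^bsub>K\<^esub> = \<one>\<^bsub>K\<^esub>" if "g \<in> carrier G" using ring_hom_one[OF *(1)[OF that]] .
  show "\<sigma> (g \<otimes>\<^bsub>G\<^esub> h) c = \<sigma> g (\<sigma> h c)" if "g \<in> carrier G" "h \<in> carrier G" "c \<in> carrier K"
    using hom_mult[OF assms(1) that(1,2)] *(2) that unfolding field_Aut_def BijGroup_def
    by (simp add: compose_eq)
  show "\<sigma> g c \<noteq> \<zero>\<^bsub>K\<^esub>" if "g \<in> carrier G" "c \<in> carrier K" "c \<noteq> \<zero>\<^bsub>K\<^esub>"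
  proof -
    have "\<sigma> g \<zero>\<^bsub>K\<^esub> = \<zero>\<^bsub>K\<^esub>" using ring_hom_zero[OF *(1)[OF that(1)]] K.ring_axioms by blast
    moreover have "inj_on (\<sigma> g) (carrier K)" using *(2)[OF that(1)] unfolding Bij_def bij_betw_def by blast
    ultimately show ?thesis using that K.zero_closed unfolding inj_on_def by metis
  qed
qed

context triangulated_category_with_action
begin

lemmas sigma = field_Aut_hom[OF sigma_hom field_axioms G.group_axioms]
lemmas [simp] = sigma

lemma Act_sh_functor: "g \<in> carrier G \<Longrightarrow> sh_functor K (\<sigma> g) T T (Act T g)"
  by (rule exact_functor_sh_functor)
    (auto simp: Act_exact Act_semilinear triangulated_category_axioms)

lemmas Act_lin_functor = sh_functor.axioms(3)[OF Act_sh_functor]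

lemmas Act_simps [simp] =
  lin_functor.F_Obj[OF Act_lin_functor] lin_functor.F_Id[OF Act_lin_functor]
  lin_functor.F_arr[OF Act_lin_functor] lin_functor.F_Comp[OF Act_lin_functor]
  lin_functor.F_scale[OF Act_lin_functor] lin_functor.F_zer[OF Act_lin_functor]
  sh_functor.Fsh_simps(1-3)[OF Act_sh_functor]

lemma Act_Fsh_iso:
  "\<lbrakk>g \<in> carrier G; X \<in> Obj T\<rbrakk> \<Longrightarrow> is_iso T (act_obj T g (sh_obj T X)) (sh_obj T (act_obj T g X)) (Fsh (Act T g) X)"
  by (rule sh_functor.Fsh_iso[OF Act_sh_functor])

lemma Act_Fsh_natural:
  "\<lbrakk>g \<in> carrier G; arr T f; dm T f = X; cd T f = Y\<rbrakk>
    \<Longrightarrow> Fsh (Act T g) Y \<cdot>\<^bsub>T\<^esub> act_mor T g (sh_mor T f) = sh_mor T (act_mor T g f) \<cdot>\<^bsub>T\<^esub> Fsh (Act T g) X"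
  by (rule sh_functor.Fsh_natural[OF Act_sh_functor])

lemma Act_iso:
  "\<lbrakk>g \<in> carrier G; is_iso T X Y f; X \<in> Obj T; Y \<in> Obj T\<rbrakk>
    \<Longrightarrow> is_iso T (act_obj T g X) (act_obj T g Y) (act_mor T g f)"
  by (rule lin_functor.F_iso[OF Act_lin_functor])

lemma Eps_is_iso:
  assumes "g \<in> carrier G" "h \<in> carrier G" "X \<in> Obj T"
  shows "is_iso T (act_obj T g (act_obj T h X)) (act_obj T (g \<otimes>\<^bsub>G\<^esub> h) X) (Eps T g h X)"
  using Eps_iso[OF assms(1,2)] assms(3) unfolding exact_iso_def nat_iso_def comp_exact_def by simp

lemma Eps_simps [simp]:
  assumes "g \<in> carrier G" "h \<in> carrier G" "X \<in> Obj T"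
  shows "arr T (Eps T g h X)" "dm T (Eps T g h X) = act_obj T g (act_obj T h X)"
    "cd T (Eps T g h X) = act_obj T (g \<otimes>\<^bsub>G\<^esub> h) X"
  using is_iso_inverse(1-3)[OF Eps_is_iso] assms by auto

lemma Eps_natural:
  assumes "g \<in> carrier G" "h \<in> carrier G" "arr T f" "dm T f = X" "cd T f = Y"
  shows "Eps T g h Y \<cdot>\<^bsub>T\<^esub> act_mor T g (act_mor T h f) = act_mor T (g \<otimes>\<^bsub>G\<^esub> h) f \<cdot>\<^bsub>T\<^esub> Eps T g h X"
proof -
  have "nat_iso T T (comp_exact T (Act T g) (Act T h)) (Act T (g \<otimes>\<^bsub>G\<^esub> h)) (Eps T g h)"
    using Eps_iso[OF assms(1,2)] unfolding exact_iso_def by blast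
  then show ?thesis using assms(3-) unfolding nat_iso_iff by (auto simp: comp_exact_def)
qed

lemma Eps_shift:
  assumes "g \<in> carrier G" "h \<in> carrier G" "X \<in> Obj T"
  shows "Fsh (Act T (g \<otimes>\<^bsub>G\<^esub> h)) X \<cdot>\<^bsub>T\<^esub> Eps T g h (sh_obj T X)
    = sh_mor T (Eps T g h X) \<cdot>\<^bsub>T\<^esub> Fsh (Act T g) (act_obj T h X) \<cdot>\<^bsub>T\<^esub> act_mor T g (Fsh (Act T h) X)"
  using Eps_iso[OF assms(1,2)] assms(3) unfolding exact_iso_def comp_exact_def by simp

text \<open>The twisting equation in components: \<open>\<theta> g i\<close> compares \<open>D (\<rho> g i)\<close> with the translate of \<open>D i\<close>.\<close>

definition block_system :: "nat \<Rightarrow> ('g \<Rightarrow> nat \<Rightarrow> nat) \<Rightarrow> ('g \<times> 'g \<Rightarrow> nat \<Rightarrow> 'k) \<Rightarrow> (nat \<Rightarrow> 'o) \<Rightarrow> ('g \<Rightarrow> nat \<Rightarrow> 'm) \<Rightarrow> bool"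
  where "block_system n \<rho> \<alpha> D \<theta> \<longleftrightarrow>
    (\<forall>i \<in> {1..n}. D i \<in> Obj T) \<and>
    (\<forall>g \<in> carrier G. \<forall>i \<in> {1..n}. is_iso T (D (\<rho> g i)) (act_obj T g (D i)) (\<theta> g i)) \<and>
    (\<forall>g \<in> carrier G. \<forall>h \<in> carrier G. \<forall>i \<in> {1..n}.
      \<alpha> (g, h) (\<rho> (g \<otimes>\<^bsub>G\<^esub> h) i) \<star>\<^bsub>T\<^esub> \<theta> (g \<otimes>\<^bsub>G\<^esub> h) i =
        Eps T g h (D i) \<cdot>\<^bsub>T\<^esub> act_mor T g (\<theta> h i) \<cdot>\<^bsub>T\<^esub> \<theta> g (\<rho> h i))"

end

lemma sym_hom:
  assumes "\<rho> \<in> hom G (sym_group n)"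
  shows "\<lbrakk>g \<in> carrier G; i \<in> {1..n}\<rbrakk> \<Longrightarrow> \<rho> g i \<in> {1..n}"
    "\<lbrakk>g \<in> carrier G; h \<in> carrier G\<rbrakk> \<Longrightarrow> \<rho> (g \<otimes>\<^bsub>G\<^esub> h) i = \<rho> g (\<rho> h i)"
    "g \<in> carrier G \<Longrightarrow> \<rho> g permutes {1..n}"
proof -
  show p: "\<rho> g permutes {1..n}" if "g \<in> carrier G" for g
    using hom_in_carrier[OF assms that] by (simp add: sym_group_def)
  show "\<rho> g i \<in> {1..n}" if "g \<in> carrier G" "i \<in> {1..n}"
    using permutes_in_image[OF p[OF that(1)]] that(2) by blast
  show "\<rho> (g \<otimes>\<^bsub>G\<^esub> h) i = \<rho> g (\<rho> h i)" if "g \<in> carrier G" "h \<in> carrier G"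
    using hom_mult[OF assms that] by (simp add: sym_group_def)
qed

locale action_data = triangulated_category_with_action K G \<sigma> T
  for K :: "'k ring" and G :: "'g monoid" and \<sigma> :: "'g \<Rightarrow> 'k \<Rightarrow> 'k"
    and T :: "('g, 'o, 'm, 'k) gtricat" +
  fixes n :: nat and \<rho> :: "'g \<Rightarrow> nat \<Rightarrow> nat" and \<alpha> :: "'g \<times> 'g \<Rightarrow> nat \<Rightarrow> 'k"
  assumes rho_hom: "\<rho> \<in> hom G (sym_group n)"
    and alpha: "\<alpha> \<in> carrier (cochains2 G (torus K n))"
begin

lemma rho [simp]:
  "\<lbrakk>g \<in> carrier G; i \<in> {1..n}\<rbrakk> \<Longrightarrow> \<rho> g i \<in> {1..n}"
  "\<lbrakk>g \<in> carrier G; h \<in> carrier G\<rbrakk> \<Longrightarrow> \<rho> (g \<otimes>\<^bsub>G\<^esub> h) i = \<rho> g (\<rho> h i)"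
  using sym_hom[OF rho_hom] by blast+

lemma alpha_closed:
  assumes "g \<in> carrier G" "h \<in> carrier G" "i \<in> {1..n}"
  shows "\<alpha> (g, h) i \<in> carrier K" "\<alpha> (g, h) i \<noteq> \<zero>\<^bsub>K\<^esub>"
  using alpha assms by (auto simp: cochains2_def torus_def PiE_iff)

lemma systemD:
  assumes "block_system n \<rho> \<alpha> D \<theta>"
  shows "i \<in> {1..n} \<Longrightarrow> D i \<in> Obj T"
    "\<lbrakk>g \<in> carrier G; i \<in> {1..n}\<rbrakk> \<Longrightarrow> is_iso T (D (\<rho> g i)) (act_obj T g (D i)) (\<theta> g i)"
    "\<lbrakk>g \<in> carrier G; i \<in> {1..n}\<rbrakk> \<Longrightarrow> arr T (\<theta> g i)"
    "\<lbrakk>g \<in> carrier G; i \<in> {1..n}\<rbrakk> \<Longrightarrow> dm T (\<theta> g i) = D (\<rho> g i)"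
    "\<lbrakk>g \<in> carrier G; i \<in> {1..n}\<rbrakk> \<Longrightarrow> cd T (\<theta> g i) = act_obj T g (D i)"
    "\<lbrakk>g \<in> carrier G; h \<in> carrier G; i \<in> {1..n}\<rbrakk> \<Longrightarrow>
      \<alpha> (g, h) (\<rho> g (\<rho> h i)) \<star>\<^bsub>T\<^esub> \<theta> (g \<otimes>\<^bsub>G\<^esub> h) i =
        Eps T g h (D i) \<cdot>\<^bsub>T\<^esub> act_mor T g (\<theta> h i) \<cdot>\<^bsub>T\<^esub> \<theta> g (\<rho> h i)"
proof -
  show o: "i \<in> {1..n} \<Longrightarrow> D i \<in> Obj T" for i using assms unfolding block_system_def by blast
  show i: "\<lbrakk>g \<in> carrier G; i \<in> {1..n}\<rbrakk> \<Longrightarrow> is_iso T (D (\<rho> g i)) (act_obj T g (D i)) (\<theta> g i)" for g i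
    using assms unfolding block_system_def by blast
  show "\<lbrakk>g \<in> carrier G; i \<in> {1..n}\<rbrakk> \<Longrightarrow> arr T (\<theta> g i)"
    "\<lbrakk>g \<in> carrier G; i \<in> {1..n}\<rbrakk> \<Longrightarrow> dm T (\<theta> g i) = D (\<rho> g i)"
    "\<lbrakk>g \<in> carrier G; i \<in> {1..n}\<rbrakk> \<Longrightarrow> cd T (\<theta> g i) = act_obj T g (D i)"
    using is_iso_inverse(1-3)[OF i[of g i]] o rho(1) Act_simps(1) by auto
  show "\<lbrakk>g \<in> carrier G; h \<in> carrier G; i \<in> {1..n}\<rbrakk> \<Longrightarrow>
      \<alpha> (g, h) (\<rho> g (\<rho> h i)) \<star>\<^bsub>T\<^esub> \<theta> (g \<otimes>\<^bsub>G\<^esub> h) i =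
        Eps T g h (D i) \<cdot>\<^bsub>T\<^esub> act_mor T g (\<theta> h i) \<cdot>\<^bsub>T\<^esub> \<theta> g (\<rho> h i)"
    using assms rho(2)[of g h i] unfolding block_system_def by simp
qed

text \<open>Conjugate \<theta> by the isomorphisms \<open>e\<close>: the inner copies of
  \<open>e\<close> cancel, naturality of \<open>Eps\<close> moves the outer one to the front, and
  the scalars stay the same.\<close>

lemma system_iso:
  assumes sys: "block_system n \<rho> \<alpha> D \<theta>" and D': "\<And>i. i \<in> {1..n} \<Longrightarrow> D' i \<in> Obj T"
    and iso: "\<And>i. i \<in> {1..n} \<Longrightarrow> isomorphic T (D i) (D' i)"
  obtains \<theta>' where "block_system n \<rho> \<alpha> D' \<theta>'"
proof -
  define J where "J = {1..n}"
  have "\<forall>i. \<exists>e. i \<in> J \<longrightarrow> is_iso T (D i) (D' i) e" using iso unfolding isomorphic_def J_def by blast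
  from choice[OF this] obtain e where e: "\<And>i. i \<in> J \<Longrightarrow> is_iso T (D i) (D' i) (e i)" by blast
  note s = systemD[OF sys, folded J_def]
  note [simp] = s(1,3-5) D'[folded J_def] rho(1)[folded J_def] alpha_closed[folded J_def]
  note i = is_iso_inverse[OF e]
  have [simp]: "arr T (e i)" "dm T (e i) = D i" "cd T (e i) = D' i"
    "arr T (inv_mor T (e i))" "dm T (inv_mor T (e i)) = D' i" "cd T (inv_mor T (e i)) = D i"
    "inv_mor T (e i) \<cdot>\<^bsub>T\<^esub> e i = Id T (D i)"
    "\<And>h. \<lbrakk>arr T h; cd T h = D i\<rbrakk> \<Longrightarrow> inv_mor T (e i) \<cdot>\<^bsub>T\<^esub> e i \<cdot>\<^bsub>T\<^esub> h = h" if "i \<in> J" for i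
    using i[OF that] that by auto
  define \<theta>' where "\<theta>' g i = act_mor T g (e i) \<cdot>\<^bsub>T\<^esub> \<theta> g i \<cdot>\<^bsub>T\<^esub> inv_mor T (e (\<rho> g i))" for g i
  have "block_system n \<rho> \<alpha> D' \<theta>'"
    unfolding block_system_def J_def[symmetric]
  proof (intro conjI ballI)
    fix g i assume g [simp]: "g \<in> carrier G" "i \<in> J"
    show "is_iso T (D' (\<rho> g i)) (act_obj T g (D' i)) (\<theta>' g i)"
      unfolding \<theta>'_def
      by (rule is_iso_Comp[OF is_iso_Comp[OF is_iso_inv[OF e] s(2)] Act_iso[OF _ e], simplified]) auto
    fix h assume h [simp]: "h \<in> carrier G"
    have E: "Eps T g h (D' i) \<cdot>\<^bsub>T\<^esub> act_mor T g (act_mor T h (e i)) = act_mor T (g \<otimes>\<^bsub>G\<^esub> h) (e i) \<cdot>\<^bsub>T\<^esub> Eps T g h (D i)"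
      by (rule Eps_natural) auto
    have ee: "act_mor T g (inv_mor T (e (\<rho> h i))) \<cdot>\<^bsub>T\<^esub> act_mor T g (e (\<rho> h i)) = Id T (act_obj T g (D (\<rho> h i)))"
      using Act_simps(6)[OF g(1), of "e (\<rho> h i)" "inv_mor T (e (\<rho> h i))"] by simp
    have "Eps T g h (D' i) \<cdot>\<^bsub>T\<^esub> act_mor T g (\<theta>' h i) \<cdot>\<^bsub>T\<^esub> \<theta>' g (\<rho> h i)
      = act_mor T (g \<otimes>\<^bsub>G\<^esub> h) (e i) \<cdot>\<^bsub>T\<^esub> (Eps T g h (D i) \<cdot>\<^bsub>T\<^esub> act_mor T g (\<theta> h i) \<cdot>\<^bsub>T\<^esub> \<theta> g (\<rho> h i)) \<cdot>\<^bsub>T\<^esub> inv_mor T (e (\<rho> g (\<rho> h i)))"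
      unfolding \<theta>'_def by (simp add: Comp_reduce[OF ee] Comp_reduce[OF E])
    also have "\<dots> = \<alpha> (g, h) (\<rho> g (\<rho> h i)) \<star>\<^bsub>T\<^esub> \<theta>' (g \<otimes>\<^bsub>G\<^esub> h) i"
      unfolding s(6)[OF g(1) h g(2), symmetric] \<theta>'_def by simp
    finally show "\<alpha> (g, h) (\<rho> (g \<otimes>\<^bsub>G\<^esub> h) i) \<star>\<^bsub>T\<^esub> \<theta>' (g \<otimes>\<^bsub>G\<^esub> h) i =
        Eps T g h (D' i) \<cdot>\<^bsub>T\<^esub> act_mor T g (\<theta>' h i) \<cdot>\<^bsub>T\<^esub> \<theta>' g (\<rho> h i)" by simp
  qed auto
  then show ?thesis by (rule that)
qed

text \<open>The shift isomorphism is pushed through the composite one factor at a time: past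
  \<open>Eps\<close> since the latter is an isomorphism of exact functors, through \<open>a'\<close>
  by \<open>aa\<close>, past the autoequivalence by naturality, and finally through
  \<open>b'\<close> by \<open>bb\<close>.\<close>

lemma shift_system_equation:
  assumes [simp]: "g \<in> carrier G" "h \<in> carrier G" "X \<in> Obj T" "Y \<in> Obj T" "Z \<in> Obj T"
    and a [simp]: "arr T a" "dm T a = Y" "cd T a = act_obj T h X"
    and a' [simp]: "arr T a'" "dm T a' = sh_obj T Y" "cd T a' = act_obj T h (sh_obj T X)"
    and b [simp]: "arr T b" "dm T b = Z" "cd T b = act_obj T g Y"
    and b' [simp]: "arr T b'" "dm T b' = sh_obj T Z" "cd T b' = act_obj T g (sh_obj T Y)"
    and aa: "Fsh (Act T h) X \<cdot>\<^bsub>T\<^esub> a' = sh_mor T a" and bb: "Fsh (Act T g) Y \<cdot>\<^bsub>T\<^esub> b' = sh_mor T b"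
  shows "Fsh (Act T (g \<otimes>\<^bsub>G\<^esub> h)) X \<cdot>\<^bsub>T\<^esub> Eps T g h (sh_obj T X) \<cdot>\<^bsub>T\<^esub> act_mor T g a' \<cdot>\<^bsub>T\<^esub> b'
    = sh_mor T (Eps T g h X \<cdot>\<^bsub>T\<^esub> act_mor T g a \<cdot>\<^bsub>T\<^esub> b)"
proof -
  have 1: "act_mor T g (Fsh (Act T h) X) \<cdot>\<^bsub>T\<^esub> act_mor T g a' = act_mor T g (sh_mor T a)"
    using arg_cong[OF aa, of "act_mor T g"] by simp
  have 2: "Fsh (Act T g) (act_obj T h X) \<cdot>\<^bsub>T\<^esub> act_mor T g (sh_mor T a) = sh_mor T (act_mor T g a) \<cdot>\<^bsub>T\<^esub> Fsh (Act T g) Y"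
    by (rule Act_Fsh_natural) auto
  have "Fsh (Act T (g \<otimes>\<^bsub>G\<^esub> h)) X \<cdot>\<^bsub>T\<^esub> Eps T g h (sh_obj T X) \<cdot>\<^bsub>T\<^esub> act_mor T g a' \<cdot>\<^bsub>T\<^esub> b'
    = sh_mor T (Eps T g h X) \<cdot>\<^bsub>T\<^esub> Fsh (Act T g) (act_obj T h X) \<cdot>\<^bsub>T\<^esub> act_mor T g (Fsh (Act T h) X) \<cdot>\<^bsub>T\<^esub> act_mor T g a' \<cdot>\<^bsub>T\<^esub> b'"
    using Comp_reduce[OF Eps_shift[of g h X], of "act_mor T g a' \<cdot>\<^bsub>T\<^esub> b'"] by simp
  also have "\<dots> = sh_mor T (Eps T g h X) \<cdot>\<^bsub>T\<^esub> Fsh (Act T g) (act_obj T h X) \<cdot>\<^bsub>T\<^esub> act_mor T g (sh_mor T a) \<cdot>\<^bsub>T\<^esub> b'"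
    by (simp add: Comp_reduce[OF 1])
  also have "\<dots> = sh_mor T (Eps T g h X) \<cdot>\<^bsub>T\<^esub> sh_mor T (act_mor T g a) \<cdot>\<^bsub>T\<^esub> Fsh (Act T g) Y \<cdot>\<^bsub>T\<^esub> b'"
    by (simp add: Comp_reduce[OF 2])
  also have "\<dots> = sh_mor T (Eps T g h X \<cdot>\<^bsub>T\<^esub> act_mor T g a \<cdot>\<^bsub>T\<^esub> b)"
    by (simp add: bb)
  finally show ?thesis .
qed

lemma system_shift:
  assumes sys: "block_system n \<rho> \<alpha> D \<theta>"
  obtains \<theta>' where "block_system n \<rho> \<alpha> (\<lambda>i. sh_obj T (D i)) \<theta>'"
proof -
  define J where "J = {1..n}"
  note s = systemD[OF sys, folded J_def]
  note [simp] = s(1,3-5) rho(1)[folded J_def] alpha_closed[folded J_def]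
  define \<theta>' where "\<theta>' g i = inv_mor T (Fsh (Act T g) (D i)) \<cdot>\<^bsub>T\<^esub> sh_mor T (\<theta> g i)" for g i
  have iso: "is_iso T (sh_obj T (act_obj T g (D i))) (act_obj T g (sh_obj T (D i))) (inv_mor T (Fsh (Act T g) (D i)))"
    and \<theta>' [simp]: "arr T (\<theta>' g i)" "dm T (\<theta>' g i) = sh_obj T (D (\<rho> g i))" "cd T (\<theta>' g i) = act_obj T g (sh_obj T (D i))"
      "Fsh (Act T g) (D i) \<cdot>\<^bsub>T\<^esub> \<theta>' g i = sh_mor T (\<theta> g i)"
    if "g \<in> carrier G" "i \<in> J" for g i
  proof -
    show "is_iso T (sh_obj T (act_obj T g (D i))) (act_obj T g (sh_obj T (D i))) (inv_mor T (Fsh (Act T g) (D i)))"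
      by (rule is_iso_inv[OF Act_Fsh_iso]) (use that in auto)
    show "arr T (\<theta>' g i)" "dm T (\<theta>' g i) = sh_obj T (D (\<rho> g i))" "cd T (\<theta>' g i) = act_obj T g (sh_obj T (D i))"
      "Fsh (Act T g) (D i) \<cdot>\<^bsub>T\<^esub> \<theta>' g i = sh_mor T (\<theta> g i)"
      using is_iso_inverse[OF Act_Fsh_iso[of g "D i"]] that unfolding \<theta>'_def by simp_all
  qed
  have "block_system n \<rho> \<alpha> (\<lambda>i. sh_obj T (D i)) \<theta>'"
    unfolding block_system_def J_def[symmetric]
  proof (intro conjI ballI)
    fix g i assume g [simp]: "g \<in> carrier G" "i \<in> J"
    show "is_iso T (sh_obj T (D (\<rho> g i))) (act_obj T g (sh_obj T (D i))) (\<theta>' g i)"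
      unfolding \<theta>'_def
      by (rule is_iso_Comp[OF Sh.F_iso[OF s(2)] iso]) auto
    fix h assume h [simp]: "h \<in> carrier G"
    have *: "Fsh (Act T (g \<otimes>\<^bsub>G\<^esub> h)) (D i) \<cdot>\<^bsub>T\<^esub> (Eps T g h (sh_obj T (D i)) \<cdot>\<^bsub>T\<^esub> act_mor T g (\<theta>' h i) \<cdot>\<^bsub>T\<^esub> \<theta>' g (\<rho> h i))
      = Fsh (Act T (g \<otimes>\<^bsub>G\<^esub> h)) (D i) \<cdot>\<^bsub>T\<^esub> (\<alpha> (g, h) (\<rho> g (\<rho> h i)) \<star>\<^bsub>T\<^esub> \<theta>' (g \<otimes>\<^bsub>G\<^esub> h) i)"
      using shift_system_equation[of g h "D i" "D (\<rho> h i)" "D (\<rho> g (\<rho> h i))" "\<theta> h i" "\<theta>' h i" "\<theta> g (\<rho> h i)" "\<theta>' g (\<rho> h i)"]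
        s(6)[OF g(1) h g(2), symmetric] by simp
    have "Eps T g h (sh_obj T (D i)) \<cdot>\<^bsub>T\<^esub> act_mor T g (\<theta>' h i) \<cdot>\<^bsub>T\<^esub> \<theta>' g (\<rho> h i)
      = \<alpha> (g, h) (\<rho> g (\<rho> h i)) \<star>\<^bsub>T\<^esub> \<theta>' (g \<otimes>\<^bsub>G\<^esub> h) i"
      by (rule is_iso_cancel(1)[OF Act_Fsh_iso _ _ *]) auto
    then show "\<alpha> (g, h) (\<rho> (g \<otimes>\<^bsub>G\<^esub> h) i) \<star>\<^bsub>T\<^esub> \<theta>' (g \<otimes>\<^bsub>G\<^esub> h) i =
        Eps T g h (sh_obj T (D i)) \<cdot>\<^bsub>T\<^esub> act_mor T g (\<theta>' h i) \<cdot>\<^bsub>T\<^esub> \<theta>' g (\<rho> h i)" by simp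
  qed auto
  then show ?thesis by (rule that)
qed

lemma system_unshift:
  assumes sys: "block_system n \<rho> \<alpha> (\<lambda>i. sh_obj T (D i)) \<theta>'" and D: "\<And>i. i \<in> {1..n} \<Longrightarrow> D i \<in> Obj T"
  obtains \<theta> where "block_system n \<rho> \<alpha> D \<theta>"
proof -
  define J where "J = {1..n}"
  note s = systemD[OF sys, folded J_def]
  note [simp] = D[folded J_def] s(3-5) rho(1)[folded J_def] alpha_closed[folded J_def]
  \<comment> \<open>A preimage under the full shift functor of what the system on the shifted
    objects prescribes.\<close>
  define \<theta> where "\<theta> g i = (SOME \<theta>. arr T \<theta> \<and> dm T \<theta> = D (\<rho> g i) \<and> cd T \<theta> = act_obj T g (D i) \<and>
      sh_mor T \<theta> = Fsh (Act T g) (D i) \<cdot>\<^bsub>T\<^esub> \<theta>' g i)" for g i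
  have \<theta> [simp]: "arr T (\<theta> g i)" "dm T (\<theta> g i) = D (\<rho> g i)" "cd T (\<theta> g i) = act_obj T g (D i)"
    and sh\<theta>: "sh_mor T (\<theta> g i) = Fsh (Act T g) (D i) \<cdot>\<^bsub>T\<^esub> \<theta>' g i"
    if [simp]: "g \<in> carrier G" "i \<in> J" for g i
  proof -
    have "arr T (Fsh (Act T g) (D i) \<cdot>\<^bsub>T\<^esub> \<theta>' g i)" "dm T (Fsh (Act T g) (D i) \<cdot>\<^bsub>T\<^esub> \<theta>' g i) = sh_obj T (D (\<rho> g i))"
      "cd T (Fsh (Act T g) (D i) \<cdot>\<^bsub>T\<^esub> \<theta>' g i) = sh_obj T (act_obj T g (D i))" by simp_all
    from Sh.full[OF this]
    have "\<exists>\<theta>. arr T \<theta> \<and> dm T \<theta> = D (\<rho> g i) \<and> cd T \<theta> = act_obj T g (D i) \<and>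
      sh_mor T \<theta> = Fsh (Act T g) (D i) \<cdot>\<^bsub>T\<^esub> \<theta>' g i" by (metis Act_simps(1) D[folded J_def] rho(1)[folded J_def] that)
    from someI_ex[OF this, folded \<theta>_def]
    show "arr T (\<theta> g i)" "dm T (\<theta> g i) = D (\<rho> g i)" "cd T (\<theta> g i) = act_obj T g (D i)"
      "sh_mor T (\<theta> g i) = Fsh (Act T g) (D i) \<cdot>\<^bsub>T\<^esub> \<theta>' g i" by auto
  qed
  have "block_system n \<rho> \<alpha> D \<theta>"
    unfolding block_system_def J_def[symmetric]
  proof (intro conjI ballI)
    fix g i assume g [simp]: "g \<in> carrier G" "i \<in> J"
    have "is_iso T (sh_obj T (D (\<rho> g i))) (sh_obj T (act_obj T g (D i))) (sh_mor T (\<theta> g i))"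
      unfolding sh\<theta>[OF g] by (rule is_iso_Comp[OF s(2) Act_Fsh_iso]) auto
    then show "is_iso T (D (\<rho> g i)) (act_obj T g (D i)) (\<theta> g i)"
      by (rule Sh.reflects_iso) auto
    fix h assume h [simp]: "h \<in> carrier G"
    have "sh_mor T (Eps T g h (D i) \<cdot>\<^bsub>T\<^esub> act_mor T g (\<theta> h i) \<cdot>\<^bsub>T\<^esub> \<theta> g (\<rho> h i))
      = Fsh (Act T (g \<otimes>\<^bsub>G\<^esub> h)) (D i) \<cdot>\<^bsub>T\<^esub> (\<alpha> (g, h) (\<rho> g (\<rho> h i)) \<star>\<^bsub>T\<^esub> \<theta>' (g \<otimes>\<^bsub>G\<^esub> h) i)"
      using shift_system_equation[of g h "D i" "D (\<rho> h i)" "D (\<rho> g (\<rho> h i))" "\<theta> h i" "\<theta>' h i" "\<theta> g (\<rho> h i)" "\<theta>' g (\<rho> h i)"]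
        s(6)[OF g(1) h g(2)] sh\<theta> by simp
    also have "\<dots> = sh_mor T (\<alpha> (g, h) (\<rho> g (\<rho> h i)) \<star>\<^bsub>T\<^esub> \<theta> (g \<otimes>\<^bsub>G\<^esub> h) i)"
      using sh\<theta>[of "g \<otimes>\<^bsub>G\<^esub> h" i] by simp
    finally have "Eps T g h (D i) \<cdot>\<^bsub>T\<^esub> act_mor T g (\<theta> h i) \<cdot>\<^bsub>T\<^esub> \<theta> g (\<rho> h i) = \<alpha> (g, h) (\<rho> g (\<rho> h i)) \<star>\<^bsub>T\<^esub> \<theta> (g \<otimes>\<^bsub>G\<^esub> h) i"
      by (rule Sh.faithful) auto
    then show "\<alpha> (g, h) (\<rho> (g \<otimes>\<^bsub>G\<^esub> h) i) \<star>\<^bsub>T\<^esub> \<theta> (g \<otimes>\<^bsub>G\<^esub> h) i =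
        Eps T g h (D i) \<cdot>\<^bsub>T\<^esub> act_mor T g (\<theta> h i) \<cdot>\<^bsub>T\<^esub> \<theta> g (\<rho> h i)" by simp
  qed auto
  then show ?thesis by (rule that)
qed

lemma system_shift_by:
  assumes sys: "block_system n \<rho> \<alpha> E \<theta>"
  shows "\<exists>\<theta>'. block_system n \<rho> \<alpha> (\<lambda>i. shift_by T j (E i)) \<theta>'"
proof (induction j rule: int_step_induct)
  case zero
  then show ?case using sys by auto
next
  case (up j)
  then obtain \<theta>' where "block_system n \<rho> \<alpha> (\<lambda>i. shift_by T j (E i)) \<theta>'" by blast
  then obtain \<theta>'' where 1: "block_system n \<rho> \<alpha> (\<lambda>i. sh_obj T (shift_by T j (E i))) \<theta>''" by (rule system_shift)
  show ?case
    by (rule system_iso[OF 1, of "\<lambda>i. shift_by T (j + 1) (E i)"])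
      (use systemD(1)[OF sys] shift_by_step in auto)
next
  case (down j)
  then obtain \<theta>' where 1: "block_system n \<rho> \<alpha> (\<lambda>i. shift_by T (j + 1) (E i)) \<theta>'" by blast
  obtain \<theta>'' where "block_system n \<rho> \<alpha> (\<lambda>i. sh_obj T (shift_by T j (E i))) \<theta>''"
    by (rule system_iso[OF 1, of "\<lambda>i. sh_obj T (shift_by T j (E i))"])
      (use systemD(1)[OF sys] shift_by_step isomorphic_sym in auto)
  then show ?case by (rule system_unshift) (use systemD(1)[OF sys] in auto)
qed

text \<open>Orthogonality makes \<open>\<Theta> g\<close> monomial with respect to the decomposition
  of \<open>S\<close>: it sends the summand of index \<open>\<rho> g i\<close> into the translate of
  the summand of index \<open>i\<close>. Restricting the cocycle equation to one summand then gives
  it in components.\<close>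

lemma system_from_twisting:
  assumes blk: "tri_block K T {1..n} P \<kappa>" and E: "\<And>i. P i 0 = E i"
    and act: "\<And>g i. \<lbrakk>g \<in> carrier G; i \<in> {1..n}\<rbrakk> \<Longrightarrow> isomorphic T (act_obj T g (E i)) (E (\<rho> g i))"
    and tw: "twisting_cocycle K G T n E \<alpha>"
  obtains \<theta> where "block_system n \<rho> \<alpha> E \<theta>"
proof -
  define J where "J = {1..n}"
  interpret B: tri_block K T "{1..n}" P \<kappa> by (rule blk)
  have E_Obj [simp]: "E i \<in> Obj T" if "i \<in> J" for i using B.P_Obj[of i 0] that E J_def by simp
  obtain S \<iota> \<pi> \<Theta> where S: "direct_sum T {1..n} E S \<iota> \<pi>"
    and Th: "\<And>g. g \<in> carrier G \<Longrightarrow> is_iso T S (act_obj T g S) (\<Theta> g)"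
    and eq: "\<And>g h. \<lbrakk>g \<in> carrier G; h \<in> carrier G\<rbrakk> \<Longrightarrow>
        \<Theta> (g \<otimes>\<^bsub>G\<^esub> h) \<cdot>\<^bsub>T\<^esub> diagonal T n S \<iota> \<pi> (\<alpha> (g, h)) = Eps T g h S \<cdot>\<^bsub>T\<^esub> act_mor T g (\<Theta> h) \<cdot>\<^bsub>T\<^esub> \<Theta> g"
    using tw unfolding twisting_cocycle_def by blast
  have E': "\<forall>i \<in> {1..n}. E i \<in> Obj T" unfolding J_def[symmetric] by simp
  note d = direct_sumD[OF S E', folded J_def]
  note dg = diagonal_Comp[OF S E', folded J_def]
  note [simp] = d(1,3-9) rho(1)[folded J_def] alpha_closed[folded J_def]
  have [simp]: "arr T (\<Theta> g)" "dm T (\<Theta> g) = S" "cd T (\<Theta> g) = act_obj T g S" if "g \<in> carrier G" for g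
    using is_iso_inverse(1-3)[OF Th[OF that]] that by auto
  define \<theta> where "\<theta> g i = act_mor T g (\<pi> i) \<cdot>\<^bsub>T\<^esub> \<Theta> g \<cdot>\<^bsub>T\<^esub> \<iota> (\<rho> g i)" for g i
  have \<theta> [simp]: "arr T (\<theta> g i)" "dm T (\<theta> g i) = E (\<rho> g i)" "cd T (\<theta> g i) = act_obj T g (E i)"
    if "g \<in> carrier G" "i \<in> J" for g i
    using that by (simp_all add: \<theta>_def)
  have inj: "i = j" if "\<rho> g i = \<rho> g j" "g \<in> carrier G" for g i j
    using permutes_inj[OF sym_hom(3)[OF rho_hom that(2)]] that(1) by (auto dest: injD)
  \<comment> \<open>The monomial shape of \<open>\<Theta> g\<close>: the columns are compared after
    each translated projection.\<close>
  have comp: "\<Theta> g \<cdot>\<^bsub>T\<^esub> \<iota> (\<rho> g i) = act_mor T g (\<iota> i) \<cdot>\<^bsub>T\<^esub> \<theta> g i" if g [simp]: "g \<in> carrier G" "i \<in> J" for g i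
  proof -
    interpret A: sh_functor K "\<sigma> g" T T "Act T g" by (rule Act_sh_functor[OF g(1)])
    show ?thesis
    proof (rule A.F_jointly_monic[OF S _ E'])
      fix j assume "j \<in> {1..n}"
      then have j [simp]: "j \<in> J" by (simp add: J_def)
      show "act_mor T g (\<pi> j) \<cdot>\<^bsub>T\<^esub> \<Theta> g \<cdot>\<^bsub>T\<^esub> \<iota> (\<rho> g i) = act_mor T g (\<pi> j) \<cdot>\<^bsub>T\<^esub> act_mor T g (\<iota> i) \<cdot>\<^bsub>T\<^esub> \<theta> g i"
      proof (cases "i = j")
        case True
        have "act_mor T g (\<pi> i) \<cdot>\<^bsub>T\<^esub> act_mor T g (\<iota> i) = Id T (act_obj T g (E i))"
          using Act_simps(6)[OF g(1), of "\<iota> i" "\<pi> i"] by simp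
        from Comp_reduce[OF this, of "\<theta> g i"] show ?thesis using True by (simp add: \<theta>_def)
      next
        case False
        have "act_mor T g (\<pi> j) \<cdot>\<^bsub>T\<^esub> act_mor T g (\<iota> i) = zer T (act_obj T g (E i)) (act_obj T g (E j))"
          using Act_simps(6)[OF g(1), of "\<iota> i" "\<pi> j"] d(10)[OF g(2) j False] by simp
        from Comp_reduce[OF this, of "\<theta> g i"]
        have r: "act_mor T g (\<pi> j) \<cdot>\<^bsub>T\<^esub> act_mor T g (\<iota> i) \<cdot>\<^bsub>T\<^esub> \<theta> g i = zer T (E (\<rho> g i)) (act_obj T g (E j))" by simp
        obtain e where e: "is_iso T (act_obj T g (E j)) (E (\<rho> g j)) e"
          using act[OF g(1), of j] unfolding isomorphic_def J_def[symmetric] by auto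
        have e' [simp]: "arr T e" "dm T e = act_obj T g (E j)" "cd T e = E (\<rho> g j)"
          using is_iso_inverse(1-3)[OF e] by auto
        \<comment> \<open>Off the diagonal, the translate of \<open>E j\<close> is identified with
          \<open>E (\<rho> g j)\<close>, whose index differs from \<open>\<rho> g i\<close> since
          \<open>\<rho> g\<close> is injective.\<close>
        have z: "e \<cdot>\<^bsub>T\<^esub> act_mor T g (\<pi> j) \<cdot>\<^bsub>T\<^esub> \<Theta> g \<cdot>\<^bsub>T\<^esub> \<iota> (\<rho> g i) = zer T (E (\<rho> g i)) (E (\<rho> g j))"
          by (rule B.P_orth[where j = 0 and l = 0, unfolded E, folded J_def]) (use inj[OF _ g(1)] False in auto)
        have "act_mor T g (\<pi> j) \<cdot>\<^bsub>T\<^esub> \<Theta> g \<cdot>\<^bsub>T\<^esub> \<iota> (\<rho> g i) = zer T (E (\<rho> g i)) (act_obj T g (E j))"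
          by (rule is_iso_cancel(1)[OF e]) (use z in auto)
        then show ?thesis using r by simp
      qed
    qed (use g E_Obj in \<open>auto simp: J_def[symmetric]\<close>)
  qed
  have "block_system n \<rho> \<alpha> E \<theta>"
    unfolding block_system_def J_def[symmetric]
  proof (intro conjI ballI)
    fix g i assume g [simp]: "g \<in> carrier G" "i \<in> J"
    obtain e where e: "is_iso T (act_obj T g (E i)) (E (\<rho> g i)) e"
      using act[OF g(1), of i] unfolding isomorphic_def J_def[symmetric] by auto
    note [simp] = is_iso_inverse[OF e Act_simps(1)[OF g(1) E_Obj[OF g(2)]] E_Obj, simplified]
    obtain c where c: "c \<in> carrier K" "e \<cdot>\<^bsub>T\<^esub> \<theta> g i = c \<star>\<^bsub>T\<^esub> Id T (E (\<rho> g i))"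
      using B.P_End[of "\<rho> g i" "e \<cdot>\<^bsub>T\<^esub> \<theta> g i" 0, unfolded E, folded J_def] by auto
    have \<theta>c: "\<theta> g i = c \<star>\<^bsub>T\<^esub> inv_mor T e"
      by (rule is_iso_cancel(1)[OF e]) (use c in auto)
    \<comment> \<open>Otherwise the isomorphism \<open>\<Theta> g\<close> would kill the inclusion
      of a nonzero summand.\<close>
    have "c \<noteq> \<zero>\<^bsub>K\<^esub>"
    proof
      assume "c = \<zero>\<^bsub>K\<^esub>"
      then have "\<theta> g i = zer T (E (\<rho> g i)) (act_obj T g (E i))" using \<theta>c by simp
      then have "\<Theta> g \<cdot>\<^bsub>T\<^esub> \<iota> (\<rho> g i) = \<Theta> g \<cdot>\<^bsub>T\<^esub> zer T (E (\<rho> g i)) S" using comp[OF g] by simp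
      then have "\<iota> (\<rho> g i) = zer T (E (\<rho> g i)) S" by (rule is_iso_cancel(1)[OF Th[OF g(1)], rotated 2]) auto
      then have "Id T (E (\<rho> g i)) = zer T (E (\<rho> g i)) (E (\<rho> g i))" using d(9)[of "\<rho> g i"] by simp
      then show False using B.P_nonzero[of "\<rho> g i" 0, unfolded E, folded J_def] by simp
    qed
    then show "is_iso T (E (\<rho> g i)) (act_obj T g (E i)) (\<theta> g i)"
      unfolding \<theta>c by (intro is_iso_scale is_iso_inv[OF e] c) auto
    fix h assume h [simp]: "h \<in> carrier G"
    have c1: "act_mor T g (\<Theta> h) \<cdot>\<^bsub>T\<^esub> act_mor T g (\<iota> (\<rho> h i)) = act_mor T g (act_mor T h (\<iota> i)) \<cdot>\<^bsub>T\<^esub> act_mor T g (\<theta> h i)"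
      using arg_cong[OF comp[OF h g(2)], of "act_mor T g"] by simp
    have c2: "Eps T g h S \<cdot>\<^bsub>T\<^esub> act_mor T g (act_mor T h (\<iota> i)) = act_mor T (g \<otimes>\<^bsub>G\<^esub> h) (\<iota> i) \<cdot>\<^bsub>T\<^esub> Eps T g h (E i)"
      by (rule Eps_natural) auto
    have dgk: "diagonal T n S \<iota> \<pi> (\<alpha> (g, h)) \<cdot>\<^bsub>T\<^esub> \<iota> (\<rho> g (\<rho> h i)) = \<alpha> (g, h) (\<rho> g (\<rho> h i)) \<star>\<^bsub>T\<^esub> \<iota> (\<rho> g (\<rho> h i))"
      and dgt [simp]: "arr T (diagonal T n S \<iota> \<pi> (\<alpha> (g, h)))" "dm T (diagonal T n S \<iota> \<pi> (\<alpha> (g, h))) = S"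
        "cd T (diagonal T n S \<iota> \<pi> (\<alpha> (g, h))) = S"
      using dg[of "\<alpha> (g, h)" "\<rho> g (\<rho> h i)"] by simp_all
    \<comment> \<open>Both sides of the equation on \<open>S\<close> are restricted to the summand
      of index \<open>\<rho> g (\<rho> h i)\<close>. The diagonal automorphism acts first, so its
      entry at that index appears, and not the one at \<open>i\<close>.\<close>
    have "act_mor T (g \<otimes>\<^bsub>G\<^esub> h) (\<iota> i) \<cdot>\<^bsub>T\<^esub> (\<alpha> (g, h) (\<rho> g (\<rho> h i)) \<star>\<^bsub>T\<^esub> \<theta> (g \<otimes>\<^bsub>G\<^esub> h) i)
      = \<alpha> (g, h) (\<rho> g (\<rho> h i)) \<star>\<^bsub>T\<^esub> \<Theta> (g \<otimes>\<^bsub>G\<^esub> h) \<cdot>\<^bsub>T\<^esub> \<iota> (\<rho> g (\<rho> h i))"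
      using comp[of "g \<otimes>\<^bsub>G\<^esub> h" i] by simp
    also have "\<dots> = (\<Theta> (g \<otimes>\<^bsub>G\<^esub> h) \<cdot>\<^bsub>T\<^esub> diagonal T n S \<iota> \<pi> (\<alpha> (g, h))) \<cdot>\<^bsub>T\<^esub> \<iota> (\<rho> g (\<rho> h i))"
      by (simp add: dgk)
    also have "\<dots> = Eps T g h S \<cdot>\<^bsub>T\<^esub> act_mor T g (\<Theta> h) \<cdot>\<^bsub>T\<^esub> act_mor T g (\<iota> (\<rho> h i)) \<cdot>\<^bsub>T\<^esub> \<theta> g (\<rho> h i)"
      unfolding eq[OF g(1) h] using comp[of g "\<rho> h i"] by simp
    also have "\<dots> = Eps T g h S \<cdot>\<^bsub>T\<^esub> act_mor T g (act_mor T h (\<iota> i)) \<cdot>\<^bsub>T\<^esub> act_mor T g (\<theta> h i) \<cdot>\<^bsub>T\<^esub> \<theta> g (\<rho> h i)"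
      by (simp add: Comp_reduce[OF c1])
    also have "\<dots> = act_mor T (g \<otimes>\<^bsub>G\<^esub> h) (\<iota> i) \<cdot>\<^bsub>T\<^esub> (Eps T g h (E i) \<cdot>\<^bsub>T\<^esub> act_mor T g (\<theta> h i) \<cdot>\<^bsub>T\<^esub> \<theta> g (\<rho> h i))"
      by (simp add: Comp_reduce[OF c2])
    finally have *: "act_mor T (g \<otimes>\<^bsub>G\<^esub> h) (\<iota> i) \<cdot>\<^bsub>T\<^esub> (\<alpha> (g, h) (\<rho> g (\<rho> h i)) \<star>\<^bsub>T\<^esub> \<theta> (g \<otimes>\<^bsub>G\<^esub> h) i)
      = act_mor T (g \<otimes>\<^bsub>G\<^esub> h) (\<iota> i) \<cdot>\<^bsub>T\<^esub> (Eps T g h (E i) \<cdot>\<^bsub>T\<^esub> act_mor T g (\<theta> h i) \<cdot>\<^bsub>T\<^esub> \<theta> g (\<rho> h i))" .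
    have \<pi>\<iota>: "act_mor T (g \<otimes>\<^bsub>G\<^esub> h) (\<pi> i) \<cdot>\<^bsub>T\<^esub> act_mor T (g \<otimes>\<^bsub>G\<^esub> h) (\<iota> i) = Id T (act_obj T (g \<otimes>\<^bsub>G\<^esub> h) (E i))"
      using Act_simps(6)[of "g \<otimes>\<^bsub>G\<^esub> h" "\<iota> i" "\<pi> i"] by simp
    show "\<alpha> (g, h) (\<rho> (g \<otimes>\<^bsub>G\<^esub> h) i) \<star>\<^bsub>T\<^esub> \<theta> (g \<otimes>\<^bsub>G\<^esub> h) i =
        Eps T g h (E i) \<cdot>\<^bsub>T\<^esub> act_mor T g (\<theta> h i) \<cdot>\<^bsub>T\<^esub> \<theta> g (\<rho> h i)"
      using arg_cong[OF *, of "\<lambda>x. act_mor T (g \<otimes>\<^bsub>G\<^esub> h) (\<pi> i) \<cdot>\<^bsub>T\<^esub> x"] by (simp add: Comp_reduce[OF \<pi>\<iota>])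
  qed auto
  then show ?thesis by (rule that)
qed

end

section \<open>Equivariance on a block\<close>

lemma sh_trans_postcomp:
  assumes "sh_functor K s T U A" "sh_functor K s T U B" "sh_functor K t U V F" and \<eta>: "sh_trans T U A B \<eta>"
  shows "sh_trans T V (comp_exact V F A) (comp_exact V F B) (\<lambda>X. On_mor F (\<eta> X))"
proof -
  interpret A: sh_functor K s T U A by fact
  interpret B: sh_functor K s T U B by fact
  interpret F: sh_functor K t U V F by fact
  have h [simp]: "X \<in> Obj T \<Longrightarrow> arr U (\<eta> X)" "X \<in> Obj T \<Longrightarrow> dm U (\<eta> X) = On_obj A X"
    "X \<in> Obj T \<Longrightarrow> cd U (\<eta> X) = On_obj B X" for X
    using \<eta> unfolding sh_trans_def by auto
  show ?thesis
    unfolding sh_trans_def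
  proof (intro conjI ballI allI impI)
    fix f assume f: "arr T f"
    have "\<eta> (cd T f) \<cdot>\<^bsub>U\<^esub> On_mor A f = On_mor B f \<cdot>\<^bsub>U\<^esub> \<eta> (dm T f)" using \<eta> f unfolding sh_trans_def by blast
    then show "On_mor F (\<eta> (cd T f)) \<cdot>\<^bsub>V\<^esub> On_mor (comp_exact V F A) f = On_mor (comp_exact V F B) f \<cdot>\<^bsub>V\<^esub> On_mor F (\<eta> (dm T f))"
      using f F.F_Comp[of "On_mor A f" "\<eta> (cd T f)"] F.F_Comp[of "\<eta> (dm T f)" "On_mor B f"] by (simp add: comp_exact_def)
  next
    fix X assume X: "X \<in> Obj T"
    have "Fsh B X \<cdot>\<^bsub>U\<^esub> \<eta> (sh_obj T X) = sh_mor U (\<eta> X) \<cdot>\<^bsub>U\<^esub> Fsh A X" using \<eta> X unfolding sh_trans_def by blast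
    then have 1: "On_mor F (Fsh B X) \<cdot>\<^bsub>V\<^esub> On_mor F (\<eta> (sh_obj T X)) = On_mor F (sh_mor U (\<eta> X)) \<cdot>\<^bsub>V\<^esub> On_mor F (Fsh A X)"
      using X F.F_Comp[of "\<eta> (sh_obj T X)" "Fsh B X"] F.F_Comp[of "Fsh A X" "sh_mor U (\<eta> X)"] by simp
    have 2: "Fsh F (On_obj B X) \<cdot>\<^bsub>V\<^esub> On_mor F (sh_mor U (\<eta> X)) = sh_mor V (On_mor F (\<eta> X)) \<cdot>\<^bsub>V\<^esub> Fsh F (On_obj A X)"
      by (rule F.Fsh_natural) (use X in auto)
    show "Fsh (comp_exact V F B) X \<cdot>\<^bsub>V\<^esub> On_mor F (\<eta> (sh_obj T X)) = sh_mor V (On_mor F (\<eta> X)) \<cdot>\<^bsub>V\<^esub> Fsh (comp_exact V F A) X"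
      using X 1 F.U.Comp_reduce[OF 2, of "On_mor F (Fsh A X)"] by (simp add: comp_exact_def)
  qed (auto simp: comp_exact_def)
qed

lemma sh_trans_precomp:
  assumes "sh_functor K s U V A" "sh_functor K s U V B" "sh_functor K t T U H" and \<eta>: "sh_trans U V A B \<eta>"
  shows "sh_trans T V (comp_exact V A H) (comp_exact V B H) (\<lambda>X. \<eta> (On_obj H X))"
proof -
  interpret A: sh_functor K s U V A by fact
  interpret B: sh_functor K s U V B by fact
  interpret H: sh_functor K t T U H by fact
  have h [simp]: "X \<in> Obj U \<Longrightarrow> arr V (\<eta> X)" "X \<in> Obj U \<Longrightarrow> dm V (\<eta> X) = On_obj A X"
    "X \<in> Obj U \<Longrightarrow> cd V (\<eta> X) = On_obj B X" for X
    using \<eta> unfolding sh_trans_def by auto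
  have n: "\<eta> (cd U f) \<cdot>\<^bsub>V\<^esub> On_mor A f = On_mor B f \<cdot>\<^bsub>V\<^esub> \<eta> (dm U f)" if "arr U f" for f
    using \<eta> that unfolding sh_trans_def by blast
  show ?thesis
    unfolding sh_trans_def
  proof (intro conjI ballI allI impI)
    fix f assume f: "arr T f"
    show "\<eta> (On_obj H (cd T f)) \<cdot>\<^bsub>V\<^esub> On_mor (comp_exact V A H) f = On_mor (comp_exact V B H) f \<cdot>\<^bsub>V\<^esub> \<eta> (On_obj H (dm T f))"
      using f n[of "On_mor H f"] by (simp add: comp_exact_def)
  next
    fix X assume X: "X \<in> Obj T"
    have 1: "Fsh B (On_obj H X) \<cdot>\<^bsub>V\<^esub> \<eta> (sh_obj U (On_obj H X)) = sh_mor V (\<eta> (On_obj H X)) \<cdot>\<^bsub>V\<^esub> Fsh A (On_obj H X)"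
      using \<eta> X unfolding sh_trans_def by simp
    show "Fsh (comp_exact V B H) X \<cdot>\<^bsub>V\<^esub> \<eta> (On_obj H (sh_obj T X)) = sh_mor V (\<eta> (On_obj H X)) \<cdot>\<^bsub>V\<^esub> Fsh (comp_exact V A H) X"
      using X n[of "Fsh H X"] A.U.Comp_reduce[OF 1, of "On_mor A (Fsh H X)"] by (simp add: comp_exact_def)
  qed (auto simp: comp_exact_def)
qed

lemma sh_trans_cong:
  assumes "sh_trans T U F H \<eta>"
    and "On_obj F = On_obj F'" "On_mor F = On_mor F'" "\<And>X. X \<in> Obj T \<Longrightarrow> Fsh F X = Fsh F' X"
    and "On_obj H = On_obj H'" "On_mor H = On_mor H'" "\<And>X. X \<in> Obj T \<Longrightarrow> Fsh H X = Fsh H' X"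
  shows "sh_trans T U F' H' \<eta>"
  using assms unfolding sh_trans_def by simp

lemma comp_exact_assoc:
  assumes "sh_functor K s T U F" "sh_functor K t U V H" "sh_functor K r V W L"
  shows "On_obj (comp_exact W L (comp_exact V H F)) = On_obj (comp_exact W (comp_exact W L H) F)"
    "On_mor (comp_exact W L (comp_exact V H F)) = On_mor (comp_exact W (comp_exact W L H) F)"
    "X \<in> Obj T \<Longrightarrow> Fsh (comp_exact W L (comp_exact V H F)) X = Fsh (comp_exact W (comp_exact W L H) F) X"
proof -
  interpret F: sh_functor K s T U F by fact
  interpret H: sh_functor K t U V H by fact
  interpret L: sh_functor K r V W L by fact
  show "On_obj (comp_exact W L (comp_exact V H F)) = On_obj (comp_exact W (comp_exact W L H) F)"
    "On_mor (comp_exact W L (comp_exact V H F)) = On_mor (comp_exact W (comp_exact W L H) F)"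
    "X \<in> Obj T \<Longrightarrow> Fsh (comp_exact W L (comp_exact V H F)) X = Fsh (comp_exact W (comp_exact W L H) F) X"
    by (auto simp: comp_exact_def)
qed

lemma (in triangulated_category_with_action) Eps_sh_trans:
  assumes "g \<in> carrier G" "h \<in> carrier G"
  shows "sh_trans T T (comp_exact T (Act T g) (Act T h)) (Act T (g \<otimes>\<^bsub>G\<^esub> h)) (Eps T g h)"
  unfolding sh_trans_def using assms Eps_natural Eps_shift by (simp add: comp_exact_def)

text \<open>Used in both directions of the classification: with \<open>D2\<close> the second block
  itself when an equivalence is constructed, and with \<open>D2\<close> a shift of it when the
  equivalence is given.\<close>

locale equivariant_comparison =
  T: action_data K G \<sigma> T n \<rho>1 \<alpha>1 + U: action_data K G \<sigma> U n \<rho>2 \<alpha>2 + F: sh_functor K "\<lambda>c. c" T U F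
  for K :: "'k ring" and G :: "'g monoid" and \<sigma> :: "'g \<Rightarrow> 'k \<Rightarrow> 'k" and n :: nat
    and T :: "('g, 'o1, 'm1, 'k) gtricat" and \<rho>1 :: "'g \<Rightarrow> nat \<Rightarrow> nat" and \<alpha>1 :: "'g \<times> 'g \<Rightarrow> nat \<Rightarrow> 'k"
    and U :: "('g, 'o2, 'm2, 'k) gtricat" and \<rho>2 :: "'g \<Rightarrow> nat \<Rightarrow> nat" and \<alpha>2 :: "'g \<times> 'g \<Rightarrow> nat \<Rightarrow> 'k"
    and F :: "('o1, 'm1, 'o2, 'm2) exfunctr" +
  fixes D1 :: "nat \<Rightarrow> 'o1" and \<theta>1 :: "'g \<Rightarrow> nat \<Rightarrow> 'm1" and D2 :: "nat \<Rightarrow> 'o2" and \<theta>2 :: "'g \<Rightarrow> nat \<Rightarrow> 'm2"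
    and \<tau> :: "nat \<Rightarrow> nat" and \<psi> :: "nat \<Rightarrow> 'm2"
  assumes sys1: "T.block_system n \<rho>1 \<alpha>1 D1 \<theta>1" and sys2: "U.block_system n \<rho>2 \<alpha>2 D2 \<theta>2"
    and tau [simp]: "i \<in> {1..n} \<Longrightarrow> \<tau> i \<in> {1..n}"
    and tau_rho: "\<lbrakk>g \<in> carrier G; i \<in> {1..n}\<rbrakk> \<Longrightarrow> \<tau> (\<rho>1 g i) = \<rho>2 g (\<tau> i)"
    and psi: "i \<in> {1..n} \<Longrightarrow> is_iso U (On_obj F (D1 i)) (D2 (\<tau> i)) (\<psi> i)"
    and nonzero: "i \<in> {1..n} \<Longrightarrow> Id U (D2 i) \<noteq> zer U (D2 i) (D2 i)"
begin

definition J where "J = {1..n}"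

lemma J_simps [simp]:
  "i \<in> J \<Longrightarrow> \<tau> i \<in> J" "\<lbrakk>g \<in> carrier G; i \<in> J\<rbrakk> \<Longrightarrow> \<rho>1 g i \<in> J" "\<lbrakk>g \<in> carrier G; i \<in> J\<rbrakk> \<Longrightarrow> \<rho>2 g i \<in> J"
  "\<lbrakk>g \<in> carrier G; h \<in> carrier G; i \<in> J\<rbrakk> \<Longrightarrow> \<alpha>1 (g, h) i \<in> carrier K"
  "\<lbrakk>g \<in> carrier G; h \<in> carrier G; i \<in> J\<rbrakk> \<Longrightarrow> \<alpha>2 (g, h) i \<in> carrier K"
  "\<lbrakk>g \<in> carrier G; i \<in> J\<rbrakk> \<Longrightarrow> \<tau> (\<rho>1 g i) = \<rho>2 g (\<tau> i)"
  unfolding J_def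
  by (rule tau T.rho(1) U.rho(1) T.alpha_closed(1) U.alpha_closed(1) tau_rho; assumption)+

lemmas s1 = T.systemD[OF sys1, folded J_def] and s2 = U.systemD[OF sys2, folded J_def]
lemmas [simp] = s1(1,3-5) s2(1,3-5)

lemma psi_simps [simp]:
  assumes "i \<in> J"
  shows "arr U (\<psi> i)" "dm U (\<psi> i) = On_obj F (D1 i)" "cd U (\<psi> i) = D2 (\<tau> i)"
    "arr U (inv_mor U (\<psi> i))" "dm U (inv_mor U (\<psi> i)) = D2 (\<tau> i)" "cd U (inv_mor U (\<psi> i)) = On_obj F (D1 i)"
    "inv_mor U (\<psi> i) \<cdot>\<^bsub>U\<^esub> \<psi> i = Id U (On_obj F (D1 i))" "\<psi> i \<cdot>\<^bsub>U\<^esub> inv_mor U (\<psi> i) = Id U (D2 (\<tau> i))"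
    "\<lbrakk>arr U h; cd U h = On_obj F (D1 i)\<rbrakk> \<Longrightarrow> inv_mor U (\<psi> i) \<cdot>\<^bsub>U\<^esub> \<psi> i \<cdot>\<^bsub>U\<^esub> h = h"
    "\<lbrakk>arr U h; cd U h = D2 (\<tau> i)\<rbrakk> \<Longrightarrow> \<psi> i \<cdot>\<^bsub>U\<^esub> inv_mor U (\<psi> i) \<cdot>\<^bsub>U\<^esub> h = h"
  using U.is_iso_inverse[OF psi[folded J_def, OF assms]] assms by auto

text \<open>The system \<open>\<theta>2\<close> transported along \<psi>. It is the reference
  isomorphism against which the image of \<open>\<theta>1\<close> followed by an equivariant
  structure is measured by a scalar.\<close>

definition V :: "'g \<Rightarrow> nat \<Rightarrow> 'm2"
  where "V g i = act_mor U g (inv_mor U (\<psi> i)) \<cdot>\<^bsub>U\<^esub> \<theta>2 g (\<tau> i) \<cdot>\<^bsub>U\<^esub> \<psi> (\<rho>1 g i)"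

lemma V_iso:
  assumes [simp]: "g \<in> carrier G" "i \<in> J"
  shows "is_iso U (On_obj F (D1 (\<rho>1 g i))) (act_obj U g (On_obj F (D1 i))) (V g i)"
proof -
  have 1: "is_iso U (On_obj F (D1 (\<rho>1 g i))) (D2 (\<rho>2 g (\<tau> i))) (\<psi> (\<rho>1 g i))"
    using psi[folded J_def, of "\<rho>1 g i"] by simp
  have 2: "is_iso U (act_obj U g (D2 (\<tau> i))) (act_obj U g (On_obj F (D1 i))) (act_mor U g (inv_mor U (\<psi> i)))"
    by (rule U.Act_iso[OF _ U.is_iso_inv[OF psi[folded J_def]]]) auto
  show ?thesis
    unfolding V_def
    by (rule U.is_iso_Comp[OF U.is_iso_Comp[OF 1 s2(2)] 2, simplified])
qed

lemma V_simps [simp]: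
  assumes "g \<in> carrier G" "i \<in> J"
  shows "arr U (V g i)" "dm U (V g i) = On_obj F (D1 (\<rho>1 g i))" "cd U (V g i) = act_obj U g (On_obj F (D1 i))"
  using U.is_iso_inverse(1-3)[OF V_iso[OF assms]] assms by auto

lemma V_cocycle:
  assumes [simp]: "g \<in> carrier G" "h \<in> carrier G" "i \<in> J"
  shows "Eps U g h (On_obj F (D1 i)) \<cdot>\<^bsub>U\<^esub> act_mor U g (V h i) \<cdot>\<^bsub>U\<^esub> V g (\<rho>1 h i)
    = \<alpha>2 (g, h) (\<rho>2 g (\<rho>2 h (\<tau> i))) \<star>\<^bsub>U\<^esub> V (g \<otimes>\<^bsub>G\<^esub> h) i"
proof -
  have pp: "act_mor U g (\<psi> (\<rho>1 h i)) \<cdot>\<^bsub>U\<^esub> act_mor U g (inv_mor U (\<psi> (\<rho>1 h i))) = Id U (act_obj U g (D2 (\<rho>2 h (\<tau> i))))"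
    using U.Act_simps(6)[OF assms(1), of "inv_mor U (\<psi> (\<rho>1 h i))" "\<psi> (\<rho>1 h i)"] by simp
  have E: "Eps U g h (On_obj F (D1 i)) \<cdot>\<^bsub>U\<^esub> act_mor U g (act_mor U h (inv_mor U (\<psi> i)))
    = act_mor U (g \<otimes>\<^bsub>G\<^esub> h) (inv_mor U (\<psi> i)) \<cdot>\<^bsub>U\<^esub> Eps U g h (D2 (\<tau> i))"
    by (rule U.Eps_natural) auto
  have "Eps U g h (On_obj F (D1 i)) \<cdot>\<^bsub>U\<^esub> act_mor U g (V h i) \<cdot>\<^bsub>U\<^esub> V g (\<rho>1 h i)
    = act_mor U (g \<otimes>\<^bsub>G\<^esub> h) (inv_mor U (\<psi> i)) \<cdot>\<^bsub>U\<^esub>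
      (Eps U g h (D2 (\<tau> i)) \<cdot>\<^bsub>U\<^esub> act_mor U g (\<theta>2 h (\<tau> i)) \<cdot>\<^bsub>U\<^esub> \<theta>2 g (\<rho>2 h (\<tau> i))) \<cdot>\<^bsub>U\<^esub> \<psi> (\<rho>1 g (\<rho>1 h i))"
    unfolding V_def by (simp add: U.Comp_reduce[OF pp] U.Comp_reduce[OF E])
  also have "\<dots> = \<alpha>2 (g, h) (\<rho>2 g (\<rho>2 h (\<tau> i))) \<star>\<^bsub>U\<^esub> V (g \<otimes>\<^bsub>G\<^esub> h) i"
    unfolding s2(6)[OF assms(1,2) J_simps(1)[OF assms(3)], symmetric] V_def by simp
  finally show ?thesis .
qed

text \<open>On the block, equivariance of \<open>\<beta>\<close> amounts to \<open>\<alpha>1\<close> and \<open>\<alpha>2\<close> being cohomologous via \<open>c\<close>.\<close>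

lemma equivariance_iff:
  assumes b: "\<And>g X. \<lbrakk>g \<in> carrier G; X \<in> Obj T\<rbrakk> \<Longrightarrow> arr U (\<beta> g X)"
    "\<And>g X. \<lbrakk>g \<in> carrier G; X \<in> Obj T\<rbrakk> \<Longrightarrow> dm U (\<beta> g X) = On_obj F (act_obj T g X)"
    "\<And>g X. \<lbrakk>g \<in> carrier G; X \<in> Obj T\<rbrakk> \<Longrightarrow> cd U (\<beta> g X) = act_obj U g (On_obj F X)"
    and nat: "\<And>g f X Y. \<lbrakk>g \<in> carrier G; arr T f; dm T f = X; cd T f = Y\<rbrakk>
      \<Longrightarrow> \<beta> g Y \<cdot>\<^bsub>U\<^esub> On_mor F (act_mor T g f) = act_mor U g (On_mor F f) \<cdot>\<^bsub>U\<^esub> \<beta> g X"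
    and c: "\<And>g i. \<lbrakk>g \<in> carrier G; i \<in> J\<rbrakk> \<Longrightarrow> c g i \<in> carrier K"
      "\<And>g i. \<lbrakk>g \<in> carrier G; i \<in> J\<rbrakk> \<Longrightarrow> \<beta> g (D1 i) \<cdot>\<^bsub>U\<^esub> On_mor F (\<theta>1 g i) = c g i \<star>\<^bsub>U\<^esub> V g i"
    and g [simp]: "g \<in> carrier G" "h \<in> carrier G" "i \<in> J"
  shows "\<beta> (g \<otimes>\<^bsub>G\<^esub> h) (D1 i) \<cdot>\<^bsub>U\<^esub> On_mor F (Eps T g h (D1 i)) =
      Eps U g h (On_obj F (D1 i)) \<cdot>\<^bsub>U\<^esub> act_mor U g (\<beta> h (D1 i)) \<cdot>\<^bsub>U\<^esub> \<beta> g (act_obj T h (D1 i)) \<longleftrightarrow>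
    \<alpha>1 (g, h) (\<rho>1 g (\<rho>1 h i)) \<otimes>\<^bsub>K\<^esub> c (g \<otimes>\<^bsub>G\<^esub> h) i =
      \<sigma> g (c h i) \<otimes>\<^bsub>K\<^esub> c g (\<rho>1 h i) \<otimes>\<^bsub>K\<^esub> \<alpha>2 (g, h) (\<rho>2 g (\<rho>2 h (\<tau> i)))"
    (is "?L = ?R \<longleftrightarrow> ?a = ?b")
proof -
  note [simp] = b c(1)
  let ?gh = "g \<otimes>\<^bsub>G\<^esub> h"
  \<comment> \<open>An isomorphism onto the twice translated object. After precomposition with its
    image, both sides of the equivariance condition become multiples of the reference isomorphism
    for \<open>g h\<close>, and cancelling it leaves an equation of scalars.\<close>
  define W where "W = act_mor T g (\<theta>1 h i) \<cdot>\<^bsub>T\<^esub> \<theta>1 g (\<rho>1 h i)"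
  have W: "is_iso T (D1 (\<rho>1 g (\<rho>1 h i))) (act_obj T g (act_obj T h (D1 i))) W"
    unfolding W_def by (rule T.is_iso_Comp[OF s1(2) T.Act_iso[OF _ s1(2)]]) auto
  have [simp]: "arr T W" "dm T W = D1 (\<rho>1 g (\<rho>1 h i))" "cd T W = act_obj T g (act_obj T h (D1 i))"
    unfolding W_def by simp_all
  have FW: "is_iso U (On_obj F (D1 (\<rho>1 g (\<rho>1 h i)))) (On_obj F (act_obj T g (act_obj T h (D1 i)))) (On_mor F W)"
    by (rule F.F_iso[OF W]) auto
  have EW: "Eps T g h (D1 i) \<cdot>\<^bsub>T\<^esub> W = \<alpha>1 (g, h) (\<rho>1 g (\<rho>1 h i)) \<star>\<^bsub>T\<^esub> \<theta>1 ?gh i"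
    unfolding W_def using s1(6)[OF g] by simp
  have LW: "?L \<cdot>\<^bsub>U\<^esub> On_mor F W = ?a \<star>\<^bsub>U\<^esub> V ?gh i"
    using arg_cong[OF EW, of "On_mor F"] c(2)[of ?gh i] by simp
  have n1: "\<beta> g (act_obj T h (D1 i)) \<cdot>\<^bsub>U\<^esub> On_mor F (act_mor T g (\<theta>1 h i))
    = act_mor U g (On_mor F (\<theta>1 h i)) \<cdot>\<^bsub>U\<^esub> \<beta> g (D1 (\<rho>1 h i))"
    by (rule nat) auto
  \<comment> \<open>The scalar \<open>c h i\<close> leaves the semilinear autoequivalence of
    \<open>g\<close> as \<open>\<sigma> g (c h i)\<close>, which produces the module action in the
    coboundary.\<close>
  have n2: "act_mor U g (\<beta> h (D1 i)) \<cdot>\<^bsub>U\<^esub> act_mor U g (On_mor F (\<theta>1 h i)) = \<sigma> g (c h i) \<star>\<^bsub>U\<^esub> act_mor U g (V h i)"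
    using arg_cong[OF c(2)[of h i], of "act_mor U g"] by simp
  have "?R \<cdot>\<^bsub>U\<^esub> On_mor F W = Eps U g h (On_obj F (D1 i)) \<cdot>\<^bsub>U\<^esub> act_mor U g (\<beta> h (D1 i)) \<cdot>\<^bsub>U\<^esub>
      act_mor U g (On_mor F (\<theta>1 h i)) \<cdot>\<^bsub>U\<^esub> \<beta> g (D1 (\<rho>1 h i)) \<cdot>\<^bsub>U\<^esub> On_mor F (\<theta>1 g (\<rho>1 h i))"
    unfolding W_def by (simp add: U.Comp_reduce[OF n1])
  also have "\<dots> = (\<sigma> g (c h i) \<otimes>\<^bsub>K\<^esub> c g (\<rho>1 h i)) \<star>\<^bsub>U\<^esub>
      Eps U g h (On_obj F (D1 i)) \<cdot>\<^bsub>U\<^esub> act_mor U g (V h i) \<cdot>\<^bsub>U\<^esub> V g (\<rho>1 h i)"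
    using c(2)[of g "\<rho>1 h i"] T.m_comm[of "c g (\<rho>1 h i)" "\<sigma> g (c h i)"] by (simp add: U.Comp_reduce[OF n2])
  also have "\<dots> = ?b \<star>\<^bsub>U\<^esub> V ?gh i"
    unfolding V_cocycle[OF g] by simp
  finally have RW: "?R \<cdot>\<^bsub>U\<^esub> On_mor F W = ?b \<star>\<^bsub>U\<^esub> V ?gh i" .
  have ab: "?a \<in> carrier K" "?b \<in> carrier K" by simp_all
  show ?thesis
  proof
    assume "?L = ?R"
    then have *: "?a \<star>\<^bsub>U\<^esub> V ?gh i = ?b \<star>\<^bsub>U\<^esub> V ?gh i" using LW RW by simp
    note v = U.is_iso_inverse[OF V_iso[of ?gh i], simplified]
    \<comment> \<open>Scalars can be compared because the identity of the source object is nonzero,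
      as it is isomorphic to a member of the second system.\<close>
    define Z where "Z = \<rho>1 g (\<rho>1 h i)"
    have Z [simp]: "Z \<in> J" unfolding Z_def by simp
    have "?a \<star>\<^bsub>U\<^esub> Id U (On_obj F (D1 Z)) = ?b \<star>\<^bsub>U\<^esub> Id U (On_obj F (D1 Z))"
      using arg_cong[OF *, of "\<lambda>x. inv_mor U (V ?gh i) \<cdot>\<^bsub>U\<^esub> x"] v ab unfolding Z_def by simp
    moreover have "Id U (On_obj F (D1 Z)) \<noteq> zer U (On_obj F (D1 Z)) (On_obj F (D1 Z))"
    proof
      assume "Id U (On_obj F (D1 Z)) = zer U (On_obj F (D1 Z)) (On_obj F (D1 Z))"
      then have "\<psi> Z \<cdot>\<^bsub>U\<^esub> Id U (On_obj F (D1 Z)) \<cdot>\<^bsub>U\<^esub> inv_mor U (\<psi> Z) = \<psi> Z \<cdot>\<^bsub>U\<^esub> zer U (On_obj F (D1 Z)) (On_obj F (D1 Z)) \<cdot>\<^bsub>U\<^esub> inv_mor U (\<psi> Z)"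
        by simp
      then show False using nonzero[folded J_def, of "\<tau> Z"] by simp
    qed
    ultimately show "?a = ?b" 
      using U.scale_Id_inject[of ?a "On_obj F (D1 Z)" ?b] ab by simp
  next
    assume "?a = ?b"
    then have *: "?L \<cdot>\<^bsub>U\<^esub> On_mor F W = ?R \<cdot>\<^bsub>U\<^esub> On_mor F W" using LW RW by simp
    show "?L = ?R" by (rule U.is_iso_cancel(2)[OF FW _ _ *]) auto
  qed
qed

end

section \<open>Comparison of twisting classes\<close>

lemma cochains2_simps:
  "carrier (cochains2 G M) = (carrier G \<times> carrier G \<rightarrow>\<^sub>E carrier M)"
  "a \<otimes>\<^bsub>cochains2 G M\<^esub> b = (\<lambda>x \<in> carrier G \<times> carrier G. a x \<otimes>\<^bsub>M\<^esub> b x)"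
  unfolding cochains2_def by simp_all

definition delta :: "'g monoid \<Rightarrow> 'a monoid \<Rightarrow> ('g \<Rightarrow> 'a \<Rightarrow> 'a) \<Rightarrow> ('g \<Rightarrow> 'a) \<Rightarrow> 'g \<times> 'g \<Rightarrow> 'a"
  where "delta G M act b =
    (\<lambda>(g, h) \<in> carrier G \<times> carrier G. act g (b h) \<otimes>\<^bsub>M\<^esub> inv\<^bsub>M\<^esub> b (g \<otimes>\<^bsub>G\<^esub> h) \<otimes>\<^bsub>M\<^esub> b g)"

lemma coboundaries2_delta: "coboundaries2 G M act = delta G M act ` (carrier G \<rightarrow>\<^sub>E carrier M)"
  unfolding coboundaries2_def delta_def ..

locale group_module = G?: group G + M: comm_group M for G :: "'g monoid" and M :: "'a monoid" +
  fixes act :: "'g \<Rightarrow> 'a \<Rightarrow> 'a"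
  assumes act_hom: "g \<in> carrier G \<Longrightarrow> act g \<in> hom M M"
begin

lemma act_simps [simp]:
  assumes "g \<in> carrier G"
  shows "x \<in> carrier M \<Longrightarrow> act g x \<in> carrier M" "act g \<one>\<^bsub>M\<^esub> = \<one>\<^bsub>M\<^esub>"
    "\<lbrakk>x \<in> carrier M; y \<in> carrier M\<rbrakk> \<Longrightarrow> act g (x \<otimes>\<^bsub>M\<^esub> y) = act g x \<otimes>\<^bsub>M\<^esub> act g y"
    "x \<in> carrier M \<Longrightarrow> act g (inv\<^bsub>M\<^esub> x) = inv\<^bsub>M\<^esub> (act g x)"
proof -
  interpret h: group_hom M M "act g"
    by (intro group_hom.intro group_hom_axioms.intro act_hom assms M.group_axioms)
  show "x \<in> carrier M \<Longrightarrow> act g x \<in> carrier M" "act g \<one>\<^bsub>M\<^esub> = \<one>\<^bsub>M\<^esub>"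
    "\<lbrakk>x \<in> carrier M; y \<in> carrier M\<rbrakk> \<Longrightarrow> act g (x \<otimes>\<^bsub>M\<^esub> y) = act g x \<otimes>\<^bsub>M\<^esub> act g y"
    "x \<in> carrier M \<Longrightarrow> act g (inv\<^bsub>M\<^esub> x) = inv\<^bsub>M\<^esub> (act g x)"
    by simp_all
qed

lemma cochains_group: "group (cochains2 G M)"
  unfolding cochains2_def by (simp add: M.group_axioms)

lemma delta_carrier: "b \<in> carrier G \<rightarrow>\<^sub>E carrier M \<Longrightarrow> delta G M act b \<in> carrier (cochains2 G M)"
  unfolding cochains2_simps delta_def by (auto simp: PiE_iff)

lemma delta_mult:
  assumes "b \<in> carrier G \<rightarrow>\<^sub>E carrier M" "b' \<in> carrier G \<rightarrow>\<^sub>E carrier M"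
  shows "delta G M act b \<otimes>\<^bsub>cochains2 G M\<^esub> delta G M act b' = delta G M act (\<lambda>g \<in> carrier G. b g \<otimes>\<^bsub>M\<^esub> b' g)"
  unfolding cochains2_simps delta_def
  using assms by (intro restrict_ext) (auto simp: PiE_iff M.inv_mult M.m_ac)

lemma delta_one: "delta G M act (\<lambda>g \<in> carrier G. \<one>\<^bsub>M\<^esub>) = \<one>\<^bsub>cochains2 G M\<^esub>"
proof -
  show ?thesis unfolding delta_def cochains2_def by (auto intro!: restrict_ext)
qed

lemma coboundaries_subgroup: "subgroup (coboundaries2 G M act) (cochains2 G M)"
proof (rule group.subgroupI[OF cochains_group])
  interpret A: group "cochains2 G M" by (rule cochains_group)
  show "coboundaries2 G M act \<subseteq> carrier (cochains2 G M)"
    unfolding coboundaries2_delta using delta_carrier by blast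
  show "coboundaries2 G M act \<noteq> {}"
    unfolding coboundaries2_delta using delta_one by (auto simp: PiE_eq_empty_iff)
  fix x assume "x \<in> coboundaries2 G M act"
  then obtain b where b: "b \<in> carrier G \<rightarrow>\<^sub>E carrier M" "x = delta G M act b"
    unfolding coboundaries2_delta by blast
  define b' where "b' = (\<lambda>g \<in> carrier G. inv\<^bsub>M\<^esub> b g)"
  have b': "b' \<in> carrier G \<rightarrow>\<^sub>E carrier M" unfolding b'_def using b(1) by (auto simp: PiE_iff)
  have "(\<lambda>g \<in> carrier G. b' g \<otimes>\<^bsub>M\<^esub> b g) = (\<lambda>g \<in> carrier G. \<one>\<^bsub>M\<^esub>)"
    unfolding b'_def using b(1) by (intro restrict_ext) (auto simp: PiE_iff)
  then have "delta G M act b' \<otimes>\<^bsub>cochains2 G M\<^esub> x = \<one>\<^bsub>cochains2 G M\<^esub>"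
    using delta_mult[OF b' b(1)] delta_one b(2) by simp
  then have "inv\<^bsub>cochains2 G M\<^esub> x = delta G M act b'"
    by (rule A.inv_equality) (use delta_carrier b b' in auto)
  then show "inv\<^bsub>cochains2 G M\<^esub> x \<in> coboundaries2 G M act"
    unfolding coboundaries2_delta using b' by blast
  fix y assume "y \<in> coboundaries2 G M act"
  then obtain d where d: "d \<in> carrier G \<rightarrow>\<^sub>E carrier M" "y = delta G M act d"
    unfolding coboundaries2_delta by blast
  have "(\<lambda>g \<in> carrier G. b g \<otimes>\<^bsub>M\<^esub> d g) \<in> carrier G \<rightarrow>\<^sub>E carrier M"
    using b d by (auto simp: PiE_iff)
  then show "x \<otimes>\<^bsub>cochains2 G M\<^esub> y \<in> coboundaries2 G M act"
    unfolding b(2) d(2) delta_mult[OF b(1) d(1)] coboundaries2_delta by blast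
qed

text \<open>Cocycles multiply as cochains do, so the coset may be formed in the group of all
  cochains.\<close>

lemma H2_class_eq: "H2_class G M act a = coboundaries2 G M act #>\<^bsub>cochains2 G M\<^esub> a"
  unfolding H2_class_def cocycles2_def r_coset_def by simp

lemma mem_H2_coset:
  "x \<in> coboundaries2 G M act #>\<^bsub>cochains2 G M\<^esub> a \<longleftrightarrow>
    (\<exists>b \<in> carrier G \<rightarrow>\<^sub>E carrier M. x = delta G M act b \<otimes>\<^bsub>cochains2 G M\<^esub> a)"
  unfolding r_coset_def coboundaries2_delta by auto

end

text \<open>An equivariant \<phi> carries coboundaries to coboundaries, so the union over
  representatives collapses to the single coset of the image of \<open>a\<close>. Equality of cosets
  is then membership of \<open>a'\<close>.\<close>

lemma H2_map_class_eq_iff: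
  assumes "group_module G M act" "group_module G N act'"
    and \<phi>: "\<phi> \<in> hom M N" and eqv: "\<And>g x. \<lbrakk>g \<in> carrier G; x \<in> carrier M\<rbrakk> \<Longrightarrow> \<phi> (act g x) = act' g (\<phi> x)"
    and a: "a \<in> carrier (cochains2 G M)" and a': "a' \<in> carrier (cochains2 G N)"
  shows "H2_class G N act' a' = H2_map G N act' \<phi> (H2_class G M act a) \<longleftrightarrow>
    (\<exists>b \<in> carrier G \<rightarrow>\<^sub>E carrier N.
      a' = delta G N act' b \<otimes>\<^bsub>cochains2 G N\<^esub> (\<lambda>x \<in> carrier G \<times> carrier G. \<phi> (a x)))"
proof -
  interpret M: group_module G M act by fact
  interpret N: group_module G N act' by fact
  interpret A: group "cochains2 G M" by (rule M.cochains_group)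
  interpret B: group "cochains2 G N" by (rule N.cochains_group)
  let ?X = "carrier G \<times> carrier G"
  let ?\<phi> = "\<lambda>a. \<lambda>x \<in> ?X. \<phi> (a x)"
  let ?B = "coboundaries2 G N act'"
  have sg: "subgroup ?B (cochains2 G N)" by (rule N.coboundaries_subgroup)
  have \<phi>c [simp]: "\<phi> x \<in> carrier N" if "x \<in> carrier M" for x using hom_in_carrier[OF \<phi> that] .
  have \<phi>inv: "\<phi> (inv\<^bsub>M\<^esub> x) = inv\<^bsub>N\<^esub> \<phi> x" if "x \<in> carrier M" for x
    using that \<phi> M.M.group_axioms N.M.group_axioms
    by (meson group_hom.hom_inv group_hom.intro group_hom_axioms.intro)
  have \<phi>A: "?\<phi> x \<in> carrier (cochains2 G N)" if "x \<in> carrier (cochains2 G M)" for x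
    using that unfolding cochains2_simps by (auto simp: PiE_iff)
  have \<phi>m: "?\<phi> (x \<otimes>\<^bsub>cochains2 G M\<^esub> y) = ?\<phi> x \<otimes>\<^bsub>cochains2 G N\<^esub> ?\<phi> y"
    if "x \<in> carrier (cochains2 G M)" "y \<in> carrier (cochains2 G M)" for x y
    using that unfolding cochains2_simps by (intro restrict_ext) (auto simp: PiE_iff hom_mult[OF \<phi>])
  have \<phi>\<delta>: "?\<phi> (delta G M act b) = delta G N act' (\<lambda>g \<in> carrier G. \<phi> (b g))"
    if b: "b \<in> carrier G \<rightarrow>\<^sub>E carrier M" for b
    unfolding delta_def using b
    by (intro restrict_ext) (auto simp: PiE_iff hom_mult[OF \<phi>] \<phi>inv eqv)
  \<comment> \<open>A coboundary factor does not change the coset; this makes the induced map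
    independent of the representative.\<close>
  have absorb: "?B #>\<^bsub>cochains2 G N\<^esub> (delta G N act' b \<otimes>\<^bsub>cochains2 G N\<^esub> x) = ?B #>\<^bsub>cochains2 G N\<^esub> x"
    if "b \<in> carrier G \<rightarrow>\<^sub>E carrier N" "x \<in> carrier (cochains2 G N)" for b x
  proof -
    have d: "delta G N act' b \<in> ?B" using that(1) unfolding coboundaries2_delta by blast
    have c: "delta G N act' b \<in> carrier (cochains2 G N)" using N.delta_carrier that(1) .
    show ?thesis
      using B.coset_mult_assoc[OF subgroup.subset[OF sg] c that(2)] B.coset_join2[OF c sg d] by simp
  qed
  have map: "H2_map G N act' \<phi> (H2_class G M act a) = ?B #>\<^bsub>cochains2 G N\<^esub> ?\<phi> a"
  proof -
    have "H2_class G N act' (?\<phi> x) = ?B #>\<^bsub>cochains2 G N\<^esub> ?\<phi> a" if x: "x \<in> H2_class G M act a" for x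
    proof -
      obtain b where b: "b \<in> carrier G \<rightarrow>\<^sub>E carrier M" "x = delta G M act b \<otimes>\<^bsub>cochains2 G M\<^esub> a"
        using x unfolding M.H2_class_eq M.mem_H2_coset by blast
      have "?\<phi> x = delta G N act' (\<lambda>g \<in> carrier G. \<phi> (b g)) \<otimes>\<^bsub>cochains2 G N\<^esub> ?\<phi> a"
        unfolding b(2) \<phi>m[OF M.delta_carrier[OF b(1)] a] \<phi>\<delta>[OF b(1)] ..
      moreover have "(\<lambda>g \<in> carrier G. \<phi> (b g)) \<in> carrier G \<rightarrow>\<^sub>E carrier N"
        using b(1) by (auto simp: PiE_iff)
      ultimately show ?thesis
        unfolding N.H2_class_eq using absorb \<phi>A[OF a] by simp
    qed
    moreover have "a \<in> H2_class G M act a"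
      unfolding M.H2_class_eq using A.rcos_self[OF a M.coboundaries_subgroup] .
    ultimately show ?thesis unfolding H2_map_def by blast
  qed
  show ?thesis
  proof
    assume "H2_class G N act' a' = H2_map G N act' \<phi> (H2_class G M act a)"
    then have "a' \<in> ?B #>\<^bsub>cochains2 G N\<^esub> ?\<phi> a"
      unfolding map N.H2_class_eq using B.rcos_self[OF a' sg] by simp
    then show "\<exists>b \<in> carrier G \<rightarrow>\<^sub>E carrier N. a' = delta G N act' b \<otimes>\<^bsub>cochains2 G N\<^esub> ?\<phi> a"
      unfolding N.mem_H2_coset .
  next
    assume "\<exists>b \<in> carrier G \<rightarrow>\<^sub>E carrier N. a' = delta G N act' b \<otimes>\<^bsub>cochains2 G N\<^esub> ?\<phi> a"
    then obtain b where b: "b \<in> carrier G \<rightarrow>\<^sub>E carrier N" "a' = delta G N act' b \<otimes>\<^bsub>cochains2 G N\<^esub> ?\<phi> a" by blast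
    show "H2_class G N act' a' = H2_map G N act' \<phi> (H2_class G M act a)"
      unfolding map N.H2_class_eq b(2) by (rule absorb[OF b(1) \<phi>A[OF a]])
  qed
qed

section \<open>The coefficient module of tuples of nonzero scalars\<close>

lemma torus_simps:
  "x \<in> carrier (torus K n) \<longleftrightarrow> (\<forall>i \<in> {1..n}. x i \<in> carrier K \<and> x i \<noteq> \<zero>\<^bsub>K\<^esub>) \<and> x \<in> extensional {1..n}"
  "x \<otimes>\<^bsub>torus K n\<^esub> y = (\<lambda>i \<in> {1..n}. x i \<otimes>\<^bsub>K\<^esub> y i)"
  unfolding torus_def by (auto simp: PiE_iff)

lemma torus_comm_group:
  assumes "field K"
  shows "comm_group (torus K n)"
proof -
  interpret field K by fact
  interpret M: comm_group "mult_of K" by (rule field_mult_group[THEN group.group_comm_groupI]) (auto simp: m_comm)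
  have g: "group (torus K n)" unfolding torus_def by (simp add: M.group_axioms)
  then show ?thesis
    by (rule group.group_comm_groupI) (auto simp: torus_simps m_comm intro!: restrict_ext)
qed

lemma torus_inv:
  assumes "field K" "x \<in> carrier (torus K n)" "i \<in> {1..n}"
  shows "(inv\<^bsub>torus K n\<^esub> x) i = inv\<^bsub>K\<^esub> (x i)"
proof -
  interpret field K by fact
  have "inv\<^bsub>torus K n\<^esub> x = (\<lambda>i \<in> {1..n}. inv\<^bsub>mult_of K\<^esub> x i)"
    unfolding torus_def by (rule inv_product_group) (use assms(2) field_mult_group in \<open>auto simp: torus_def\<close>)
  then show ?thesis using assms(2,3) m_inv_mult_of[of "x i"] by (simp add: torus_simps)
qed

lemma inv_into_permutes:
  assumes "p permutes S" "j \<in> S"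
  shows "inv_into S p j \<in> S" "p (inv_into S p j) = j"
  using assms by (auto simp: permutes_image inv_into_into f_inv_into_f)

lemma inv_into_permutes_eq: "\<lbrakk>p permutes S; i \<in> S; p i = j\<rbrakk> \<Longrightarrow> inv_into S p j = i"
  by (metis inv_into_f_f inj_on_subset permutes_inj subset_UNIV)

lemma torus_module:
  assumes "field K" "group G" "\<sigma> \<in> hom G (field_Aut K)" "\<rho> \<in> hom G (sym_group n)"
  shows "group_module G (torus K n) (torus_act \<sigma> n \<rho>)"
proof -
  interpret field K by fact
  note s = field_Aut_hom[OF assms(3,1,2)]
  show ?thesis
  proof (intro group_module.intro group_module_axioms.intro assms torus_comm_group)
    fix g assume g: "g \<in> carrier G"
    note i = inv_into_permutes[OF sym_hom(3)[OF assms(4) g]]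
    show "torus_act \<sigma> n \<rho> g \<in> hom (torus K n) (torus K n)"
    proof (rule homI)
      fix x assume x: "x \<in> carrier (torus K n)"
      then show "torus_act \<sigma> n \<rho> g x \<in> carrier (torus K n)"
        unfolding torus_simps torus_act_def using s(1,5)[OF g] i(1) by simp
      fix y assume "y \<in> carrier (torus K n)"
      with x show "torus_act \<sigma> n \<rho> g (x \<otimes>\<^bsub>torus K n\<^esub> y) = torus_act \<sigma> n \<rho> g x \<otimes>\<^bsub>torus K n\<^esub> torus_act \<sigma> n \<rho> g y"
        unfolding torus_simps torus_act_def using s(2)[OF g] i(1) by (auto intro!: restrict_ext)
    qed
  qed
qed

lemma torus_perm_hom:
  assumes "\<tau> permutes {1..n}"
  shows "torus_perm n \<tau> \<in> hom (torus K n) (torus K n)"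
  using inv_into_permutes(1)[OF assms]
  by (intro homI) (auto simp: torus_simps torus_perm_def intro!: restrict_ext)

lemma torus_perm_equivariant:
  assumes "\<rho>1 g permutes {1..n}" "\<rho>2 g permutes {1..n}" and \<tau>: "\<tau> permutes {1..n}"
    and eq: "\<And>i. i \<in> {1..n} \<Longrightarrow> \<tau> (\<rho>1 g i) = \<rho>2 g (\<tau> i)"
  shows "torus_perm n \<tau> (torus_act \<sigma> n \<rho>1 g x) = torus_act \<sigma> n \<rho>2 g (torus_perm n \<tau> x)"
  unfolding torus_perm_def torus_act_def
proof (rule restrict_ext)
  fix j assume j: "j \<in> {1..n}"
  note 1 = inv_into_permutes[OF assms(1)] and 2 = inv_into_permutes[OF assms(2) j]
    and t = inv_into_permutes[OF \<tau>]
  define k where "k = inv_into {1..n} \<tau> (inv_into {1..n} (\<rho>2 g) j)"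
  have k: "k \<in> {1..n}" "\<tau> (\<rho>1 g k) = j" unfolding k_def using t[OF 2(1)] 2 eq by auto
  have "inv_into {1..n} \<tau> j = \<rho>1 g k"
    by (rule inv_into_permutes_eq[OF \<tau> _ k(2)]) (use k permutes_in_image[OF assms(1)] in blast)
  then have "inv_into {1..n} (\<rho>1 g) (inv_into {1..n} \<tau> j) = k"
    by (intro inv_into_permutes_eq[OF assms(1) k(1)]) simp
  then show "(\<lambda>j \<in> {1..n}. \<sigma> g (x (inv_into {1..n} (\<rho>1 g) j))) (inv_into {1..n} \<tau> j) =
      \<sigma> g ((\<lambda>j \<in> {1..n}. x (inv_into {1..n} \<tau> j)) (inv_into {1..n} (\<rho>2 g) j))"
    using t(1)[OF j] 2(1) by (simp add: k_def)
qed

text \<open>Here \<open>s\<close>, \<open>x\<close> and \<open>y\<close> are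
  \<open>\<sigma> g (b h)\<close>, \<open>b (g h)\<close> and \<open>b g\<close> at one coordinate.
  Passing to inverses turns the coboundary relation into the form in which equivariance on the block
  produces it.\<close>

lemma (in field) cocycle_rearrange:
  assumes "s \<in> carrier R" "s \<noteq> \<zero>" "x \<in> carrier R" "x \<noteq> \<zero>" "y \<in> carrier R" "y \<noteq> \<zero>" "a \<in> carrier R" "b \<in> carrier R"
  shows "b = s \<otimes> inv x \<otimes> y \<otimes> a \<longleftrightarrow> a \<otimes> inv x = inv s \<otimes> inv y \<otimes> b"
proof -
  have [simp]: "inv s \<in> carrier R" "inv x \<in> carrier R" "inv y \<in> carrier R"
    and i: "inv s \<otimes> s = \<one>" "inv y \<otimes> y = \<one>"
    using assms by (simp_all add: field_Units)
  have 1: "inv s \<otimes> inv y \<otimes> (s \<otimes> inv x \<otimes> y \<otimes> a) = (inv s \<otimes> s) \<otimes> ((inv y \<otimes> y) \<otimes> (a \<otimes> inv x))"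
    using assms by (simp add: m_ac)
  have 2: "(inv s \<otimes> s) \<otimes> ((inv y \<otimes> y) \<otimes> b) = s \<otimes> (y \<otimes> (inv s \<otimes> inv y \<otimes> b))"
    using assms by (simp add: m_ac)
  have 3: "s \<otimes> (y \<otimes> (a \<otimes> inv x)) = s \<otimes> inv x \<otimes> y \<otimes> a"
    using assms by (simp add: m_ac)
  show ?thesis
  proof
    assume "b = s \<otimes> inv x \<otimes> y \<otimes> a"
    then show "a \<otimes> inv x = inv s \<otimes> inv y \<otimes> b" using 1 i assms by simp
  next
    assume e: "a \<otimes> inv x = inv s \<otimes> inv y \<otimes> b"
    then show "b = s \<otimes> inv x \<otimes> y \<otimes> a" using 2 3 i assms by simp
  qed
qed

text \<open>The coboundary relation is read at the coordinate
  \<open>\<rho>2 g (\<rho>2 h (\<tau> i))\<close>, which runs over all coordinates with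
  \<open>i\<close>. There the action of \<open>g\<close> looks up \<open>b h\<close> at
  \<open>\<rho>2 h (\<tau> i)\<close> and the permutation looks up \<open>\<alpha>1\<close> at
  \<open>\<rho>1 g (\<rho>1 h i)\<close>; inverting \<open>b\<close> and relabelling its coordinates
  gives \<open>c\<close>.\<close>

lemma twisting_class_eq_iff:
  assumes K: "field K" and G: "group G" and \<sigma>: "\<sigma> \<in> hom G (field_Aut K)"
    and \<rho>1: "\<rho>1 \<in> hom G (sym_group n)" and \<rho>2: "\<rho>2 \<in> hom G (sym_group n)" and \<tau>: "\<tau> permutes {1..n}"
    and eqv: "\<And>g i. \<lbrakk>g \<in> carrier G; i \<in> {1..n}\<rbrakk> \<Longrightarrow> \<tau> (\<rho>1 g i) = \<rho>2 g (\<tau> i)"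
    and \<alpha>1: "\<alpha>1 \<in> carrier (cochains2 G (torus K n))" and \<alpha>2: "\<alpha>2 \<in> carrier (cochains2 G (torus K n))"
  shows "H2_class G (torus K n) (torus_act \<sigma> n \<rho>2) \<alpha>2 =
      H2_map G (torus K n) (torus_act \<sigma> n \<rho>2) (torus_perm n \<tau>) (H2_class G (torus K n) (torus_act \<sigma> n \<rho>1) \<alpha>1) \<longleftrightarrow>
    (\<exists>c. (\<forall>g \<in> carrier G. \<forall>i \<in> {1..n}. c g i \<in> carrier K \<and> c g i \<noteq> \<zero>\<^bsub>K\<^esub>) \<and>
      (\<forall>g \<in> carrier G. \<forall>h \<in> carrier G. \<forall>i \<in> {1..n}.
        \<alpha>1 (g, h) (\<rho>1 g (\<rho>1 h i)) \<otimes>\<^bsub>K\<^esub> c (g \<otimes>\<^bsub>G\<^esub> h) i =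
        \<sigma> g (c h i) \<otimes>\<^bsub>K\<^esub> c g (\<rho>1 h i) \<otimes>\<^bsub>K\<^esub> \<alpha>2 (g, h) (\<rho>2 g (\<rho>2 h (\<tau> i)))))"
    (is "?L \<longleftrightarrow> ?R")
proof -
  interpret field K by fact
  interpret G: group G by fact
  define J where "J = {1..n}"
  let ?M = "torus K n" and ?act = "torus_act \<sigma> n \<rho>2"
  note s = field_Aut_hom[OF \<sigma> K G]
  note r1 = sym_hom[OF \<rho>1, folded J_def] and r2 = sym_hom[OF \<rho>2, folded J_def]
  note eqv = eqv[folded J_def] and \<tau>' = \<tau>[folded J_def]
  have \<tau>J: "\<tau> i \<in> J" if "i \<in> J" for i using permutes_in_image[OF \<tau>'] that by blast
  have a1: "\<alpha>1 (g, h) \<in> carrier ?M" and a2: "\<alpha>2 (g, h) \<in> carrier ?M" if "g \<in> carrier G" "h \<in> carrier G" for g h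
    using \<alpha>1 \<alpha>2 that unfolding cochains2_simps by (auto simp: PiE_iff)
  have a1K: "\<alpha>1 (g, h) i \<in> carrier K" and a2K: "\<alpha>2 (g, h) i \<in> carrier K"
    if "g \<in> carrier G" "h \<in> carrier G" "i \<in> J" for g h i
    using a1[OF that(1,2)] a2[OF that(1,2)] that(3) unfolding torus_simps J_def by auto
  have sinv: "\<sigma> g (inv\<^bsub>K\<^esub> x) = inv\<^bsub>K\<^esub> (\<sigma> g x)" "inv\<^bsub>K\<^esub> (\<sigma> g (inv\<^bsub>K\<^esub> x)) = \<sigma> g x"
    if g: "g \<in> carrier G" and x: "x \<in> carrier K" "x \<noteq> \<zero>\<^bsub>K\<^esub>" for g x
  proof -
    have u: "x \<in> Units K" using x by (simp add: field_Units)
    have "\<sigma> g (inv\<^bsub>K\<^esub> x) \<otimes>\<^bsub>K\<^esub> \<sigma> g x = \<one>\<^bsub>K\<^esub>"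
      using s(2)[OF g Units_inv_closed[OF u] x(1)] Units_l_inv[OF u] s(4)[OF g] by simp
    moreover have "\<sigma> g x \<in> carrier K" "\<sigma> g (inv\<^bsub>K\<^esub> x) \<in> carrier K"
      using s(1)[OF g] x(1) Units_inv_closed[OF u] by auto
    ultimately show "\<sigma> g (inv\<^bsub>K\<^esub> x) = inv\<^bsub>K\<^esub> (\<sigma> g x)" "inv\<^bsub>K\<^esub> (\<sigma> g (inv\<^bsub>K\<^esub> x)) = \<sigma> g x"
      by (metis comm_inv_char m_comm)+
  qed
  have pe: "torus_perm n \<tau> (torus_act \<sigma> n \<rho>1 g x) = torus_act \<sigma> n \<rho>2 g (torus_perm n \<tau> x)" if "g \<in> carrier G" for g x
    by (rule torus_perm_equivariant[of \<rho>1 g n \<rho>2 \<tau>, OF sym_hom(3)[OF \<rho>1 that] sym_hom(3)[OF \<rho>2 that] \<tau>]) (rule assms(7)[OF that])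
  have "?L \<longleftrightarrow> (\<exists>b \<in> carrier G \<rightarrow>\<^sub>E carrier ?M.
      \<alpha>2 = delta G ?M ?act b \<otimes>\<^bsub>cochains2 G ?M\<^esub> (\<lambda>x \<in> carrier G \<times> carrier G. torus_perm n \<tau> (\<alpha>1 x)))"
    by (rule H2_map_class_eq_iff[OF torus_module[OF K G \<sigma> \<rho>1] torus_module[OF K G \<sigma> \<rho>2] torus_perm_hom[OF \<tau>] _ \<alpha>1 \<alpha>2]) (rule pe)
  also have "\<dots> \<longleftrightarrow> (\<exists>b \<in> carrier G \<rightarrow>\<^sub>E carrier ?M. \<forall>g \<in> carrier G. \<forall>h \<in> carrier G. \<forall>i \<in> J.
      \<alpha>2 (g, h) (\<rho>2 g (\<rho>2 h (\<tau> i))) = \<sigma> g (b h (\<rho>2 h (\<tau> i))) \<otimes>\<^bsub>K\<^esub> inv\<^bsub>K\<^esub> (b (g \<otimes>\<^bsub>G\<^esub> h) (\<rho>2 g (\<rho>2 h (\<tau> i))))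
        \<otimes>\<^bsub>K\<^esub> b g (\<rho>2 g (\<rho>2 h (\<tau> i))) \<otimes>\<^bsub>K\<^esub> \<alpha>1 (g, h) (\<rho>1 g (\<rho>1 h i)))"
    (is "_ \<longleftrightarrow> (\<exists>b \<in> ?Bs. \<forall>g \<in> _. \<forall>h \<in> _. \<forall>i \<in> J. ?P b g h i)")
  proof (rule bex_cong[OF refl])
    fix b assume b: "b \<in> ?Bs"
    have bM: "b g \<in> carrier ?M" if "g \<in> carrier G" for g using b that by auto
    let ?rhs = "\<lambda>g h j. \<sigma> g (b h (inv_into J (\<rho>2 g) j)) \<otimes>\<^bsub>K\<^esub> inv\<^bsub>K\<^esub> (b (g \<otimes>\<^bsub>G\<^esub> h) j) \<otimes>\<^bsub>K\<^esub> b g j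
      \<otimes>\<^bsub>K\<^esub> \<alpha>1 (g, h) (inv_into J \<tau> j)"
    have v: "(delta G ?M ?act b \<otimes>\<^bsub>cochains2 G ?M\<^esub> (\<lambda>x \<in> carrier G \<times> carrier G. torus_perm n \<tau> (\<alpha>1 x))) (g, h)
      = (\<lambda>j \<in> J. ?rhs g h j)" if g: "g \<in> carrier G" "h \<in> carrier G" for g h
    proof -
      have "(delta G ?M ?act b \<otimes>\<^bsub>cochains2 G ?M\<^esub> (\<lambda>x \<in> carrier G \<times> carrier G. torus_perm n \<tau> (\<alpha>1 x))) (g, h)
        = ?act g (b h) \<otimes>\<^bsub>?M\<^esub> inv\<^bsub>?M\<^esub> (b (g \<otimes>\<^bsub>G\<^esub> h)) \<otimes>\<^bsub>?M\<^esub> b g \<otimes>\<^bsub>?M\<^esub> torus_perm n \<tau> (\<alpha>1 (g, h))"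
        using g by (simp add: cochains2_simps(2) delta_def)
      also have "\<dots> = (\<lambda>j \<in> J. ?rhs g h j)"
        unfolding torus_simps(2) J_def[symmetric]
      proof (rule restrict_ext)
        fix j assume j: "j \<in> J"
        have "(inv\<^bsub>?M\<^esub> (b (g \<otimes>\<^bsub>G\<^esub> h))) j = inv\<^bsub>K\<^esub> (b (g \<otimes>\<^bsub>G\<^esub> h) j)"
          by (rule torus_inv[OF K bM]) (use g j J_def in simp_all)
        then show "(\<lambda>i \<in> J. (\<lambda>i \<in> J. ?act g (b h) i \<otimes>\<^bsub>K\<^esub> (inv\<^bsub>?M\<^esub> (b (g \<otimes>\<^bsub>G\<^esub> h))) i) i \<otimes>\<^bsub>K\<^esub> b g i) j \<otimes>\<^bsub>K\<^esub>
            torus_perm n \<tau> (\<alpha>1 (g, h)) j = ?rhs g h j"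
          unfolding torus_act_def torus_perm_def J_def[symmetric] using j by simp
      qed
      finally show ?thesis .
    qed
    have "\<alpha>2 = delta G ?M ?act b \<otimes>\<^bsub>cochains2 G ?M\<^esub> (\<lambda>x \<in> carrier G \<times> carrier G. torus_perm n \<tau> (\<alpha>1 x)) \<longleftrightarrow>
      (\<forall>g \<in> carrier G. \<forall>h \<in> carrier G. \<alpha>2 (g, h) = (\<lambda>j \<in> J. ?rhs g h j))" (is "\<alpha>2 = ?r \<longleftrightarrow> _")
    proof
      assume r: "\<alpha>2 = ?r"
      show "\<forall>g \<in> carrier G. \<forall>h \<in> carrier G. \<alpha>2 (g, h) = (\<lambda>j \<in> J. ?rhs g h j)"
        unfolding r by (intro ballI v)
    next
      assume a: "\<forall>g \<in> carrier G. \<forall>h \<in> carrier G. \<alpha>2 (g, h) = (\<lambda>j \<in> J. ?rhs g h j)"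
      show "\<alpha>2 = ?r"
      proof (rule extensionalityI[of _ "carrier G \<times> carrier G"])
        show "\<alpha>2 \<in> extensional (carrier G \<times> carrier G)" using \<alpha>2 unfolding cochains2_simps by (simp add: PiE_iff)
        show "?r \<in> extensional (carrier G \<times> carrier G)" unfolding cochains2_simps by simp
        fix x assume "x \<in> carrier G \<times> carrier G"
        then obtain g h where x: "x = (g, h)" "g \<in> carrier G" "h \<in> carrier G" by blast
        show "\<alpha>2 x = ?r x" unfolding x(1) v[OF x(2,3)] using a x(2,3) by blast
      qed
    qed
    also have "\<dots> \<longleftrightarrow> (\<forall>g \<in> carrier G. \<forall>h \<in> carrier G. \<forall>i \<in> J. ?P b g h i)"
    proof (intro ball_cong refl)
      fix g h assume g: "g \<in> carrier G" and h: "h \<in> carrier G"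
      have i: "?rhs g h (\<rho>2 g (\<rho>2 h (\<tau> i))) = \<sigma> g (b h (\<rho>2 h (\<tau> i))) \<otimes>\<^bsub>K\<^esub> inv\<^bsub>K\<^esub> (b (g \<otimes>\<^bsub>G\<^esub> h) (\<rho>2 g (\<rho>2 h (\<tau> i))))
        \<otimes>\<^bsub>K\<^esub> b g (\<rho>2 g (\<rho>2 h (\<tau> i))) \<otimes>\<^bsub>K\<^esub> \<alpha>1 (g, h) (\<rho>1 g (\<rho>1 h i))" if i: "i \<in> J" for i
      proof -
        have "inv_into J (\<rho>2 g) (\<rho>2 g (\<rho>2 h (\<tau> i))) = \<rho>2 h (\<tau> i)"
          by (rule inv_into_permutes_eq[OF r2(3)[OF g]]) (use r2(1)[OF h \<tau>J[OF i]] in auto)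
        moreover have "inv_into J \<tau> (\<rho>2 g (\<rho>2 h (\<tau> i))) = \<rho>1 g (\<rho>1 h i)"
          by (rule inv_into_permutes_eq[OF \<tau>']) (use r1(1) eqv g h i in auto)
        ultimately show ?thesis by simp
      qed
      show "\<alpha>2 (g, h) = (\<lambda>j \<in> J. ?rhs g h j) \<longleftrightarrow> (\<forall>i \<in> J. ?P b g h i)"
      proof
        assume a: "\<alpha>2 (g, h) = (\<lambda>j \<in> J. ?rhs g h j)"
        show "\<forall>i \<in> J. ?P b g h i"
        proof
          fix i assume iJ: "i \<in> J"
          then have "\<rho>2 g (\<rho>2 h (\<tau> i)) \<in> J" using r2(1) g h \<tau>J by blast
          then show "?P b g h i" using i[OF iJ] by (subst a) simp
        qed
      next
        assume a: "\<forall>i \<in> J. ?P b g h i"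
        show "\<alpha>2 (g, h) = (\<lambda>j \<in> J. ?rhs g h j)"
        proof (rule extensionalityI[of _ J])
          show "\<alpha>2 (g, h) \<in> extensional J" using a2[OF g h] unfolding torus_simps J_def by simp
          fix j assume j: "j \<in> J"
          \<comment> \<open>Undoing the three permutations shows that every coordinate
            \<open>j\<close> is of the form considered.\<close>
          define i' where "i' = inv_into J \<tau> (inv_into J (\<rho>2 h) (inv_into J (\<rho>2 g) j))"
          have i': "i' \<in> J" "\<rho>2 g (\<rho>2 h (\<tau> i')) = j"
            unfolding i'_def using inv_into_permutes[OF r2(3)[OF g]] inv_into_permutes[OF r2(3)[OF h]]
              inv_into_permutes[OF \<tau>'] j by auto
          then show "\<alpha>2 (g, h) j = (\<lambda>j \<in> J. ?rhs g h j) j" using a[rule_format, OF i'(1)] i[OF i'(1)] j by simp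
        qed simp
      qed
    qed
    finally show "\<alpha>2 = ?r \<longleftrightarrow> (\<forall>g \<in> carrier G. \<forall>h \<in> carrier G. \<forall>i \<in> J. ?P b g h i)" .
  qed
  also have "\<dots> \<longleftrightarrow> ?R"
  proof
    assume "\<exists>b \<in> ?Bs. \<forall>g \<in> carrier G. \<forall>h \<in> carrier G. \<forall>i \<in> J. ?P b g h i"
    then obtain b where b: "b \<in> ?Bs" and P: "\<And>g h i. \<lbrakk>g \<in> carrier G; h \<in> carrier G; i \<in> J\<rbrakk> \<Longrightarrow> ?P b g h i" by blast
    have bK: "b g i \<in> carrier K" "b g i \<noteq> \<zero>\<^bsub>K\<^esub>" if "g \<in> carrier G" "i \<in> J" for g i
      using b that unfolding J_def by (auto simp: PiE_iff torus_simps)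
    \<comment> \<open>The component of index \<open>i\<close> of a system for \<open>g\<close>
      starts at index \<open>\<rho> g i\<close>; hence \<open>c g i\<close> belongs to the
      coordinate \<open>\<rho>2 g (\<tau> i)\<close> of \<open>b\<close>.\<close>
    define c where "c g i = inv\<^bsub>K\<^esub> (b g (\<rho>2 g (\<tau> i)))" for g i
    have cK: "c g i \<in> carrier K \<and> c g i \<noteq> \<zero>\<^bsub>K\<^esub>" if "g \<in> carrier G" "i \<in> J" for g i
    proof -
      have "b g (\<rho>2 g (\<tau> i)) \<in> Units K" using bK[OF that(1) r2(1)[OF that(1) \<tau>J[OF that(2)]]] by (simp add: field_Units)
      from Units_inv_Units[OF this] show ?thesis unfolding c_def by (simp add: field_Units)
    qed
    have "\<alpha>1 (g, h) (\<rho>1 g (\<rho>1 h i)) \<otimes>\<^bsub>K\<^esub> c (g \<otimes>\<^bsub>G\<^esub> h) i =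
        \<sigma> g (c h i) \<otimes>\<^bsub>K\<^esub> c g (\<rho>1 h i) \<otimes>\<^bsub>K\<^esub> \<alpha>2 (g, h) (\<rho>2 g (\<rho>2 h (\<tau> i)))"
      if g: "g \<in> carrier G" "h \<in> carrier G" "i \<in> J" for g h i
    proof -
      let ?j = "\<rho>2 g (\<rho>2 h (\<tau> i))" and ?k = "\<rho>2 h (\<tau> i)"
      have k: "?k \<in> J" and j: "?j \<in> J" using r2(1) g \<tau>J by auto
      note si = sinv(1)[OF g(1) bK[OF g(2) k]]
      have "c g (\<rho>1 h i) = inv\<^bsub>K\<^esub> (b g ?j)" unfolding c_def using eqv g by simp
      moreover have "c (g \<otimes>\<^bsub>G\<^esub> h) i = inv\<^bsub>K\<^esub> (b (g \<otimes>\<^bsub>G\<^esub> h) ?j)" unfolding c_def using r2(2)[OF g(1,2)] by simp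
      moreover have "\<sigma> g (c h i) = inv\<^bsub>K\<^esub> (\<sigma> g (b h ?k))" unfolding c_def using si .
      ultimately show ?thesis
        using P[OF g] cocycle_rearrange[of "\<sigma> g (b h ?k)" "b (g \<otimes>\<^bsub>G\<^esub> h) ?j" "b g ?j"
            "\<alpha>1 (g, h) (\<rho>1 g (\<rho>1 h i))" "\<alpha>2 (g, h) ?j"]
          bK[OF g(2) k] bK[OF g(1) j] bK[OF G.m_closed[OF g(1,2)] j] s(1,5)[OF g(1)]
          a1K[OF g(1,2)] a2K[OF g(1,2) j] r1(1) g by simp
    qed
    then show ?R using cK unfolding J_def by blast
  next
    assume ?R
    then obtain c where cK: "\<And>g i. \<lbrakk>g \<in> carrier G; i \<in> J\<rbrakk> \<Longrightarrow> c g i \<in> carrier K"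
      "\<And>g i. \<lbrakk>g \<in> carrier G; i \<in> J\<rbrakk> \<Longrightarrow> c g i \<noteq> \<zero>\<^bsub>K\<^esub>"
      and P: "\<And>g h i. \<lbrakk>g \<in> carrier G; h \<in> carrier G; i \<in> J\<rbrakk> \<Longrightarrow> \<alpha>1 (g, h) (\<rho>1 g (\<rho>1 h i)) \<otimes>\<^bsub>K\<^esub> c (g \<otimes>\<^bsub>G\<^esub> h) i =
        \<sigma> g (c h i) \<otimes>\<^bsub>K\<^esub> c g (\<rho>1 h i) \<otimes>\<^bsub>K\<^esub> \<alpha>2 (g, h) (\<rho>2 g (\<rho>2 h (\<tau> i)))"
      unfolding J_def by blast
    \<comment> \<open>The inverse of the relabelling that sends \<open>i\<close> to
      \<open>\<rho>2 g (\<tau> i)\<close>.\<close>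
    define pre where "pre g j = inv_into J \<tau> (inv_into J (\<rho>2 g) j)" for g j
    have preJ: "pre g j \<in> J" if "g \<in> carrier G" "j \<in> J" for g j
      unfolding pre_def using inv_into_permutes(1)[OF r2(3)[OF that(1)] that(2)] inv_into_permutes(1)[OF \<tau>'] by blast
    have pre: "pre g (\<rho>2 g (\<tau> i)) = i" if "g \<in> carrier G" "i \<in> J" for g i
    proof -
      have "inv_into J (\<rho>2 g) (\<rho>2 g (\<tau> i)) = \<tau> i"
        by (rule inv_into_permutes_eq[OF r2(3)[OF that(1)]]) (use \<tau>J that in auto)
      then show ?thesis unfolding pre_def using inv_into_permutes_eq[OF \<tau>' that(2) refl] by simp
    qed
    have ci: "inv\<^bsub>K\<^esub> (c g i) \<in> carrier K \<and> inv\<^bsub>K\<^esub> (c g i) \<noteq> \<zero>\<^bsub>K\<^esub>" "inv\<^bsub>K\<^esub> (inv\<^bsub>K\<^esub> (c g i)) = c g i"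
      if "g \<in> carrier G" "i \<in> J" for g i
    proof -
      have "c g i \<in> Units K" using cK that by (simp add: field_Units)
      from Units_inv_Units[OF this] Units_inv_inv[OF this]
      show "inv\<^bsub>K\<^esub> (c g i) \<in> carrier K \<and> inv\<^bsub>K\<^esub> (c g i) \<noteq> \<zero>\<^bsub>K\<^esub>" "inv\<^bsub>K\<^esub> (inv\<^bsub>K\<^esub> (c g i)) = c g i"
        by (simp_all add: field_Units)
    qed
    define b where "b = (\<lambda>g \<in> carrier G. \<lambda>j \<in> J. inv\<^bsub>K\<^esub> (c g (pre g j)))"
    have "b \<in> ?Bs"
    proof (rule PiE_I)
      show "b g \<in> carrier ?M" if "g \<in> carrier G" for g
        unfolding torus_simps J_def[symmetric] b_def using that ci(1) preJ by simp
    qed (simp add: b_def)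
    moreover have "?P b g h i" if g: "g \<in> carrier G" "h \<in> carrier G" "i \<in> J" for g h i
    proof -
      let ?j = "\<rho>2 g (\<rho>2 h (\<tau> i))" and ?k = "\<rho>2 h (\<tau> i)"
      have k: "?k \<in> J" and j: "?j \<in> J" using r2(1) g \<tau>J by auto
      have h1: "\<rho>1 h i \<in> J" using r1(1) g by blast
      have gh: "g \<otimes>\<^bsub>G\<^esub> h \<in> carrier G" using g by simp
      have 1: "b h ?k = inv\<^bsub>K\<^esub> (c h i)" unfolding b_def using g k pre by simp
      have "?j = \<rho>2 g (\<tau> (\<rho>1 h i))" using eqv g by simp
      then have 2: "b g ?j = inv\<^bsub>K\<^esub> (c g (\<rho>1 h i))" unfolding b_def using g j pre h1 by simp
      have "?j = \<rho>2 (g \<otimes>\<^bsub>G\<^esub> h) (\<tau> i)" using r2(2) g by simp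
      then have 3: "b (g \<otimes>\<^bsub>G\<^esub> h) ?j = inv\<^bsub>K\<^esub> (c (g \<otimes>\<^bsub>G\<^esub> h) i)" unfolding b_def using gh j pre g by simp
      note si = sinv(2)[OF g(1) cK[OF g(2,3)]]
      show ?thesis
        unfolding 1 2 3
        using P[OF g] cocycle_rearrange[of "\<sigma> g (inv\<^bsub>K\<^esub> (c h i))" "inv\<^bsub>K\<^esub> (c (g \<otimes>\<^bsub>G\<^esub> h) i)" "inv\<^bsub>K\<^esub> (c g (\<rho>1 h i))"
            "\<alpha>1 (g, h) (\<rho>1 g (\<rho>1 h i))" "\<alpha>2 (g, h) ?j"]
          ci[OF g(2,3)] ci[OF g(1) h1] ci[OF gh g(3)] s(1,5)[OF g(1)] si
          a1K[OF g(1,2)] a2K[OF g(1,2) j] r1(1) g by simp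
    qed
    ultimately show "\<exists>b \<in> ?Bs. \<forall>g \<in> carrier G. \<forall>h \<in> carrier G. \<forall>i \<in> J. ?P b g h i" by blast
  qed
  finally show ?thesis .
qed

section \<open>Equivariant equivalences between categories generated by blocks\<close>

locale block_comparison =
  T: action_data K G \<sigma> T n1 \<rho>1 \<alpha>1 + U: action_data K G \<sigma> U n2 \<rho>2 \<alpha>2 +
  TB: tri_block K T "{1..n1}" "\<lambda>i j. shift_by T j (E1 i)" \<kappa>1 +
  UB: tri_block K U "{1..n2}" "\<lambda>i j. shift_by U j (E2 i)" \<kappa>2
  for K :: "'k ring" and G :: "'g monoid" and \<sigma> :: "'g \<Rightarrow> 'k \<Rightarrow> 'k"
    and T :: "('g, 'o1, 'm1, 'k) gtricat" and n1 :: nat and \<rho>1 :: "'g \<Rightarrow> nat \<Rightarrow> nat"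
    and \<alpha>1 :: "'g \<times> 'g \<Rightarrow> nat \<Rightarrow> 'k" and E1 :: "nat \<Rightarrow> 'o1" and \<kappa>1 :: "nat \<Rightarrow> int \<Rightarrow> 'm1"
    and U :: "('g, 'o2, 'm2, 'k) gtricat" and n2 :: nat and \<rho>2 :: "'g \<Rightarrow> nat \<Rightarrow> nat"
    and \<alpha>2 :: "'g \<times> 'g \<Rightarrow> nat \<Rightarrow> 'k" and E2 :: "nat \<Rightarrow> 'o2" and \<kappa>2 :: "nat \<Rightarrow> int \<Rightarrow> 'm2" +
  fixes \<theta>1 :: "'g \<Rightarrow> nat \<Rightarrow> 'm1" and \<theta>2 :: "'g \<Rightarrow> nat \<Rightarrow> 'm2"
  assumes sys1: "T.block_system n1 \<rho>1 \<alpha>1 E1 \<theta>1" and sys2: "U.block_system n2 \<rho>2 \<alpha>2 E2 \<theta>2"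
begin

text \<open>The block equivalence for \<tau> exists without any cohomological condition. An
  equivariant structure may be prescribed on the block, using \<open>c\<close>, and it extends
  uniquely; the condition on \<open>c\<close> is its cocycle identity there.\<close>

lemma equivalence_from_class:
  assumes n: "n2 = n1" and \<tau>: "\<tau> permutes {1..n1}"
    and eqv: "\<And>g i. \<lbrakk>g \<in> carrier G; i \<in> {1..n1}\<rbrakk> \<Longrightarrow> \<tau> (\<rho>1 g i) = \<rho>2 g (\<tau> i)"
    and c: "\<And>g i. \<lbrakk>g \<in> carrier G; i \<in> {1..n1}\<rbrakk> \<Longrightarrow> c g i \<in> carrier K" "\<And>g i. \<lbrakk>g \<in> carrier G; i \<in> {1..n1}\<rbrakk> \<Longrightarrow> c g i \<noteq> \<zero>\<^bsub>K\<^esub>"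
    and coh: "\<And>g h i. \<lbrakk>g \<in> carrier G; h \<in> carrier G; i \<in> {1..n1}\<rbrakk> \<Longrightarrow>
        \<alpha>1 (g, h) (\<rho>1 g (\<rho>1 h i)) \<otimes>\<^bsub>K\<^esub> c (g \<otimes>\<^bsub>G\<^esub> h) i =
        \<sigma> g (c h i) \<otimes>\<^bsub>K\<^esub> c g (\<rho>1 h i) \<otimes>\<^bsub>K\<^esub> \<alpha>2 (g, h) (\<rho>2 g (\<rho>2 h (\<tau> i)))"
  shows "linearly_equivariantly_exact_equivalent K G T U"
proof -
  have UB\<tau>: "tri_block K U {1..n1} (\<lambda>i j. shift_by U j (E2 (\<tau> i))) (\<lambda>i. \<kappa>2 (\<tau> i))"
    using tri_block_reindex[OF UB.tri_block_axioms, of \<tau> "{1..n1}"] permutes_imp_bij[OF \<tau>] n by simp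
  obtain F where F: "exact_functor T U F" "linear_functor K T U F" "equivalence T U F"
    and iso: "\<And>i. i \<in> {1..n1} \<Longrightarrow> isomorphic U (shift_by U 0 (E2 (\<tau> i))) (On_obj F (shift_by T 0 (E1 i)))"
    by (rule block_equivalence_exists[OF TB.tri_block_axioms UB\<tau>]) blast
  have Fs: "sh_functor K (\<lambda>c. c) T U F"
    by (rule exact_functor_sh_functor[OF T.triangulated_category_axioms U.triangulated_category_axioms F(1,2)])
  interpret F: sh_functor K "\<lambda>c. c" T U F by (rule Fs)
  have \<tau>J: "\<tau> i \<in> {1..n1}" if "i \<in> {1..n1}" for i using permutes_in_image[OF \<tau>] that by blast
  have "\<exists>p. is_iso U (On_obj F (E1 i)) (E2 (\<tau> i)) p" if "i \<in> {1..n1}" for i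
    using U.isomorphic_sym[OF iso[OF that]] T.systemD(1)[OF sys1 that] U.systemD(1)[OF sys2, of "\<tau> i"] \<tau>J[OF that] n
    unfolding isomorphic_def by simp
  then obtain \<psi> where \<psi>: "\<And>i. i \<in> {1..n1} \<Longrightarrow> is_iso U (On_obj F (E1 i)) (E2 (\<tau> i)) (\<psi> i)" by metis
  interpret C: equivariant_comparison K G \<sigma> n1 T \<rho>1 \<alpha>1 U \<rho>2 \<alpha>2 F E1 \<theta>1 E2 \<theta>2 \<tau> \<psi>
  proof (intro equivariant_comparison.intro equivariant_comparison_axioms.intro T.action_data_axioms Fs)
    show "action_data K G \<sigma> U n1 \<rho>2 \<alpha>2" using U.action_data_axioms n by simp
    show "U.block_system n1 \<rho>2 \<alpha>2 E2 \<theta>2" using sys2 n by simp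
    show "Id U (E2 i) \<noteq> zer U (E2 i) (E2 i)" if "i \<in> {1..n1}" for i
      using UB.P_nonzero[of i 0] that n by simp
  qed (use sys1 \<tau>J eqv \<psi> in auto)
  let ?J = "C.J"
  have cJ: "c g i \<in> carrier K" "c g i \<noteq> \<zero>\<^bsub>K\<^esub>" if "g \<in> carrier G" "i \<in> ?J" for g i
    using c that unfolding C.J_def by auto
  have tw: "sh_functor K (\<sigma> g) T U (comp_exact U F (Act T g))" "sh_functor K (\<sigma> g) T U (comp_exact U (Act U g) F)"
    if "g \<in> carrier G" for g
    using sh_functor_comp[OF T.Act_sh_functor[OF that] Fs] sh_functor_comp[OF Fs U.Act_sh_functor[OF that]] by simp_all
  have bf: "block_functors K (\<sigma> g) T {1..n1} (\<lambda>i j. shift_by T j (E1 i)) \<kappa>1 U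
      (comp_exact U F (Act T g)) (comp_exact U (Act U g) F)" if "g \<in> carrier G" for g
    by (intro block_functors.intro TB.tri_block_axioms tw that)
  \<comment> \<open>The only choice for which \<open>e g i\<close> composed with the image of
    \<open>\<theta>1 g i\<close> is \<open>c g i\<close> times the reference isomorphism.\<close>
  define e where "e g i = (c g i \<star>\<^bsub>U\<^esub> C.V g i) \<cdot>\<^bsub>U\<^esub> inv_mor U (On_mor F (\<theta>1 g i))" for g i
  have F\<theta>: "is_iso U (On_obj F (E1 (\<rho>1 g i))) (On_obj F (act_obj T g (E1 i))) (On_mor F (\<theta>1 g i))"
    if "g \<in> carrier G" "i \<in> ?J" for g i
    by (rule F.F_iso[OF C.s1(2)]) (use that in auto)
  have e_iso: "is_iso U (On_obj F (act_obj T g (E1 i))) (act_obj U g (On_obj F (E1 i))) (e g i)"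
    if g: "g \<in> carrier G" "i \<in> ?J" for g i
    unfolding e_def
    by (rule U.is_iso_Comp[OF U.is_iso_inv[OF F\<theta>[OF g]] U.is_iso_scale[OF C.V_iso[OF g] cJ[OF g]]]) (use g in auto)
  have e\<theta>: "e g i \<cdot>\<^bsub>U\<^esub> On_mor F (\<theta>1 g i) = c g i \<star>\<^bsub>U\<^esub> C.V g i" if g: "g \<in> carrier G" "i \<in> ?J" for g i
    unfolding e_def using g cJ U.is_iso_inverse[OF F\<theta>[OF g]] by simp
  have "\<exists>\<eta>. exact_iso T U (comp_exact U F (Act T g)) (comp_exact U (Act U g) F) \<eta> \<and> (\<forall>i \<in> ?J. \<eta> (E1 i) = e g i)"
    if g: "g \<in> carrier G" for g
  proof -
    interpret B: block_functors K "\<sigma> g" T "{1..n1}" "\<lambda>i j. shift_by T j (E1 i)" \<kappa>1 U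
      "comp_exact U F (Act T g)" "comp_exact U (Act U g) F" by (rule bf[OF g])
    obtain \<eta> where "exact_iso T U (comp_exact U F (Act T g)) (comp_exact U (Act U g) F) \<eta>"
      "\<And>i. i \<in> {1..n1} \<Longrightarrow> \<eta> (shift_by T 0 (E1 i)) = e g i"
      by (rule B.exact_iso_exists[of "e g"]) (use e_iso[OF g] in \<open>auto simp: comp_exact_def C.J_def\<close>)
    then show ?thesis by (auto simp: C.J_def)
  qed
  then have "\<forall>g \<in> carrier G. \<exists>\<eta>. exact_iso T U (comp_exact U F (Act T g)) (comp_exact U (Act U g) F) \<eta> \<and> (\<forall>i \<in> ?J. \<eta> (E1 i) = e g i)"
    by blast
  from bchoice[OF this] obtain \<beta> where
    \<beta>: "\<And>g. g \<in> carrier G \<Longrightarrow> exact_iso T U (comp_exact U F (Act T g)) (comp_exact U (Act U g) F) (\<beta> g)"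
    and \<beta>e: "\<And>g i. \<lbrakk>g \<in> carrier G; i \<in> ?J\<rbrakk> \<Longrightarrow> \<beta> g (E1 i) = e g i" by blast
  have \<beta>t: "sh_trans T U (comp_exact U F (Act T g)) (comp_exact U (Act U g) F) (\<beta> g)" if "g \<in> carrier G" for g
    using \<beta>[OF that] block_functors.exact_iso_iff[OF bf[OF that]] by blast
  note bD = block_functors.sh_transD[OF bf \<beta>t]
  have on_block: "\<beta> (g \<otimes>\<^bsub>G\<^esub> h) (E1 i) \<cdot>\<^bsub>U\<^esub> On_mor F (Eps T g h (E1 i)) =
      Eps U g h (On_obj F (E1 i)) \<cdot>\<^bsub>U\<^esub> act_mor U g (\<beta> h (E1 i)) \<cdot>\<^bsub>U\<^esub> \<beta> g (act_obj T h (E1 i))"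
    if g: "g \<in> carrier G" "h \<in> carrier G" "i \<in> ?J" for g h i
  proof (rule C.equivariance_iff[where c = c, THEN iffD2])
    show "arr U (\<beta> g X)" "dm U (\<beta> g X) = On_obj F (act_obj T g X)" "cd U (\<beta> g X) = act_obj U g (On_obj F X)"
      if "g \<in> carrier G" "X \<in> Obj T" for g X
      using bD(1-3)[OF that(1) that(1) that(2)] by (simp_all add: comp_exact_def)
    show "\<beta> g Y \<cdot>\<^bsub>U\<^esub> On_mor F (act_mor T g f) = act_mor U g (On_mor F f) \<cdot>\<^bsub>U\<^esub> \<beta> g X"
      if "g \<in> carrier G" "arr T f" "dm T f = X" "cd T f = Y" for g f X Y
      using bD(4)[OF that(1) that] by (simp add: comp_exact_def)
    show "\<alpha>1 (g, h) (\<rho>1 g (\<rho>1 h i)) \<otimes>\<^bsub>K\<^esub> c (g \<otimes>\<^bsub>G\<^esub> h) i =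
        \<sigma> g (c h i) \<otimes>\<^bsub>K\<^esub> c g (\<rho>1 h i) \<otimes>\<^bsub>K\<^esub> \<alpha>2 (g, h) (\<rho>2 g (\<rho>2 h (\<tau> i)))"
      using coh[OF g(1,2)] g(3) unfolding C.J_def by blast
  qed (use g cJ \<beta>e e\<theta> in auto)
  \<comment> \<open>Both sides are shift-compatible transformations between the same two functors,
    so their agreement on the block suffices. The point is to assemble each side from whiskered
    pieces with matching composite functors.\<close>
  have "\<beta> (g \<otimes>\<^bsub>G\<^esub> h) X \<cdot>\<^bsub>U\<^esub> On_mor F (Eps T g h X) =
      Eps U g h (On_obj F X) \<cdot>\<^bsub>U\<^esub> act_mor U g (\<beta> h X) \<cdot>\<^bsub>U\<^esub> \<beta> g (act_obj T h X)"
    if g [simp]: "g \<in> carrier G" "h \<in> carrier G" and X: "X \<in> Obj T" for g h X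
  proof -
    let ?gh = "g \<otimes>\<^bsub>G\<^esub> h"
    let ?s = "\<sigma> ?gh"
    let ?Fgh = "comp_exact U F (comp_exact T (Act T g) (Act T h))"
    let ?gFh = "comp_exact U (Act U g) (comp_exact U F (Act T h))"
    let ?ghF = "comp_exact U (comp_exact U (Act U g) (Act U h)) F"
    let ?Fp = "comp_exact U F (Act T ?gh)" and ?pF = "comp_exact U (Act U ?gh) F"
    note Ag = T.Act_sh_functor[OF g(1)] and Ah = T.Act_sh_functor[OF g(2)]
      and Bg = U.Act_sh_functor[OF g(1)] and Bh = U.Act_sh_functor[OF g(2)]
    have cong: "sh_functor K ?s V W H" if "sh_functor K (\<lambda>c. \<sigma> g (\<sigma> h c)) V W H"
      for H and V :: "('g, 'x, 'y, 'k) gtricat" and W :: "('g, 'u, 'v, 'k) gtricat"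
      by (rule sh_functor_cong[OF that]) simp
    have Agh: "sh_functor K ?s T T (comp_exact T (Act T g) (Act T h))"
      by (rule cong[OF sh_functor_comp[OF Ah Ag]])
    have Bgh: "sh_functor K ?s U U (comp_exact U (Act U g) (Act U h))"
      by (rule cong[OF sh_functor_comp[OF Bh Bg]])
    have f1: "sh_functor K ?s T U ?Fgh" by (rule sh_functor_comp[OF Agh Fs])
    have f2: "sh_functor K ?s T U ?gFh" by (rule cong[OF sh_functor_comp[OF tw(1)[OF g(2)] Bg]])
    have f3: "sh_functor K ?s T U ?ghF" by (rule sh_functor_comp[OF Fs Bgh])
    have f4: "sh_functor K ?s T U ?Fp" "sh_functor K ?s T U ?pF" by (rule tw; simp)+
    have bl: "block_functors K ?s T {1..n1} (\<lambda>i j. shift_by T j (E1 i)) \<kappa>1 U A B"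
      if "sh_functor K ?s T U A" "sh_functor K ?s T U B" for A B
      by (intro block_functors.intro TB.tri_block_axioms that)
    have "sh_trans T U (comp_exact U (comp_exact U F (Act T g)) (Act T h)) (comp_exact U (comp_exact U (Act U g) F) (Act T h))
        (\<lambda>X. \<beta> g (act_obj T h X))"
      by (rule sh_trans_precomp[OF tw(1)[OF g(1)] tw(2)[OF g(1)] Ah \<beta>t[OF g(1)]])
    then have t1: "sh_trans T U ?Fgh ?gFh (\<lambda>X. \<beta> g (act_obj T h X))"
      by (rule sh_trans_cong)
        (use comp_exact_assoc[OF Ah Ag Fs] comp_exact_assoc[OF Ah Fs Bg] in simp_all)
    have "sh_trans T U ?gFh (comp_exact U (Act U g) (comp_exact U (Act U h) F)) (\<lambda>X. act_mor U g (\<beta> h X))"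
      by (rule sh_trans_postcomp[OF tw(1)[OF g(2)] tw(2)[OF g(2)] Bg \<beta>t[OF g(2)]])
    then have t2: "sh_trans T U ?gFh ?ghF (\<lambda>X. act_mor U g (\<beta> h X))"
      by (rule sh_trans_cong) (use comp_exact_assoc[OF Fs Bh Bg] in simp_all)
    have t3: "sh_trans T U ?ghF ?pF (\<lambda>X. Eps U g h (On_obj F X))"
      by (rule sh_trans_precomp[OF Bgh U.Act_sh_functor Fs U.Eps_sh_trans]) simp_all
    have t4: "sh_trans T U ?Fgh ?Fp (\<lambda>X. On_mor F (Eps T g h X))"
      by (rule sh_trans_postcomp[OF Agh T.Act_sh_functor Fs T.Eps_sh_trans]) simp_all
    have t5: "sh_trans T U ?Fp ?pF (\<beta> ?gh)" by (rule \<beta>t) simp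
    have R: "sh_trans T U ?Fgh ?pF (\<lambda>X. Eps U g h (On_obj F X) \<cdot>\<^bsub>U\<^esub> act_mor U g (\<beta> h X) \<cdot>\<^bsub>U\<^esub> \<beta> g (act_obj T h X))"
      using block_functors.sh_trans_comp[OF bl[OF f1 f2] t1 block_functors.sh_trans_comp[OF bl[OF f2 f3] t2 t3 f4(2)] f4(2)]
        block_functors.sh_transD[OF bl[OF f1 f2] t1] block_functors.sh_transD[OF bl[OF f2 f3] t2]
        block_functors.sh_transD[OF bl[OF f3 f4(2)] t3]
      by (simp add: sh_trans_def comp_exact_def)
    have L: "sh_trans T U ?Fgh ?pF (\<lambda>X. \<beta> ?gh X \<cdot>\<^bsub>U\<^esub> On_mor F (Eps T g h X))"
      by (rule block_functors.sh_trans_comp[OF bl[OF f1 f4(1)] t4 t5 f4(2)])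
    show ?thesis
      by (rule block_functors.sh_trans_unique[OF bl[OF f1 f4(2)] L R _ X])
        (use on_block[of g h] in \<open>simp add: C.J_def\<close>)
  qed
  then have "equivariant_exact_functor G T U F \<beta>"
    unfolding equivariant_exact_functor_def using F(1) \<beta> by blast
  then show ?thesis
    unfolding linearly_equivariantly_exact_equivalent_def using F(2,3) by blast
qed

end

section \<open>Recognising shifted block objects up to isomorphism\<close>

context tri_block
begin

lemma P_isomorphic_unique:
  assumes "isomorphic T (P i j) (P k l)" "i \<in> I" "k \<in> I"
  shows "i = k" "j = l"
proof -
  obtain f where f: "is_iso T (P i j) (P k l) f" using assms(1) unfolding isomorphic_def by blast
  note v = is_iso_inverse[OF f P_Obj[OF assms(2)] P_Obj[OF assms(3)]]
  have "(i, j) = (k, l)"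
  proof (rule ccontr)
    assume "(i, j) \<noteq> (k, l)"
    then have "f = zer T (P i j) (P k l)" using P_orth assms v(1-3) by blast
    then have "Id T (P i j) = zer T (P i j) (P i j)" using v(4-7) assms by simp
    then show False using P_nonzero assms by blast
  qed
  then show "i = k" "j = l" by auto
qed

text \<open>A nonzero \<open>A\<close> receives a nonzero \<open>p\<close> from some
  \<open>P i j\<close>. Regularity gives \<open>p s p = p\<close>; both \<open>s p\<close> and
  \<open>p s\<close> are scalars, necessarily nonzero, so \<open>p\<close> is invertible.\<close>

lemma scalar_End_block:
  assumes A: "A \<in> Obj T" "Id T A \<noteq> zer T A A"
    and End: "\<And>f. \<lbrakk>arr T f; dm T f = A; cd T f = A\<rbrakk> \<Longrightarrow> \<exists>c \<in> carrier K. f = c \<star>\<^bsub>T\<^esub> Id T A"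
  obtains i j where "i \<in> I" "isomorphic T (P i j) A"
proof -
  have "\<exists>i j p. i \<in> I \<and> arr T p \<and> dm T p = P i j \<and> cd T p = A \<and> p \<noteq> zer T (P i j) A"
  proof (rule ccontr)
    assume n: "\<not> ?thesis"
    have "Id T A = zer T A A"
    proof (rule P_separates[of _ _ A])
      fix i j p assume p: "i \<in> I" "arr T p" "dm T p = P i j" "cd T p = A"
      then have "p = zer T (P i j) A" using n by blast
      then show "Id T A \<cdot>\<^bsub>T\<^esub> p = zer T A A \<cdot>\<^bsub>T\<^esub> p" using p A by simp
    qed (use A in auto)
    then show False using A by blast
  qed
  then obtain i j p where p: "i \<in> I" "arr T p" "dm T p = P i j" "cd T p = A" "p \<noteq> zer T (P i j) A" by blast
  obtain s where s: "arr T s" "dm T s = A" "cd T s = P i j" "p \<cdot>\<^bsub>T\<^esub> s \<cdot>\<^bsub>T\<^esub> p = p"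
    using regular[OF p(2)] p by metis
  have "arr T (s \<cdot>\<^bsub>T\<^esub> p)" "dm T (s \<cdot>\<^bsub>T\<^esub> p) = P i j" "cd T (s \<cdot>\<^bsub>T\<^esub> p) = P i j" using p s by simp_all
  then obtain c where c: "c \<in> carrier K" "s \<cdot>\<^bsub>T\<^esub> p = c \<star>\<^bsub>T\<^esub> Id T (P i j)" using P_End[OF p(1)] by blast
  have cp: "c \<star>\<^bsub>T\<^esub> p = p" using s(4) p c by simp
  have c0: "c \<noteq> \<zero>\<^bsub>K\<^esub>"
  proof
    assume "c = \<zero>\<^bsub>K\<^esub>"
    then have "p = zer T (P i j) A" using cp scale_zero[OF p(2-4)] by simp
    then show False using p(5) by blast
  qed
  have "arr T (p \<cdot>\<^bsub>T\<^esub> s)" "dm T (p \<cdot>\<^bsub>T\<^esub> s) = A" "cd T (p \<cdot>\<^bsub>T\<^esub> s) = A" using p s by simp_all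
  then obtain d where d: "d \<in> carrier K" "p \<cdot>\<^bsub>T\<^esub> s = d \<star>\<^bsub>T\<^esub> Id T A" using End by blast
  have "(p \<cdot>\<^bsub>T\<^esub> s) \<cdot>\<^bsub>T\<^esub> p = d \<star>\<^bsub>T\<^esub> p" unfolding d(2) using p d(1) A by simp
  then have dp: "d \<star>\<^bsub>T\<^esub> p = p" using p s by simp
  have d0: "d \<noteq> \<zero>\<^bsub>K\<^esub>"
  proof
    assume "d = \<zero>\<^bsub>K\<^esub>"
    then have "p = zer T (P i j) A" using dp scale_zero[OF p(2-4)] by simp
    then show False using p(5) by blast
  qed
  have inv: "inv\<^bsub>K\<^esub> c \<in> carrier K" "inv\<^bsub>K\<^esub> c \<otimes>\<^bsub>K\<^esub> c = \<one>\<^bsub>K\<^esub>" "inv\<^bsub>K\<^esub> d \<in> carrier K" "inv\<^bsub>K\<^esub> d \<otimes>\<^bsub>K\<^esub> d = \<one>\<^bsub>K\<^esub>"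
    using c(1) c0 d(1) d0 by (simp_all add: field_Units)
  have l: "((inv\<^bsub>K\<^esub> c) \<star>\<^bsub>T\<^esub> s) \<cdot>\<^bsub>T\<^esub> p = Id T (P i j)" using p s c inv by simp
  have r: "p \<cdot>\<^bsub>T\<^esub> ((inv\<^bsub>K\<^esub> d) \<star>\<^bsub>T\<^esub> s) = Id T A" using p s d inv A by simp
  have "((inv\<^bsub>K\<^esub> c) \<star>\<^bsub>T\<^esub> s) = ((inv\<^bsub>K\<^esub> c) \<star>\<^bsub>T\<^esub> s) \<cdot>\<^bsub>T\<^esub> p \<cdot>\<^bsub>T\<^esub> ((inv\<^bsub>K\<^esub> d) \<star>\<^bsub>T\<^esub> s)" unfolding r using s inv by simp
  also have "\<dots> = (inv\<^bsub>K\<^esub> d) \<star>\<^bsub>T\<^esub> s" using Comp_reduce[OF l, of "(inv\<^bsub>K\<^esub> d) \<star>\<^bsub>T\<^esub> s"] p s inv by simp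
  finally have "p \<cdot>\<^bsub>T\<^esub> ((inv\<^bsub>K\<^esub> c) \<star>\<^bsub>T\<^esub> s) = Id T A" using r by simp
  then have "is_iso T (P i j) A p"
    using l p s inv A by (intro is_isoI[of _ _ _ "(inv\<^bsub>K\<^esub> c) \<star>\<^bsub>T\<^esub> s"]) auto
  then show ?thesis using that[OF p(1)] unfolding isomorphic_def by blast
qed

end

context block_comparison
begin

text \<open>The image of \<open>E1 i\<close> has scalar endomorphisms and is therefore a shift of a
  member of the second block. This defines the permutation, and equivariance with transitivity makes
  the degree of the shift constant, so the given structure can be compared with one shifted
  system.\<close>

lemma class_from_equivalence:
  assumes trans: "transitive_action G n1 \<rho>1"
    and Fb: "equivariant_exact_functor G T U F \<beta>" and Fl: "linear_functor K T U F" and Fe: "equivalence T U F"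
  obtains \<tau> c where "n2 = n1" "\<tau> permutes {1..n1}"
    "\<And>g i. \<lbrakk>g \<in> carrier G; i \<in> {1..n1}\<rbrakk> \<Longrightarrow> \<tau> (\<rho>1 g i) = \<rho>2 g (\<tau> i)"
    "\<And>g i. \<lbrakk>g \<in> carrier G; i \<in> {1..n1}\<rbrakk> \<Longrightarrow> c g i \<in> carrier K \<and> c g i \<noteq> \<zero>\<^bsub>K\<^esub>"
    "\<And>g h i. \<lbrakk>g \<in> carrier G; h \<in> carrier G; i \<in> {1..n1}\<rbrakk> \<Longrightarrow>
        \<alpha>1 (g, h) (\<rho>1 g (\<rho>1 h i)) \<otimes>\<^bsub>K\<^esub> c (g \<otimes>\<^bsub>G\<^esub> h) i =
        \<sigma> g (c h i) \<otimes>\<^bsub>K\<^esub> c g (\<rho>1 h i) \<otimes>\<^bsub>K\<^esub> \<alpha>2 (g, h) (\<rho>2 g (\<rho>2 h (\<tau> i)))"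
proof -
  have Fx: "exact_functor T U F" using Fb unfolding equivariant_exact_functor_def by blast
  have Fs: "sh_functor K (\<lambda>c. c) T U F"
    by (rule exact_functor_sh_functor[OF T.triangulated_category_axioms U.triangulated_category_axioms Fx Fl])
  interpret F: sh_functor K "\<lambda>c. c" T U F by (rule Fs)
  interpret Fe: lin_equivalence K "\<lambda>c. c" T U F
    by (intro lin_equivalence.intro lin_equivalence_axioms.intro F.lin_functor_axioms Fe)
  define J1 J2 where "J1 = {1..n1}" and "J2 = {1..n2}"
  let ?P1 = "\<lambda>i j. shift_by T j (E1 i)" and ?P2 = "\<lambda>k j. shift_by U j (E2 k)"
  note P2 = UB.P_Obj[folded J2_def]
  note s1 = T.systemD[OF sys1, folded J1_def]
  have E1 [simp]: "i \<in> J1 \<Longrightarrow> E1 i \<in> Obj T" for i using s1(1) .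
  have r1 [simp]: "\<lbrakk>g \<in> carrier G; i \<in> J1\<rbrakk> \<Longrightarrow> \<rho>1 g i \<in> J1" and r2 [simp]: "\<lbrakk>g \<in> carrier G; k \<in> J2\<rbrakk> \<Longrightarrow> \<rho>2 g k \<in> J2" for g i k
    unfolding J1_def J2_def by (rule T.rho(1) U.rho(1); assumption)+
  have FE_End: "\<exists>c \<in> carrier K. f = c \<star>\<^bsub>U\<^esub> Id U (On_obj F (E1 i))"
    if i: "i \<in> J1" and f: "arr U f" "dm U f = On_obj F (E1 i)" "cd U f = On_obj F (E1 i)" for i f
  proof -
    obtain f' where f': "arr T f'" "dm T f' = E1 i" "cd T f' = E1 i" "On_mor F f' = f"
      by (rule Fe.full[OF f]) (use i in auto)
    obtain c where "c \<in> carrier K" "f' = c \<star>\<^bsub>T\<^esub> Id T (E1 i)"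
      using TB.P_End[of i f' 0, folded J1_def] f' i by auto
    then show ?thesis using f'(4) i by auto
  qed
  have FE_nz: "Id U (On_obj F (E1 i)) \<noteq> zer U (On_obj F (E1 i)) (On_obj F (E1 i))" if i: "i \<in> J1" for i
  proof
    assume "Id U (On_obj F (E1 i)) = zer U (On_obj F (E1 i)) (On_obj F (E1 i))"
    then have "On_mor F (Id T (E1 i)) = On_mor F (zer T (E1 i) (E1 i))" using i by simp
    then have "Id T (E1 i) = zer T (E1 i) (E1 i)" by (rule Fe.faithful) (use i in auto)
    then show False using TB.P_nonzero[of i 0, folded J1_def] i by simp
  qed
  have "\<forall>i \<in> J1. \<exists>km. fst km \<in> J2 \<and> isomorphic U (?P2 (fst km) (snd km)) (On_obj F (E1 i))"
  proof
    fix i assume i: "i \<in> J1"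
    obtain k m where "k \<in> J2" "isomorphic U (?P2 k m) (On_obj F (E1 i))"
      by (rule UB.scalar_End_block[folded J2_def, of "On_obj F (E1 i)"]) (use FE_nz FE_End i in auto)
    then show "\<exists>km. fst km \<in> J2 \<and> isomorphic U (?P2 (fst km) (snd km)) (On_obj F (E1 i))" by force
  qed
  from bchoice[OF this] obtain km where km: "\<And>i. i \<in> J1 \<Longrightarrow> fst (km i) \<in> J2"
    "\<And>i. i \<in> J1 \<Longrightarrow> isomorphic U (?P2 (fst (km i)) (snd (km i))) (On_obj F (E1 i))" by blast
  define t m where "t i = fst (km i)" and "m i = snd (km i)" for i
  have t [simp]: "i \<in> J1 \<Longrightarrow> t i \<in> J2" and tm: "i \<in> J1 \<Longrightarrow> isomorphic U (?P2 (t i) (m i)) (On_obj F (E1 i))" for i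
    using km unfolding t_def m_def by auto
  have bf: "block_functors K (\<sigma> g) T {1..n1} ?P1 \<kappa>1 U (comp_exact U F (Act T g)) (comp_exact U (Act U g) F)"
    if "g \<in> carrier G" for g
    using sh_functor_comp[OF T.Act_sh_functor[OF that] Fs] sh_functor_comp[OF Fs U.Act_sh_functor[OF that]]
    by (intro block_functors.intro TB.tri_block_axioms) simp_all
  have \<beta>: "exact_iso T U (comp_exact U F (Act T g)) (comp_exact U (Act U g) F) (\<beta> g)" if "g \<in> carrier G" for g
    using Fb that unfolding equivariant_exact_functor_def by blast
  have \<beta>t: "sh_trans T U (comp_exact U F (Act T g)) (comp_exact U (Act U g) F) (\<beta> g)"
    and \<beta>i: "X \<in> Obj T \<Longrightarrow> is_iso U (On_obj F (act_obj T g X)) (act_obj U g (On_obj F X)) (\<beta> g X)"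
    if "g \<in> carrier G" for g X
    using \<beta>[OF that] block_functors.exact_iso_iff[OF bf[OF that]] by (auto simp: comp_exact_def)
  note bD = block_functors.sh_transD[OF bf \<beta>t]
  \<comment> \<open>The translate of the image of \<open>E1 i\<close> is computed in two ways:
    through the equivariant structure and the first system, and through the shifted second system.
    Index and degree of a shifted block object are determined by its isomorphism class.\<close>
  have tg: "t (\<rho>1 g i) = \<rho>2 g (t i)" and mg: "m (\<rho>1 g i) = m i" if g: "g \<in> carrier G" and i: "i \<in> J1" for g i
  proof -
    obtain \<theta>' where "U.block_system n2 \<rho>2 \<alpha>2 (\<lambda>k. ?P2 k (m i)) \<theta>'"
      using U.system_shift_by[OF sys2, of "m i"] by blast
    from U.systemD(2)[OF this, of g "t i", folded J2_def] g i
    have 1: "isomorphic U (?P2 (\<rho>2 g (t i)) (m i)) (act_obj U g (?P2 (t i) (m i)))"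
      unfolding isomorphic_def by auto
    have 2: "isomorphic U (act_obj U g (?P2 (t i) (m i))) (act_obj U g (On_obj F (E1 i)))"
      using tm[OF i] U.Act_iso[OF g] P2[OF t[OF i]] i unfolding isomorphic_def by (metis E1 F.F_Obj)
    have 3: "isomorphic U (On_obj F (act_obj T g (E1 i))) (act_obj U g (On_obj F (E1 i)))"
      using \<beta>i[OF g E1[OF i]] unfolding isomorphic_def by blast
    have "is_iso T (E1 (\<rho>1 g i)) (act_obj T g (E1 i)) (\<theta>1 g i)" by (rule s1(2)[OF g i])
    then have 4: "isomorphic U (On_obj F (E1 (\<rho>1 g i))) (On_obj F (act_obj T g (E1 i)))"
      using F.F_iso g i unfolding isomorphic_def by (metis E1 T.Act_simps(1) r1)
    have o: "?P2 (\<rho>2 g (t i)) (m i) \<in> Obj U" "act_obj U g (?P2 (t i) (m i)) \<in> Obj U" "act_obj U g (On_obj F (E1 i)) \<in> Obj U"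
      "On_obj F (act_obj T g (E1 i)) \<in> Obj U" "On_obj F (E1 (\<rho>1 g i)) \<in> Obj U" "?P2 (t (\<rho>1 g i)) (m (\<rho>1 g i)) \<in> Obj U"
      using g i P2 by simp_all
    have 5: "isomorphic U (?P2 (t (\<rho>1 g i)) (m (\<rho>1 g i))) (On_obj F (E1 (\<rho>1 g i)))"
      by (rule tm) (use g i in simp)
    have 6: "isomorphic U (?P2 (t (\<rho>1 g i)) (m (\<rho>1 g i))) (act_obj U g (On_obj F (E1 i)))"
      by (rule U.isomorphic_trans[OF U.isomorphic_trans[OF 5 4] 3]) (use o in auto)
    have 7: "isomorphic U (act_obj U g (On_obj F (E1 i))) (?P2 (\<rho>2 g (t i)) (m i))"
      by (rule U.isomorphic_sym[OF U.isomorphic_trans[OF 1 2]]) (use o in auto)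
    have "isomorphic U (?P2 (t (\<rho>1 g i)) (m (\<rho>1 g i))) (?P2 (\<rho>2 g (t i)) (m i))"
      by (rule U.isomorphic_trans[OF 6 7]) (use o in auto)
    from UB.P_isomorphic_unique[OF this, folded J2_def] g i
    show "t (\<rho>1 g i) = \<rho>2 g (t i)" "m (\<rho>1 g i) = m i" by auto
  qed
  \<comment> \<open>The common degree is read off at index 1; for an empty block the value is
    arbitrary.\<close>
  define M where "M = m 1"
  have mM: "m i = M" if i: "i \<in> J1" for i
  proof -
    have 1: "1 \<in> J1" using i unfolding J1_def by auto
    then obtain g where "g \<in> carrier G" "\<rho>1 g 1 = i"
      using trans i unfolding transitive_action_def J1_def by blast
    then show ?thesis using mg[OF _ 1] M_def by metis
  qed
  have tM: "isomorphic U (?P2 (t i) M) (On_obj F (E1 i))" if "i \<in> J1" for i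
    using tm[OF that] mM[OF that] by simp
  \<comment> \<open>Up to isomorphism, shifts of \<open>E1 i\<close> go to shifts of the same
    \<open>E2 (t i)\<close>; downwards an isomorphism between shifted objects is lifted along the
    shift, which is full and reflects isomorphisms.\<close>
  have Pshift: "\<exists>l. isomorphic U (?P2 (t i) l) (On_obj F (?P1 i j))" if i: "i \<in> J1" for i j
  proof (induction j rule: T.int_step_induct)
    case zero
    then show ?case using tM[OF i] by auto
  next
    case (up j)
    then obtain l where l: "isomorphic U (?P2 (t i) l) (On_obj F (?P1 i j))" by blast
    have 1: "isomorphic U (sh_obj U (?P2 (t i) l)) (sh_obj U (On_obj F (?P1 i j)))"
      by (rule U.Sh.F_isomorphic[OF l]) (use i P2 in auto)
    have 2: "isomorphic U (On_obj F (sh_obj T (?P1 i j))) (sh_obj U (On_obj F (?P1 i j)))"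
      using F.Fsh_iso[of "?P1 i j"] i unfolding isomorphic_def by auto
    have 3: "isomorphic U (On_obj F (sh_obj T (?P1 i j))) (On_obj F (?P1 i (j + 1)))"
      by (rule F.F_isomorphic[OF T.shift_by_step]) (use i in auto)
    have 4: "isomorphic U (sh_obj U (?P2 (t i) l)) (?P2 (t i) (l + 1))"
      by (rule U.shift_by_step) (use P2[OF t[OF i], of 0] in simp)
    have o: "sh_obj U (?P2 (t i) l) \<in> Obj U" "?P2 (t i) (l + 1) \<in> Obj U" using P2 i by simp_all
    have "isomorphic U (?P2 (t i) (l + 1)) (On_obj F (?P1 i (j + 1)))"
      by (rule U.isomorphic_trans[OF U.isomorphic_trans[OF U.isomorphic_sym[OF 4] 1]
            U.isomorphic_trans[OF U.isomorphic_sym[OF 2] 3]]) (use o i in auto)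
    then show ?case by blast
  next
    case (down j)
    then obtain l' where "isomorphic U (?P2 (t i) l') (On_obj F (?P1 i (j + 1)))" by blast
    moreover obtain l where "l' = l + 1" by (rule that[of "l' - 1"]) simp
    ultimately have l: "isomorphic U (?P2 (t i) (l + 1)) (On_obj F (?P1 i (j + 1)))" by simp
    have 1: "isomorphic U (On_obj F (sh_obj T (?P1 i j))) (sh_obj U (On_obj F (?P1 i j)))"
      using F.Fsh_iso[of "?P1 i j"] i unfolding isomorphic_def by auto
    have 2: "isomorphic U (On_obj F (sh_obj T (?P1 i j))) (On_obj F (?P1 i (j + 1)))"
      by (rule F.F_isomorphic[OF T.shift_by_step]) (use i in auto)
    have 3: "isomorphic U (sh_obj U (?P2 (t i) l)) (?P2 (t i) (l + 1))"
      by (rule U.shift_by_step) (use P2[OF t[OF i], of 0] in simp)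
    have o: "sh_obj U (?P2 (t i) l) \<in> Obj U" "?P2 (t i) (l + 1) \<in> Obj U" "?P2 (t i) l \<in> Obj U" using P2 i by simp_all
    have "isomorphic U (sh_obj U (?P2 (t i) l)) (sh_obj U (On_obj F (?P1 i j)))"
      by (rule U.isomorphic_trans[OF U.isomorphic_trans[OF 3 l] U.isomorphic_trans[OF U.isomorphic_sym[OF 2] 1]])
        (use o i in auto)
    then obtain f where f: "is_iso U (sh_obj U (?P2 (t i) l)) (sh_obj U (On_obj F (?P1 i j))) f"
      unfolding isomorphic_def by blast
    have oF: "On_obj F (?P1 i j) \<in> Obj U" using i by simp
    note fv = U.is_iso_inverse(1-3)[OF f U.Sh.F_Obj[OF o(3)] U.Sh.F_Obj[OF oF]]
    obtain f' where f': "arr U f'" "dm U f' = ?P2 (t i) l" "cd U f' = On_obj F (?P1 i j)" "sh_mor U f' = f"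
      by (rule U.Sh.full[OF fv o(3) oF])
    have "is_iso U (?P2 (t i) l) (On_obj F (?P1 i j)) f'"
      by (rule U.Sh.reflects_iso) (use f f' o oF in auto)
    then show ?case unfolding isomorphic_def by blast
  qed
  have inj: "inj_on t J1"
  proof (rule inj_onI)
    fix i k assume ik: "i \<in> J1" "k \<in> J1" "t i = t k"
    have "isomorphic U (On_obj F (E1 i)) (On_obj F (E1 k))"
      using U.isomorphic_trans[OF U.isomorphic_sym[OF tM[OF ik(1)]], of "On_obj F (E1 k)"] tM[OF ik(2)] ik P2 by simp
    then obtain f where f: "is_iso U (On_obj F (E1 i)) (On_obj F (E1 k)) f" unfolding isomorphic_def by blast
    have o: "E1 i \<in> Obj T" "E1 k \<in> Obj T" using ik by auto
    obtain f' where f': "arr T f'" "dm T f' = E1 i" "cd T f' = E1 k" "On_mor F f' = f"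
      by (rule Fe.full[OF U.is_iso_inverse(1-3)[OF f F.F_Obj[OF o(1)] F.F_Obj[OF o(2)]] o])
    have "is_iso T (E1 i) (E1 k) f'" by (rule Fe.reflects_iso) (use f f' o in auto)
    then have "isomorphic T (?P1 i 0) (?P1 k 0)" unfolding isomorphic_def by auto
    from TB.P_isomorphic_unique(1)[OF this, folded J1_def] ik show "i = k" by blast
  qed
  \<comment> \<open>\<open>E2 k\<close> is isomorphic to the image of some \<open>X\<close>, which
    is nonzero and receives a nonzero morphism from a shift of some \<open>E1 i\<close>. Its image
    is a nonzero morphism from a shift of \<open>E2 (t i)\<close> to \<open>E2 k\<close>, and
    orthogonality forces \<open>t i = k\<close>.\<close>
  have surj: "J2 \<subseteq> t ` J1"
  proof
    fix k assume k: "k \<in> J2"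
    have Ek: "E2 k \<in> Obj U" using P2[OF k, of 0] by simp
    obtain X where X: "X \<in> Obj T" "isomorphic U (On_obj F X) (E2 k)" by (rule Fe.essentially_surjective[OF Ek])
    then obtain e where e: "is_iso U (On_obj F X) (E2 k) e" unfolding isomorphic_def by blast
    note ev = U.is_iso_inverse[OF e F.F_Obj[OF X(1)] Ek]
    have "\<exists>i j p. i \<in> J1 \<and> arr T p \<and> dm T p = ?P1 i j \<and> cd T p = X \<and> p \<noteq> zer T (?P1 i j) X"
    proof (rule ccontr)
      assume n: "\<not> ?thesis"
      have "Id T X = zer T X X"
      proof (rule TB.P_separates[of _ _ X, folded J1_def])
        fix i j p assume p: "i \<in> J1" "arr T p" "dm T p = ?P1 i j" "cd T p = X"
        then have "p = zer T (?P1 i j) X" using n by blast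
        then show "Id T X \<cdot>\<^bsub>T\<^esub> p = zer T X X \<cdot>\<^bsub>T\<^esub> p" using p X(1) by simp
      qed (use X in auto)
      then have "On_mor F (Id T X) = On_mor F (zer T X X)" by simp
      then have "e \<cdot>\<^bsub>U\<^esub> Id U (On_obj F X) \<cdot>\<^bsub>U\<^esub> inv_mor U e = e \<cdot>\<^bsub>U\<^esub> zer U (On_obj F X) (On_obj F X) \<cdot>\<^bsub>U\<^esub> inv_mor U e"
        using X(1) by simp
      then have "Id U (E2 k) = zer U (E2 k) (E2 k)" using ev Ek X(1) by simp
      then show False using UB.P_nonzero[of k 0, folded J2_def] k by simp
    qed
    then obtain i j p where p: "i \<in> J1" "arr T p" "dm T p = ?P1 i j" "cd T p = X" "p \<noteq> zer T (?P1 i j) X" by blast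
    obtain l where "isomorphic U (?P2 (t i) l) (On_obj F (?P1 i j))" using Pshift[OF p(1)] by blast
    then obtain d where d: "is_iso U (?P2 (t i) l) (On_obj F (?P1 i j)) d" unfolding isomorphic_def by blast
    have oP: "?P2 (t i) l \<in> Obj U" "On_obj F (?P1 i j) \<in> Obj U" using p(1) P2 by simp_all
    note dv = U.is_iso_inverse[OF d oP]
    have "t i = k"
    proof (rule ccontr)
      assume n: "t i \<noteq> k"
      have "e \<cdot>\<^bsub>U\<^esub> On_mor F p \<cdot>\<^bsub>U\<^esub> d = zer U (?P2 (t i) l) (?P2 k 0)"
        by (rule UB.P_orth[folded J2_def]) (use n p k dv ev in auto)
      then have z: "e \<cdot>\<^bsub>U\<^esub> On_mor F p \<cdot>\<^bsub>U\<^esub> d = e \<cdot>\<^bsub>U\<^esub> zer U (On_obj F (?P1 i j)) (On_obj F X) \<cdot>\<^bsub>U\<^esub> d"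
        using ev dv X(1) p(1) oP by simp
      have "On_mor F p \<cdot>\<^bsub>U\<^esub> d = zer U (On_obj F (?P1 i j)) (On_obj F X) \<cdot>\<^bsub>U\<^esub> d"
        by (rule U.is_iso_cancel(1)[OF e _ Ek z]) (use ev dv p X(1) oP in auto)
      then have "On_mor F p = zer U (On_obj F (?P1 i j)) (On_obj F X)"
        by (rule U.is_iso_cancel(2)[OF d oP]) (use p X(1) oP in auto)
      then have "On_mor F p = On_mor F (zer T (?P1 i j) X)" using p(1) X(1) by simp
      then have "p = zer T (?P1 i j) X" by (rule Fe.faithful) (use p X(1) in auto)
      then show False using p(5) by blast
    qed
    then show "k \<in> t ` J1" using p(1) by blast
  qed
  have bij: "bij_betw t J1 J2" using inj surj t unfolding bij_betw_def by blast
  then have n: "n2 = n1" using bij_betw_same_card[OF bij] unfolding J1_def J2_def by simp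
  then have J: "J2 = J1" unfolding J1_def J2_def by simp
  \<comment> \<open>Extended by the identity outside the interval, as a permutation of
    \<open>{1..n1}\<close> requires.\<close>
  define \<tau> where "\<tau> i = (if i \<in> J1 then t i else i)" for i
  have \<tau>t [simp]: "\<tau> i = t i" if "i \<in> J1" for i using that by (simp add: \<tau>_def)
  have "bij_betw \<tau> J1 J1" using bij unfolding J by (subst bij_betw_cong[of J1 \<tau> t]) auto
  then have \<tau>: "\<tau> permutes J1" by (rule bij_imp_permutes) (simp add: \<tau>_def)
  have eqv: "\<tau> (\<rho>1 g i) = \<rho>2 g (\<tau> i)" if "g \<in> carrier G" "i \<in> J1" for g i
    using tg that by simp
  \<comment> \<open>The image of the first block is the second one in degree \<open>M\<close>;
    shifting the system keeps the cocycle \<open>\<alpha>2\<close>.\<close>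
  obtain \<theta>' where sys': "U.block_system n2 \<rho>2 \<alpha>2 (\<lambda>k. ?P2 k M) \<theta>'" using U.system_shift_by[OF sys2] by blast
  have "\<exists>p. is_iso U (On_obj F (E1 i)) (?P2 (\<tau> i) M) p" if "i \<in> J1" for i
    using U.isomorphic_sym[OF tM[OF that]] that P2 unfolding isomorphic_def by simp
  then obtain \<psi> where \<psi>: "\<And>i. i \<in> J1 \<Longrightarrow> is_iso U (On_obj F (E1 i)) (?P2 (\<tau> i) M) (\<psi> i)" by metis
  interpret C: equivariant_comparison K G \<sigma> n1 T \<rho>1 \<alpha>1 U \<rho>2 \<alpha>2 F E1 \<theta>1 "\<lambda>k. ?P2 k M" \<theta>' \<tau> \<psi>
  proof (intro equivariant_comparison.intro equivariant_comparison_axioms.intro T.action_data_axioms Fs)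
    show "action_data K G \<sigma> U n1 \<rho>2 \<alpha>2" using U.action_data_axioms n by simp
    show "U.block_system n1 \<rho>2 \<alpha>2 (\<lambda>k. ?P2 k M) \<theta>'" using sys' n by simp
    show "Id U (?P2 i M) \<noteq> zer U (?P2 i M) (?P2 i M)" if "i \<in> {1..n1}" for i
      using UB.P_nonzero[of i M] that n by simp
    show "\<tau> i \<in> {1..n1}" if "i \<in> {1..n1}" for i
      using that t unfolding J1_def[symmetric] J by simp
  qed (use sys1 eqv \<psi> in \<open>auto simp: J1_def\<close>)
  have CJ: "C.J = J1" unfolding C.J_def J1_def ..
  have Wi: "is_iso U (On_obj F (E1 (\<rho>1 g i))) (act_obj U g (On_obj F (E1 i))) (\<beta> g (E1 i) \<cdot>\<^bsub>U\<^esub> On_mor F (\<theta>1 g i))"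
    if g: "g \<in> carrier G" and i: "i \<in> J1" for g i
    by (rule U.is_iso_Comp[OF F.F_iso[OF s1(2)[OF g i]] \<beta>i[OF g E1[OF i]]]) (use g i in auto)
  \<comment> \<open>Both morphisms are isomorphisms between the same objects, and their source has
    only scalar endomorphisms; they differ by a nonzero scalar.\<close>
  have "\<exists>c. c \<in> carrier K \<and> c \<noteq> \<zero>\<^bsub>K\<^esub> \<and> \<beta> g (E1 i) \<cdot>\<^bsub>U\<^esub> On_mor F (\<theta>1 g i) = c \<star>\<^bsub>U\<^esub> C.V g i"
    if g [simp]: "g \<in> carrier G" and i [simp]: "i \<in> J1" for g i
  proof -
    define W where "W = \<beta> g (E1 i) \<cdot>\<^bsub>U\<^esub> On_mor F (\<theta>1 g i)"
    have iJ: "i \<in> C.J" using CJ by simp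
    have oU: "On_obj F (E1 (\<rho>1 g i)) \<in> Obj U" "act_obj U g (On_obj F (E1 i)) \<in> Obj U" by simp_all
    note Wv = U.is_iso_inverse[OF Wi[OF g i, folded W_def] oU]
    note Vv = U.is_iso_inverse[OF C.V_iso[OF g iJ] oU]
    obtain c where c: "c \<in> carrier K" "inv_mor U (C.V g i) \<cdot>\<^bsub>U\<^esub> W = c \<star>\<^bsub>U\<^esub> Id U (On_obj F (E1 (\<rho>1 g i)))"
      using FE_End[of "\<rho>1 g i" "inv_mor U (C.V g i) \<cdot>\<^bsub>U\<^esub> W"] Wv(1-3) Vv(4-6) by auto
    have "C.V g i \<cdot>\<^bsub>U\<^esub> inv_mor U (C.V g i) \<cdot>\<^bsub>U\<^esub> W = C.V g i \<cdot>\<^bsub>U\<^esub> (c \<star>\<^bsub>U\<^esub> Id U (On_obj F (E1 (\<rho>1 g i))))"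
      unfolding c(2) ..
    then have Wc: "W = c \<star>\<^bsub>U\<^esub> C.V g i" using Wv(1-3) Vv c(1) by simp
    have "c \<noteq> \<zero>\<^bsub>K\<^esub>"
    proof
      assume "c = \<zero>\<^bsub>K\<^esub>"
      then have "W = zer U (On_obj F (E1 (\<rho>1 g i))) (act_obj U g (On_obj F (E1 i)))" using Wc Vv(1-3) by simp
      then have "Id U (On_obj F (E1 (\<rho>1 g i))) = zer U (On_obj F (E1 (\<rho>1 g i))) (On_obj F (E1 (\<rho>1 g i)))"
        using Wv(4-7) oU by simp
      then show False using FE_nz[of "\<rho>1 g i"] by simp
    qed
    then show ?thesis unfolding W_def[symmetric] by (intro exI[of _ c] conjI c(1) Wc)
  qed
  then have "\<forall>g. \<forall>i. \<exists>c. g \<in> carrier G \<longrightarrow> i \<in> J1 \<longrightarrow> c \<in> carrier K \<and> c \<noteq> \<zero>\<^bsub>K\<^esub> \<and> \<beta> g (E1 i) \<cdot>\<^bsub>U\<^esub> On_mor F (\<theta>1 g i) = c \<star>\<^bsub>U\<^esub> C.V g i"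
    by blast
  then obtain c where c: "\<And>g i. \<lbrakk>g \<in> carrier G; i \<in> J1\<rbrakk> \<Longrightarrow> c g i \<in> carrier K" "\<And>g i. \<lbrakk>g \<in> carrier G; i \<in> J1\<rbrakk> \<Longrightarrow> c g i \<noteq> \<zero>\<^bsub>K\<^esub>"
    "\<And>g i. \<lbrakk>g \<in> carrier G; i \<in> J1\<rbrakk> \<Longrightarrow> \<beta> g (E1 i) \<cdot>\<^bsub>U\<^esub> On_mor F (\<theta>1 g i) = c g i \<star>\<^bsub>U\<^esub> C.V g i"
    by metis
  have coh: "\<alpha>1 (g, h) (\<rho>1 g (\<rho>1 h i)) \<otimes>\<^bsub>K\<^esub> c (g \<otimes>\<^bsub>G\<^esub> h) i =
        \<sigma> g (c h i) \<otimes>\<^bsub>K\<^esub> c g (\<rho>1 h i) \<otimes>\<^bsub>K\<^esub> \<alpha>2 (g, h) (\<rho>2 g (\<rho>2 h (\<tau> i)))"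
    if g: "g \<in> carrier G" "h \<in> carrier G" "i \<in> J1" for g h i
  proof (rule C.equivariance_iff[where c = c and \<beta> = \<beta>, THEN iffD1])
    show "arr U (\<beta> g X)" "dm U (\<beta> g X) = On_obj F (act_obj T g X)" "cd U (\<beta> g X) = act_obj U g (On_obj F X)"
      if "g \<in> carrier G" "X \<in> Obj T" for g X
      using bD(1-3)[OF that(1) that(1) that(2)] by (simp_all add: comp_exact_def)
    show "\<beta> g Y \<cdot>\<^bsub>U\<^esub> On_mor F (act_mor T g f) = act_mor U g (On_mor F f) \<cdot>\<^bsub>U\<^esub> \<beta> g X"
      if "g \<in> carrier G" "arr T f" "dm T f = X" "cd T f = Y" for g f X Y
      using bD(4)[OF that(1) that] by (simp add: comp_exact_def)
    show "\<beta> (g \<otimes>\<^bsub>G\<^esub> h) (E1 i) \<cdot>\<^bsub>U\<^esub> On_mor F (Eps T g h (E1 i)) =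
      Eps U g h (On_obj F (E1 i)) \<cdot>\<^bsub>U\<^esub> act_mor U g (\<beta> h (E1 i)) \<cdot>\<^bsub>U\<^esub> \<beta> g (act_obj T h (E1 i))"
      using Fb g E1[OF g(3)] unfolding equivariant_exact_functor_def by blast
  qed (use g c CJ in auto)
  note r = eqv[unfolded J1_def] c(1,2)[unfolded J1_def] coh[unfolded J1_def]
  show ?thesis
    by (rule that[of \<tau> c, OF n \<tau>[unfolded J1_def]]) (assumption | rule r conjI)+
qed

end

text \<open>Permutations are functions on all natural numbers that fix everything outside the
  interval, so equality of functions reduces to the points \<open>\<tau> i\<close> with
  \<open>i\<close> in \<open>{1..n}\<close>.\<close>

lemma conjugate_iff:
  assumes \<tau>: "\<tau> permutes {1..n}" and \<rho>: "\<rho>1 permutes {1..n}" "\<rho>2 permutes {1..n}"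
  shows "\<rho>2 = \<tau> \<otimes>\<^bsub>sym_group n\<^esub> \<rho>1 \<otimes>\<^bsub>sym_group n\<^esub> inv\<^bsub>sym_group n\<^esub> \<tau> \<longleftrightarrow> (\<forall>i \<in> {1..n}. \<tau> (\<rho>1 i) = \<rho>2 (\<tau> i))"
proof -
  have inv: "inv\<^bsub>sym_group n\<^esub> \<tau> = inv' \<tau>" by (rule sym_group_inv_equality[OF sym_group_carrier[THEN iffD2, OF \<tau>]])
  have "\<rho>2 = \<tau> \<circ> \<rho>1 \<circ> inv' \<tau> \<longleftrightarrow> (\<forall>i \<in> {1..n}. \<tau> (\<rho>1 i) = \<rho>2 (\<tau> i))"
  proof
    assume r: "\<rho>2 = \<tau> \<circ> \<rho>1 \<circ> inv' \<tau>"
    show "\<forall>i \<in> {1..n}. \<tau> (\<rho>1 i) = \<rho>2 (\<tau> i)" unfolding r using permutes_inverses(2)[OF \<tau>] by simp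
  next
    assume r: "\<forall>i \<in> {1..n}. \<tau> (\<rho>1 i) = \<rho>2 (\<tau> i)"
    show "\<rho>2 = \<tau> \<circ> \<rho>1 \<circ> inv' \<tau>"
    proof
      fix x
      define i where "i = inv' \<tau> x"
      have x: "x = \<tau> i" unfolding i_def using permutes_inverses(1)[OF \<tau>] by simp
      have "\<rho>2 (\<tau> i) = \<tau> (\<rho>1 i)"
        using r permutes_not_in[OF \<tau>] permutes_not_in[OF \<rho>(1)] permutes_not_in[OF \<rho>(2)] by (cases "i \<in> {1..n}") auto
      then show "\<rho>2 x = (\<tau> \<circ> \<rho>1 \<circ> inv' \<tau>) x" unfolding x using permutes_inverses(2)[OF \<tau>] by simp
    qed
  qed
  then show ?thesis unfolding inv sym_group_mult .
qed

lemma block_data: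
  fixes T :: "('g, 'o, 'm, 'k) gtricat"
  assumes "triangulated_category_with_action K G \<sigma> T" "G_block K G T n E" "generated_by T (E ` {1..n})"
    "block_action G T n E \<rho>" "twisting_cocycle K G T n E \<alpha>"
  obtains \<kappa> \<theta> where "action_data K G \<sigma> T n \<rho> \<alpha>"
    "tri_block K T {1..n} (\<lambda>i j. shift_by T j (E i)) \<kappa>"
    "triangulated_category_with_action.block_system G T n \<rho> \<alpha> E \<theta>"
proof -
  interpret A: action_data K G \<sigma> T n \<rho> \<alpha>
    by (intro action_data.intro action_data_axioms.intro assms(1))
      (use assms(4,5) in \<open>auto simp: block_action_def twisting_cocycle_def\<close>)
  obtain \<kappa> where \<kappa>: "tri_block K T {1..n} (\<lambda>i j. shift_by T j (E i)) \<kappa>"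
    by (rule A.exceptional_tri_block[OF _ assms(3)]) (use assms(2) in \<open>auto simp: G_block_def\<close>)
  obtain \<theta> where "A.block_system n \<rho> \<alpha> E \<theta>"
    by (rule A.system_from_twisting[OF \<kappa> _ _ assms(5)]) (use assms(4) in \<open>auto simp: block_action_def\<close>)
  with \<kappa> A.action_data_axioms that show ?thesis by blast
qed

theorem proposition3p41:
  fixes K :: "'k ring" and G :: "'g monoid" and \<sigma> :: "'g \<Rightarrow> 'k \<Rightarrow> 'k"
    and T1 :: "('g, 'o1, 'm1, 'k) gtricat" and T2 :: "('g, 'o2, 'm2, 'k) gtricat"
    and n1 n2 :: nat and E1 :: "nat \<Rightarrow> 'o1" and E2 :: "nat \<Rightarrow> 'o2"
    and \<rho>1 \<rho>2 :: "'g \<Rightarrow> nat \<Rightarrow> nat" and \<alpha>1 \<alpha>2 :: "'g \<times> 'g \<Rightarrow> nat \<Rightarrow> 'k"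
  assumes "field K" and "group G" and "\<sigma> \<in> hom G (field_Aut K)"
    and "triangulated_category_with_action K G \<sigma> T1"
    and "G_block K G T1 n1 E1" and "generated_by T1 (E1 ` {1..n1})"
    and "block_action G T1 n1 E1 \<rho>1" and "transitive_action G n1 \<rho>1"
    and "twisting_cocycle K G T1 n1 E1 \<alpha>1"
    and "triangulated_category_with_action K G \<sigma> T2"
    and "G_block K G T2 n2 E2" and "generated_by T2 (E2 ` {1..n2})"
    and "block_action G T2 n2 E2 \<rho>2" and "transitive_action G n2 \<rho>2"
    and "twisting_cocycle K G T2 n2 E2 \<alpha>2"
  shows "linearly_equivariantly_exact_equivalent K G T1 T2 \<longleftrightarrow>
    n1 = n2 \<and>
    (\<exists>\<tau> \<in> carrier (sym_group n1).
      (\<forall>g \<in> carrier G. \<rho>2 g = \<tau> \<otimes>\<^bsub>sym_group n1\<^esub> \<rho>1 g \<otimes>\<^bsub>sym_group n1\<^esub> inv\<^bsub>sym_group n1\<^esub> \<tau>) \<and>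
      H2_class G (torus K n2) (torus_act \<sigma> n2 \<rho>2) \<alpha>2 =
        H2_map G (torus K n2) (torus_act \<sigma> n2 \<rho>2) (torus_perm n1 \<tau>)
          (H2_class G (torus K n1) (torus_act \<sigma> n1 \<rho>1) \<alpha>1))"
proof -
  obtain \<kappa>1 \<theta>1 where 1: "action_data K G \<sigma> T1 n1 \<rho>1 \<alpha>1" "tri_block K T1 {1..n1} (\<lambda>i j. shift_by T1 j (E1 i)) \<kappa>1"
    "triangulated_category_with_action.block_system G T1 n1 \<rho>1 \<alpha>1 E1 \<theta>1"
    using block_data[OF assms(4-7,9)] by blast
  obtain \<kappa>2 \<theta>2 where 2: "action_data K G \<sigma> T2 n2 \<rho>2 \<alpha>2" "tri_block K T2 {1..n2} (\<lambda>i j. shift_by T2 j (E2 i)) \<kappa>2"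
    "triangulated_category_with_action.block_system G T2 n2 \<rho>2 \<alpha>2 E2 \<theta>2"
    using block_data[OF assms(10-13,15)] by blast
  interpret B: block_comparison K G \<sigma> T1 n1 \<rho>1 \<alpha>1 E1 \<kappa>1 T2 n2 \<rho>2 \<alpha>2 E2 \<kappa>2 \<theta>1 \<theta>2
    by (intro block_comparison.intro block_comparison_axioms.intro 1 2)
  note r = B.T.rho_hom B.U.rho_hom
  show ?thesis (is "?L \<longleftrightarrow> ?R")
  proof
    assume ?L
    then obtain F \<beta> where "equivariant_exact_functor G T1 T2 F \<beta>" "linear_functor K T1 T2 F" "equivalence T1 T2 F"
      unfolding linearly_equivariantly_exact_equivalent_def by blast
    from B.class_from_equivalence[OF assms(8) this] obtain \<tau> c where n: "n2 = n1" and \<tau>: "\<tau> permutes {1..n1}"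
      and eqv: "\<And>g i. \<lbrakk>g \<in> carrier G; i \<in> {1..n1}\<rbrakk> \<Longrightarrow> \<tau> (\<rho>1 g i) = \<rho>2 g (\<tau> i)"
      and c: "\<And>g i. \<lbrakk>g \<in> carrier G; i \<in> {1..n1}\<rbrakk> \<Longrightarrow> c g i \<in> carrier K \<and> c g i \<noteq> \<zero>\<^bsub>K\<^esub>"
      "\<And>g h i. \<lbrakk>g \<in> carrier G; h \<in> carrier G; i \<in> {1..n1}\<rbrakk> \<Longrightarrow>
        \<alpha>1 (g, h) (\<rho>1 g (\<rho>1 h i)) \<otimes>\<^bsub>K\<^esub> c (g \<otimes>\<^bsub>G\<^esub> h) i =
        \<sigma> g (c h i) \<otimes>\<^bsub>K\<^esub> c g (\<rho>1 h i) \<otimes>\<^bsub>K\<^esub> \<alpha>2 (g, h) (\<rho>2 g (\<rho>2 h (\<tau> i)))"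
      by blast
    have iff: "H2_class G (torus K n1) (torus_act \<sigma> n1 \<rho>2) \<alpha>2 =
        H2_map G (torus K n1) (torus_act \<sigma> n1 \<rho>2) (torus_perm n1 \<tau>) (H2_class G (torus K n1) (torus_act \<sigma> n1 \<rho>1) \<alpha>1) \<longleftrightarrow>
      (\<exists>c. (\<forall>g \<in> carrier G. \<forall>i \<in> {1..n1}. c g i \<in> carrier K \<and> c g i \<noteq> \<zero>\<^bsub>K\<^esub>) \<and>
        (\<forall>g \<in> carrier G. \<forall>h \<in> carrier G. \<forall>i \<in> {1..n1}.
          \<alpha>1 (g, h) (\<rho>1 g (\<rho>1 h i)) \<otimes>\<^bsub>K\<^esub> c (g \<otimes>\<^bsub>G\<^esub> h) i =
          \<sigma> g (c h i) \<otimes>\<^bsub>K\<^esub> c g (\<rho>1 h i) \<otimes>\<^bsub>K\<^esub> \<alpha>2 (g, h) (\<rho>2 g (\<rho>2 h (\<tau> i)))))"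
      by (rule twisting_class_eq_iff[OF assms(1-3) r(1) r(2)[unfolded n] \<tau> _ B.T.alpha B.U.alpha[unfolded n]]) (rule eqv)
    have "H2_class G (torus K n2) (torus_act \<sigma> n2 \<rho>2) \<alpha>2 =
        H2_map G (torus K n2) (torus_act \<sigma> n2 \<rho>2) (torus_perm n1 \<tau>) (H2_class G (torus K n1) (torus_act \<sigma> n1 \<rho>1) \<alpha>1)"
      unfolding n iff
    proof (intro exI[of _ c] conjI ballI)
      show "c g i \<in> carrier K" "c g i \<noteq> \<zero>\<^bsub>K\<^esub>" if "g \<in> carrier G" "i \<in> {1..n1}" for g i using c(1)[OF that] by auto
    qed (rule c(2))
    moreover have "\<rho>2 g = \<tau> \<otimes>\<^bsub>sym_group n1\<^esub> \<rho>1 g \<otimes>\<^bsub>sym_group n1\<^esub> inv\<^bsub>sym_group n1\<^esub> \<tau>" if "g \<in> carrier G" for g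
      using conjugate_iff[OF \<tau> sym_hom(3)[OF r(1) that] sym_hom(3)[OF r(2)[unfolded n] that]] eqv[OF that] by blast
    ultimately show ?R using n \<tau> sym_group_carrier by blast
  next
    assume R: ?R
    then have n: "n2 = n1" by simp
    from R obtain \<tau> where "\<tau> \<in> carrier (sym_group n1)"
      and conj: "\<And>g. g \<in> carrier G \<Longrightarrow> \<rho>2 g = \<tau> \<otimes>\<^bsub>sym_group n1\<^esub> \<rho>1 g \<otimes>\<^bsub>sym_group n1\<^esub> inv\<^bsub>sym_group n1\<^esub> \<tau>"
      and cl: "H2_class G (torus K n2) (torus_act \<sigma> n2 \<rho>2) \<alpha>2 =
        H2_map G (torus K n2) (torus_act \<sigma> n2 \<rho>2) (torus_perm n1 \<tau>) (H2_class G (torus K n1) (torus_act \<sigma> n1 \<rho>1) \<alpha>1)"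
      by blast
    then have \<tau>: "\<tau> permutes {1..n1}" by (simp only: sym_group_carrier)
    have eqv: "\<tau> (\<rho>1 g i) = \<rho>2 g (\<tau> i)" if "g \<in> carrier G" "i \<in> {1..n1}" for g i
      using conjugate_iff[OF \<tau> sym_hom(3)[OF r(1) that(1)] sym_hom(3)[OF r(2)[unfolded n] that(1)]] conj[OF that(1)] that(2)
      by blast
    have iff: "H2_class G (torus K n1) (torus_act \<sigma> n1 \<rho>2) \<alpha>2 =
        H2_map G (torus K n1) (torus_act \<sigma> n1 \<rho>2) (torus_perm n1 \<tau>) (H2_class G (torus K n1) (torus_act \<sigma> n1 \<rho>1) \<alpha>1) \<longleftrightarrow>
      (\<exists>c. (\<forall>g \<in> carrier G. \<forall>i \<in> {1..n1}. c g i \<in> carrier K \<and> c g i \<noteq> \<zero>\<^bsub>K\<^esub>) \<and>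
        (\<forall>g \<in> carrier G. \<forall>h \<in> carrier G. \<forall>i \<in> {1..n1}.
          \<alpha>1 (g, h) (\<rho>1 g (\<rho>1 h i)) \<otimes>\<^bsub>K\<^esub> c (g \<otimes>\<^bsub>G\<^esub> h) i =
          \<sigma> g (c h i) \<otimes>\<^bsub>K\<^esub> c g (\<rho>1 h i) \<otimes>\<^bsub>K\<^esub> \<alpha>2 (g, h) (\<rho>2 g (\<rho>2 h (\<tau> i)))))"
      by (rule twisting_class_eq_iff[OF assms(1-3) r(1) r(2)[unfolded n] \<tau> _ B.T.alpha B.U.alpha[unfolded n]]) (rule eqv)
    from cl[unfolded n iff]
    obtain c where c: "\<forall>g \<in> carrier G. \<forall>i \<in> {1..n1}. c g i \<in> carrier K \<and> c g i \<noteq> \<zero>\<^bsub>K\<^esub>"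
      "\<forall>g \<in> carrier G. \<forall>h \<in> carrier G. \<forall>i \<in> {1..n1}.
        \<alpha>1 (g, h) (\<rho>1 g (\<rho>1 h i)) \<otimes>\<^bsub>K\<^esub> c (g \<otimes>\<^bsub>G\<^esub> h) i =
        \<sigma> g (c h i) \<otimes>\<^bsub>K\<^esub> c g (\<rho>1 h i) \<otimes>\<^bsub>K\<^esub> \<alpha>2 (g, h) (\<rho>2 g (\<rho>2 h (\<tau> i)))"
      by blast
    show ?L
      by (rule B.equivalence_from_class[OF n \<tau> eqv, of c]) (use c in auto)
  qed
qed

end
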